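(* Suppose there is a static deterministic distributed algorithm which, on any $n$-vertex distributed network of constant diameter, given as input an independent set $M'$ of the network, computes within $T'(n)$ rounds (in the CONGEST model) a maximal independent set that contains $M'$. Then, using this algorithm as a black box, an MIS can be maintained deterministically in the local wakeup model over any sequence of edge insertions and deletions that starts from the empty network on $n$ vertices (with no restriction on the diameter of the dynamic network), with $O(T'(n))$ amortized round complexity and $O(m^{2/3}\cdot T'(n))$ amortized message complexity, where $m$ denotes the dynamic number of edges.
   Context: A maximal independent set (MIS) of a graph is an independent set not contained in any larger independent set; an MIS algorithm is input-respecting if, given an independent set $M'$, it outputs an MIS containing $M'$. In the CONGEST model, computation proceeds in synchronous fault-free rounds in which every vertex may send an $O(\log n)$-bit message to each neighbor; vertices know their neighbors' IDs. Local wakeup model: the graph on the fixed vertex set $V$, $|V|=n$, starts empty and undergoes edge insertions/deletions; after an update of edge $(u,v)$ only $u$ and $v$ wake up, and other vertices participate only after receiving a message; communication is synchronous CONGEST with unicast messages. After each update the maintained set must be an MIS of the current graph. Amortized round (resp. message) complexity is the average, over a worst-case update sequence, of the number of rounds (resp. $O(\log n)$-bit messages) per update. The dynamic number of edges $m$ may be taken as the maximum number of edges present at any time, or as the average number of edges over the sequence. *)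

theory Defs
  imports Complex_Main
begin

section \<open>Graphs\<close>

text \<open>Vertices are identified with their IDs; an edge is the two-element set of its endpoints.\<close>

definition simple_graph :: "nat set \<Rightarrow> nat set set \<Rightarrow> bool" where
  "simple_graph V E \<longleftrightarrow> finite V \<and> (\<forall>e\<in>E. \<exists>u\<in>V. \<exists>v\<in>V. u \<noteq> v \<and> e = {u, v})"

definition neighbours :: "nat set set \<Rightarrow> nat \<Rightarrow> nat set" where
  "neighbours E u = {v. {u, v} \<in> E}"

definition diameter_at_most :: "nat set \<Rightarrow> nat set set \<Rightarrow> nat \<Rightarrow> bool" where
  "diameter_at_most V E D \<longleftrightarrow>
     (\<forall>u\<in>V. \<forall>v\<in>V. \<exists>k\<le>D. (u, v) \<in> {(x, y). {x, y} \<in> E} ^^ k)"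

definition independent_set :: "nat set \<Rightarrow> nat set set \<Rightarrow> nat set \<Rightarrow> bool" where
  "independent_set V E S \<longleftrightarrow> S \<subseteq> V \<and> (\<forall>u\<in>S. \<forall>v\<in>S. {u, v} \<notin> E)"

definition maximal_independent_set :: "nat set \<Rightarrow> nat set set \<Rightarrow> nat set \<Rightarrow> bool" where
  "maximal_independent_set V E S \<longleftrightarrow>
     independent_set V E S \<and> (\<forall>S'. independent_set V E S' \<and> S \<subseteq> S' \<longrightarrow> S' = S)"

text \<open>
  Vertex sets of \<open>n\<close> vertices whose IDs are distinct and polynomially bounded in \<open>n\<close>,
  that is, IDs of \<open>O(log n)\<close> bits.
\<close>

definition vertex_ids :: "nat \<Rightarrow> nat \<Rightarrow> nat set \<Rightarrow> bool" where
  "vertex_ids a n V \<longleftrightarrow> finite V \<and> card V = n \<and> V \<subseteq> {..<n ^ a}"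


section \<open>Static deterministic CONGEST algorithms\<close>

text \<open>
  A message is a bit string, and \<^term>\<open>None\<close> stands for sending nothing. Local computation and
  local memory are unrestricted, as usual in the CONGEST model.

  \<^item> \<open>s_init n v N x\<close>: initial state of the vertex with ID \<open>v\<close>, which knows the number \<open>n\<close> of
    vertices, the set \<open>N\<close> of the IDs of its neighbours, and whether it belongs to the input set.
  \<^item> \<open>s_send s w\<close>: the message for neighbour \<open>w\<close> in the current round.
  \<^item> \<open>s_step s inbox\<close>: the new state, where \<open>inbox w\<close> is what neighbour \<open>w\<close> sent in this round.
  \<^item> \<open>s_out s\<close>: whether the vertex currently declares itself a member of the output set.
\<close>

record 's static_alg =
  s_init :: "nat \<Rightarrow> nat \<Rightarrow> nat set \<Rightarrow> bool \<Rightarrow> 's"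
  s_send :: "'s \<Rightarrow> nat \<Rightarrow> bool list option"
  s_step :: "'s \<Rightarrow> (nat \<Rightarrow> bool list option) \<Rightarrow> 's"
  s_out  :: "'s \<Rightarrow> bool"

definition static_start ::
  "'s static_alg \<Rightarrow> nat \<Rightarrow> nat set set \<Rightarrow> nat set \<Rightarrow> (nat \<Rightarrow> 's)" where
  "static_start A n E M = (\<lambda>v. s_init A n v (neighbours E v) (v \<in> M))"

definition static_sent ::
  "'s static_alg \<Rightarrow> nat set set \<Rightarrow> (nat \<Rightarrow> 's) \<Rightarrow> nat \<Rightarrow> nat \<Rightarrow> bool list option" where
  "static_sent A E s u v = (if {u, v} \<in> E then s_send A (s u) v else None)"

definition static_round ::
  "'s static_alg \<Rightarrow> nat set set \<Rightarrow> (nat \<Rightarrow> 's) \<Rightarrow> (nat \<Rightarrow> 's)" where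
  "static_round A E s = (\<lambda>v. s_step A (s v) (\<lambda>u. static_sent A E s u v))"

definition static_states ::
  "'s static_alg \<Rightarrow> nat \<Rightarrow> nat set set \<Rightarrow> nat set \<Rightarrow> nat \<Rightarrow> (nat \<Rightarrow> 's)" where
  "static_states A n E M r = (static_round A E ^^ r) (static_start A n E M)"

text \<open>
  \<open>A\<close> is an input-respecting MIS algorithm: on every \<open>n\<close>-vertex network of diameter at most \<open>D\<close>
  (in particular, connected) with IDs below \<open>n ^ a\<close>, using messages of at most \<open>b * log 2 n\<close> bits,
  the outputs after \<open>T n\<close> rounds form an MIS containing the given independent set. An algorithm
  whose vertices stop earlier keeps its states, hence its outputs, from then on.
\<close>

definition static_MIS_algorithm ::
  "nat \<Rightarrow> nat \<Rightarrow> real \<Rightarrow> (nat \<Rightarrow> nat) \<Rightarrow> 's static_alg \<Rightarrow> bool" where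
  "static_MIS_algorithm a D b T A \<longleftrightarrow>
     (\<forall>n V E M. vertex_ids a n V \<and> simple_graph V E \<and> diameter_at_most V E D \<and>
        independent_set V E M \<longrightarrow>
        (\<forall>r<T n. \<forall>u v msg. static_sent A E (static_states A n E M r) u v = Some msg \<longrightarrow>
            real (length msg) \<le> b * log 2 (real n)) \<and>
        maximal_independent_set V E {v \<in> V. s_out A (static_states A n E M (T n) v)} \<and>
        M \<subseteq> {v \<in> V. s_out A (static_states A n E M (T n) v)})"


section \<open>Update sequences\<close>

datatype edge_update = Insert nat nat | Delete nat nat

fun apply_update :: "edge_update \<Rightarrow> nat set set \<Rightarrow> nat set set" where
  "apply_update (Insert u v) E = insert {u, v} E"
| "apply_update (Delete u v) E = E - {{u, v}}"

fun legal_update :: "nat set \<Rightarrow> nat set set \<Rightarrow> edge_update \<Rightarrow> bool" where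
  "legal_update V E (Insert u v) \<longleftrightarrow> u \<in> V \<and> v \<in> V \<and> u \<noteq> v \<and> {u, v} \<notin> E"
| "legal_update V E (Delete u v) \<longleftrightarrow> {u, v} \<in> E"

definition edges_after :: "edge_update list \<Rightarrow> nat \<Rightarrow> nat set set" where
  "edges_after us i = fold apply_update (take i us) {}"

definition update_sequence :: "nat set \<Rightarrow> edge_update list \<Rightarrow> bool" where
  "update_sequence V us \<longleftrightarrow> (\<forall>i<length us. legal_update V (edges_after us i) (us ! i))"

definition max_edges :: "edge_update list \<Rightarrow> real" where
  "max_edges us = real (Max ((\<lambda>i. card (edges_after us i)) ` {..length us}))"

definition avg_edges :: "edge_update list \<Rightarrow> real" where
  "avg_edges us = (\<Sum>i=1..length us. real (card (edges_after us i))) / real (length us)"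


section \<open>Deterministic algorithms in the local wakeup model\<close>

datatype local_event = Inserted nat | Deleted nat

text \<open>
  \<^item> \<open>d_init n v\<close>: initial state of vertex \<open>v\<close> in the empty network on \<open>n\<close> vertices.
  \<^item> \<open>d_notify ev s\<close>: the new state of an endpoint of the updated edge; it learns the kind of the
    update and the ID of the other endpoint.
  \<^item> \<open>d_send\<close>, \<open>d_step\<close>: as for static algorithms.
  \<^item> \<open>d_asleep s\<close>: whether the vertex is asleep. A sleeping vertex sends nothing and keeps its
    state until it is notified of an update or receives a message.
  \<^item> \<open>d_out s\<close>: whether the vertex is in the maintained set.
\<close>

record 's dynamic_alg =
  d_init   :: "nat \<Rightarrow> nat \<Rightarrow> 's"
  d_notify :: "local_event \<Rightarrow> 's \<Rightarrow> 's"
  d_send   :: "'s \<Rightarrow> nat \<Rightarrow> bool list option"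
  d_step   :: "'s \<Rightarrow> (nat \<Rightarrow> bool list option) \<Rightarrow> 's"
  d_asleep :: "'s \<Rightarrow> bool"
  d_out    :: "'s \<Rightarrow> bool"

fun wake_endpoints :: "'s dynamic_alg \<Rightarrow> edge_update \<Rightarrow> (nat \<Rightarrow> 's) \<Rightarrow> (nat \<Rightarrow> 's)" where
  "wake_endpoints B (Insert u v) s =
     s(u := d_notify B (Inserted v) (s u), v := d_notify B (Inserted u) (s v))"
| "wake_endpoints B (Delete u v) s =
     s(u := d_notify B (Deleted v) (s u), v := d_notify B (Deleted u) (s v))"

definition dynamic_sent ::
  "'s dynamic_alg \<Rightarrow> nat set set \<Rightarrow> (nat \<Rightarrow> 's) \<Rightarrow> nat \<Rightarrow> nat \<Rightarrow> bool list option" where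
  "dynamic_sent B E s u v =
     (if {u, v} \<in> E \<and> \<not> d_asleep B (s u) then d_send B (s u) v else None)"

definition dynamic_round ::
  "'s dynamic_alg \<Rightarrow> nat set set \<Rightarrow> (nat \<Rightarrow> 's) \<Rightarrow> (nat \<Rightarrow> 's)" where
  "dynamic_round B E s =
     (\<lambda>v. if d_asleep B (s v) \<and> (\<forall>u. dynamic_sent B E s u v = None) then s v
          else d_step B (s v) (\<lambda>u. dynamic_sent B E s u v))"

definition quiescent :: "'s dynamic_alg \<Rightarrow> nat set \<Rightarrow> (nat \<Rightarrow> 's) \<Rightarrow> bool" where
  "quiescent B V s \<longleftrightarrow> (\<forall>v\<in>V. d_asleep B (s v))"

definition recovery_rounds ::
  "'s dynamic_alg \<Rightarrow> nat set \<Rightarrow> nat set set \<Rightarrow> (nat \<Rightarrow> 's) \<Rightarrow> nat" where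
  "recovery_rounds B V E s = (LEAST r. quiescent B V ((dynamic_round B E ^^ r) s))"

text \<open>States once the first \<open>i\<close> updates have been handled; the next update arrives only then.\<close>

primrec states_after ::
  "'s dynamic_alg \<Rightarrow> nat \<Rightarrow> nat set \<Rightarrow> edge_update list \<Rightarrow> nat \<Rightarrow> (nat \<Rightarrow> 's)" where
  "states_after B n V us 0 = d_init B n"
| "states_after B n V us (Suc i) =
     (let E = edges_after us (Suc i);
          s = wake_endpoints B (us ! i) (states_after B n V us i)
      in (dynamic_round B E ^^ recovery_rounds B V E s) s)"

text \<open>States \<open>r\<close> rounds after the arrival of update \<open>us ! i\<close>.\<close>

definition states_during ::
  "'s dynamic_alg \<Rightarrow> nat \<Rightarrow> nat set \<Rightarrow> edge_update list \<Rightarrow> nat \<Rightarrow> nat \<Rightarrow> (nat \<Rightarrow> 's)" where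
  "states_during B n V us i r =
     (dynamic_round B (edges_after us (Suc i)) ^^ r)
       (wake_endpoints B (us ! i) (states_after B n V us i))"

definition update_rounds ::
  "'s dynamic_alg \<Rightarrow> nat \<Rightarrow> nat set \<Rightarrow> edge_update list \<Rightarrow> nat \<Rightarrow> nat" where
  "update_rounds B n V us i =
     recovery_rounds B V (edges_after us (Suc i))
       (wake_endpoints B (us ! i) (states_after B n V us i))"

definition update_messages ::
  "'s dynamic_alg \<Rightarrow> nat \<Rightarrow> nat set \<Rightarrow> edge_update list \<Rightarrow> nat \<Rightarrow> nat" where
  "update_messages B n V us i =
     (\<Sum>r<update_rounds B n V us i.
        card {(u, v). u \<in> V \<and> v \<in> V \<and>
          dynamic_sent B (edges_after us (Suc i)) (states_during B n V us i r) u v \<noteq> None})"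

text \<open>
  The conjunct on termination is essential: without it \<^const>\<open>recovery_rounds\<close> would be an
  unspecified number.
\<close>

definition dynamic_MIS_algorithm :: "nat \<Rightarrow> real \<Rightarrow> 's dynamic_alg \<Rightarrow> bool" where
  "dynamic_MIS_algorithm a b B \<longleftrightarrow>
     (\<forall>n V us. vertex_ids a n V \<and> update_sequence V us \<longrightarrow>
        quiescent B V (d_init B n) \<and>
        (\<forall>i<length us. \<exists>r. quiescent B V (states_during B n V us i r)) \<and>
        (\<forall>i<length us. \<forall>r<update_rounds B n V us i. \<forall>u v msg.
            dynamic_sent B (edges_after us (Suc i)) (states_during B n V us i r) u v = Some msg \<longrightarrow>
            real (length msg) \<le> b * log 2 (real n)) \<and>
        (\<forall>i\<le>length us. maximal_independent_set V (edges_after us i)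
            {v \<in> V. d_out B (states_after B n V us i v)}))"

definition amortized_rounds ::
  "'s dynamic_alg \<Rightarrow> nat \<Rightarrow> nat set \<Rightarrow> edge_update list \<Rightarrow> real" where
  "amortized_rounds B n V us =
     (\<Sum>i<length us. real (update_rounds B n V us i)) / real (length us)"

definition amortized_messages ::
  "'s dynamic_alg \<Rightarrow> nat \<Rightarrow> nat set \<Rightarrow> edge_update list \<Rightarrow> real" where
  "amortized_messages B n V us =
     (\<Sum>i<length us. real (update_messages B n V us i)) / real (length us)"

end

theory Submission
  imports Defs "HOL-Library.Countable"
begin

text \<open>A run of the black box may use every edge of its network in every round, and its time is
  guaranteed only on networks of constant diameter with \<open>n\<close> vertices. As
  \<open>T'\<close> need not be monotone, nothing is known about smaller networks; hence the
  padding. Only heavy vertices take part, because few of them survive the conversion. Light members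
  never leave the set. When two light members come into conflict, the loser is first made heavy, and
  this is the only way to become heavy. A leaver thus has only heavy neighbours to inform, and the
  light ones that relied on it are known through their registrations. An uncovered light vertex
  found by the token repairs itself at once. Its join can drive out further heavy members, whose
  registered vertices must be visited in turn. The walk still ends: each such repair converts a
  vertex or lets the centre join, and both lower \<open>mu\<close>. Radius 3 is one more than the
  depth of the network of the static algorithm, so that all heavy neighbours to be told of a change
  there have been explored.\<close>

text \<open>
  The vertices do not know \<open>m\<close>, so a vertex counts as heavy only until it sees evidence that it
  is light. A light member of the set \<open>M\<close> is known as such to all its neighbours, a heavy member only
  to its heavy neighbours. A light vertex outside \<open>M\<close> without light neighbours in \<open>M\<close> is registered
  with one heavy neighbour in \<open>M\<close>, its boss, who summons it when it leaves \<open>M\<close>.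

  Every repair is an operation around a centre \<open>c\<close>. It floods the heavy ball of radius 3 around \<open>c\<close>
  and sums up the degrees; a ball member of degree \<open>d\<close> with \<open>d^3 \<le> s^2\<close>, where \<open>s \<le> 2m\<close> is
  that sum, becomes light. Since the degrees of the members that stay heavy add up to at most \<open>s\<close> and
  each of them exceeds \<open>s powr (2 / 3)\<close>, at most \<open>s powr (1 / 3)\<close> members stay heavy, and they span at
  most \<open>s powr (2 / 3)\<close> edges. Then \<open>c\<close> joins \<open>M\<close>, or \<open>c\<close> is in conflict with a heavy neighbour in \<open>M\<close>;
  the heavy members of \<open>M\<close> that have to leave do so, and the static algorithm is
  run on \<open>c\<close>, the leavers and the heavy vertices uncovered by them. This network has constant diameter,
  its number of vertices is padded to \<open>n\<close> with pendants simulated by \<open>c\<close>, and the input \<open>{c}\<close> keeps \<open>c\<close> in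
  the set. The light vertices registered with the leavers are visited by a token that walks depth first
  along the registrations; each of them joins as a light member if it is still uncovered.

  The potential is the number of registrations, plus a multiple of \<open>(T + 1) m powr (2 / 3)\<close> for every
  heavy vertex and every light vertex outside \<open>M\<close>, plus a multiple of the amount by which the degrees of
  light vertices exceed \<open>(2m) powr (2 / 3)\<close>. An update raises it by \<open>O((T + 1) m powr (2 / 3))\<close>; the number
  \<open>2 |H| + |L - M|\<close> times \<open>O(T)\<close> is a potential for the rounds. Averaging over the sequence uses
  the tangent of \<open>x powr (2 / 3)\<close> at the average of the numbers of edges.
\<close>

section \<open>Algorithms with arbitrary states and messages\<close>

record ('x, 'm) typed_alg =
  t_init   :: "nat \<Rightarrow> nat \<Rightarrow> 'x"
  t_notify :: "local_event \<Rightarrow> 'x \<Rightarrow> 'x"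
  t_send   :: "'x \<Rightarrow> nat \<Rightarrow> 'm option"
  t_step   :: "'x \<Rightarrow> (nat \<Rightarrow> 'm option) \<Rightarrow> 'x"
  t_out    :: "'x \<Rightarrow> bool"

definition t_sent :: "('x, 'm) typed_alg \<Rightarrow> nat set set \<Rightarrow> (nat \<Rightarrow> 'x) \<Rightarrow> nat \<Rightarrow> nat \<Rightarrow> 'm option" where
  "t_sent Z E s u v = (if {u, v} \<in> E then t_send Z (s u) v else None)"

definition t_round :: "('x, 'm) typed_alg \<Rightarrow> nat set set \<Rightarrow> (nat \<Rightarrow> 'x) \<Rightarrow> (nat \<Rightarrow> 'x)" where
  "t_round Z E s = (\<lambda>v. t_step Z (s v) (\<lambda>u. t_sent Z E s u v))"

definition t_msgs :: "('x, 'm) typed_alg \<Rightarrow> nat set set \<Rightarrow> (nat \<Rightarrow> 'x) \<Rightarrow> nat" where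
  "t_msgs Z E s = card {(u, v). t_sent Z E s u v \<noteq> None}"

text \<open>This becomes \<open>d_asleep\<close>: a vertex may sleep exactly when it has nothing to
  send and an empty inbox would leave its state as it is.\<close>

definition t_silent :: "('x, 'm) typed_alg \<Rightarrow> 'x \<Rightarrow> bool" where
  "t_silent Z x \<longleftrightarrow> (\<forall>w. t_send Z x w = None) \<and> t_step Z x (\<lambda>_. None) = x"

fun t_wake :: "('x, 'm) typed_alg \<Rightarrow> edge_update \<Rightarrow> (nat \<Rightarrow> 'x) \<Rightarrow> (nat \<Rightarrow> 'x)" where
  "t_wake Z (Insert u v) s =
     s(u := t_notify Z (Inserted v) (s u), v := t_notify Z (Inserted u) (s v))"
| "t_wake Z (Delete u v) s =
     s(u := t_notify Z (Deleted v) (s u), v := t_notify Z (Deleted u) (s v))"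

text \<open>The number of rounds is exact, since the next run starts where this one ends; the number
  of messages is only bounded, so that costs simply add up under concatenation.\<close>

definition t_run :: "('x, 'm) typed_alg \<Rightarrow> ('m \<Rightarrow> bool) \<Rightarrow> nat set set \<Rightarrow> (nat \<Rightarrow> 'x) \<Rightarrow> nat \<Rightarrow> nat
    \<Rightarrow> (nat \<Rightarrow> 'x) \<Rightarrow> bool" where
  "t_run Z ok E s k c s' \<longleftrightarrow> (t_round Z E ^^ k) s = s' \<and>
     (\<Sum>i<k. t_msgs Z E ((t_round Z E ^^ i) s)) \<le> c \<and>
     (\<forall>i<k. \<forall>u v m. t_sent Z E ((t_round Z E ^^ i) s) u v = Some m \<longrightarrow> ok m)"

lemma t_run_refl: "t_run Z ok E s 0 c s"
  by (simp add: t_run_def)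

lemma t_run_step:
  assumes "t_round Z E s = s'" "t_msgs Z E s \<le> c"
    and "\<And>u v m. t_sent Z E s u v = Some m \<Longrightarrow> ok m"
  shows "t_run Z ok E s 1 c s'"
  using assms by (simp add: t_run_def)

lemma t_run_trans:
  assumes "t_run Z ok E s k c s'" "t_run Z ok E s' k' c' s''"
  shows "t_run Z ok E s (k + k') (c + c') s''"
proof -
  let ?r = "t_round Z E"
  have s': "s' = (?r ^^ k) s" using assms by (simp add: t_run_def)
  have add: "(?r ^^ (k + i)) s = (?r ^^ i) s'" for i
    by (metis add.commute comp_apply funpow_add s')
  have "(\<Sum>i<k + k'. t_msgs Z E ((?r ^^ i) s))
      = (\<Sum>i<k. t_msgs Z E ((?r ^^ i) s)) + (\<Sum>i<k'. t_msgs Z E ((?r ^^ i) s'))"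
  proof (induction k')
    case (Suc j)
    then show ?case using add[of j] by simp
  qed simp
  moreover have "ok m" if "i < k + k'" "t_sent Z E ((?r ^^ i) s) u v = Some m" for i u v m
  proof (cases "i < k")
    case True
    then show ?thesis using that assms(1) unfolding t_run_def by blast
  next
    case False
    then have "(?r ^^ i) s = (?r ^^ (i - k)) s'" "i - k < k'"
      using add[of "i - k"] that by auto
    then show ?thesis using that assms(2) unfolding t_run_def by metis
  qed
  ultimately show ?thesis
    using assms add[of k'] unfolding t_run_def by fastforce
qed

section \<open>Transfer to states that are natural numbers\<close>

text \<open>A vertex whose state is the history of everything it has observed can reconstruct a state
  of any type, and a history is a finite object, hence encodable as a number.\<close>

type_synonym history = "nat \<times> nat \<times> ((bool \<times> nat) + (nat \<times> bool list) list) list"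

context
  fixes Z :: "('x, 'm) typed_alg" and enc :: "'m \<Rightarrow> bool list"
  assumes inj_enc: "inj enc"
begin

fun observe :: "'x \<Rightarrow> (bool \<times> nat) + (nat \<times> bool list) list \<Rightarrow> 'x" where
  "observe x (Inl (b, u)) = t_notify Z (if b then Inserted u else Deleted u) x"
| "observe x (Inr l) = t_step Z x (\<lambda>u. map_option (inv enc) (map_of l u))"

definition replay :: "nat \<Rightarrow> 'x" where
  "replay h = (case (from_nat h :: history) of (n, v, l) \<Rightarrow> foldl observe (t_init Z n v) l)"

definition append_event :: "nat \<Rightarrow> (bool \<times> nat) + (nat \<times> bool list) list \<Rightarrow> nat" where
  "append_event h e = (case (from_nat h :: history) of (n, v, l) \<Rightarrow> to_nat (n, v, l @ [e]))"

text \<open>An inbox is a function. With finitely many senders it is \<open>map_of\<close> of some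
  association list, and any such list replays to the same state, so an arbitrary choice
  does.\<close>

definition nat_alg :: "nat dynamic_alg" where
  "nat_alg = \<lparr> d_init = (\<lambda>n v. to_nat ((n, v, []) :: history)),
     d_notify = (\<lambda>ev h. append_event h (case ev of Inserted u \<Rightarrow> Inl (True, u) | Deleted u \<Rightarrow> Inl (False, u))),
     d_send = (\<lambda>h w. map_option enc (t_send Z (replay h) w)),
     d_step = (\<lambda>h ib. append_event h (Inr (SOME l. map_of l = ib))),
     d_asleep = (\<lambda>h. t_silent Z (replay h)),
     d_out = (\<lambda>h. t_out Z (replay h)) \<rparr>"

lemma replay_append: "replay (append_event h e) = observe (replay h) e"
  by (cases "from_nat h :: history") (simp add: replay_def append_event_def)

lemma replay_init: "replay (d_init nat_alg n v) = t_init Z n v"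
  by (simp add: replay_def nat_alg_def)

lemma replay_wake: "replay \<circ> wake_endpoints nat_alg up h = t_wake Z up (replay \<circ> h)"
  by (cases up) (auto simp: fun_eq_iff nat_alg_def replay_append)

lemma finite_map_is_map_of:
  assumes "finite (dom m)"
  shows "\<exists>l. map_of l = m"
proof -
  obtain ks where "set ks = dom m" using finite_list[OF assms] by blast
  then have "map_of (map (\<lambda>k. (k, the (m k))) ks) = m"
    by (auto simp: fun_eq_iff map_of_map_keys domIff)
  then show ?thesis by blast
qed

lemma replay_step:
  assumes "finite (dom ib)"
  shows "replay (d_step nat_alg h ib) = t_step Z (replay h) (\<lambda>u. map_option (inv enc) (ib u))"
proof -
  have "map_of (SOME l. map_of l = ib) = ib"
    using finite_map_is_map_of[OF assms] by (rule someI_ex)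
  then show ?thesis by (simp add: nat_alg_def replay_append)
qed

lemma dynamic_sent_nat_alg:
  "dynamic_sent nat_alg E h u v = map_option enc (t_sent Z E (replay \<circ> h) u v)"
  by (auto simp: dynamic_sent_def nat_alg_def t_sent_def t_silent_def)

lemma replay_round:
  assumes "finite E"
  shows "replay \<circ> dynamic_round nat_alg E h = t_round Z E (replay \<circ> h)"
proof
  fix v
  \<comment> \<open>\<open>E\<close> is only known to be a finite family of sets, so its infinite
    members are discarded before taking the union.\<close>
  have "dom (\<lambda>u. dynamic_sent nat_alg E h u v) \<subseteq> \<Union> (E \<inter> {e. finite e})"
    by (auto simp: dynamic_sent_def split: if_splits)
  moreover have "finite (\<Union> (E \<inter> {e. finite e}))" using assms by auto
  ultimately have fin: "finite (dom (\<lambda>u. dynamic_sent nat_alg E h u v))" by (rule finite_subset)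
  have inv: "inv enc (enc m) = m" for m using inj_enc by simp
  have dec: "(\<lambda>u. map_option (inv enc) (dynamic_sent nat_alg E h u v)) = (\<lambda>u. t_sent Z E (replay \<circ> h) u v)"
    by (simp add: dynamic_sent_nat_alg option.map_comp comp_def inv option.map_ident)
  show "(replay \<circ> dynamic_round nat_alg E h) v = t_round Z E (replay \<circ> h) v"
  proof (cases "d_asleep nat_alg (h v) \<and> (\<forall>u. dynamic_sent nat_alg E h u v = None)")
    case True
    then have "t_silent Z (replay (h v))" "\<And>u. t_sent Z E (replay \<circ> h) u v = None"
      by (simp_all only: dynamic_sent_nat_alg option.map_disc_iff) (simp add: nat_alg_def)
    then show ?thesis using True
      by (simp add: dynamic_round_def t_round_def t_silent_def)
  next
    case False
    then have "dynamic_round nat_alg E h v = d_step nat_alg (h v) (\<lambda>u. dynamic_sent nat_alg E h u v)"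
      unfolding dynamic_round_def by (rule if_not_P)
    then show ?thesis
      using replay_step[OF fin, of "h v"] by (simp only: dec t_round_def comp_apply[of replay])
  qed
qed

lemma replay_rounds:
  assumes "finite E"
  shows "replay \<circ> (dynamic_round nat_alg E ^^ r) h = (t_round Z E ^^ r) (replay \<circ> h)"
proof (induction r)
  case (Suc r)
  then show ?case
    by (simp only: funpow.simps comp_apply[where f = "dynamic_round nat_alg E"]
        comp_apply[where f = "t_round Z E"] replay_round[OF assms])
qed simp

lemma quiescent_nat_alg: "quiescent nat_alg V h \<longleftrightarrow> (\<forall>v\<in>V. t_silent Z (replay (h v)))"
  by (simp add: quiescent_def nat_alg_def)

text \<open>A quiescent configuration is a fixed point of the round function, so running the typed
  algorithm for longer than the recovery time changes neither the result nor the costs.\<close>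

lemma nat_alg_update:
  assumes E: "finite E" "\<And>u v. {u, v} \<in> E \<Longrightarrow> u \<in> V \<and> v \<in> V"
    and out: "\<And>v. v \<notin> V \<Longrightarrow> t_silent Z (replay (h v))"
    and run: "t_run Z ok E (replay \<circ> h) k c s'" and quiet: "\<And>v. t_silent Z (s' v)"
  defines "r \<equiv> recovery_rounds nat_alg V E h"
  shows "quiescent nat_alg V ((dynamic_round nat_alg E ^^ k) h)"
    and "r \<le> k"
    and "replay \<circ> (dynamic_round nat_alg E ^^ r) h = s'"
    and "(\<Sum>i<r. card {(u, v). u \<in> V \<and> v \<in> V \<and>
           dynamic_sent nat_alg E ((dynamic_round nat_alg E ^^ i) h) u v \<noteq> None}) \<le> c"
    and "\<And>i u v msg. i < r \<Longrightarrow>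
           dynamic_sent nat_alg E ((dynamic_round nat_alg E ^^ i) h) u v = Some msg \<Longrightarrow>
           \<exists>m. ok m \<and> msg = enc m"
proof -
  let ?R = "t_round Z E" and ?s = "replay \<circ> h"
  let ?q = "\<lambda>i. quiescent nat_alg V ((dynamic_round nat_alg E ^^ i) h)"
  have st: "replay (((dynamic_round nat_alg E ^^ i) h) v) = (?R ^^ i) ?s v" for i v
    using replay_rounds[OF E(1), of i h] by (metis comp_apply)
  have fin: "(?R ^^ k) ?s = s'" using run by (simp add: t_run_def)
  show qk: "?q k" using quiet by (simp add: quiescent_nat_alg st fin)
  show rk: "r \<le> k" unfolding r_def recovery_rounds_def using qk by (rule Least_le)
  have qr: "?q r" unfolding r_def recovery_rounds_def using qk by (rule LeastI)
  \<comment> \<open>No edge touches a vertex outside \<open>V\<close>, so it keeps its silent state;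
    quiescence on \<open>V\<close> is then silence everywhere.\<close>
  have iso: "v \<notin> V \<Longrightarrow> (?R ^^ i) ?s v = ?s v" for v i
  proof (induction i)
    case (Suc i)
    have "t_sent Z E ((?R ^^ i) ?s) u v = None" for u
      using E(2) Suc.prems by (auto simp: t_sent_def)
    then have "(?R ^^ Suc i) ?s v = t_step Z ((?R ^^ i) ?s v) (\<lambda>_. None)"
      unfolding funpow.simps comp_apply[of ?R] by (simp only: t_round_def)
    also have "\<dots> = t_step Z (?s v) (\<lambda>_. None)" by (simp only: Suc.IH[OF Suc.prems])
    finally show ?case using out[OF Suc.prems] unfolding t_silent_def comp_apply[of replay h]
      by (elim conjE) (rule trans)
  qed simp
  have sil: "t_silent Z ((?R ^^ r) ?s v)" for v
    using qr out[of v] iso[of v r] by (cases "v \<in> V") (auto simp: quiescent_nat_alg st)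
  have fix1: "?R ((?R ^^ r) ?s) = (?R ^^ r) ?s"
  proof
    fix v
    have "t_sent Z E ((?R ^^ r) ?s) u v = None" for u
      using sil by (auto simp: t_sent_def t_silent_def)
    then show "?R ((?R ^^ r) ?s) v = (?R ^^ r) ?s v"
      using sil[of v] by (simp add: t_round_def t_silent_def)
  qed
  have "(?R ^^ (j + r)) ?s = (?R ^^ r) ?s" for j
    by (induction j) (simp_all add: fix1[unfolded comp_def] comp_def)
  from this[of "k - r"] have "(?R ^^ r) ?s = s'" using rk fin by simp
  then show "replay \<circ> (dynamic_round nat_alg E ^^ r) h = s'"
    by (simp add: replay_rounds[OF E(1)])
  have sent: "dynamic_sent nat_alg E ((dynamic_round nat_alg E ^^ i) h) u v
      = map_option enc (t_sent Z E ((?R ^^ i) ?s) u v)" for i u v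
    by (simp add: dynamic_sent_nat_alg replay_rounds[OF E(1)])
  have "{(u, v). u \<in> V \<and> v \<in> V \<and> t_sent Z E s u v \<noteq> None} = {(u, v). t_sent Z E s u v \<noteq> None}" for s
    using E(2) by (auto simp: t_sent_def split: if_splits)
  then have "(\<Sum>i<r. card {(u, v). u \<in> V \<and> v \<in> V \<and>
           dynamic_sent nat_alg E ((dynamic_round nat_alg E ^^ i) h) u v \<noteq> None})
      = (\<Sum>i<r. t_msgs Z E ((?R ^^ i) ?s))"
    by (simp add: sent t_msgs_def)
  also have "\<dots> \<le> (\<Sum>i<k. t_msgs Z E ((?R ^^ i) ?s))"
    using rk by (intro sum_mono2) auto
  also have "\<dots> \<le> c" using run by (simp add: t_run_def)
  finally show "(\<Sum>i<r. card {(u, v). u \<in> V \<and> v \<in> V \<and>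
           dynamic_sent nat_alg E ((dynamic_round nat_alg E ^^ i) h) u v \<noteq> None}) \<le> c" .
  show "\<exists>m. ok m \<and> msg = enc m" if il: "i < r"
    and se: "dynamic_sent nat_alg E ((dynamic_round nat_alg E ^^ i) h) u v = Some msg" for i u v msg
  proof -
    obtain m where "t_sent Z E ((?R ^^ i) ?s) u v = Some m" "msg = enc m"
      using se unfolding sent by (auto simp only: map_option_eq_Some)
    moreover from this(1) have "ok m"
      using run less_le_trans[OF il rk] unfolding t_run_def by blast
    ultimately show ?thesis by blast
  qed
qed

end

section \<open>The algorithm\<close>

text \<open>The flag of \<open>Mem\<close> singles out the one leaver that has to count the sender;
  \<open>Tok\<close> moves the token down the walk and \<open>Ret\<close> moves it back.\<close>

datatype opmsg = Explore nat | Up nat | Down nat | Mem bool | Cnt nat | Sim "bool list" | Tok | Ret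

text \<open>
  The components of a message are a status (heavy, member), a registration (\<^const>\<open>True\<close>) or its
  withdrawal, and a part belonging to an operation or to the token walk.
\<close>

type_synonym msg = "(bool \<times> bool) option \<times> bool option \<times> opmsg option"

text \<open>
  Local memory during an operation. The \<open>kind\<close> at the centre is 1 for a light vertex that may join, 2 for an
  uncovered heavy vertex and 3 for the winner of a conflict; it is 0 at all other vertices. \<open>dep\<close> and \<open>par\<close>
  describe the flooding tree, \<open>acc\<close> and \<open>tot\<close> the degree sums below the vertex and of the whole ball, \<open>gone\<close>
  the leavers, \<open>fpar\<close> the leaver chosen by an uncovered vertex, which is counted in the \<open>cnt\<close> of that leaver.
  \<open>sim\<close> holds the simulated states of the vertex itself and, at the centre, of the pendants.
\<close>

record 's mem =
  clk :: nat
  kind :: nat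
  dep :: nat
  par :: nat
  acc :: nat
  tot :: nat
  gone :: bool
  fpar :: "nat option"
  net :: "nat set"
  cnt :: nat
  sim :: "nat \<Rightarrow> 's"

text \<open>
  \<open>CW k\<close>: the winner of a conflict waits for the loser to become heavy; \<open>TW\<close>: the token has just arrived;
  \<open>Serve\<close>: the vertex holds the token.
\<close>

datatype 's phase = Idle | Greet nat | CW nat | TW | Serve | Op "'s mem"

text \<open>
  \<open>pH\<close>, \<open>pM\<close> and \<open>pboss\<close> are the values one round ago, \<open>nH\<close>, \<open>nP\<close> and \<open>nS\<close> the known heavy neighbours, light
  neighbours in the set and heavy neighbours in the set (the last only at heavy vertices), \<open>ch\<close> the vertices
  registered here, \<open>kick\<close> marks the loser of a conflict, and \<open>prs\<close> is the stack of vertices that passed the token on.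
\<close>

record 's st =
  nn :: nat
  me :: nat
  nbs :: "nat set"
  isH :: bool
  inM :: bool
  pH :: bool
  pM :: bool
  nH :: "nat set"
  nP :: "nat set"
  nS :: "nat set"
  boss :: "nat option"
  pboss :: "nat option"
  ch :: "nat set"
  ph :: "'s phase"
  kick :: bool
  prs :: "nat list"

record 's act =
  a_H :: bool
  a_M :: bool
  a_req :: "nat option"
  a_ph :: "'s phase"
  a_kick :: bool
  a_prs :: "nat list"

fun upval where "upval (Some (Up k)) = k" | "upval _ = (0::nat)"
text \<open>The successor accounts for the leaver itself besides the vertices that chose it.\<close>

fun cntval where "cntval (Some (Cnt k)) = Suc k" | "cntval _ = 0"
fun simval where "simval (Some (Sim l)) = Some l" | "simval _ = None"

lemma in_neighbours: "u \<in> neighbours E v \<longleftrightarrow> {u, v} \<in> E"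
  by (simp add: neighbours_def insert_commute)

lemma in_neighbours': "u \<in> neighbours E v \<longleftrightarrow> {v, u} \<in> E"
  by (simp add: neighbours_def)

lemma finite_edge_pairs:
  fixes E :: "nat set set"
  shows "finite E \<Longrightarrow> finite {(u, v). {u, v} \<in> E}"
proof -
  assume "finite E"
  have "{(u, v). {u, v} \<in> E} \<subseteq> \<Union> (E \<inter> {e. finite e}) \<times> \<Union> (E \<inter> {e. finite e})" by auto
  moreover have "finite (\<Union> (E \<inter> {e. finite e}))" using \<open>finite E\<close> by auto
  ultimately show ?thesis by (meson finite_SigmaI finite_subset)
qed

locale mis_scheme =
  fixes A :: "'s static_alg" and T :: "nat \<Rightarrow> nat" and a :: nat
begin

text \<open>Starting at \<open>n ^ a\<close> keeps the pendants apart from all IDs of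
  \<open>V\<close>; for this the static algorithm is invoked with the exponent
  \<open>a + 2\<close>.\<close>

definition vids :: "nat \<Rightarrow> nat \<Rightarrow> nat set" where
  "vids n k = {n ^ a ..< n ^ a + (n - k)}"

text \<open>A vertex at depth \<open>i\<close> is reached after \<open>i\<close> rounds. Starting
  its clock at \<open>i\<close> makes all clocks of an operation agree.\<close>

definition mem0 :: "nat \<Rightarrow> nat \<Rightarrow> nat \<Rightarrow> nat \<Rightarrow> 's mem" where
  "mem0 kd i p d = \<lparr>clk = i, kind = kd, dep = i, par = p, acc = d, tot = 0,
     gone = False, fpar = None, net = {}, cnt = 0, sim = (\<lambda>_. undefined)\<rparr>"

text \<open>A heavy member covers the vertices registered with it and keeps them; any other holder
  empties its list before returning the token.\<close>

definition serve_target :: "'s st \<Rightarrow> (nat \<times> opmsg) option" where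
  "serve_target s = (if \<not> (isH s \<and> inM s) \<and> ch s \<noteq> {} then Some (Min (ch s), Tok)
     else case prs s of [] \<Rightarrow> None | p # _ \<Rightarrow> Some (p, Ret))"

definition inR :: "'s mem \<Rightarrow> bool" where
  "inR m \<longleftrightarrow> kind m \<noteq> 0 \<or> gone m \<or> fpar m \<noteq> None"

text \<open>Schedule by the common clock: 0 to 2 flooding; 3 to 5 sums going up, sent from depth
  \<open>i\<close> at clock \<open>6 - i\<close>; 6 to 8 the total going down; 8 conversion; 11 the
  centre joins; 12 the leavers leave; 13 uncovered vertices choose a leaver; 14 and 15 the simulated
  network and its size; from 16 on the simulation. Clocks 9 to 13 carry only statuses and
  registrations.\<close>

definition memsend :: "'s st \<Rightarrow> 's mem \<Rightarrow> nat \<Rightarrow> opmsg option" where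
  "memsend s m w =
    (if clk m = dep m \<and> clk m < 3 then (if w \<in> nH s then Some (Explore (clk m)) else None)
     else if 3 \<le> clk m \<and> clk m + dep m = 6 \<and> 0 < dep m then (if w = par m then Some (Up (acc m)) else None)
     else if clk m = 6 + dep m \<and> dep m < 3 then (if w \<in> nH s then Some (Down (tot m)) else None)
     else if clk m = 14 \<and> inR m then
       (if w \<in> nH s \<or> gone m \<and> w = par m then Some (Mem (fpar m = Some w)) else None)
     else if clk m = 15 \<and> gone m then (if w = par m then Some (Cnt (cnt m)) else None)
     else if 16 \<le> clk m \<and> clk m < 16 + T (nn s) then
       (if w \<in> net m then map_option Sim (s_send A (sim m (me s)) w) else None)
     else None)"

definition opsend :: "'s st \<Rightarrow> nat \<Rightarrow> opmsg option" where
  "opsend s w = (case ph s of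
     Serve \<Rightarrow> (case serve_target s of Some (p, msg) \<Rightarrow> if w = p then Some msg else None | None \<Rightarrow> None)
   | Op m \<Rightarrow> memsend s m w
   | _ \<Rightarrow> None)"

text \<open>A change is announced one round later, by comparison with the previous values.
  Restricting the announcement to heavy neighbours when the sender was and stays heavy is what makes
  joins and leaves of heavy vertices cheap.\<close>

definition stsend :: "'s st \<Rightarrow> nat \<Rightarrow> (bool \<times> bool) option" where
  "stsend s w = (if (isH s, inM s) \<noteq> (pH s, pM s) \<and> w \<in> (if isH s \<and> pH s then nH s else nbs s)
       \<or> ph s = Greet w then Some (isH s, inM s) else None)"

definition rgsend :: "'s st \<Rightarrow> nat \<Rightarrow> bool option" where
  "rgsend s w = (if boss s = Some w \<and> pboss s \<noteq> Some w then Some True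
     else if pboss s = Some w \<and> boss s \<noteq> Some w then Some False else None)"

definition send :: "'s st \<Rightarrow> nat \<Rightarrow> msg option" where
  "send s w = (if stsend s w = None \<and> rgsend s w = None \<and> opsend s w = None then None
     else Some (stsend s w, rgsend s w, opsend s w))"

text \<open>At clock 12 the announcement of a light centre that joined at clock 11 has just arrived
  in \<open>nP'\<close>. The loser of a conflict leaves on account of its mark instead.\<close>

definition leaves :: "'s st \<Rightarrow> nat set \<Rightarrow> 's mem \<Rightarrow> bool" where
  "leaves s nP' m \<longleftrightarrow> clk m = 12 \<and> inM s \<and> isH s \<and> kind m = 0 \<and> (nP' \<noteq> {} \<or> kick s)"

definition simnext :: "'s st \<Rightarrow> 's mem \<Rightarrow> (nat \<Rightarrow> opmsg option) \<Rightarrow> nat \<Rightarrow> 's" where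
  "simnext s m oi = (\<lambda>i.
     if i = me s then s_step A (sim m (me s))
       (\<lambda>j. if kind m \<noteq> 0 \<and> j \<in> vids (nn s) (cnt m) then s_send A (sim m j) (me s) else simval (oi j))
     else if kind m \<noteq> 0 \<and> i \<in> vids (nn s) (cnt m) then
       s_step A (sim m i) (\<lambda>j. if j = me s then s_send A (sim m (me s)) i else None)
     else undefined)"

text \<open>Only the centre has a nonzero kind, so this test doubles as membership in the input
  set.\<close>

definition siminit :: "'s st \<Rightarrow> 's mem \<Rightarrow> nat \<Rightarrow> nat \<Rightarrow> 's" where
  "siminit s m c = (\<lambda>i.
     if i = me s then s_init A (nn s) (me s) (net m \<union> (if kind m \<noteq> 0 then vids (nn s) c else {})) (kind m \<noteq> 0)
     else if kind m \<noteq> 0 \<and> i \<in> vids (nn s) c then s_init A (nn s) i {me s} False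
     else undefined)"

text \<open>At clock 13 the status \<open>(True, False)\<close> comes exactly from the neighbours
  that left in the round before, so the senders are the leavers among which an uncovered vertex
  chooses.\<close>

definition memstep :: "'s st \<Rightarrow> nat set \<Rightarrow> nat set \<Rightarrow> (nat \<Rightarrow> (bool \<times> bool) option)
    \<Rightarrow> (nat \<Rightarrow> opmsg option) \<Rightarrow> 's mem \<Rightarrow> 's mem" where
  "memstep s nP' nS' si oi m =
    (let acc' = acc m + (\<Sum>u\<in>nbs s. upval (oi u));
         D = {k. \<exists>u. oi u = Some (Down k)};
         cnt' = (if clk m = 14 then card {u. oi u = Some (Mem True)}
            else if clk m = 15 \<and> kind m \<noteq> 0 then Suc (\<Sum>u\<in>nbs s. cntval (oi u)) else cnt m)
     in \<lparr>clk = Suc (clk m), kind = kind m, dep = dep m, par = par m, acc = acc',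
         tot = (if kind m \<noteq> 0 \<and> clk m = 5 then acc' else if D = {} then tot m else Min D),
         gone = (gone m \<or> leaves s nP' m),
         fpar = (if clk m = 13 \<and> kind m = 0 \<and> isH s \<and> \<not> inM s \<and> nP' = {} \<and> nS' = {}
                 then Some (Min {u. si u = Some (True, False)}) else fpar m),
         net = (if clk m = 14 \<and> inR m then {u. \<exists>b. oi u = Some (Mem b)} else net m),
         cnt = cnt',
         sim = (if clk m = 15 then siminit s m cnt'
                else if 16 \<le> clk m then simnext s m oi else sim m)\<rparr>)"

text \<open>In a conflict a heavy endpoint is preferred as the loser, since a light one has to tell
  all its neighbours that it turns heavy. The two rounds of \<open>CW\<close> let this announcement
  and the registrations that it causes settle. A kicked vertex is exempt from conversion because it
  has to leave as a heavy one.\<close>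

definition act :: "'s st \<Rightarrow> nat set \<Rightarrow> nat set \<Rightarrow> nat set \<Rightarrow> (nat \<Rightarrow> (bool \<times> bool) option)
    \<Rightarrow> (nat \<Rightarrow> opmsg option) \<Rightarrow> 's act" where
  "act s nP' nS' ch' si oi =
    (let d = \<lparr>a_H = isH s, a_M = inM s, a_req = None, a_ph = Idle, a_kick = kick s, a_prs = prs s\<rparr>
     in case ph s of
       Idle \<Rightarrow>
        (if \<exists>u k. oi u = Some (Explore k)
         then d\<lparr>a_ph := Op (mem0 0 (Suc (Min {k. \<exists>u. oi u = Some (Explore k)}))
                  (Min {u. \<exists>k. oi u = Some (Explore k)}) (card (nbs s)))\<rparr>
         else if \<exists>p. oi p = Some Tok then d\<lparr>a_ph := TW, a_prs := (THE p. oi p = Some Tok) # prs s\<rparr>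
         else if \<exists>p. oi p = Some Ret then d\<lparr>a_ph := TW\<rparr>
         else d)
     | Greet v \<Rightarrow>
        (case si v of None \<Rightarrow> d
         | Some (h, m) \<Rightarrow>
            if inM s \<and> m then
              (if (if isH s = h then v < me s else isH s)
               then d\<lparr>a_H := True, a_kick := True\<rparr> else d\<lparr>a_ph := CW 1\<rparr>)
            else d)
     | CW k \<Rightarrow> d\<lparr>a_ph := (if k = 0 then Op (mem0 3 0 (me s) (card (nbs s))) else CW (k - 1))\<rparr>
     | TW \<Rightarrow> d\<lparr>a_ph := (if \<not> isH s \<and> \<not> inM s \<and> nP' = {} \<and> boss s = None then Op (mem0 1 0 (me s) (card (nbs s))) else Serve)\<rparr>
     | Serve \<Rightarrow> d\<lparr>a_prs := (if \<not> (isH s \<and> inM s) \<and> ch s \<noteq> {} then prs s else tl (prs s))\<rparr>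
     | Op m \<Rightarrow>
        (let m' = memstep s nP' nS' si oi m in
         \<lparr>a_H = (isH s \<and> \<not> (clk m = 8 \<and> kind m = 0 \<and> \<not> kick s \<and> card (nbs s) ^ 3 \<le> tot m' ^ 2)),
          a_M = (if clk m = 11 \<and> (kind m = 1 \<and> nP' = {} \<or> kind m = 2) then True
                 else if leaves s nP' m then False
                 else if clk m = 15 + T (nn s) \<and> fpar m \<noteq> None \<and> s_out A (sim m' (me s)) then True
                 else inM s),
          a_req = (if leaves s nP' m \<and> \<not> kick s \<and> ch' \<noteq> {} then Some (par m) else None),
          a_ph = (if clk m = 16 + T (nn s) then (if kind m \<in> {1, 2} \<or> kick s then Serve else Idle) else Op m'),
          a_kick = (kick s \<and> clk m \<noteq> 16 + T (nn s)),
          a_prs = prs s\<rparr>))"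

text \<open>The token cancels the registration of its receiver, who is being served right now. A
  returning token does so only next to a light member: there the registration merely asked for the
  receiver's own list to be visited, which it now does itself.\<close>

definition tokened :: "(nat \<Rightarrow> opmsg option) \<Rightarrow> nat set \<Rightarrow> bool" where
  "tokened oi nP' \<longleftrightarrow> (\<exists>p. oi p = Some Tok) \<or> nP' \<noteq> {} \<and> (\<exists>p. oi p = Some Ret)"

definition stin :: "(nat \<Rightarrow> msg option) \<Rightarrow> nat \<Rightarrow> (bool \<times> bool) option" where
  "stin ib u = Option.bind (ib u) fst"
definition rgin :: "(nat \<Rightarrow> msg option) \<Rightarrow> nat \<Rightarrow> bool option" where
  "rgin ib u = Option.bind (ib u) (fst \<circ> snd)"
definition opin :: "(nat \<Rightarrow> msg option) \<Rightarrow> nat \<Rightarrow> opmsg option" where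
  "opin ib u = Option.bind (ib u) (snd \<circ> snd)"

text \<open>A registration lasts while it has a purpose: the vertex is light without a light
  neighbour in the set, or others are registered with it and must be reached through it. A vertex
  that turns light keeps \<open>nS\<close> for one more round, in order to pick its boss
  there.\<close>

definition step :: "'s st \<Rightarrow> (nat \<Rightarrow> msg option) \<Rightarrow> 's st" where
  "step s ib =
    (let si = stin ib; oi = opin ib;
         nH' = {u \<in> nbs s. case si u of Some (h, _) \<Rightarrow> h | None \<Rightarrow> u \<in> nH s};
         nP' = {u \<in> nbs s. case si u of Some (h, m) \<Rightarrow> \<not> h \<and> m | None \<Rightarrow> u \<in> nP s};
         nS' = {u \<in> nbs s. case si u of Some (h, m) \<Rightarrow> h \<and> m | None \<Rightarrow> u \<in> nS s};
         ch' = {u. case rgin ib u of Some b \<Rightarrow> b | None \<Rightarrow> u \<in> ch s};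
         r = act s nP' nS' ch' si oi
     in \<lparr>nn = nn s, me = me s, nbs = nbs s, isH = a_H r, inM = a_M r, pH = isH s, pM = inM s,
         nH = nH', nP = nP', nS = (if a_H r \<or> isH s then nS' else {}),
         boss = (if tokened oi nP' then None
            else if boss s = None then
              (if a_req r \<noteq> None then a_req r
               else if \<not> isH s \<and> \<not> a_M r \<and> nP' = {} \<and> nS' \<noteq> {} \<and> ch' = {} then Some (Min nS') else None)
            else if \<not> a_M r \<and> (\<not> a_H r \<and> nP' = {} \<or> ch' \<noteq> {}) then boss s else None),
         pboss = boss s, ch = ch', ph = a_ph r, kick = a_kick r, prs = a_prs r\<rparr>)"

text \<open>After a deletion the fields of an endpoint already show whether it lost its last cover,
  so an operation can start at once; after an insertion the statuses of the endpoints must first be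
  exchanged.\<close>

fun notify :: "local_event \<Rightarrow> 's st \<Rightarrow> 's st" where
  "notify (Inserted v) s = s\<lparr>nbs := insert v (nbs s), ph := Greet v\<rparr>"
| "notify (Deleted v) s =
    (let s1 = s\<lparr>nbs := nbs s - {v}, nH := nH s - {v}, nP := nP s - {v}, nS := nS s - {v},
               ch := ch s - {v}, boss := (if boss s = Some v then None else boss s),
               pboss := (if pboss s = Some v then None else pboss s)\<rparr>
     in s1\<lparr>ph := (if \<not> inM s1 \<and> \<not> isH s1 \<and> nP s1 = {} \<and> boss s1 = None
                  then Op (mem0 1 0 (me s) (card (nbs s1)))
                 else if \<not> inM s1 \<and> isH s1 \<and> nP s1 = {} \<and> nS s1 = {}
                  then Op (mem0 2 0 (me s) (card (nbs s1)))
                 else Idle)\<rparr>)"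

text \<open>All vertices start as light members, which is the only MIS of the empty network; with
  \<open>pM\<close> set as well, there is nothing to announce.\<close>

definition alg :: "('s st, msg) typed_alg" where
  "alg = \<lparr>t_init = (\<lambda>n v. \<lparr>nn = n, me = v, nbs = {}, isH = False, inM = True, pH = False, pM = True,
        nH = {}, nP = {}, nS = {}, boss = None, pboss = None, ch = {}, ph = Idle, kick = False, prs = []\<rparr>),
     t_notify = notify, t_send = send, t_step = step, t_out = inM\<rparr>"

lemma alg_simps [simp]:
  "t_notify alg = notify" "t_send alg = send" "t_step alg = step" "t_out alg = inM"
  by (simp_all add: alg_def)

section \<open>Global configurations\<close>

text \<open>The fields describing the neighbourhood lag one round behind: \<open>(H0, M0, b0)\<close> is the
  previous and \<open>(H1, M1, b1)\<close> the current global assignment of heaviness, membership and bosses.\<close>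

definition conf :: "nat \<Rightarrow> nat set set \<Rightarrow> nat set \<Rightarrow> nat set \<Rightarrow> (nat \<Rightarrow> nat option) \<Rightarrow>
   nat set \<Rightarrow> nat set \<Rightarrow> (nat \<Rightarrow> nat option) \<Rightarrow> (nat \<Rightarrow> 's phase) \<Rightarrow> (nat \<Rightarrow> bool) \<Rightarrow> (nat \<Rightarrow> nat list)
   \<Rightarrow> nat \<Rightarrow> 's st" where
  "conf n E H0 M0 b0 H1 M1 b1 f kf pr v =
    \<lparr>nn = n, me = v, nbs = neighbours E v, isH = (v \<in> H1), inM = (v \<in> M1), pH = (v \<in> H0), pM = (v \<in> M0),
     nH = neighbours E v \<inter> H0, nP = neighbours E v \<inter> (M0 - H0),
     nS = (if v \<in> H1 \<or> v \<in> H0 then neighbours E v \<inter> (M0 \<inter> H0) else {}),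
     boss = b1 v, pboss = b0 v, ch = {u. b0 u = Some v}, ph = f v, kick = kf v, prs = pr v\<rparr>"

text \<open>The value of \<open>nS\<close> once the current announcements are taken in. A light
  vertex has no record of heavy members, so it sees only those neighbours that turn heavy right
  now.\<close>

definition freshS :: "nat set set \<Rightarrow> nat set \<Rightarrow> nat set \<Rightarrow> nat set \<Rightarrow> nat \<Rightarrow> nat set" where
  "freshS E H0 H1 M1 v = neighbours E v \<inter> M1 \<inter> (if v \<in> H1 \<or> v \<in> H0 then H1 else H1 - H0)"

text \<open>The rule for \<open>boss\<close> in \<open>step\<close>, expressed by global sets; the
  list of vertices registered with \<open>v\<close> is read off \<open>b1\<close>.\<close>

definition bnext :: "nat set set \<Rightarrow> nat set \<Rightarrow> nat set \<Rightarrow> nat set \<Rightarrow> (nat \<Rightarrow> nat option) \<Rightarrow> nat set \<Rightarrow>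
    nat set \<Rightarrow> (nat \<Rightarrow> nat option) \<Rightarrow> (nat \<Rightarrow> bool) \<Rightarrow> nat \<Rightarrow> nat option" where
  "bnext E H0 H1 M1 b1 H2 M2 req tk v =
    (if tk v then None
     else if b1 v = None then
       (if req v \<noteq> None then req v
        else if v \<notin> H1 \<and> v \<notin> M2 \<and> neighbours E v \<inter> (M1 - H1) = {} \<and> freshS E H0 H1 M1 v \<noteq> {}
          \<and> {u. b1 u = Some v} = {}
        then Some (Min (freshS E H0 H1 M1 v)) else None)
     else if v \<notin> M2 \<and> (v \<notin> H2 \<and> neighbours E v \<inter> (M1 - H1) = {} \<or> {u. b1 u = Some v} \<noteq> {})
     then b1 v else None)"

definition opinbox :: "nat \<Rightarrow> nat set set \<Rightarrow> nat set \<Rightarrow> nat set \<Rightarrow> (nat \<Rightarrow> nat option) \<Rightarrow>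
   nat set \<Rightarrow> nat set \<Rightarrow> (nat \<Rightarrow> nat option) \<Rightarrow> (nat \<Rightarrow> 's phase) \<Rightarrow> (nat \<Rightarrow> bool) \<Rightarrow> (nat \<Rightarrow> nat list)
   \<Rightarrow> nat \<Rightarrow> nat \<Rightarrow> opmsg option" where
  "opinbox n E H0 M0 b0 H1 M1 b1 f kf pr v u =
     (if {u, v} \<in> E then opsend (conf n E H0 M0 b0 H1 M1 b1 f kf pr u) v else None)"

definition stinbox :: "nat set set \<Rightarrow> nat set \<Rightarrow> nat set \<Rightarrow> nat set \<Rightarrow> nat set \<Rightarrow> nat \<Rightarrow> nat \<Rightarrow> (bool \<times> bool) option" where
  "stinbox E H0 M0 H1 M1 v u =
     (if {u, v} \<in> E \<and> (u \<in> H1, u \<in> M1) \<noteq> (u \<in> H0, u \<in> M0) \<and> (u \<in> H1 \<and> u \<in> H0 \<longrightarrow> v \<in> H0)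
      then Some (u \<in> H1, u \<in> M1) else None)"

lemma sent_conf:
  fixes n E H0 M0 b0 H1 M1 b1 f kf pr
  assumes "\<And>u v. f u \<noteq> Greet v"
  defines "s \<equiv> conf n E H0 M0 b0 H1 M1 b1 f kf pr"
  shows "stin (\<lambda>u. t_sent alg E s u v) = stinbox E H0 M0 H1 M1 v"
    and "opin (\<lambda>u. t_sent alg E s u v) = opinbox n E H0 M0 b0 H1 M1 b1 f kf pr v"
    and "rgin (\<lambda>u. t_sent alg E s u v) = (\<lambda>u. if {u, v} \<in> E then rgsend (s u) v else None)"
  using assms(1)
  by (auto simp: fun_eq_iff stin_def opin_def rgin_def t_sent_def send_def stinbox_def stsend_def
      opinbox_def s_def conf_def in_neighbours')

text \<open>Rounds map configurations to configurations, so that the rest can speak of sets instead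
  of states. A light vertex is not told of membership changes of its heavy neighbours;
  \<open>nsA\<close> and \<open>nsB\<close> ensure that a vertex turning heavy has missed none that
  matters.\<close>

lemma round_conf:
  assumes ng: "\<And>u v. f u \<noteq> Greet v"
    and bE: "\<And>u v. b0 u = Some v \<Longrightarrow> {u, v} \<in> E" "\<And>u v. b1 u = Some v \<Longrightarrow> {u, v} \<in> E"
    and nsA: "\<And>u v. v \<notin> H0 \<Longrightarrow> v \<in> H1 \<or> v \<in> H2 \<Longrightarrow> {u, v} \<in> E \<Longrightarrow> u \<in> H0 \<Longrightarrow> u \<in> H1
        \<Longrightarrow> u \<in> M0 \<longleftrightarrow> u \<in> M1"
    and nsB: "\<And>u v. v \<notin> H0 \<Longrightarrow> v \<notin> H1 \<Longrightarrow> v \<in> H2 \<Longrightarrow> {u, v} \<in> E \<Longrightarrow> u \<in> H1 \<Longrightarrow> u \<in> M1 \<Longrightarrow> False"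
    and act: "\<And>v. act (conf n E H0 M0 b0 H1 M1 b1 f kf pr v) (neighbours E v \<inter> (M1 - H1)) (freshS E H0 H1 M1 v)
        {u. b1 u = Some v} (stinbox E H0 M0 H1 M1 v) (opinbox n E H0 M0 b0 H1 M1 b1 f kf pr v)
      = \<lparr>a_H = (v \<in> H2), a_M = (v \<in> M2), a_req = req v, a_ph = f' v, a_kick = kf' v, a_prs = pr' v\<rparr>"
    and b2: "\<And>v. b2 v = bnext E H0 H1 M1 b1 H2 M2 req (\<lambda>v. tokened (opinbox n E H0 M0 b0 H1 M1 b1 f kf pr v) (neighbours E v \<inter> (M1 - H1))) v"
  shows "t_round alg E (conf n E H0 M0 b0 H1 M1 b1 f kf pr) = conf n E H1 M1 b1 H2 M2 b2 f' kf' pr'"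
proof
  fix v
  let ?s = "conf n E H0 M0 b0 H1 M1 b1 f kf pr"
  let ?si = "stinbox E H0 M0 H1 M1 v"
  have nb: "nbs (?s v) = neighbours E v" "isH (?s v) = (v \<in> H1)" "inM (?s v) = (v \<in> M1)"
    "boss (?s v) = b1 v" "nn (?s v) = n" "me (?s v) = v"
    by (simp_all add: conf_def)
  have e1: "{u \<in> nbs (?s v). case ?si u of Some (h, _) \<Rightarrow> h | None \<Rightarrow> u \<in> nH (?s v)} = neighbours E v \<inter> H1"
    by (auto simp: conf_def stinbox_def in_neighbours split: if_splits option.splits)
  have e2: "{u \<in> nbs (?s v). case ?si u of Some (h, m) \<Rightarrow> \<not> h \<and> m | None \<Rightarrow> u \<in> nP (?s v)}
      = neighbours E v \<inter> (M1 - H1)"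
    by (auto simp: conf_def stinbox_def in_neighbours split: if_splits option.splits)
  have e3: "{u \<in> nbs (?s v). case ?si u of Some (h, m) \<Rightarrow> h \<and> m | None \<Rightarrow> u \<in> nS (?s v)}
      = freshS E H0 H1 M1 v"
    using nsA[of v] by (auto simp: conf_def stinbox_def in_neighbours freshS_def split: if_splits option.splits)
  have e4: "{u. case rgin (\<lambda>u. t_sent alg E ?s u v) u of Some b \<Rightarrow> b | None \<Rightarrow> u \<in> ch (?s v)} = {u. b1 u = Some v}"
    using bE by (auto simp: sent_conf(3)[OF ng] conf_def rgsend_def split: if_splits option.splits)
  have e5: "(if v \<in> H2 \<or> v \<in> H1 then freshS E H0 H1 M1 v else {})
     = (if v \<in> H2 \<or> v \<in> H1 then neighbours E v \<inter> (M1 \<inter> H1) else {})"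
    using nsB[of v] by (auto simp: freshS_def in_neighbours)
  show "t_round alg E ?s v = conf n E H1 M1 b1 H2 M2 b2 f' kf' pr' v"
    unfolding t_round_def alg_simps step_def Let_def sent_conf(1,2)[OF ng] unfolding e4 unfolding e1 e2 e3
    unfolding nb act unfolding act.simps e5 unfolding conf_def[of n E H1 M1 b1 H2 M2 b2 f' kf' pr'] b2 bnext_def
    by (rule refl)
qed

definition opcount :: "nat \<Rightarrow> nat set set \<Rightarrow> nat set \<Rightarrow> nat set \<Rightarrow> (nat \<Rightarrow> nat option) \<Rightarrow>
   nat set \<Rightarrow> nat set \<Rightarrow> (nat \<Rightarrow> nat option) \<Rightarrow> (nat \<Rightarrow> 's phase) \<Rightarrow> (nat \<Rightarrow> bool) \<Rightarrow> (nat \<Rightarrow> nat list)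
   \<Rightarrow> (nat \<times> nat) set" where
  "opcount n E H0 M0 b0 H1 M1 b1 f kf pr =
     {(u, v). opinbox n E H0 M0 b0 H1 M1 b1 f kf pr v u \<noteq> None}"

definition stcount :: "nat set set \<Rightarrow> nat set \<Rightarrow> nat set \<Rightarrow> nat set \<Rightarrow> nat set \<Rightarrow> (nat \<times> nat) set" where
  "stcount E H0 M0 H1 M1 = {(u, v). stinbox E H0 M0 H1 M1 v u \<noteq> None}"

lemma stcount_same [simp]: "stcount E H0 M0 H0 M0 = {}"
  by (simp add: stcount_def stinbox_def)

lemma rgsend_conf:
  "rgsend (conf n E H0 M0 b0 H1 M1 b1 f kf pr u) v \<noteq> None \<longleftrightarrow>
     b0 u \<noteq> b1 u \<and> (b0 u = Some v \<or> b1 u = Some v)"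
  by (auto simp: rgsend_def conf_def)

text \<open>By \<open>nd\<close> a boss is never exchanged for another one in a single round, so a
  vertex whose registration changes sends one message about it.\<close>

lemma msgs_conf:
  assumes E: "finite E" and ng: "\<And>u v. f u \<noteq> Greet v"
    and bE: "\<And>u v. b0 u = Some v \<Longrightarrow> {u, v} \<in> E" "\<And>u v. b1 u = Some v \<Longrightarrow> {u, v} \<in> E"
    and nd: "\<And>u. b0 u \<noteq> b1 u \<Longrightarrow> b0 u = None \<or> b1 u = None"
  shows "t_msgs alg E (conf n E H0 M0 b0 H1 M1 b1 f kf pr)
     \<le> card (stcount E H0 M0 H1 M1) + card {u. b0 u \<noteq> b1 u} + card (opcount n E H0 M0 b0 H1 M1 b1 f kf pr)"
proof -
  let ?s = "conf n E H0 M0 b0 H1 M1 b1 f kf pr"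
  let ?rg = "{(u, v). {u, v} \<in> E \<and> rgsend (?s u) v \<noteq> None}"
  have sub: "{(u, v). t_sent alg E ?s u v \<noteq> None} \<subseteq>
      stcount E H0 M0 H1 M1 \<union> ?rg \<union> opcount n E H0 M0 b0 H1 M1 b1 f kf pr"
  proof safe
    fix u v msg
    assume m: "t_sent alg E ?s u v = Some msg"
      and n1: "(u, v) \<notin> opcount n E H0 M0 b0 H1 M1 b1 f kf pr" and n2: "(u, v) \<notin> stcount E H0 M0 H1 M1"
    have e: "{u, v} \<in> E" using m by (auto simp: t_sent_def split: if_splits)
    have "stin (\<lambda>u. t_sent alg E ?s u v) u = None" "opin (\<lambda>u. t_sent alg E ?s u v) u = None"
      unfolding sent_conf[OF ng] using n1 n2 by (simp_all add: opcount_def stcount_def del: not_None_eq)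
    then have "stsend (?s u) v = None" "opsend (?s u) v = None"
      using m e by (auto simp: stin_def opin_def t_sent_def send_def split: if_splits)
    then have "rgsend (?s u) v \<noteq> None" using m e by (auto simp: t_sent_def send_def split: if_splits)
    then show "{u, v} \<in> E" "\<exists>y. rgsend (?s u) v = Some y" using e by auto
  qed
  have f: "finite (stcount E H0 M0 H1 M1)" "finite ?rg" "finite (opcount n E H0 M0 b0 H1 M1 b1 f kf pr)"
    by (auto intro!: finite_subset[OF _ finite_edge_pairs[OF E]]
        simp: stcount_def stinbox_def opcount_def opinbox_def split: if_splits)
  have "card ?rg \<le> card {u. b0 u \<noteq> b1 u}"
  proof (rule card_inj_on_le[where f = fst])
    show "inj_on fst ?rg"
    proof (rule inj_onI)
      fix x y assume x: "x \<in> ?rg" and y: "y \<in> ?rg" and xy: "fst x = fst y"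
      obtain u v v' where p: "x = (u, v)" "y = (u, v')" using xy by (cases x; cases y) auto
      have "b0 u = Some v \<or> b1 u = Some v" "b0 u = Some v' \<or> b1 u = Some v'" "b0 u \<noteq> b1 u"
        using x y unfolding p mem_Collect_eq case_prod_conv rgsend_conf by blast+
      then show "x = y" using nd[of u] unfolding p by auto
    qed
    show "fst ` ?rg \<subseteq> {u. b0 u \<noteq> b1 u}" unfolding rgsend_conf by auto
    have "{u. b0 u \<noteq> b1 u} \<subseteq> fst ` {(u, v). {u, v} \<in> E}"
    proof
      fix u assume "u \<in> {u. b0 u \<noteq> b1 u}"
      then obtain v where "b0 u = Some v \<or> b1 u = Some v" by (cases "b0 u"; cases "b1 u") auto
      then have "{u, v} \<in> E" using bE by blast
      then show "u \<in> fst ` {(u, v). {u, v} \<in> E}" by force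
    qed
    then show "finite {u. b0 u \<noteq> b1 u}"
      using finite_edge_pairs[OF E] by (meson finite_imageI finite_subset)
  qed
  moreover have "t_msgs alg E ?s \<le> card (stcount E H0 M0 H1 M1 \<union> ?rg \<union> opcount n E H0 M0 b0 H1 M1 b1 f kf pr)"
    unfolding t_msgs_def using f by (intro card_mono[OF _ sub]) simp
  moreover note card_Un_le[of "stcount E H0 M0 H1 M1 \<union> ?rg" "opcount n E H0 M0 b0 H1 M1 b1 f kf pr"]
      card_Un_le[of "stcount E H0 M0 H1 M1" ?rg]
  ultimately show ?thesis by linarith
qed

definition okop :: "nat \<Rightarrow> real \<Rightarrow> opmsg option \<Rightarrow> bool" where
  "okop n \<beta> o' = (case o' of Some (Explore k) \<Rightarrow> k \<le> n ^ 2 | Some (Up k) \<Rightarrow> k \<le> n ^ 2 | Some (Down k) \<Rightarrow> k \<le> n ^ 2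
     | Some (Cnt k) \<Rightarrow> k \<le> n ^ 2 | Some (Sim l) \<Rightarrow> real (length l) \<le> \<beta> * log 2 (real n) | _ \<Rightarrow> True)"

definition okmsg :: "nat \<Rightarrow> real \<Rightarrow> msg \<Rightarrow> bool" where
  "okmsg n \<beta> m = okop n \<beta> (snd (snd m))"

lemma run_conf:
  assumes E: "finite E" and ng: "\<And>u v. f u \<noteq> Greet v"
    and bE: "\<And>u v. b0 u = Some v \<Longrightarrow> {u, v} \<in> E" "\<And>u v. b1 u = Some v \<Longrightarrow> {u, v} \<in> E"
    and nd: "\<And>u. b0 u \<noteq> b1 u \<Longrightarrow> b0 u = None \<or> b1 u = None"
    and r: "t_round alg E (conf n E H0 M0 b0 H1 M1 b1 f kf pr) = s'"
    and ok: "\<And>u v. okop n \<beta> (opinbox n E H0 M0 b0 H1 M1 b1 f kf pr v u)"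
    and c: "card (stcount E H0 M0 H1 M1) + card {u. b0 u \<noteq> b1 u} + card (opcount n E H0 M0 b0 H1 M1 b1 f kf pr) \<le> c"
  shows "t_run alg (okmsg n \<beta>) E (conf n E H0 M0 b0 H1 M1 b1 f kf pr) 1 c s'"
proof (rule t_run_step[OF r])
  let ?s = "conf n E H0 M0 b0 H1 M1 b1 f kf pr"
  show "t_msgs alg E ?s \<le> c"
    using msgs_conf[OF E ng bE nd] c by (rule le_trans)
  fix u v m assume m: "t_sent alg E ?s u v = Some m"
  have "opin (\<lambda>u. t_sent alg E ?s u v) u = snd (snd m)" by (simp add: opin_def m)
  then show "okmsg n \<beta> m" using ok[of v u] unfolding sent_conf[OF ng] okmsg_def by simp
qed

end

section \<open>Degrees\<close>

abbreviation degree :: "nat set set \<Rightarrow> nat \<Rightarrow> nat" where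
  "degree E v \<equiv> card (neighbours E v)"

lemma finite_neighbours: "finite E \<Longrightarrow> finite (neighbours E v)"
  by (rule finite_subset[OF _ finite_imageI[OF finite_edge_pairs, of E snd]])
     (force simp: neighbours_def)+

lemma card_edge_pairs:
  fixes E :: "nat set set"
  shows "finite E \<Longrightarrow> card {(u, v). {u, v} \<in> E} \<le> 2 * card E"
proof -
  assume E: "finite E"
  have two: "card {(u, v). {u, v} = e} \<le> 2" for e :: "nat set"
  proof (cases "\<exists>x y. e = {x, y}")
    case True
    then obtain x y where "e = {x, y}" by blast
    then have "{(u, v). {u, v} = e} \<subseteq> {(x, y), (y, x)}" by (auto simp: doubleton_eq_iff)
    then show ?thesis using card_mono[of "{(x, y), (y, x)}" "{(u, v). {u, v} = e}"] card_insert_le_m1[of 2 "{(y, x)}" "(x, y)"]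
      by simp
  next
    case False
    then have "{(u, v). {u, v} = e} = {}" by blast
    then show ?thesis by simp
  qed
  have "{(u, v). {u, v} \<in> E} = (\<Union>e\<in>E. {(u, v). {u, v} = e})" by auto
  then have "card {(u, v). {u, v} \<in> E} \<le> (\<Sum>e\<in>E. card {(u, v). {u, v} = e})"
    by (simp add: card_UN_le E)
  also have "\<dots> \<le> (\<Sum>e\<in>E. 2)" by (rule sum_mono) (rule two)
  finally show ?thesis by simp
qed

lemma sum_degree_le:
  assumes "finite E" "finite B"
  shows "(\<Sum>v\<in>B. degree E v) \<le> 2 * card E"
proof -
  have "(\<Sum>v\<in>B. degree E v) = card (SIGMA v:B. neighbours E v)"
    using assms finite_neighbours by simp
  also have "\<dots> \<le> card {(u, v). {u, v} \<in> E}"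
    by (rule card_mono[OF finite_edge_pairs[OF assms(1)]]) (auto simp: neighbours_def)
  also have "\<dots> \<le> 2 * card E" by (rule card_edge_pairs[OF assms(1)])
  finally show ?thesis .
qed

section \<open>Settling of the registrations\<close>

text \<open>\<open>P\<close> stands for the light members and \<open>L\<close> for the light
  vertices. Registrations form chains of length at most two: a waiting vertex has a boss, and the
  boss may be a relay, itself registered with a light member. When new light members appear, waiting
  vertices next to them withdraw in the first round and relays with an emptied list in the second;
  after that nobody has a reason to change.\<close>

lemma registration_settles:
  fixes N :: "nat \<Rightarrow> nat set" and b b' b'' :: "nat \<Rightarrow> nat option"
  assumes bN: "\<And>v z. b v = Some z \<Longrightarrow> z \<in> N v"
    and brel: "\<And>v z. b v = Some z \<Longrightarrow> z \<in> P0 \<Longrightarrow> {u. b u = Some v} \<noteq> {}"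
    and bdirt: "\<And>v z. b v = Some z \<Longrightarrow> z \<notin> P0 \<Longrightarrow> v \<in> L0 \<and> N v \<inter> P0 = {} \<and> {u. b u = Some v} = {}"
    and sub: "P0 \<subseteq> P1" "L0 \<subseteq> L1"
    and new: "\<And>v z. b v = None \<Longrightarrow> b' v = Some z \<Longrightarrow> z \<in> N v \<and> b z = None \<and> b' z = None \<and>
        (if z \<in> P1 then {u. b u = Some v} \<noteq> {} else v \<in> L1 \<and> N v \<inter> P1 = {} \<and> {u. b u = Some v} = {})"
    and nP: "\<And>v. v \<in> P1 \<Longrightarrow> b' v = None"
    and s1: "\<And>v z. b v = Some z \<Longrightarrow> b' v = (if v \<in> L1 \<and> N v \<inter> P1 = {} \<or> {u. b u = Some v} \<noteq> {} then Some z else None)"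
    and s2: "\<And>v. b'' v = (if v \<in> L1 \<and> N v \<inter> P1 = {} \<or> {u. b' u = Some v} \<noteq> {} then b' v else None)"
  shows "\<And>v z. b'' v = Some z \<Longrightarrow> z \<in> N v"
    and "\<And>v z. b'' v = Some z \<Longrightarrow> z \<in> P1 \<Longrightarrow> {u. b'' u = Some v} \<noteq> {}"
    and "\<And>v z. b'' v = Some z \<Longrightarrow> z \<notin> P1 \<Longrightarrow> v \<in> L1 \<and> N v \<inter> P1 = {} \<and> {u. b'' u = Some v} = {}"
    and "\<And>v. v \<notin> P1 \<Longrightarrow> {u. b'' u = Some v} = {u. b' u = Some v}"
    and "\<And>v z. b' v = Some z \<Longrightarrow> z \<notin> P1 \<Longrightarrow> b'' v = Some z"
proof -
  have N': "b' v = Some z \<Longrightarrow> z \<in> N v" for v z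
    using bN[of v z] new[of v z] s1[of v] by (cases "b v") (auto split: if_splits)
  \<comment> \<open>A registration that survives the first round at a boss outside \<open>P1\<close>
    belongs to a waiting vertex, whose reason to wait still holds.\<close>
  have D: "v \<in> L1 \<and> N v \<inter> P1 = {}" if "b' v = Some z" "z \<notin> P1" for v z
  proof (cases "b v")
    case None
    then show ?thesis using new[of v z] that by auto
  next
    case (Some y)
    then have "y = z" using s1[OF Some] that by (auto split: if_splits)
    then have "{u. b u = Some v} = {}" using bdirt[OF Some] that sub by auto
    then show ?thesis using s1[OF Some] that by (auto split: if_splits)
  qed
  show g1: "z \<in> N v" if "b'' v = Some z" for v z
    using N'[of v z] that s2[of v] by (auto split: if_splits)
  show keep: "b'' v = Some z" if "b' v = Some z" "z \<notin> P1" for v z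
    using D[OF that] that s2[of v] by auto
  show ch: "{u. b'' u = Some v} = {u. b' u = Some v}" if "v \<notin> P1" for v
  proof -
    have "b'' u = Some v \<Longrightarrow> b' u = Some v" for u using s2[of u] by (auto split: if_splits)
    then show ?thesis using keep[OF _ that] by blast
  qed
  show "{u. b'' u = Some v} \<noteq> {}" if "b'' v = Some z" "z \<in> P1" for v z
  proof -
    have "z \<in> N v" "b' v = Some z" using g1[OF that(1)] that s2[of v] by (auto split: if_splits)
    then have "v \<notin> P1" "{u. b' u = Some v} \<noteq> {}" using nP[of v] that s2[of v] by (auto split: if_splits)
    then show ?thesis using ch by simp
  qed
  show "v \<in> L1 \<and> N v \<inter> P1 = {} \<and> {u. b'' u = Some v} = {}" if "b'' v = Some z" "z \<notin> P1" for v z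
  proof -
    have b': "b' v = Some z" using that s2[of v] by (auto split: if_splits)
    have "b u = Some v \<Longrightarrow> False" for u
    proof (cases "b v")
      case None
      then show "b u = Some v \<Longrightarrow> False" using new[OF None b'] that by auto
    next
      case (Some y)
      then have "y = z" using s1[OF Some] b' by (auto split: if_splits)
      then show "b u = Some v \<Longrightarrow> False" using bdirt[OF Some] that sub by auto
    qed
    moreover have "b' u = Some v \<Longrightarrow> b u = None \<Longrightarrow> False" for u
      using new[of u v] b' by auto
    moreover have "b' u = Some v \<Longrightarrow> b u = Some x \<Longrightarrow> x = v" for u x
      using s1[of u x] by (auto split: if_splits)
    ultimately have "b' u \<noteq> Some v" for u by (cases "b u") blast+
    then have "{u. b' u = Some v} = {}" by blast
    moreover have "v \<notin> P1" using nP b' by auto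
    ultimately show ?thesis using D[OF b' that(2)] ch by auto
  qed
qed

text \<open>A withdrawal lowers the number of registrations by one and so pays for its own message;
  a new registration costs one message and raises the number by one, hence the factor 2.\<close>

lemma registration_changes:
  fixes b b' :: "nat \<Rightarrow> nat option"
  assumes f: "finite {u. b u \<noteq> None}" "finite {u. b' u \<noteq> None}"
    and nd: "\<And>u. b u \<noteq> b' u \<Longrightarrow> b u = None \<or> b' u = None"
    and new: "{u. b u = None \<and> b' u \<noteq> None} \<subseteq> Y" "finite Y"
  shows "card {u. b u \<noteq> b' u} + card {u. b' u \<noteq> None} \<le> card {u. b u \<noteq> None} + 2 * card Y"
proof -
  let ?n = "{u. b u = None \<and> b' u \<noteq> None}" and ?o = "{u. b u \<noteq> None \<and> b' u = None}"
  let ?k = "{u. b u \<noteq> None \<and> b' u \<noteq> None}"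
  have fi: "finite ?n" "finite ?o" "finite ?k"
    using f by (auto intro: finite_subset[OF _ f(1)] finite_subset[OF _ f(2)])
  have "u \<in> {u. b u \<noteq> b' u} \<longleftrightarrow> u \<in> ?n \<union> ?o" for u using nd[of u] by (cases "b u"; cases "b' u") auto
  then have e1: "{u. b u \<noteq> b' u} = ?n \<union> ?o" by (rule set_eqI)
  have e2: "{u. b' u \<noteq> None} = ?n \<union> ?k" and e3: "{u. b u \<noteq> None} = ?o \<union> ?k" by auto
  have "card (?n \<union> ?o) = card ?n + card ?o" "card (?n \<union> ?k) = card ?n + card ?k"
    "card (?o \<union> ?k) = card ?o + card ?k"
    using card_Un_disjoint[OF fi(1,2)] card_Un_disjoint[OF fi(1,3)] card_Un_disjoint[OF fi(2,3)] by blast+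
  moreover have "card ?n \<le> card Y" using card_mono[OF new(2,1)] .
  ultimately show ?thesis unfolding e1 e2 e3 by linarith
qed

section \<open>Exploring the heavy ball around a centre\<close>

context mis_scheme
begin

lemma conf_sel [simp]:
  "nn (conf n E H0 M0 b0 H1 M1 b1 f kf pr v) = n" "me (conf n E H0 M0 b0 H1 M1 b1 f kf pr v) = v"
  "nbs (conf n E H0 M0 b0 H1 M1 b1 f kf pr v) = neighbours E v"
  "isH (conf n E H0 M0 b0 H1 M1 b1 f kf pr v) = (v \<in> H1)" "inM (conf n E H0 M0 b0 H1 M1 b1 f kf pr v) = (v \<in> M1)"
  "nH (conf n E H0 M0 b0 H1 M1 b1 f kf pr v) = neighbours E v \<inter> H0"
  "ch (conf n E H0 M0 b0 H1 M1 b1 f kf pr v) = {u. b0 u = Some v}"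
  "ph (conf n E H0 M0 b0 H1 M1 b1 f kf pr v) = f v" "kick (conf n E H0 M0 b0 H1 M1 b1 f kf pr v) = kf v"
  "prs (conf n E H0 M0 b0 H1 M1 b1 f kf pr v) = pr v" "boss (conf n E H0 M0 b0 H1 M1 b1 f kf pr v) = b1 v"
  by (simp_all add: conf_def)

lemma act_Idle:
  assumes "ph s = Idle" "\<And>p. oi p \<noteq> Some Tok" "\<And>p. oi p \<noteq> Some Ret"
  shows "act s nP' nS' ch' si oi = \<lparr>a_H = isH s, a_M = inM s, a_req = None,
    a_ph = (if \<exists>u k. oi u = Some (Explore k)
            then Op (mem0 0 (Suc (Min {k. \<exists>u. oi u = Some (Explore k)}))
                  (Min {u. \<exists>k. oi u = Some (Explore k)}) (card (nbs s))) else Idle),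
    a_kick = kick s, a_prs = prs s\<rparr>"
  using assms by (simp add: act_def)

lemma act_Op:
  assumes "ph s = Op m"
  shows "act s nP' nS' ch' si oi =
        (let m' = memstep s nP' nS' si oi m in
         \<lparr>a_H = (isH s \<and> \<not> (clk m = 8 \<and> kind m = 0 \<and> \<not> kick s \<and> card (nbs s) ^ 3 \<le> tot m' ^ 2)),
          a_M = (if clk m = 11 \<and> (kind m = 1 \<and> nP' = {} \<or> kind m = 2) then True
                 else if leaves s nP' m then False
                 else if clk m = 15 + T (nn s) \<and> fpar m \<noteq> None \<and> s_out A (sim m' (me s)) then True
                 else inM s),
          a_req = (if leaves s nP' m \<and> \<not> kick s \<and> ch' \<noteq> {} then Some (par m) else None),
          a_ph = (if clk m = 16 + T (nn s) then (if kind m \<in> {1, 2} \<or> kick s then Serve else Idle) else Op m'),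
          a_kick = (kick s \<and> clk m \<noteq> 16 + T (nn s)),
          a_prs = prs s\<rparr>)"
  using assms by (simp add: act_def)

lemma opinbox_simp:
  "opinbox n E H0 M0 b0 H1 M1 b1 f kf pr v u =
     (if {u, v} \<in> E then opsend (conf n E H0 M0 b0 H1 M1 b1 f kf pr u) v else None)"
  by (simp add: opinbox_def)

end

text \<open>\<open>St\<close> is the set of vertices on the stack of the depth-first token walk.\<close>

locale op_start = mis_scheme A T a for A :: "'s static_alg" and T :: "nat \<Rightarrow> nat" and a :: nat +
  fixes n :: nat and E :: "nat set set" and H M St :: "nat set" and b :: "nat \<Rightarrow> nat option"
    and c kd w :: nat and pr :: "nat \<Rightarrow> nat list"
  assumes finE: "finite E" and loop: "\<And>v. {v, v} \<notin> E" and finH: "finite H"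
    and edges2: "2 * card E \<le> n ^ 2" and T1: "T n \<ge> 1"
    and kd: "kd \<in> {1, 2, 3}"
    and K1: "kd = 1 \<Longrightarrow> c \<notin> H \<and> c \<notin> M \<and> neighbours E c \<inter> (M - H) = {} \<and> b c = None \<and> c \<in> St"
    and K2: "kd = 2 \<Longrightarrow> c \<in> H \<and> c \<notin> M \<and> neighbours E c \<inter> M = {} \<and> {u. b u = Some c} = {}"
    and K3: "kd = 3 \<Longrightarrow> {c, w} \<in> E \<and> c \<in> M \<and> w \<in> M \<and> w \<in> H \<and> w \<in> St"
    and indep: "\<And>u v. u \<in> M \<Longrightarrow> v \<in> M \<Longrightarrow> {u, v} \<in> E \<Longrightarrow> kd = 3 \<and> {u, v} = {c, w}"
    and cov: "\<And>v. v \<in> H \<Longrightarrow> v \<notin> M \<Longrightarrow> v \<noteq> c \<Longrightarrow> neighbours E v \<inter> M \<noteq> {}"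
    and dirt: "\<And>v. v \<notin> H \<Longrightarrow> v \<notin> M \<Longrightarrow> v \<notin> St \<Longrightarrow> neighbours E v \<inter> (M - H) = {} \<Longrightarrow> b v \<noteq> None"
    and bE: "\<And>v z. b v = Some z \<Longrightarrow> {v, z} \<in> E"
    and bM: "\<And>v z. b v = Some z \<Longrightarrow> v \<notin> M"
    and brel: "\<And>v z. b v = Some z \<Longrightarrow> z \<in> M - H \<Longrightarrow> {u. b u = Some v} \<noteq> {}"
    and bdirt: "\<And>v z. b v = Some z \<Longrightarrow> z \<notin> M - H \<Longrightarrow> v \<notin> H \<and> neighbours E v \<inter> (M - H) = {} \<and> {u. b u = Some v} = {}"
    and stack: "\<And>v. v \<notin> M \<Longrightarrow> {u. b u = Some v} \<noteq> {} \<Longrightarrow> v \<notin> St \<Longrightarrow> \<exists>z. z \<in> M - H \<and> b v = Some z"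
    and stackP: "\<And>v. v \<in> M - H \<Longrightarrow> {u. b u = Some v} \<noteq> {} \<Longrightarrow> v \<in> St"
begin

abbreviation "N \<equiv> neighbours E"
abbreviation kf :: "nat \<Rightarrow> bool" where "kf v \<equiv> kd = 3 \<and> v = w"

primrec Bl :: "nat \<Rightarrow> nat set" where
  "Bl 0 = {c}"
| "Bl (Suc k) = Bl k \<union> {v \<in> H. \<exists>u\<in>Bl k. {u, v} \<in> E}"

lemmas Bl_Suc = Bl.simps(2)
declare Bl_Suc [simp del]

lemma Bl_mono: "i \<le> j \<Longrightarrow> Bl i \<subseteq> Bl j"
  by (induction j) (auto simp: le_Suc_eq Bl_Suc)

lemma Bl_sub: "Bl k \<subseteq> insert c H"
  by (induction k) (auto simp: Bl_Suc)

lemma finite_Bl: "finite (Bl k)"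
  using Bl_sub finH by (meson finite.insertI finite_subset)

definition dp :: "nat \<Rightarrow> nat" where "dp v = (LEAST k. v \<in> Bl k)"

lemma dp_in: "v \<in> Bl k \<Longrightarrow> v \<in> Bl (dp v)"
  unfolding dp_def by (rule LeastI)

lemma dp_le: "v \<in> Bl k \<Longrightarrow> dp v \<le> k"
  unfolding dp_def by (rule Least_le)

lemma Bl_iff: "v \<in> Bl j \<Longrightarrow> v \<in> Bl k \<longleftrightarrow> dp v \<le> k"
  using dp_in dp_le Bl_mono by blast

lemma dp_c [simp]: "dp c = 0" "c \<in> Bl k"
  using dp_le[of c 0] Bl_mono[of 0 k] by auto

lemma dp_0: "v \<in> Bl k \<Longrightarrow> dp v = 0 \<longleftrightarrow> v = c"
  using dp_in[of v k] by auto

lemma dp_Suc: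
  assumes "v \<in> Bl k" "dp v = Suc i"
  shows "v \<in> H" "\<exists>u. u \<in> Bl i \<and> dp u = i \<and> {u, v} \<in> E"
proof -
  have v: "v \<in> Bl (Suc i)" "v \<notin> Bl i" using dp_in[OF assms(1)] dp_le[of v i] assms(2) by auto
  then show "v \<in> H" by (auto simp: Bl_Suc)
  from v obtain u where u: "u \<in> Bl i" "{u, v} \<in> E" by (auto simp: Bl_Suc)
  have "dp u = i"
  proof (rule ccontr)
    assume "dp u \<noteq> i"
    then obtain j where "i = Suc j" "dp u \<le> j" using dp_le[OF u(1)] by (cases i) auto
    then have "u \<in> Bl j" using Bl_iff[OF u(1)] by simp
    then show False using v u \<open>v \<in> H\<close> \<open>i = Suc j\<close> by (auto simp: Bl_Suc)
  qed
  then show "\<exists>u. u \<in> Bl i \<and> dp u = i \<and> {u, v} \<in> E" using u by blast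
qed

lemma Bl_H: "v \<in> Bl k \<Longrightarrow> v \<noteq> c \<Longrightarrow> v \<in> H"
  using Bl_sub by blast

lemma Bl_adj: "u \<in> Bl 3 \<Longrightarrow> dp u < 3 \<Longrightarrow> v \<in> H \<Longrightarrow> {u, v} \<in> E \<Longrightarrow> v \<in> Bl 3 \<and> dp v \<le> Suc (dp u)"
proof -
  assume a: "u \<in> Bl 3" "dp u < 3" "v \<in> H" "{u, v} \<in> E"
  then have "v \<in> Bl (Suc (dp u))" using dp_in by (auto simp: Bl_Suc)
  then show ?thesis using a(2) dp_le[of v] Bl_mono[of "Suc (dp u)" 3] by auto
qed

definition pa :: "nat \<Rightarrow> nat" where
  "pa v = (if v = c then c else Min {u. {u, v} \<in> E \<and> u \<in> Bl 3 \<and> Suc (dp u) = dp v})"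

lemma pa_props:
  assumes "v \<in> Bl 3" "v \<noteq> c"
  shows "{pa v, v} \<in> E" "pa v \<in> Bl 3" "Suc (dp (pa v)) = dp v"
proof -
  let ?S = "{u. {u, v} \<in> E \<and> u \<in> Bl 3 \<and> Suc (dp u) = dp v}"
  obtain i where i: "dp v = Suc i" using dp_0[OF assms(1)] assms(2) by (cases "dp v") auto
  have "i \<le> 3" using dp_le[OF assms(1)] i by simp
  then have "?S \<noteq> {}" using dp_Suc(2)[OF assms(1) i] i Bl_mono[of i 3] by auto
  moreover have "finite ?S" by (rule finite_subset[OF _ finite_Bl[of 3]]) auto
  ultimately have "Min ?S \<in> ?S" by (rule Min_in[rotated])
  then show "{pa v, v} \<in> E" "pa v \<in> Bl 3" "Suc (dp (pa v)) = dp v"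
    using assms(2) by (auto simp: pa_def)
qed

text \<open>Depth \<open>i\<close> receives from depth \<open>i + 1\<close> at clock
  \<open>5 - i\<close> and sends at clock \<open>6 - i\<close>, so a sum is complete before it is
  passed on.\<close>

primrec ac :: "nat \<Rightarrow> nat \<Rightarrow> nat" where
  "ac 0 v = degree E v"
| "ac (Suc t) v = ac t v + (if 3 \<le> t \<and> t < 6 then
      (\<Sum>u\<in>{u. {u, v} \<in> E \<and> u \<in> Bl 3 \<and> u \<noteq> c \<and> dp u + t = 6 \<and> pa u = v}. ac t u) else 0)"

definition s where "s = ac 6 c"

lemma ac_small: "t \<le> 3 \<Longrightarrow> ac t v = degree E v"
  by (induction t) auto

lemma ac_big: "6 \<le> t \<Longrightarrow> ac t v = ac 6 v"
  by (induction t rule: dec_induct) auto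

text \<open>Invariant of the upward phase: the sums held within radius \<open>3 - i\<close> already
  account for the whole ball, because the layers outside have handed theirs to their
  parents.\<close>

lemma ac_sum:
  assumes "i \<le> 3" shows "(\<Sum>v\<in>Bl (3 - i). ac (3 + i) v) = (\<Sum>v\<in>Bl 3. degree E v)"
  using assms
proof (induction i)
  case 0 then show ?case using ac_small[of 3] by simp
next
  case (Suc i)
  define j where "j = 2 - i"
  have j: "3 - i = Suc j" "3 - Suc i = j" "j < 3" using Suc.prems by (auto simp: j_def)
  let ?L = "Bl (Suc j) - Bl j"
  have L: "u \<in> ?L \<longleftrightarrow> u \<in> Bl 3 \<and> dp u = Suc j" for u
  proof -
    have "Bl (Suc j) \<subseteq> Bl 3" using Bl_mono[of "Suc j" 3] j(3) by simp
    then show ?thesis using Bl_iff[of u 3 "Suc j"] Bl_iff[of u 3 j] by (cases "u \<in> Bl 3") auto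
  qed
  have "(\<Sum>v\<in>Bl j. ac (3 + Suc i) v) = (\<Sum>v\<in>Bl j. ac (3 + i) v) +
     (\<Sum>v\<in>Bl j. \<Sum>u\<in>{u. {u, v} \<in> E \<and> u \<in> Bl 3 \<and> u \<noteq> c \<and> dp u + (3 + i) = 6 \<and> pa u = v}. ac (3 + i) u)"
    using Suc.prems unfolding add_Suc_right ac.simps(2) sum.distrib by simp
  also have "(\<Sum>v\<in>Bl j. \<Sum>u\<in>{u. {u, v} \<in> E \<and> u \<in> Bl 3 \<and> u \<noteq> c \<and> dp u + (3 + i) = 6 \<and> pa u = v}. ac (3 + i) u)
     = (\<Sum>v\<in>Bl j. \<Sum>u\<in>{u \<in> ?L. pa u = v}. ac (3 + i) u)"
  proof (intro sum.cong refl)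
    fix v
    have "dp u + (3 + i) = 6 \<longleftrightarrow> dp u = Suc j" for u using j_def Suc.prems by auto
    then show "{u. {u, v} \<in> E \<and> u \<in> Bl 3 \<and> u \<noteq> c \<and> dp u + (3 + i) = 6 \<and> pa u = v} = {u \<in> ?L. pa u = v}"
    proof (intro set_eqI)
      fix u assume dp: "\<And>u. dp u + (3 + i) = 6 \<longleftrightarrow> dp u = Suc j"
      show "u \<in> {u. {u, v} \<in> E \<and> u \<in> Bl 3 \<and> u \<noteq> c \<and> dp u + (3 + i) = 6 \<and> pa u = v} \<longleftrightarrow>
          u \<in> {u \<in> ?L. pa u = v}"
        unfolding mem_Collect_eq L dp using pa_props(1)[of u] by (cases "u = c") (auto simp: insert_commute)
    qed
  qed
  also have "\<dots> = (\<Sum>u\<in>?L. ac (3 + i) u)"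
  proof (rule sum.group)
    show "pa ` ?L \<subseteq> Bl j"
    proof
      fix x assume "x \<in> pa ` ?L"
      then obtain u where u: "x = pa u" "u \<in> Bl 3" "dp u = Suc j" using L by auto
      then have "u \<noteq> c" by auto
      then show "x \<in> Bl j" using pa_props[OF u(2)] u Bl_iff[of x 3 j] by simp
    qed
  qed (auto simp: finite_Bl)
  also have "(\<Sum>v\<in>Bl j. ac (3 + i) v) + (\<Sum>u\<in>?L. ac (3 + i) u) = (\<Sum>v\<in>Bl (Suc j). ac (3 + i) v)"
    by (subst add.commute, rule sum.subset_diff[symmetric]) (auto simp: finite_Bl Bl_mono)
  finally show ?case using Suc j by simp
qed

lemma s_eq: "s = (\<Sum>v\<in>Bl 3. degree E v)"
  using ac_sum[of 3] by (simp add: s_def)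

lemma s_le: "s \<le> 2 * card E"
  unfolding s_eq by (rule sum_degree_le[OF finE finite_Bl])

lemma ac_le: "3 \<le> t \<Longrightarrow> t \<le> 6 \<Longrightarrow> u \<in> Bl 3 \<Longrightarrow> dp u + t = 6 \<Longrightarrow> ac t u \<le> n ^ 2"
proof -
  assume a: "3 \<le> t" "t \<le> 6" "u \<in> Bl 3" "dp u + t = 6"
  then have "u \<in> Bl (6 - t)" using Bl_iff[of u 3 "6 - t"] by simp
  then have "ac t u \<le> (\<Sum>v\<in>Bl (6 - t). ac t v)" by (rule member_le_sum) (auto simp: finite_Bl)
  also have "\<dots> = s" unfolding s_eq using ac_sum[of "t - 3"] a by simp
  finally show ?thesis using s_le edges2 by simp
qed

definition tt :: "nat \<Rightarrow> nat \<Rightarrow> nat" where "tt t v = (if 6 + dp v \<le> t then s else 0)"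

definition memA :: "nat \<Rightarrow> nat \<Rightarrow> 's mem" where
  "memA t v = \<lparr>clk = t, kind = (if v = c then kd else 0), dep = dp v, par = pa v, acc = ac t v, tot = tt t v,
     gone = False, fpar = None, net = {}, cnt = 0, sim = (\<lambda>_. undefined)\<rparr>"

definition fA :: "nat \<Rightarrow> nat \<Rightarrow> 's phase" where
  "fA t v = (if v \<in> Bl (min t 3) then Op (memA t v) else Idle)"

lemma memA_sel [simp]:
  "clk (memA t v) = t" "kind (memA t v) = (if v = c then kd else 0)" "dep (memA t v) = dp v"
  "par (memA t v) = pa v" "acc (memA t v) = ac t v" "tot (memA t v) = tt t v" "gone (memA t v) = False"
  "fpar (memA t v) = None" "net (memA t v) = {}" "cnt (memA t v) = 0" "sim (memA t v) = (\<lambda>_. undefined)"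
  by (simp_all add: memA_def)

lemma kd_pos: "kd \<noteq> 0" using kd by auto

lemma fA_0: "fA 0 = (\<lambda>v. Idle)(c := Op (mem0 kd 0 c (degree E c)))"
  by (auto simp: fun_eq_iff fA_def memA_def mem0_def pa_def tt_def)

lemma fA_no_Greet: "fA t u \<noteq> Greet v"
  by (simp add: fA_def)

lemma inbox_early:
  assumes "t < 3"
  shows "opinbox n E H0 M0 b0 H1 M1 b1 (fA t) kf' pr' v u =
    (if {u, v} \<in> E \<and> u \<in> Bl 3 \<and> dp u = t \<and> v \<in> H0 then Some (Explore t) else None)"
proof -
  have "u \<in> Bl t \<and> dp u = t \<longleftrightarrow> u \<in> Bl 3 \<and> dp u = t"
    using Bl_iff[of u 3] Bl_mono[of t 3] assms by auto
  then show ?thesis using assms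
    by (auto simp: opinbox_simp opsend_def fA_def memA_def memsend_def inR_def in_neighbours' min_def)
qed

lemma inbox_up:
  assumes "3 \<le> t" "t < 6"
  shows "opinbox n E H0 M0 b0 H1 M1 b1 (fA t) kf' pr' v u =
    (if {u, v} \<in> E \<and> u \<in> Bl 3 \<and> u \<noteq> c \<and> dp u + t = 6 \<and> pa u = v then Some (Up (ac t u)) else None)"
  using assms dp_0[of u 3]
  by (auto simp: opinbox_simp opsend_def fA_def memA_def memsend_def inR_def in_neighbours' min_def)

lemma inbox_down:
  assumes "6 \<le> t" "t < 9"
  shows "opinbox n E H0 M0 b0 H1 M1 b1 (fA t) kf' pr' v u =
    (if {u, v} \<in> E \<and> u \<in> Bl 3 \<and> 6 + dp u = t \<and> v \<in> H0 then Some (Down s) else None)"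
  using assms
  by (auto simp: opinbox_simp opsend_def fA_def memA_def memsend_def inR_def in_neighbours' min_def tt_def)

lemma inbox_quiet:
  assumes "9 \<le> t" "t < 14"
  shows "opinbox n E H0 M0 b0 H1 M1 b1 (fA t) kf' pr' v u = None"
  using assms dp_le[of u 3]
  by (auto simp: opinbox_simp opsend_def fA_def memA_def memsend_def inR_def)

lemma inbox_no_token:
  assumes "t < 14"
  shows "opinbox n E H0 M0 b0 H1 M1 b1 (fA t) kf' pr' v u \<noteq> Some Tok"
    "opinbox n E H0 M0 b0 H1 M1 b1 (fA t) kf' pr' v u \<noteq> Some Ret"
  using inbox_early[of t] inbox_up[of t] inbox_down[of t] inbox_quiet[of t] assms
  by (cases "t < 3"; cases "t < 6"; cases "t < 9"; auto)+

lemma inbox_early_only: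
  assumes "3 \<le> t" "t < 14"
  shows "opinbox n E H0 M0 b0 H1 M1 b1 (fA t) kf' pr' v u \<noteq> Some (Explore k)"
  using inbox_up[of t] inbox_down[of t] inbox_quiet[of t] assms by (cases "t < 6"; cases "t < 9") auto

lemma memstep_A:
  assumes "t < 12" "v \<in> Bl (min t 3)" "t \<le> 8 \<Longrightarrow> H0 = H"
  shows "memstep (conf n E H0 M0 b0 H1 M1 b1 (fA t) kf' pr' v) nP' nS' si
      (opinbox n E H0 M0 b0 H1 M1 b1 (fA t) kf' pr' v) (memA t v) = memA (Suc t) v"
proof -
  let ?oi = "opinbox n E H0 M0 b0 H1 M1 b1 (fA t) kf' pr' v"
  have v3: "v \<in> Bl 3" using assms(2) Bl_mono[of "min t 3" 3] by auto
  have up: "ac t v + (\<Sum>u\<in>neighbours E v. upval (?oi u)) = ac (Suc t) v"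
  proof (cases "3 \<le> t \<and> t < 6")
    case True
    let ?S = "{u. {u, v} \<in> E \<and> u \<in> Bl 3 \<and> u \<noteq> c \<and> dp u + t = 6 \<and> pa u = v}"
    have "(\<Sum>u\<in>neighbours E v. upval (?oi u)) = (\<Sum>u\<in>?S. upval (?oi u))"
      using True by (intro sum.mono_neutral_right finite_neighbours finE) (auto simp: inbox_up in_neighbours)
    also have "\<dots> = (\<Sum>u\<in>?S. ac t u)" using True by (intro sum.cong) (auto simp: inbox_up)
    finally show ?thesis using True by simp
  next
    case False
    have "upval (?oi u) = 0" for u
      using False assms(1) inbox_early[of t] inbox_down[of t] inbox_quiet[of t] by (cases "t < 3"; cases "t < 9") auto
    then show ?thesis using False by (simp only: ac.simps if_False sum.neutral_const)
  qed
  have down: "(if (if v = c then kd else 0) \<noteq> 0 \<and> t = 5 then ac (Suc t) v else if {k. \<exists>u. ?oi u = Some (Down k)} = {}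
      then tt t v else Min {k. \<exists>u. ?oi u = Some (Down k)}) = tt (Suc t) v"
  proof (cases "6 \<le> t \<and> t < 9")
    case True
    let ?D = "{k. \<exists>u. ?oi u = Some (Down k)}"
    have D: "k \<in> ?D \<longleftrightarrow> k = s \<and> (\<exists>u. {u, v} \<in> E \<and> u \<in> Bl 3 \<and> 6 + dp u = t \<and> v \<in> H0)" for k
      using True inbox_down[of t] by auto
    show ?thesis
    proof (cases "?D = {}")
      case True': True
      \<comment> \<open>A vertex one layer below the current senders would have received the total
        from one of them.\<close>
      have "dp v \<noteq> t - 5"
      proof
        assume d: "dp v = t - 5"
        then obtain i where i: "dp v = Suc i" "6 + i = t" using True by (intro that[of "t - 6"]) auto
        from dp_Suc[OF v3 i(1)] obtain u where "v \<in> H" "u \<in> Bl i" "dp u = i" "{u, v} \<in> E" by auto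
        moreover have "i \<le> 3" using True i by auto
        ultimately have "s \<in> ?D" using D i Bl_mono[of i 3] assms(3) True by auto
        then show False using True' by auto
      qed
      then have "6 + dp v \<le> Suc t \<longleftrightarrow> 6 + dp v \<le> t" using True by auto
      then show ?thesis using True' True by (auto simp: tt_def)
    next
      case False
      then have "?D = {s}" using D by auto
      moreover obtain u where u: "{u, v} \<in> E" "u \<in> Bl 3" "6 + dp u = t" "v \<in> H0" using False D by auto
      then have "dp v \<le> Suc (dp u)" using Bl_adj[OF u(2) _ _ u(1)] True assms(3) by auto
      then have "6 + dp v \<le> Suc t" using u by auto
      ultimately show ?thesis using True by (auto simp: tt_def)
    qed
  next
    case False
    then have "?oi u \<noteq> Some (Down k)" for u k
      using inbox_early[of t] inbox_up[of t] inbox_quiet[of t] assms(1) by (cases "t < 3"; cases "t < 6") auto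
    then have e: "{k. \<exists>u. ?oi u = Some (Down k)} = {}" by auto
    have "v = c \<Longrightarrow> t = 5 \<Longrightarrow> ac (Suc t) v = s" by (simp add: s_def numeral_eq_Suc)
    moreover have "v \<noteq> c \<Longrightarrow> dp v \<noteq> 0" using dp_0[OF v3] by simp
    ultimately show ?thesis unfolding e using False kd v3 dp_le[OF v3] by (auto simp: tt_def)
  qed
  show ?thesis
    unfolding memstep_def Let_def leaves_def memA_sel conf_sel up down using assms(1) by (simp add: memA_def)
qed

lemma act_A:
  assumes "t < 12" "t < 8 \<Longrightarrow> H0 = H"
    and "t = 8 \<Longrightarrow> H0 = H"
  shows "act (conf n E H0 M0 b0 H1 M1 b1 (fA t) kf' pr' v) nP' nS' ch' si
      (opinbox n E H0 M0 b0 H1 M1 b1 (fA t) kf' pr' v) =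
     \<lparr>a_H = (v \<in> H1 \<and> \<not> (t = 8 \<and> v \<in> Bl 3 \<and> v \<noteq> c \<and> \<not> kf' v \<and> degree E v ^ 3 \<le> s ^ 2)),
      a_M = (v \<in> M1 \<or> t = 11 \<and> v = c \<and> (kd = 1 \<and> nP' = {} \<or> kd = 2)), a_req = None,
      a_ph = fA (Suc t) v, a_kick = kf' v, a_prs = pr' v\<rparr>"
proof (cases "v \<in> Bl (min t 3)")
  case True
  have "min t 3 \<le> min (Suc t) 3" by simp
  then have Suc: "v \<in> Bl (min (Suc t) 3)" using True Bl_mono by blast
  have v3: "v \<in> Bl 3" using True Bl_mono[of "min t 3" 3] by auto
  have m: "memstep (conf n E H0 M0 b0 H1 M1 b1 (fA t) kf' pr' v) nP' nS' si
      (opinbox n E H0 M0 b0 H1 M1 b1 (fA t) kf' pr' v) (memA t v) = memA (Suc t) v"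
    using assms True by (intro memstep_A) (auto simp: le_less)
  \<comment> \<open>The last layer receives the total at clock 8; since the test uses the updated
    memory, it decides together with the others.\<close>
  have "t = 8 \<Longrightarrow> tt (Suc t) v = s" using dp_le[OF v3] by (simp add: tt_def)
  then show ?thesis
    using assms(1) True Suc T1 kd_pos v3 dp_0[OF v3]
    by (subst act_Op[where m = "memA t v"]) (auto simp: fA_def m leaves_def Let_def)
next
  case False
  have t: "t < 14" using assms by simp
  let ?oi = "opinbox n E H0 M0 b0 H1 M1 b1 (fA t) kf' pr' v"
  have nc: "v \<noteq> c" using False by auto
  have ph: "(if \<exists>u k. ?oi u = Some (Explore k)
            then Op (mem0 0 (Suc (Min {k. \<exists>u. ?oi u = Some (Explore k)}))
                  (Min {u. \<exists>k. ?oi u = Some (Explore k)}) (card (neighbours E v))) else Idle) = fA (Suc t) v"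
  proof (cases "t < 3")
    case t3: True
    have oi: "?oi u = Some (Explore k) \<longleftrightarrow> k = t \<and> {u, v} \<in> E \<and> u \<in> Bl 3 \<and> dp u = t \<and> v \<in> H" for u k
      using inbox_early[OF t3] assms(2) t3 by auto
    show ?thesis
    proof (cases "v \<in> Bl (Suc t)")
      case True
      then have d: "dp v = Suc t" using False t3 dp_le[OF True] Bl_iff[OF True, of t] by (auto simp: min_def)
      have v3: "v \<in> Bl 3" using True Bl_mono[of "Suc t" 3] t3 by auto
      obtain u where u: "u \<in> Bl t" "dp u = t" "{u, v} \<in> E" "v \<in> H" using dp_Suc[OF True d] by auto
      then have ex: "?oi u = Some (Explore t)" using oi Bl_mono[of t 3] t3 by auto
      then have "{k. \<exists>u. ?oi u = Some (Explore k)} = {t}" using oi by auto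
      moreover have "{u. \<exists>k. ?oi u = Some (Explore k)} = {u. {u, v} \<in> E \<and> u \<in> Bl 3 \<and> Suc (dp u) = dp v}"
        using oi u(4) d by auto
      moreover have "tt (Suc t) v = 0" using d by (simp add: tt_def)
      ultimately show ?thesis using ex t3 True d nc
        by (auto simp: fA_def memA_def mem0_def pa_def min_def ac_small)
    next
      case nB: False
      have "?oi u \<noteq> Some (Explore k)" for u k
      proof
        assume "?oi u = Some (Explore k)"
        then have "{u, v} \<in> E" "u \<in> Bl 3" "dp u = t" "v \<in> H" using oi by auto
        then have "u \<in> Bl t" using dp_in by auto
        then show False using nB \<open>{u, v} \<in> E\<close> \<open>v \<in> H\<close> by (auto simp: Bl_Suc)
      qed
      then show ?thesis using nB t3 by (simp add: fA_def min_def)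
    qed
  next
    case t3: False
    then show ?thesis using False inbox_early_only[of t] t by (simp add: fA_def min_absorb2)
  qed
  have idle: "ph (conf n E H0 M0 b0 H1 M1 b1 (fA t) kf' pr' v) = Idle" using False by (simp add: fA_def)
  have "\<not> (t = 8 \<and> v \<in> Bl 3)" using False by (auto simp: min_def)
  then show ?thesis
    unfolding act_Idle[OF idle inbox_no_token(1)[OF t] inbox_no_token(2)[OF t]] conf_sel ph using nc by auto
qed

section \<open>Converted vertices and the messages of the exploration\<close>

definition Cv :: "nat set" where
  "Cv = {v \<in> Bl 3. v \<noteq> c \<and> \<not> kf v \<and> degree E v ^ 3 \<le> s ^ 2}"

lemma Cv_H: "Cv \<subseteq> H"
  using Bl_H by (auto simp: Cv_def)

lemma settled_bnext: "bnext E H H M b H M (\<lambda>_. None) (\<lambda>_. False) v = b v"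
proof (cases "b v")
  case (Some z)
  then show ?thesis using brel[of v z] bdirt[of v z] bM[of v z] by (cases "z \<in> M - H") (auto simp: bnext_def)
qed (simp add: bnext_def freshS_def)

definition BB :: "(nat \<times> nat) set" where
  "BB = {(u, v). {u, v} \<in> E \<and> u \<in> Bl 3 \<and> v \<in> Bl 3}"

lemma finite_BB: "finite BB"
  unfolding BB_def by (rule finite_subset[OF _ finite_edge_pairs[OF finE]]) auto

lemma opcount_A:
  assumes "t < 9"
  shows "opcount n E H M b H M b (fA t) kf pr \<subseteq> BB"
proof
  fix x assume "x \<in> opcount n E H M b H M b (fA t) kf pr"
  then obtain u v where x: "x = (u, v)" "opinbox n E H M b H M b (fA t) kf pr v u \<noteq> None"
    by (cases x) (auto simp: opcount_def)
  consider "t < 3" | "3 \<le> t" "t < 6" | "6 \<le> t" "t < 9" using assms by linarith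
  then show "x \<in> BB"
  proof cases
    case 1
    then show ?thesis using x inbox_early[OF 1] Bl_adj[of u v] by (auto simp: BB_def split: if_splits)
  next
    case 2
    then show ?thesis using x inbox_up[OF 2] pa_props[of u] by (auto simp: BB_def split: if_splits)
  next
    case 3
    then show ?thesis using x inbox_down[OF 3] Bl_adj[of u v] by (auto simp: BB_def split: if_splits)
  qed
qed

lemma okop_A:
  assumes "t < 14"
  shows "okop n \<beta> (opinbox n E H0 M0 b0 H1 M1 b1 (fA t) kf' pr' v u)"
proof -
  have "Explore t \<noteq> Explore t \<or> t \<le> n ^ 2" if "t < 3" "{u, v} \<in> E" for t
  proof -
    have "card E \<noteq> 0" using that finE by auto
    then have "n ^ 2 \<ge> 2" using edges2 by linarith
    then show ?thesis using that by simp
  qed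
  moreover have "s \<le> n ^ 2" using s_le edges2 by simp
  ultimately show ?thesis
    using inbox_early[of t] inbox_up[of t] inbox_down[of t] inbox_quiet[of t] assms ac_le[of t u]
    by (cases "t < 3"; cases "t < 6"; cases "t < 9") (auto simp: okop_def)
qed

lemma run_A_step:
  assumes "t < 9"
  shows "t_run alg (okmsg n \<beta>) E (conf n E H M b H M b (fA t) kf pr) 1 (card BB)
     (conf n E H M b (if t = 8 then H - Cv else H) M b (fA (Suc t)) kf pr)"
proof (rule run_conf[OF finE fA_no_Greet bE bE])
  show "okop n \<beta> (opinbox n E H M b H M b (fA t) kf pr v u)" for u v
    using assms by (intro okop_A) simp
  show "card (stcount E H M H M) + card {u. b u \<noteq> b u} + card (opcount n E H M b H M b (fA t) kf pr) \<le> card BB"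
    using card_mono[OF finite_BB opcount_A[OF assms]] by simp
  let ?H2 = "if t = 8 then H - Cv else H"
  show "t_round alg E (conf n E H M b H M b (fA t) kf pr) = conf n E H M b ?H2 M b (fA (Suc t)) kf pr"
  proof (rule round_conf[OF fA_no_Greet bE bE])
    fix v
    show "act (conf n E H M b H M b (fA t) kf pr v) (N v \<inter> (M - H)) (freshS E H H M v)
          {u. b u = Some v} (stinbox E H M H M v) (opinbox n E H M b H M b (fA t) kf pr v) =
         \<lparr>a_H = v \<in> ?H2, a_M = v \<in> M, a_req = None, a_ph = fA (Suc t) v, a_kick = kf v, a_prs = pr v\<rparr>"
      using assms Cv_H by (subst act_A) (auto simp: Cv_def)
    have "(\<lambda>v. tokened (opinbox n E H M b H M b (fA t) kf pr v) (N v \<inter> (M - H))) = (\<lambda>_. False)"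
      using inbox_no_token[of t] assms by (auto simp: fun_eq_iff tokened_def)
    \<comment> \<open>A heavy vertex with a registration is a relay and keeps it for the sake of its
      own list, so turning light at clock 8 changes no registration yet.\<close>
    moreover have "bnext E H H M b ?H2 M (\<lambda>_. None) (\<lambda>_. False) v = b v"
    proof -
      have "b v \<noteq> None \<Longrightarrow> v \<notin> H \<or> {u. b u = Some v} \<noteq> {}" using brel[of v] bdirt[of v] by blast
      then show ?thesis
        using settled_bnext[of v] bM[of v] by (cases "b v") (simp_all add: bnext_def split: if_splits, blast?)
    qed
    ultimately show "b v = bnext E H H M b ?H2 M (\<lambda>_. None)
        (\<lambda>v. tokened (opinbox n E H M b H M b (fA t) kf pr v) (N v \<inter> (M - H))) v" by simp
  qed (auto split: if_splits)
qed auto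

lemma run_A:
  "t \<le> 9 \<Longrightarrow> t_run alg (okmsg n \<beta>) E (conf n E H M b H M b (fA 0) kf pr) t (t * card BB)
     (conf n E H M b (if t = 9 then H - Cv else H) M b (fA t) kf pr)"
proof (induction t)
  case 0
  then show ?case by (simp add: t_run_refl)
next
  case (Suc t)
  then have "t_run alg (okmsg n \<beta>) E (conf n E H M b H M b (fA 0) kf pr) t (t * card BB)
     (conf n E H M b H M b (fA t) kf pr)" by (simp split: if_splits)
  from t_run_trans[OF this run_A_step[of t]] Suc.prems show ?case by (simp add: add.commute)
qed

end

context op_start
begin

section \<open>Conversion, kick and recruitment\<close>

text \<open>\<open>Hc\<close>: heavy vertices after the conversion, \<open>Mj\<close>: the set after the centre has joined, \<open>Xs\<close>: leavers,
  \<open>Fs\<close>: heavy vertices uncovered by them, \<open>Rs\<close>: vertices of the network of the static algorithm.\<close>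

definition "Hc = H - Cv"
text \<open>A light centre may turn out to be covered by a neighbour converted in this very
  operation; then it does not join.\<close>

definition "jn \<longleftrightarrow> kd = 1 \<and> N c \<inter> (M - Hc) = {} \<or> kd = 2"
definition "Mj = (if jn then insert c M else M)"
definition "Xs = {x \<in> Bl 3. x \<noteq> c \<and> x \<in> Mj \<and> x \<in> Hc \<and> (N x \<inter> (Mj - Hc) \<noteq> {} \<or> kf x)}"
definition "Mk = Mj - Xs"
definition "Fs = {v \<in> Bl 3. v \<noteq> c \<and> v \<in> Hc \<and> v \<notin> Mk \<and> N v \<inter> Mk = {}}"
definition "Rs = insert c (Xs \<union> Fs)"
definition "fpv v = Min (N v \<inter> Xs)"
definition "cn v = card {u \<in> Fs. fpv u = v}"

lemma c_Cv: "c \<notin> Cv" by (simp add: Cv_def)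

lemma w_props:
  assumes "kd = 3" shows "w \<in> Hc" "w \<noteq> c" "w \<in> Bl 1" "w \<in> Bl 3"
proof -
  show "w \<noteq> c" using K3[OF assms] loop[of c] by force
  show "w \<in> Hc" unfolding Hc_def Cv_def using K3[OF assms] assms by simp
  show "w \<in> Bl 1" using K3[OF assms] by (auto simp: Bl_Suc numeral_eq_Suc)
  then show "w \<in> Bl 3" using Bl_mono[of 1 3] by auto
qed

text \<open>The set was independent apart from the conflict, so a heavy member can only be driven
  out by a light centre that has just joined, or as the loser. A heavy centre drives out nobody, as
  leavers react to light neighbours.\<close>

lemma Xs_props:
  assumes "x \<in> Xs"
  shows "{c, x} \<in> E" "x \<in> M" "x \<in> H" "x \<in> Hc" "c \<in> Mj" "c \<in> Mk" "kd = 1 \<and> jn \<or> kd = 3 \<and> x = w" "x \<noteq> c" "x \<in> Bl 3"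
proof -
  have x: "x \<noteq> c" "x \<in> Mj" "x \<in> Hc" "N x \<inter> (Mj - Hc) \<noteq> {} \<or> kf x" "x \<in> Bl 3"
    using assms by (auto simp: Xs_def)
  show xM: "x \<in> M" "x \<in> H" "x \<in> Hc" "x \<noteq> c" "x \<in> Bl 3" using x by (auto simp: Mj_def Hc_def split: if_splits)
  have "{c, x} \<in> E \<and> c \<in> Mj \<and> (kd = 1 \<and> jn \<or> kd = 3 \<and> x = w)"
  proof (cases "kf x")
    case True
    then show ?thesis unfolding Mj_def using K3 by auto
  next
    case False
    then obtain p where p: "p \<in> N x" "p \<in> Mj" "p \<notin> Hc" using x(4) by blast
    show ?thesis
    proof (cases "p \<in> M")
      case True
      then have "kd = 3" "{x, p} = {c, w}" using indep[OF xM(1), of p] p by (auto simp: in_neighbours')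
      then show ?thesis using x(1) False by auto
    next
      case nM: False
      then have "p = c" "jn" using p by (auto simp: Mj_def split: if_splits)
      moreover have "kd \<noteq> 2" using K2 p(3) \<open>p = c\<close> c_Cv by (auto simp: Hc_def)
      moreover have "kd = 1" using \<open>jn\<close> \<open>kd \<noteq> 2\<close> unfolding jn_def by blast
      ultimately show ?thesis using p unfolding in_neighbours by blast
    qed
  qed
  then show "{c, x} \<in> E" "c \<in> Mj" "kd = 1 \<and> jn \<or> kd = 3 \<and> x = w" by auto
  show "c \<in> Mk" using \<open>{c, x} \<in> E \<and> c \<in> Mj \<and> (kd = 1 \<and> jn \<or> kd = 3 \<and> x = w)\<close> by (auto simp: Mk_def Xs_def)
qed

lemma Xs_dp: "x \<in> Xs \<Longrightarrow> x \<in> Bl 1" "x \<in> Xs \<Longrightarrow> dp x = 1" "x \<in> Xs \<Longrightarrow> pa x = c"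
proof -
  assume x: "x \<in> Xs"
  show b: "x \<in> Bl 1" using Xs_props[OF x] by (auto simp: Bl_Suc numeral_eq_Suc)
  then show d: "dp x = 1" using dp_le[OF b] dp_0[OF b] Xs_props(8)[OF x] by linarith
  have "dp (pa x) = 0" "pa x \<in> Bl 3" using pa_props[of x] Xs_props[OF x] d by auto
  then show "pa x = c" using dp_0 by blast
qed

lemma finite_Xs: "finite Xs" unfolding Xs_def by (rule finite_subset[OF _ finite_Bl[of 3]]) auto
lemma finite_Fs: "finite Fs" unfolding Fs_def by (rule finite_subset[OF _ finite_Bl[of 3]]) auto

text \<open>The old cover of an uncovered vertex must be a leaver. The vertex cannot be next to the
  centre, which is in the set whenever there are leavers; and being next to a leaver it has depth at
  most 2.\<close>

lemma Fs_props:
  assumes "f \<in> Fs"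
  shows "f \<notin> M" "f \<notin> Xs" "f \<in> H" "f \<in> Hc" "f \<noteq> c" "f \<in> Bl 3" "N f \<inter> Xs \<noteq> {}" "{c, f} \<notin> E" "dp f \<le> 2" "fpv f \<in> N f \<inter> Xs"
proof -
  have f: "f \<in> Bl 3" "f \<noteq> c" "f \<in> Hc" "f \<notin> Mk" "N f \<inter> Mk = {}" using assms by (auto simp: Fs_def)
  show "f \<in> H" "f \<in> Hc" "f \<noteq> c" "f \<in> Bl 3" using f by (auto simp: Hc_def)
  show nX: "f \<notin> Xs"
  proof
    assume "f \<in> Xs"
    then have "c \<in> N f \<inter> Mk" using Xs_props by (auto simp: in_neighbours)
    then show False using f by auto
  qed
  show nM: "f \<notin> M" using f nX by (auto simp: Mk_def Mj_def split: if_splits)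
  show ne: "N f \<inter> Xs \<noteq> {}" using cov[OF \<open>f \<in> H\<close> nM f(2)] f(5) by (auto simp: Mk_def Mj_def split: if_splits)
  then obtain x where x: "x \<in> Xs" "x \<in> N f" by auto
  then show "{c, f} \<notin> E" using f(5) Xs_props(6)[OF x(1)] by (auto simp: in_neighbours)
  have "f \<in> Bl 2" using Xs_dp(1)[OF x(1)] x(2) \<open>f \<in> H\<close> by (auto simp: Bl_Suc numeral_eq_Suc in_neighbours)
  then show "dp f \<le> 2" by (rule dp_le)
  show "fpv f \<in> N f \<inter> Xs" unfolding fpv_def using ne finite_Xs by (intro Min_in) auto
qed

lemma Rs_Bl: "Rs \<subseteq> Bl 3" using Xs_props(9) Fs_props(6) by (auto simp: Rs_def)

lemma finite_Rs: "finite Rs" using finite_Xs finite_Fs by (simp add: Rs_def)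

lemma Rs_dp: "v \<in> Rs \<Longrightarrow> dp v < 3"
  using Xs_dp(2) Fs_props(9) by (fastforce simp: Rs_def)

text \<open>Leavers can share uncovered neighbours. Since \<open>fpv\<close> assigns each of these
  to a single leaver, the local counts partition \<open>Fs\<close>, and the centre learns the exact
  size that it needs for the padding.\<close>

lemma card_Rs: "card Rs = 1 + (\<Sum>x\<in>Xs. Suc (cn x))"
proof -
  have "card Fs = (\<Sum>x\<in>Xs. card {u \<in> Fs. fpv u = x})"
  proof -
    have "(\<Sum>x\<in>Xs. card {u \<in> Fs. fpv u = x}) = (\<Sum>x\<in>Xs. \<Sum>u\<in>{u \<in> Fs. fpv u = x}. 1)" by simp
    also have "\<dots> = (\<Sum>u\<in>Fs. 1)"
      using Fs_props(10) by (intro sum.group finite_Fs finite_Xs) auto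
    finally show ?thesis by simp
  qed
  moreover have "card (Xs \<union> Fs) = card Xs + card Fs"
    using Fs_props(2) by (intro card_Un_disjoint finite_Xs finite_Fs) auto
  moreover have "c \<notin> Xs \<union> Fs" using Xs_props(8) Fs_props(5) by auto
  ultimately show ?thesis by (simp add: Rs_def finite_Xs finite_Fs cn_def sum_Suc)
qed

subsection \<open>Registrations during an operation\<close>

text \<open>A leaver with a nonempty list registers with the centre, so that the token reaches that
  list through it. The loser of a conflict needs no such link, because it holds the token itself
  after the operation.\<close>

definition "req v = (if v \<in> Xs \<and> \<not> kf v \<and> {u. (bnext E Hc Hc M (bnext E H Hc M b Hc M (\<lambda>_. None) (\<lambda>_. False))
    Hc M (\<lambda>_. None) (\<lambda>_. False)) u = Some v} \<noteq> {} then Some c else None)"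
text \<open>The numbers in \<open>b10\<close>, \<open>b11\<close>, \<open>b13\<close> and
  \<open>b14\<close> are the clocks at which these registrations come into force.\<close>

definition "b10 = bnext E H Hc M b Hc M (\<lambda>_. None) (\<lambda>_. False)"
definition "b11 = bnext E Hc Hc M b10 Hc M (\<lambda>_. None) (\<lambda>_. False)"
definition "b13 = bnext E Hc Hc Mj b11 Hc Mk req (\<lambda>_. False)"
definition "b14 = bnext E Hc Hc Mk b13 Hc Mk (\<lambda>_. None) (\<lambda>_. False)"

lemma req_eq: "req v = (if v \<in> Xs \<and> \<not> kf v \<and> {u. b11 u = Some v} \<noteq> {} then Some c else None)"
  by (simp add: req_def b11_def b10_def)

lemma bnext_same:
  "bnext E H1 H1 M1 b1 H1 M2 rq (\<lambda>_. False) v = (if b1 v = None then rq v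
     else if v \<notin> M2 \<and> (v \<notin> H1 \<and> N v \<inter> (M1 - H1) = {} \<or> {u. b1 u = Some v} \<noteq> {}) then b1 v else None)"
  by (auto simp: bnext_def freshS_def)

text \<open>No vertex turns heavy in this round, so a vertex that was light before sees no candidate
  for a boss; only converted vertices can register anew.\<close>

lemma b10_char: "b10 v = (if b v = None then
    (if v \<in> Cv \<and> v \<notin> M \<and> N v \<inter> (M - Hc) = {} \<and> N v \<inter> M \<inter> Hc \<noteq> {} \<and> {u. b u = Some v} = {}
     then Some (Min (N v \<inter> M \<inter> Hc)) else None)
   else if v \<notin> Hc \<and> N v \<inter> (M - Hc) = {} \<or> {u. b u = Some v} \<noteq> {} then b v else None)"
proof (cases "b v")
  case None
  have "v \<notin> H \<Longrightarrow> freshS E H Hc M v = {}" "v \<in> H \<Longrightarrow> freshS E H Hc M v = N v \<inter> M \<inter> Hc"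
    by (auto simp: freshS_def Hc_def)
  moreover have "v \<in> Cv \<longleftrightarrow> v \<in> H \<and> v \<notin> Hc" using Cv_H by (auto simp: Hc_def)
  ultimately show ?thesis using None by (cases "v \<in> H") (auto simp: b10_def bnext_def)
next
  case (Some z)
  then show ?thesis using bM[OF Some] by (simp add: b10_def bnext_def)
qed

lemma b_M: "v \<in> M \<Longrightarrow> b v = None" "v \<in> M \<Longrightarrow> b10 v = None" "v \<in> M \<Longrightarrow> b11 v = None"
proof -
  assume v: "v \<in> M"
  show "b v = None" using bM[of v] v by (cases "b v") auto
  then show "b10 v = None" using v by (simp add: b10_char)
  then show "b11 v = None" by (simp add: b11_def bnext_same)
qed

lemma b11_eq: "b11 v = (if v \<notin> Hc \<and> N v \<inter> (M - Hc) = {} \<or> {u. b10 u = Some v} \<noteq> {} then b10 v else None)"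
  using b_M(2)[of v] unfolding b11_def bnext_same by auto

lemma finite_N: "finite (N v)" by (rule finite_neighbours[OF finE])

lemmas settle1 = registration_settles[of b N "M - H" "- H" "M - Hc" "- Hc" b10 b11]

lemma settle1_prems:
  "b v = Some z \<Longrightarrow> z \<in> N v"
  "b v = Some z \<Longrightarrow> z \<in> M - H \<Longrightarrow> {u. b u = Some v} \<noteq> {}"
  "b v = Some z \<Longrightarrow> z \<notin> M - H \<Longrightarrow> v \<in> - H \<and> N v \<inter> (M - H) = {} \<and> {u. b u = Some v} = {}"
  "M - H \<subseteq> M - Hc" "- H \<subseteq> - Hc"
  "b v = None \<Longrightarrow> b10 v = Some z \<Longrightarrow> z \<in> N v \<and> b z = None \<and> b10 z = None \<and>
      (if z \<in> M - Hc then {u. b u = Some v} \<noteq> {} else v \<in> - Hc \<and> N v \<inter> (M - Hc) = {} \<and> {u. b u = Some v} = {})"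
  "v \<in> M - Hc \<Longrightarrow> b10 v = None"
  "b v = Some z \<Longrightarrow> b10 v = (if v \<in> - Hc \<and> N v \<inter> (M - Hc) = {} \<or> {u. b u = Some v} \<noteq> {} then Some z else None)"
  "b11 v = (if v \<in> - Hc \<and> N v \<inter> (M - Hc) = {} \<or> {u. b10 u = Some v} \<noteq> {} then b10 v else None)"
proof -
  show "b v = Some z \<Longrightarrow> z \<in> N v" using bE by (simp add: in_neighbours')
  show "b v = Some z \<Longrightarrow> z \<in> M - H \<Longrightarrow> {u. b u = Some v} \<noteq> {}" by (rule brel)
  show "b v = Some z \<Longrightarrow> z \<notin> M - H \<Longrightarrow> v \<in> - H \<and> N v \<inter> (M - H) = {} \<and> {u. b u = Some v} = {}"
    using bdirt[of v z] by simp
  show "M - H \<subseteq> M - Hc" "- H \<subseteq> - Hc" by (auto simp: Hc_def)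
  show "v \<in> M - Hc \<Longrightarrow> b10 v = None" using b_M by simp
  show "b v = Some z \<Longrightarrow> b10 v = (if v \<in> - Hc \<and> N v \<inter> (M - Hc) = {} \<or> {u. b u = Some v} \<noteq> {} then Some z else None)"
    by (simp add: b10_char)
  show "b11 v = (if v \<in> - Hc \<and> N v \<inter> (M - Hc) = {} \<or> {u. b10 u = Some v} \<noteq> {} then b10 v else None)"
    unfolding b11_eq[of v] by simp
  assume "b v = None" "b10 v = Some z"
  then have v: "v \<in> Cv" "N v \<inter> (M - Hc) = {}" "N v \<inter> M \<inter> Hc \<noteq> {}" "{u. b u = Some v} = {}" "z = Min (N v \<inter> M \<inter> Hc)"
    unfolding b10_char[of v] by (auto split: if_splits)
  have "z \<in> N v \<inter> M \<inter> Hc" unfolding v(5) using v(3) finite_N by (intro Min_in) auto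
  then show "z \<in> N v \<and> b z = None \<and> b10 z = None \<and>
      (if z \<in> M - Hc then {u. b u = Some v} \<noteq> {} else v \<in> - Hc \<and> N v \<inter> (M - Hc) = {} \<and> {u. b u = Some v} = {})"
    using v b_M by (auto simp: Hc_def)
qed

lemma b11_N: "b11 v = Some z \<Longrightarrow> z \<in> N v"
  by (rule settle1(1)[OF settle1_prems])
lemma b11_rel: "b11 v = Some z \<Longrightarrow> z \<in> M - Hc \<Longrightarrow> {u. b11 u = Some v} \<noteq> {}"
  by (rule settle1(2)[OF settle1_prems])
lemma b11_dirt: "b11 v = Some z \<Longrightarrow> z \<notin> M - Hc \<Longrightarrow> v \<in> - Hc \<and> N v \<inter> (M - Hc) = {} \<and> {u. b11 u = Some v} = {}"
  by (rule settle1(3)[OF settle1_prems])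
lemma b10_keep: "b10 v = Some z \<Longrightarrow> z \<notin> M - Hc \<Longrightarrow> b11 v = Some z"
  by (rule settle1(5)[OF settle1_prems])

lemma b11_c: "jn \<Longrightarrow> b11 c = None"
proof -
  assume "jn"
  then have "b c = None"
  proof (cases "b c")
    case (Some z)
    have "kd \<noteq> 1" using K1 Some by auto
    then have "kd = 2" using \<open>jn\<close> by (auto simp: jn_def)
    then show ?thesis using K2 Some brel[OF Some] bdirt[OF Some] by auto
  qed simp
  then have "b10 c = None" using c_Cv by (simp add: b10_char)
  then show ?thesis by (simp add: b11_eq)
qed

lemma b11_Mj: "v \<in> Mj \<Longrightarrow> b11 v = None"
  using b_M(3) b11_c by (auto simp: Mj_def split: if_splits)

lemma b11_needy: "b11 v = Some z \<Longrightarrow> v \<notin> Hc \<and> N v \<inter> (M - Hc) = {} \<or> {u. b11 u = Some v} \<noteq> {}"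
  using b11_rel[of v z] b11_dirt[of v z] by auto

text \<open>The join of the centre is not announced yet, so no registration reacts to it.\<close>

lemma b12: "bnext E Hc Hc M b11 Hc Mj (\<lambda>_. None) (\<lambda>_. False) v = b11 v"
  unfolding bnext_same using b11_needy[of v] b11_Mj[of v] by (cases "b11 v") auto

lemma b13_eq: "b13 v = (if b11 v = None then req v
    else if v \<notin> Hc \<and> N v \<inter> (Mj - Hc) = {} \<or> {u. b11 u = Some v} \<noteq> {} then b11 v else None)"
  using b11_Mj[of v] unfolding b13_def bnext_same by (auto simp: Mk_def)

lemma Mk_P: "Mk - Hc = Mj - Hc" by (auto simp: Mk_def Xs_def)

lemma b13_Mk: "v \<in> Mk \<Longrightarrow> b13 v = None"
  using b11_Mj[of v] by (auto simp: b13_eq req_eq Mk_def)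

lemma b14_eq: "b14 v = (if v \<notin> Hc \<and> N v \<inter> (Mj - Hc) = {} \<or> {u. b13 u = Some v} \<noteq> {} then b13 v else None)"
  using b13_Mk[of v] unfolding b14_def bnext_same Mk_P by auto

lemmas settle2 = registration_settles[of b11 N "M - Hc" "- Hc" "Mj - Hc" "- Hc" b13 b14]

lemma settle2_prems:
  "M - Hc \<subseteq> Mj - Hc" "- Hc \<subseteq> - Hc"
  "b11 v = None \<Longrightarrow> b13 v = Some z \<Longrightarrow> z \<in> N v \<and> b11 z = None \<and> b13 z = None \<and>
      (if z \<in> Mj - Hc then {u. b11 u = Some v} \<noteq> {} else v \<in> - Hc \<and> N v \<inter> (Mj - Hc) = {} \<and> {u. b11 u = Some v} = {})"
  "v \<in> Mj - Hc \<Longrightarrow> b13 v = None"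
  "b11 v = Some z \<Longrightarrow> b13 v = (if v \<in> - Hc \<and> N v \<inter> (Mj - Hc) = {} \<or> {u. b11 u = Some v} \<noteq> {} then Some z else None)"
  "b14 v = (if v \<in> - Hc \<and> N v \<inter> (Mj - Hc) = {} \<or> {u. b13 u = Some v} \<noteq> {} then b13 v else None)"
proof -
  show "M - Hc \<subseteq> Mj - Hc" "- Hc \<subseteq> - Hc" by (auto simp: Mj_def)
  show "v \<in> Mj - Hc \<Longrightarrow> b13 v = None" using b13_Mk[of v] Mk_P by auto
  show "b11 v = Some z \<Longrightarrow> b13 v = (if v \<in> - Hc \<and> N v \<inter> (Mj - Hc) = {} \<or> {u. b11 u = Some v} \<noteq> {} then Some z else None)"
    by (simp add: b13_eq)
  show "b14 v = (if v \<in> - Hc \<and> N v \<inter> (Mj - Hc) = {} \<or> {u. b13 u = Some v} \<noteq> {} then b13 v else None)"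
    unfolding b14_eq[of v] by simp
  assume "b11 v = None" "b13 v = Some z"
  then have v: "v \<in> Xs" "\<not> kf v" "{u. b11 u = Some v} \<noteq> {}" "z = c"
    by (auto simp: b13_eq req_eq split: if_splits)
  have k: "kd = 1" "jn" using Xs_props(7)[OF v(1)] v(2) by auto
  have "c \<in> Mk" "c \<notin> Hc" "{c, v} \<in> E" using Xs_props[OF v(1)] K1[OF k(1)] by (auto simp: Hc_def)
  then show "z \<in> N v \<and> b11 z = None \<and> b13 z = None \<and>
      (if z \<in> Mj - Hc then {u. b11 u = Some v} \<noteq> {} else v \<in> - Hc \<and> N v \<inter> (Mj - Hc) = {} \<and> {u. b11 u = Some v} = {})"
    using v b11_c[OF k(2)] b13_Mk[of c] by (auto simp: in_neighbours Mk_def)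
qed

lemma b14_N: "b14 v = Some z \<Longrightarrow> z \<in> N v"
  by (rule settle2(1)[OF b11_N b11_rel b11_dirt settle2_prems])
lemma b14_rel: "b14 v = Some z \<Longrightarrow> z \<in> Mj - Hc \<Longrightarrow> {u. b14 u = Some v} \<noteq> {}"
  by (rule settle2(2)[OF b11_N b11_rel b11_dirt settle2_prems])
lemma b14_dirt: "b14 v = Some z \<Longrightarrow> z \<notin> Mj - Hc \<Longrightarrow> v \<in> - Hc \<and> N v \<inter> (Mj - Hc) = {} \<and> {u. b14 u = Some v} = {}"
  by (rule settle2(3)[OF b11_N b11_rel b11_dirt settle2_prems])
lemma b14_ch: "v \<notin> Mj - Hc \<Longrightarrow> {u. b14 u = Some v} = {u. b13 u = Some v}"
  by (rule settle2(4)[OF b11_N b11_rel b11_dirt settle2_prems])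
lemma b13_keep: "b13 v = Some z \<Longrightarrow> z \<notin> Mj - Hc \<Longrightarrow> b14 v = Some z"
  by (rule settle2(5)[OF b11_N b11_rel b11_dirt settle2_prems])

lemma b14_Mk: "v \<in> Mk \<Longrightarrow> b14 v = None"
  using b13_Mk by (simp add: b14_eq)

lemma b14_Fs: "f \<in> Fs \<Longrightarrow> b14 f = None"
proof (cases "b14 f")
  case (Some z)
  assume f: "f \<in> Fs"
  have "z \<in> Mj - Hc" using b14_dirt[OF Some] Fs_props(4)[OF f] by auto
  moreover have "z \<in> N f" using b14_N[OF Some] .
  ultimately show ?thesis using f Mk_P by (auto simp: Fs_def)
qed

text \<open>The vertices of \<open>Fs\<close> are heavy and unregistered, so it does not matter to
  the registrations which of them join.\<close>

lemma b15: "Mk \<subseteq> M' \<Longrightarrow> M' - Mk \<subseteq> Fs \<Longrightarrow> bnext E Hc Hc Mk b14 Hc M' (\<lambda>_. None) (\<lambda>_. False) v = b14 v"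
proof (cases "b14 v")
  case None
  then show ?thesis by (simp add: bnext_same)
next
  case (Some z)
  assume a: "Mk \<subseteq> M'" "M' - Mk \<subseteq> Fs"
  have "v \<notin> M'" using a b14_Mk[of v] b14_Fs[of v] Some by (metis DiffI option.distinct(1) subsetD)
  moreover have "v \<notin> Hc \<and> N v \<inter> (Mj - Hc) = {} \<or> {u. b14 u = Some v} \<noteq> {}"
    using b14_rel[OF Some] b14_dirt[OF Some] by (cases "z \<in> Mj - Hc") blast+
  ultimately show ?thesis unfolding bnext_same Mk_P by simp
qed

lemma b16: "Mk \<subseteq> M' \<Longrightarrow> M' - Mk \<subseteq> Fs \<Longrightarrow> bnext E Hc Hc M' b14 Hc M' (\<lambda>_. None) (\<lambda>_. False) v = b14 v"
proof -
  assume a: "Mk \<subseteq> M'" "M' - Mk \<subseteq> Fs"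
  have "M' - Hc = Mk - Hc" using a Fs_props(4) by blast
  then show ?thesis using b15[OF a, of v] unfolding bnext_same by (simp only:)
qed

lemma regE: "b v = Some z \<Longrightarrow> {v, z} \<in> E" "b10 v = Some z \<Longrightarrow> {v, z} \<in> E" "b11 v = Some z \<Longrightarrow> {v, z} \<in> E"
  "b13 v = Some z \<Longrightarrow> {v, z} \<in> E" "b14 v = Some z \<Longrightarrow> {v, z} \<in> E"
proof -
  show "b v = Some z \<Longrightarrow> {v, z} \<in> E" by (rule bE)
  show "b11 v = Some z \<Longrightarrow> {v, z} \<in> E" using b11_N[of v z] unfolding in_neighbours' .
  show "b14 v = Some z \<Longrightarrow> {v, z} \<in> E" using b14_N[of v z] unfolding in_neighbours' .
  show "b10 v = Some z \<Longrightarrow> {v, z} \<in> E"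
    using settle1_prems(6)[of v z] bE[of v z] settle1_prems(8)[of v]
    by (cases "b v") (simp_all add: in_neighbours' split: if_splits)
  show "b13 v = Some z \<Longrightarrow> {v, z} \<in> E"
    using settle2_prems(3)[of v z] b11_N[of v z] settle2_prems(5)[of v]
    by (cases "b11 v") (simp_all add: in_neighbours' split: if_splits)
qed

lemma reg_nd: "b u \<noteq> b10 u \<Longrightarrow> b u = None \<or> b10 u = None" "b10 u \<noteq> b11 u \<Longrightarrow> b10 u = None \<or> b11 u = None"
  "b11 u \<noteq> b13 u \<Longrightarrow> b11 u = None \<or> b13 u = None" "b13 u \<noteq> b14 u \<Longrightarrow> b13 u = None \<or> b14 u = None"
proof -
  show "b u \<noteq> b10 u \<Longrightarrow> b u = None \<or> b10 u = None" unfolding b10_char[of u] by (metis (full_types))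
  show "b10 u \<noteq> b11 u \<Longrightarrow> b10 u = None \<or> b11 u = None" unfolding b11_eq[of u] by (metis (full_types))
  show "b11 u \<noteq> b13 u \<Longrightarrow> b11 u = None \<or> b13 u = None" unfolding b13_eq[of u] by (metis (full_types))
  show "b13 u \<noteq> b14 u \<Longrightarrow> b13 u = None \<or> b14 u = None" unfolding b14_eq[of u] by (metis (full_types))
qed

lemma reg_finite: "(\<And>v z. \<beta> v = Some z \<Longrightarrow> {v, z} \<in> E) \<Longrightarrow> finite {u. \<beta> u \<noteq> None}"
proof -
  assume a: "\<And>v z. \<beta> v = Some z \<Longrightarrow> {v, z} \<in> E"
  have "{u. \<beta> u \<noteq> None} \<subseteq> fst ` {(u, v). {u, v} \<in> E}"
  proof
    fix u assume "u \<in> {u. \<beta> u \<noteq> None}"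
    then obtain z where "{u, z} \<in> E" using a by blast
    then show "u \<in> fst ` {(u, v). {u, v} \<in> E}" by force
  qed
  then show ?thesis using finite_edge_pairs[OF finE] by (meson finite_imageI finite_subset)
qed

definition "regs = card {u. b u \<noteq> b10 u} + card {u. b10 u \<noteq> b11 u} + card {u. b11 u \<noteq> b13 u} + card {u. b13 u \<noteq> b14 u}"

lemma finite_Cv: "finite Cv" using finite_Bl[of 3] by (auto simp: Cv_def)

text \<open>New registrations come only from converted vertices and from leavers; all other changes
  are withdrawals.\<close>

lemma regs_le: "regs + card {u. b14 u \<noteq> None} \<le> card {u. b u \<noteq> None} + 2 * card Cv + 2 * card Xs"
proof -
  have "{u. b u = None \<and> b10 u \<noteq> None} \<subseteq> Cv" "{u. b10 u = None \<and> b11 u \<noteq> None} \<subseteq> {}"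
    "{u. b11 u = None \<and> b13 u \<noteq> None} \<subseteq> Xs" "{u. b13 u = None \<and> b14 u \<noteq> None} \<subseteq> {}"
  proof -
    have "u \<notin> Cv \<Longrightarrow> b u = None \<Longrightarrow> b10 u = None" for u
      unfolding b10_char[of u] by (simp only: if_True if_False simp_thms if_cancel)
    then show "{u. b u = None \<and> b10 u \<noteq> None} \<subseteq> Cv" by - (intro subsetI, elim CollectE conjE, rule ccontr, simp)
    have "u \<notin> Xs \<Longrightarrow> b11 u = None \<Longrightarrow> b13 u = None" for u
      unfolding b13_eq[of u] req_eq[of u] by (simp only: if_True if_False simp_thms if_cancel)
    then show "{u. b11 u = None \<and> b13 u \<noteq> None} \<subseteq> Xs" by - (intro subsetI, elim CollectE conjE, rule ccontr, simp)
    have "b10 u = None \<Longrightarrow> b11 u = None" "b13 u = None \<Longrightarrow> b14 u = None" for u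
      unfolding b11_eq[of u] b14_eq[of u] by (simp_all only: if_cancel)
    then show "{u. b10 u = None \<and> b11 u \<noteq> None} \<subseteq> {}" "{u. b13 u = None \<and> b14 u \<noteq> None} \<subseteq> {}"
      by - (intro subsetI, elim CollectE conjE, simp del: not_None_eq)+
  qed
  note a = registration_changes[OF reg_finite reg_finite reg_nd(1) this(1) finite_Cv, OF regE(1) regE(2)]
    registration_changes[OF reg_finite reg_finite reg_nd(2) this(2), OF regE(2) regE(3)]
    registration_changes[OF reg_finite reg_finite reg_nd(3) this(3) finite_Xs, OF regE(3) regE(4)]
    registration_changes[OF reg_finite reg_finite reg_nd(4) this(4), OF regE(4) regE(5)]
  then show ?thesis unfolding regs_def by simp
qed

end

locale op_run = op_start A T a n E H M St b c kd w pr
  for A :: "'s static_alg" and T :: "nat \<Rightarrow> nat" and a n :: nat and E :: "nat set set"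
    and H M St :: "nat set" and b :: "nat \<Rightarrow> nat option" and c kd w :: nat and pr :: "nat \<Rightarrow> nat list" +
  fixes V :: "nat set" and \<beta> :: real
  assumes stat: "static_MIS_algorithm (a + 2) 4 \<beta> T A" and ids: "vertex_ids a n V"
    and EV: "\<And>u v. {u, v} \<in> E \<Longrightarrow> u \<in> V \<and> v \<in> V" and ESG: "\<And>e. e \<in> E \<Longrightarrow> \<exists>u v. e = {u, v}"
    and HV: "H \<subseteq> V" and cV: "c \<in> V" and n2: "n \<ge> 2"
begin

section \<open>Simulation of the static algorithm\<close>

definition "vt = vids n (card Rs)"
definition "E' = {e \<in> E. e \<subseteq> Rs} \<union> (\<lambda>i. {c, i}) ` vt"
definition "SS r = static_states A n E' {c} r"
definition "Js = {f \<in> Fs. s_out A (SS (T n) f)}"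
definition "Mf = Mk \<union> Js"

lemma BlV: "Bl k \<subseteq> V" using Bl_sub HV cV by auto
lemma RsV: "Rs \<subseteq> V" using Rs_Bl BlV by blast

lemma V_vt: "v \<in> V \<Longrightarrow> v \<notin> vt"
  using ids by (auto simp: vertex_ids_def vt_def vids_def)

lemma E'_iff: "{u, v} \<in> E' \<longleftrightarrow> {u, v} \<in> E \<and> u \<in> Rs \<and> v \<in> Rs \<or> u = c \<and> v \<in> vt \<or> v = c \<and> u \<in> vt"
  by (auto simp: E'_def doubleton_eq_iff)

lemma nb_E': "v \<in> V \<Longrightarrow> neighbours E' v = (if v \<in> Rs then N v \<inter> Rs else {}) \<union> (if v = c then vt else {})"
  using V_vt[of v] by (auto simp: neighbours_def E'_iff)

lemma nb_E'_vt: "i \<in> vt \<Longrightarrow> neighbours E' i = {c}"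
  using V_vt[of i] RsV cV V_vt[of c] by (auto simp: neighbours_def E'_iff)

lemma SS_0: "SS 0 v = s_init A n v (neighbours E' v) (v = c)"
  by (simp add: SS_def static_states_def static_start_def)

lemma SS_Suc: "SS (Suc r) v = s_step A (SS r v) (\<lambda>u. if {u, v} \<in> E' then s_send A (SS r u) v else None)"
proof -
  have "SS (Suc r) = static_round A E' (SS r)" by (simp add: SS_def[abs_def] static_states_def)
  then show ?thesis by (simp add: static_round_def static_sent_def)
qed

lemma cardRs: "card Rs \<le> n"
  using card_mono[of V Rs] RsV ids by (auto simp: vertex_ids_def)

text \<open>Every vertex is within two steps of the centre, hence the diameter bound 4. The input
  contains the centre, so its neighbours, among them all leavers and pendants, stay out of the
  output; apart from \<open>c\<close> the output lies in \<open>Fs\<close> and hence is a maximal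
  independent set there.\<close>

lemma static_facts:
  "\<And>r u v msg. r < T n \<Longrightarrow> {u, v} \<in> E' \<Longrightarrow> s_send A (SS r u) v = Some msg \<Longrightarrow>
     real (length msg) \<le> \<beta> * log 2 (real n)"
  "\<And>f g. f \<in> Js \<Longrightarrow> g \<in> Js \<Longrightarrow> {f, g} \<notin> E"
  "\<And>f. f \<in> Fs \<Longrightarrow> f \<notin> Js \<Longrightarrow> N f \<inter> Js \<noteq> {}"
proof -
  let ?V = "Rs \<union> vt"
  have disj: "Rs \<inter> vt = {}" using RsV V_vt by auto
  have fin: "finite ?V" using finite_Rs by (simp add: vt_def vids_def)
  have "card ?V = card Rs + card vt" using disj finite_Rs by (intro card_Un_disjoint) (auto simp: vt_def vids_def)
  also have "\<dots> = n" using cardRs by (simp add: vt_def vids_def)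
  finally have card: "card ?V = n" .
  \<comment> \<open>Pendant IDs stay below \<open>n ^ a + n\<close>. Two summands of size at most
    \<open>n ^ a * n\<close> fit below one more factor \<open>n\<close> because
    \<open>n \<ge> 2\<close>; this is the origin of \<open>a + 2\<close>.\<close>
  have big: "n ^ a + n \<le> n ^ (a + 2)"
  proof -
    have "1 \<le> n ^ a" using n2 by simp
    then have "n ^ a + n \<le> n ^ a * n + n ^ a * n" using n2 by (intro add_mono) auto
    also have "\<dots> = n ^ a * n * 2" by simp
    also have "\<dots> \<le> n ^ a * n * n" using n2 by (rule mult_le_mono2)
    finally show ?thesis by (simp add: power_add power2_eq_square ac_simps)
  qed
  have "v < n ^ a" if "v \<in> V" for v using ids that by (auto simp: vertex_ids_def)
  then have "?V \<subseteq> {..<n ^ (a + 2)}" using big RsV by (fastforce simp: vt_def vids_def)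
  then have v: "vertex_ids (a + 2) n ?V" using fin card by (simp add: vertex_ids_def)
  have cR: "c \<in> Rs" by (simp add: Rs_def)
  have sg: "simple_graph ?V E'"
    unfolding simple_graph_def
  proof (intro conjI ballI fin)
    fix e assume e: "e \<in> E'"
    show "\<exists>u\<in>?V. \<exists>v\<in>?V. u \<noteq> v \<and> e = {u, v}"
    proof (cases "e \<in> E \<and> e \<subseteq> Rs")
      case True
      then obtain u v where "e = {u, v}" using ESG by blast
      then show ?thesis using True loop[of u] by (intro bexI[of _ u] bexI[of _ v]) auto
    next
      case False
      then obtain i where "i \<in> vt" "e = {c, i}" using e by (auto simp: E'_def)
      then show ?thesis using cR disj by (intro bexI[of _ c] bexI[of _ i]) auto
    qed
  qed
  have ind: "independent_set ?V E' {c}"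
  proof -
    have "{c, c} \<notin> E'" unfolding E'_iff using loop[of c] V_vt[OF cV] by blast
    then show ?thesis using cR by (simp add: independent_set_def)
  qed
  define Q where "Q = {(x, y). {x, y} \<in> E'}"
  have sym: "(x, y) \<in> Q \<Longrightarrow> (y, x) \<in> Q" for x y by (simp add: Q_def insert_commute)
  \<comment> \<open>An uncovered vertex reaches the centre through a leaver, all others are adjacent
    to it or equal to it.\<close>
  have toc: "\<exists>k\<le>2. (v, c) \<in> Q ^^ k" if "v \<in> ?V" for v
  proof -
    consider "v = c" | "v \<in> Xs" | "v \<in> vt" | "v \<in> Fs" using \<open>v \<in> ?V\<close> by (auto simp: Rs_def)
    then show ?thesis
    proof cases
      case 1 then show ?thesis by (intro exI[of _ 0]) auto
    next
      case 2
      then have "(v, c) \<in> Q" using Xs_props(1)[OF 2] by (auto simp: Q_def E'_iff Rs_def insert_commute)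
      then show ?thesis by (intro exI[of _ 1]) auto
    next
      case 3
      then have "(v, c) \<in> Q" by (auto simp: Q_def E'_iff)
      then show ?thesis by (intro exI[of _ 1]) auto
    next
      case 4
      then obtain x where x: "x \<in> N v" "x \<in> Xs" using Fs_props(7) by blast
      then have "(v, x) \<in> Q" "(x, c) \<in> Q"
        using Xs_props(1)[OF x(2)] 4 by (auto simp: Q_def E'_iff Rs_def insert_commute in_neighbours)
      then have "(v, c) \<in> Q ^^ 2" by (auto simp: numeral_2_eq_2)
      then show ?thesis by blast
    qed
  qed
  have pow_sym: "(x, y) \<in> Q ^^ k \<Longrightarrow> (y, x) \<in> Q ^^ k" for x y k
  proof (induction k arbitrary: x y)
    case (Suc k)
    then obtain z where "(x, z) \<in> Q ^^ k" "(z, y) \<in> Q" by auto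
    then have "(y, z) \<in> Q" "(z, x) \<in> Q ^^ k" using Suc.IH sym by blast+
    then show ?case by (metis relpow_Suc_I2)
  qed simp
  have diam: "diameter_at_most ?V E' 4"
    unfolding diameter_at_most_def
  proof (intro ballI)
    fix x y assume "x \<in> ?V" "y \<in> ?V"
    then obtain i j where ij: "i \<le> 2" "(x, c) \<in> Q ^^ i" "j \<le> 2" "(y, c) \<in> Q ^^ j" using toc by meson
    then have "(x, y) \<in> Q ^^ (i + j)" using pow_sym relpow_add[of i j Q] by blast
    then show "\<exists>k\<le>4. (x, y) \<in> {(x, y). {x, y} \<in> E'} ^^ k" using ij unfolding Q_def by (intro exI[of _ "i + j"]) auto
  qed
  let ?S = "{v \<in> ?V. s_out A (SS (T n) v)}"
  have all: "(\<forall>r<T n. \<forall>u v msg. static_sent A E' (static_states A n E' {c} r) u v = Some msg \<longrightarrow>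
            real (length msg) \<le> \<beta> * log 2 (real n)) \<and>
        maximal_independent_set ?V E' ?S \<and> {c} \<subseteq> ?S"
    using stat v sg diam ind unfolding static_MIS_algorithm_def SS_def by blast
  show "real (length msg) \<le> \<beta> * log 2 (real n)"
    if "r < T n" "{u, v} \<in> E'" "s_send A (SS r u) v = Some msg" for r u v msg
    using all that unfolding static_sent_def SS_def by (metis (full_types))
  have mis: "maximal_independent_set ?V E' ?S" and cS: "c \<in> ?S" using all by auto
  then have idp: "\<And>u v. u \<in> ?S \<Longrightarrow> v \<in> ?S \<Longrightarrow> {u, v} \<notin> E'"
    by (auto simp: maximal_independent_set_def independent_set_def)
  have J: "Js = ?S \<inter> Fs" using V_vt by (auto simp: Js_def Rs_def)
  show "{f, g} \<notin> E" if "f \<in> Js" "g \<in> Js" for f g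
    using idp[of f g] that unfolding J E'_iff by (auto simp: Rs_def)
  show "N f \<inter> Js \<noteq> {}" if f: "f \<in> Fs" "f \<notin> Js" for f
  proof -
    have fS: "f \<notin> ?S" "f \<in> ?V" using f J by (auto simp: Rs_def)
    have "\<not> independent_set ?V E' (insert f ?S)"
      using mis fS unfolding maximal_independent_set_def by blast
    moreover have "{f, f} \<notin> E'" unfolding E'_iff using loop[of f] Fs_props(5)[OF f(1)] by blast
    ultimately obtain g where g: "g \<in> ?S" "{f, g} \<in> E'"
      using idp fS unfolding independent_set_def by (auto simp: insert_commute)
    have "f \<noteq> c" "f \<notin> vt" using Fs_props[OF f(1)] V_vt[of f] BlV by auto
    have gR: "g \<in> Rs" "{f, g} \<in> E" using g(2) \<open>f \<noteq> c\<close> \<open>f \<notin> vt\<close> unfolding E'_iff by auto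
    moreover have "g \<noteq> c" using gR Fs_props(8)[OF f(1)] by (auto simp: insert_commute)
    \<comment> \<open>A leaver is adjacent to the centre, and the centre is in the output because it
      is in the input.\<close>
    moreover have "g \<notin> Xs"
    proof
      assume "g \<in> Xs"
      then have "{g, c} \<in> E" using Xs_props(1)[of g] by (simp only: insert_commute)
      then have "{g, c} \<in> E'" unfolding E'_iff using gR(1) cR by blast
      then show False using idp[OF g(1) cS] by blast
    qed
    ultimately have "g \<in> Fs" by (auto simp: Rs_def)
    then show ?thesis using g gR J by (auto simp: in_neighbours')
  qed
qed

section \<open>Rounds after the exploration\<close>

definition simc :: "nat \<Rightarrow> nat \<Rightarrow> nat \<Rightarrow> 's" where
  "simc r v = (\<lambda>i. if i = v then SS r v else if v = c \<and> i \<in> vt then SS r i else undefined)"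

definition memB :: "nat \<Rightarrow> nat \<Rightarrow> 's mem" where
  "memB t v = \<lparr>clk = t, kind = (if v = c then kd else 0), dep = dp v, par = pa v, acc = ac 6 v, tot = s,
     gone = (v \<in> Xs), fpar = (if 14 \<le> t \<and> v \<in> Fs then Some (fpv v) else None),
     net = (if 15 \<le> t \<and> v \<in> Rs then N v \<inter> Rs else {}),
     cnt = (if t < 15 then 0 else if v = c \<and> 16 \<le> t then card Rs else cn v),
     sim = (if t < 16 then (\<lambda>_. undefined) else simc (t - 16) v)\<rparr>"

definition fB :: "nat \<Rightarrow> nat \<Rightarrow> 's phase" where
  "fB t v = (if v \<in> Bl 3 then Op (memB t v) else Idle)"

lemma memB_sel [simp]:
  "clk (memB t v) = t" "kind (memB t v) = (if v = c then kd else 0)" "dep (memB t v) = dp v" "par (memB t v) = pa v"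
  "acc (memB t v) = ac 6 v" "tot (memB t v) = s" "gone (memB t v) = (v \<in> Xs)"
  "fpar (memB t v) = (if 14 \<le> t \<and> v \<in> Fs then Some (fpv v) else None)"
  "net (memB t v) = (if 15 \<le> t \<and> v \<in> Rs then N v \<inter> Rs else {})"
  "cnt (memB t v) = (if t < 15 then 0 else if v = c \<and> 16 \<le> t then card Rs else cn v)"
  "sim (memB t v) = (if t < 16 then (\<lambda>_. undefined) else simc (t - 16) v)"
  by (simp_all add: memB_def)

lemma fB_no_Greet: "fB t u \<noteq> Greet v" by (simp add: fB_def)

lemma inR_B: "14 \<le> t \<Longrightarrow> inR (memB t v) \<longleftrightarrow> v \<in> Rs"
  using kd_pos by (auto simp: inR_def Rs_def)

lemma inbox13: "opinbox n E H0 M0 b0 H1 M1 b1 (fB 13) kf' pr' v u = None"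
  using dp_le[of u 3] by (auto simp: opinbox_simp opsend_def fB_def memsend_def)

lemma inbox14: "opinbox n E Hc M0 b0 H1 M1 b1 (fB 14) kf' pr' v u =
  (if {u, v} \<in> E \<and> u \<in> Rs \<and> (v \<in> Hc \<or> u \<in> Xs \<and> v = c) then Some (Mem (u \<in> Fs \<and> fpv u = v)) else None)"
  using dp_le[of u 3] Rs_Bl Xs_dp(3)[of u] Xs_props(9)[of u]
  by (auto simp: opinbox_simp opsend_def fB_def memsend_def inR_B in_neighbours')

lemma inbox15: "opinbox n E H0 M0 b0 H1 M1 b1 (fB 15) kf' pr' v u =
  (if {u, v} \<in> E \<and> u \<in> Xs \<and> v = c then Some (Cnt (cn u)) else None)"
  using dp_le[of u 3] Xs_dp(3)[of u] Xs_props(8,9)[of u]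
  by (auto simp: opinbox_simp opsend_def fB_def memsend_def)

lemma inbox16: "r < T n \<Longrightarrow> opinbox n E H0 M0 b0 H1 M1 b1 (fB (16 + r)) kf' pr' v u =
  (if {u, v} \<in> E \<and> u \<in> Rs \<and> v \<in> Rs then map_option Sim (s_send A (SS r u) v) else None)"
  using dp_le[of u 3] Rs_Bl
  by (auto simp: opinbox_simp opsend_def fB_def memsend_def simc_def in_neighbours')

lemma inboxT: "opinbox n E H0 M0 b0 H1 M1 b1 (fB (16 + T n)) kf' pr' v u = None"
  using dp_le[of u 3] by (auto simp: opinbox_simp opsend_def fB_def memsend_def)

lemma clock_cases:
  fixes t k :: nat
  assumes "13 \<le> t" "t \<le> 16 + k"
  obtains "t = 13" | "t = 14" | "t = 15" | r where "t = 16 + r" "r < k" | "t = 16 + k"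
proof (cases "t < 16")
  case True
  then have "t = 13 \<or> t = 14 \<or> t = 15" using assms(1) by linarith
  then show thesis using that by blast
next
  case False
  then obtain r where r: "t = 16 + r" using le_Suc_ex[of 16 t] by auto
  then have "r < k \<or> r = k" using assms(2) by linarith
  then show thesis using that r by blast
qed

lemma upval_Sim: "upval (map_option Sim x) = 0" by (cases x) auto

lemma inboxB_types:
  assumes "13 \<le> t" "t \<le> 16 + T n"
  shows "upval (opinbox n E Hc M0 b0 H1 M1 b1 (fB t) kf' pr' v u) = 0"
    "opinbox n E Hc M0 b0 H1 M1 b1 (fB t) kf' pr' v u \<noteq> Some (Down k)"
    "opinbox n E Hc M0 b0 H1 M1 b1 (fB t) kf' pr' v u \<noteq> Some (Explore k)"
    "opinbox n E Hc M0 b0 H1 M1 b1 (fB t) kf' pr' v u \<noteq> Some Tok"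
    "opinbox n E Hc M0 b0 H1 M1 b1 (fB t) kf' pr' v u \<noteq> Some Ret"
proof -
  let ?o = "opinbox n E Hc M0 b0 H1 M1 b1 (fB t) kf' pr' v u"
  have "upval ?o = 0 \<and> ?o \<noteq> Some (Down k) \<and> ?o \<noteq> Some (Explore k) \<and> ?o \<noteq> Some Tok \<and> ?o \<noteq> Some Ret"
    by (rule clock_cases[OF assms]) (auto simp: inbox13 inbox14 inbox15 inbox16 inboxT upval_Sim)
  then show "upval ?o = 0" "?o \<noteq> Some (Down k)" "?o \<noteq> Some (Explore k)" "?o \<noteq> Some Tok" "?o \<noteq> Some Ret" by auto
qed

text \<open>Members of the network introduce themselves to heavy neighbours, and leavers also to the
  possibly light centre. No edge inside \<open>Rs\<close> is missed, since uncovered vertices are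
  not adjacent to the centre.\<close>

lemma mem14_net: "v \<in> Rs \<Longrightarrow> {u. \<exists>x. opinbox n E Hc M0 b0 H1 M1 b1 (fB 14) kf' pr' v u = Some (Mem x)} = N v \<inter> Rs"
proof -
  assume v: "v \<in> Rs"
  have "u \<in> Rs \<Longrightarrow> {u, v} \<in> E \<Longrightarrow> v \<in> Hc \<or> u \<in> Xs \<and> v = c" for u
    using v Xs_props(4) Fs_props(4) Fs_props(8)[of u] loop[of c] by (auto simp: Rs_def insert_commute)
  then show ?thesis by (auto simp: inbox14 in_neighbours)
qed

lemma mem14_cnt: "card {u. opinbox n E Hc M0 b0 H1 M1 b1 (fB 14) kf' pr' v u = Some (Mem True)} = cn v"
proof -
  have "{u. opinbox n E Hc M0 b0 H1 M1 b1 (fB 14) kf' pr' v u = Some (Mem True)} = {u \<in> Fs. fpv u = v}"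
    using Fs_props(10) Xs_props(4) by (auto simp: inbox14 Rs_def in_neighbours' split: if_splits)
  then show ?thesis by (simp add: cn_def)
qed

lemma cnt15: "Suc (\<Sum>u\<in>N c. cntval (opinbox n E H0 M0 b0 H1 M1 b1 (fB 15) kf' pr' c u)) = card Rs"
proof -
  have "(\<Sum>u\<in>N c. cntval (opinbox n E H0 M0 b0 H1 M1 b1 (fB 15) kf' pr' c u)) =
      (\<Sum>u\<in>Xs. cntval (opinbox n E H0 M0 b0 H1 M1 b1 (fB 15) kf' pr' c u))"
    using Xs_props(1) by (intro sum.mono_neutral_right finite_N) (auto simp: inbox15 in_neighbours')
  also have "\<dots> = (\<Sum>u\<in>Xs. Suc (cn u))"
    using Xs_props(1) by (intro sum.cong) (auto simp: inbox15 insert_commute)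
  finally show ?thesis by (simp add: card_Rs)
qed

lemma siminit_B:
  assumes "v \<in> Bl 3"
  shows "siminit (conf n E H0 M0 b0 H1 M1 b1 f kf' pr' v) (memB 15 v) (if v = c then card Rs else k) = simc 0 v"
proof -
  have "v \<in> V" using assms BlV by auto
  moreover have "v = c \<Longrightarrow> v \<in> Rs" by (simp add: Rs_def)
  ultimately show ?thesis
    using kd_pos nb_E'[of v] V_vt[of v]
    by (auto simp: fun_eq_iff siminit_def simc_def SS_0 vt_def[symmetric] nb_E'_vt)
qed

text \<open>The messages between the centre and the pendants are exchanged inside the memory of the
  centre; only edges inside \<open>Rs\<close> carry real messages.\<close>

lemma simnext_B:
  assumes "v \<in> Bl 3" "r < T n"
  shows "simnext (conf n E H0 M0 b0 H1 M1 b1 f kf' pr' v) (memB (16 + r) v)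
    (opinbox n E H0' M0 b0 H1 M1 b1 (fB (16 + r)) kf' pr' v) = simc (Suc r) v"
proof -
  have vV: "v \<in> V" using assms BlV by auto
  have Rvt: "u \<in> Rs \<Longrightarrow> u \<notin> vt" for u using RsV V_vt by auto
  have E1: "simval (opinbox n E H0' M0 b0 H1 M1 b1 (fB (16 + r)) kf' pr' v u) =
      (if {u, v} \<in> E \<and> u \<in> Rs \<and> v \<in> Rs then s_send A (SS r u) v else None)" for u
    using assms by (cases "s_send A (SS r u) v") (auto simp: inbox16)
  have cR: "c \<in> Rs" by (simp add: Rs_def)
  have vc: "v \<in> vt \<longleftrightarrow> False" "c \<in> vt \<longleftrightarrow> False" using V_vt vV cV by auto
  have 2: "(\<lambda>j. if j = c then s_send A (SS r c) i else None) = (\<lambda>u. if {u, i} \<in> E' then s_send A (SS r u) i else None)"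
    if "i \<in> vt" for i
    using that vc Rvt by (auto simp: fun_eq_iff E'_iff)
  show ?thesis
  proof (cases "v = c")
    case True
    have 1: "(\<lambda>j. if kd \<noteq> 0 \<and> j \<in> vt then s_send A (simc r c j) c
         else simval (opinbox n E H0' M0 b0 H1 M1 b1 (fB (16 + r)) kf' pr' c j)) =
       (\<lambda>u. if {u, c} \<in> E' then s_send A (SS r u) c else None)"
    proof
      fix j
      show "(if kd \<noteq> 0 \<and> j \<in> vt then s_send A (simc r c j) c
         else simval (opinbox n E H0' M0 b0 H1 M1 b1 (fB (16 + r)) kf' pr' c j)) =
         (if {j, c} \<in> E' then s_send A (SS r j) c else None)"
        unfolding E1[unfolded True] E'_iff using vc(2) Rvt[of j] cR kd_pos by (cases "j \<in> vt") (auto simp: simc_def)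
    qed
    show ?thesis
    proof
      fix i
      have "simnext (conf n E H0 M0 b0 H1 M1 b1 f kf' pr' c) (memB (16 + r) c)
         (opinbox n E H0' M0 b0 H1 M1 b1 (fB (16 + r)) kf' pr' c) i = simc (Suc r) c i"
      proof -
        have d: "sim (memB (16 + r) c) = simc r c" "kind (memB (16 + r) c) = kd" "cnt (memB (16 + r) c) = card Rs"
          by simp_all
        have e: "simc r c c = SS r c" "i \<in> vt \<Longrightarrow> simc r c i = SS r i" by (simp_all add: simc_def)
        show ?thesis
          unfolding simnext_def conf_sel d vt_def[symmetric] 1 simc_def[of "Suc r"] SS_Suc e(1)
          using kd_pos 2[of i] e(2) by (cases "i = c"; cases "i \<in> vt") simp_all
      qed
      then show "simnext (conf n E H0 M0 b0 H1 M1 b1 f kf' pr' v) (memB (16 + r) v)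
         (opinbox n E H0' M0 b0 H1 M1 b1 (fB (16 + r)) kf' pr' v) i = simc (Suc r) v i" by (simp only: True)
    qed
  next
    case False
    have "(\<lambda>j. simval (opinbox n E H0' M0 b0 H1 M1 b1 (fB (16 + r)) kf' pr' v j)) =
       (\<lambda>u. if {u, v} \<in> E' then s_send A (SS r u) v else None)"
      unfolding E1 E'_iff using vc False by auto
    then show ?thesis using False
      unfolding simnext_def conf_sel memB_sel simc_def[of "Suc r"] SS_Suc
      by (simp add: fun_eq_iff simc_def)
  qed
qed

lemma memstep_B:
  assumes t: "13 \<le> t" "t < 16 + T n" and v: "v \<in> Bl 3" and M0: "t = 13 \<Longrightarrow> M0 = Mj"
  shows "memstep (conf n E Hc M0 b0 Hc Mk b1 (fB t) kf' pr' v) (N v \<inter> (Mk - Hc)) (freshS E Hc Hc Mk v)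
     (stinbox E Hc M0 Hc Mk v) (opinbox n E Hc M0 b0 Hc Mk b1 (fB t) kf' pr' v) (memB t v) = memB (Suc t) v"
proof -
  let ?oi = "opinbox n E Hc M0 b0 Hc Mk b1 (fB t) kf' pr' v"
  have up: "(\<Sum>u\<in>N v. upval (?oi u)) = 0" using inboxB_types(1)[of t] t by (intro sum.neutral) auto
  have D: "{k. \<exists>u. ?oi u = Some (Down k)} = {}" using inboxB_types(2)[of t] t by auto
  have F: "(if t = 13 \<and> (if v = c then kd else 0) = 0 \<and> v \<in> Hc \<and> v \<notin> Mk \<and> N v \<inter> (Mk - Hc) = {} \<and> freshS E Hc Hc Mk v = {}
      then Some (Min {u. stinbox E Hc M0 Hc Mk v u = Some (True, False)})
      else (if 14 \<le> t \<and> v \<in> Fs then Some (fpv v) else None)) = (if 14 \<le> Suc t \<and> v \<in> Fs then Some (fpv v) else None)"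
  proof (cases "t = 13")
    case True
    have "v \<in> Fs \<longleftrightarrow> v \<noteq> c \<and> v \<in> Hc \<and> v \<notin> Mk \<and> N v \<inter> (Mk - Hc) = {} \<and> freshS E Hc Hc Mk v = {}"
      using v by (auto simp: Fs_def freshS_def)
    moreover have "v \<in> Hc \<Longrightarrow> {u. stinbox E Hc M0 Hc Mk v u = Some (True, False)} = N v \<inter> Xs"
    proof -
      assume vH: "v \<in> Hc"
      have "u \<in> Xs \<Longrightarrow> u \<in> Mj" for u by (simp add: Xs_def)
      then have "u \<in> Hc \<and> u \<in> Mj \<and> u \<notin> Mk \<longleftrightarrow> u \<in> Xs" for u using Xs_props(4)[of u] by (auto simp: Mk_def)
      moreover have "stinbox E Hc Mj Hc Mk v u = Some (True, False) \<longleftrightarrow> {u, v} \<in> E \<and> u \<in> Hc \<and> u \<in> Mj \<and> u \<notin> Mk" for u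
        using vH by (auto simp: stinbox_def)
      ultimately show ?thesis unfolding M0[OF True] by (auto simp: in_neighbours)
    qed
    ultimately show ?thesis using True kd_pos by (auto simp: fpv_def)
  next
    case False
    then have "14 \<le> t" "14 \<le> Suc t" using t by auto
    then show ?thesis using False by simp
  qed
  consider "t = 13" | "t = 14" | "t = 15" | r where "t = 16 + r" "r < T n"
    using clock_cases[OF t(1) less_imp_le[OF t(2)]] t(2) by (metis less_irrefl)
  then show ?thesis
  proof cases
    case 1
    then show ?thesis
      unfolding memstep_def Let_def leaves_def memB_sel conf_sel up D F by (simp add: memB_def)
  next
    case 2
    then show ?thesis
      unfolding memstep_def Let_def leaves_def memB_sel conf_sel up D F
      using mem14_net[of v] mem14_cnt[of _ _ _ _ _ _ _ v] inR_B[of 14 v] by (auto simp: memB_def)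
  next
    case 3
    show ?thesis
      unfolding memstep_def Let_def leaves_def memB_sel conf_sel up D F
      using siminit_B[OF v, of Hc M0 b0 Hc Mk b1 "fB 15" kf' pr' "cn v"] cnt15 kd_pos 3
      by (cases "v = c") (auto simp: memB_def)
  next
    case 4
    show ?thesis
      unfolding memstep_def Let_def leaves_def memB_sel conf_sel up D F
      using simnext_B[OF v 4(2), of Hc M0 b0 Hc Mk b1 "fB t" kf' pr' Hc] 4 by (auto simp: memB_def)
  qed
qed

lemma act_B:
  assumes t: "13 \<le> t" "t < 16 + T n" and M0: "t = 13 \<Longrightarrow> M0 = Mj"
  shows "act (conf n E Hc M0 b0 Hc Mk b1 (fB t) kf' pr' v) (N v \<inter> (Mk - Hc)) (freshS E Hc Hc Mk v)
     ch' (stinbox E Hc M0 Hc Mk v) (opinbox n E Hc M0 b0 Hc Mk b1 (fB t) kf' pr' v) =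
   \<lparr>a_H = (v \<in> Hc), a_M = (v \<in> Mk \<or> t = 15 + T n \<and> v \<in> Js), a_req = None, a_ph = fB (Suc t) v, a_kick = kf' v, a_prs = pr' v\<rparr>"
proof (cases "v \<in> Bl 3")
  case True
  \<comment> \<open>The simulated round \<open>r\<close> takes place at clock \<open>16 + r\<close>,
    so the result after \<open>T n\<close> rounds is available in the updated memory of clock
    \<open>15 + T n\<close>.\<close>
  have "t = 15 + T n \<Longrightarrow> sim (memB (Suc t) v) v = SS (T n) v" by (simp add: simc_def)
  moreover have "v \<in> Js \<Longrightarrow> v \<in> Fs" by (simp add: Js_def)
  ultimately show ?thesis
    using t T1 True
    by (subst act_Op[where m = "memB t v"])
       (auto simp: fB_def[of t] memstep_B[OF t True M0] leaves_def Let_def fB_def[of "Suc t"] Js_def)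
next
  case False
  have idle: "ph (conf n E Hc M0 b0 Hc Mk b1 (fB t) kf' pr' v) = Idle" using False by (simp add: fB_def)
  have "v \<notin> Js" using False Fs_props(6) by (auto simp: Js_def)
  moreover note ty = inboxB_types[OF t(1) less_imp_le[OF t(2)]]
  ultimately show ?thesis
    unfolding act_Idle[OF idle ty(4) ty(5)] conf_sel using ty(3) False by (auto simp: fB_def)
qed

lemma act_12:
  "act (conf n E Hc M b11 Hc Mj b11 (fA 12) kf pr v) (N v \<inter> (Mj - Hc)) (freshS E Hc Hc Mj v)
     {u. b11 u = Some v} (stinbox E Hc M Hc Mj v) (opinbox n E Hc M b11 Hc Mj b11 (fA 12) kf pr v) =
   \<lparr>a_H = (v \<in> Hc), a_M = (v \<in> Mk), a_req = req v, a_ph = fB 13 v, a_kick = kf v, a_prs = pr v\<rparr>"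
proof (cases "v \<in> Bl 3")
  case True
  let ?s = "conf n E Hc M b11 Hc Mj b11 (fA 12) kf pr v"
  have lv: "leaves ?s (N v \<inter> (Mj - Hc)) (memA 12 v) \<longleftrightarrow> v \<in> Xs"
    using True kd_pos by (auto simp: leaves_def Xs_def)
  have d: "dp v \<le> 3" using dp_le[OF True] .
  have m: "memstep ?s (N v \<inter> (Mj - Hc)) (freshS E Hc Hc Mj v) (stinbox E Hc M Hc Mj v)
     (opinbox n E Hc M b11 Hc Mj b11 (fA 12) kf pr v) (memA 12 v) = memB 13 v"
    unfolding memstep_def Let_def lv memA_sel conf_sel
    using d ac_big[of 12 v] by (simp add: inbox_quiet memB_def tt_def)
  have p: "v \<in> Xs \<Longrightarrow> pa v = c" by (rule Xs_dp(3))
  show ?thesis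
    using True T1 p
    by (subst act_Op[where m = "memA 12 v"]) (auto simp: fA_def m lv Let_def fB_def Mk_def req_eq)
next
  case False
  have idle: "ph (conf n E Hc M b11 Hc Mj b11 (fA 12) kf pr v) = Idle" using False by (simp add: fA_def)
  have "v \<notin> Xs" using False by (auto simp: Xs_def)
  then show ?thesis
    unfolding act_Idle[OF idle inbox_no_token(1)[of 12, simplified] inbox_no_token(2)[of 12, simplified]] conf_sel
    using False by (simp add: inbox_quiet fB_def Mk_def req_eq)
qed

definition fE :: "nat \<Rightarrow> 's phase" where
  "fE v = (if v = c \<and> kd \<in> {1, 2} \<or> kf v then Serve else Idle)"

lemma act_end:
  "act (conf n E Hc Mk b14 Hc Mf b14 (fB (16 + T n)) kf pr v) nP' nS' ch' si
     (opinbox n E Hc Mk b14 Hc Mf b14 (fB (16 + T n)) kf pr v) =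
   \<lparr>a_H = (v \<in> Hc), a_M = (v \<in> Mf), a_req = None, a_ph = fE v, a_kick = False, a_prs = pr v\<rparr>"
proof (cases "v \<in> Bl 3")
  case True
  then show ?thesis using T1 w_props(2)
    by (subst act_Op[where m = "memB (16 + T n) v"]) (auto simp: fB_def leaves_def Let_def fE_def)
next
  case False
  have idle: "ph (conf n E Hc Mk b14 Hc Mf b14 (fB (16 + T n)) kf pr v) = Idle" using False by (simp add: fB_def)
  have "\<not> kf v" "v \<noteq> c" using False w_props(4) by auto
  then show ?thesis
    by (subst act_Idle[OF idle]) (auto simp: inboxT fE_def)
qed

end

section \<open>The invariant between operations and the message count of an operation\<close>

definition registered :: "(nat \<Rightarrow> nat option) \<Rightarrow> nat" where
  "registered b = card {u. b u \<noteq> None}"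

text \<open>Registrations are of two kinds. A waiting vertex is light, has no light neighbour in the
  set and nobody registered with it; its boss is not a light member. A relay has others registered
  with it and is itself registered with a light member. Vertices of \<open>St\<close> have received
  the token and not yet given it back; they may be uncovered and unregistered, and only they may
  have a list while being light members, or outside the set without being relays.\<close>

definition inv_at :: "nat set set \<Rightarrow> nat set \<Rightarrow> nat set \<Rightarrow> nat set \<Rightarrow> (nat \<Rightarrow> nat option) \<Rightarrow> bool" where
  "inv_at E St H M b \<longleftrightarrow>
    (\<forall>u\<in>M. \<forall>v\<in>M. {u, v} \<notin> E) \<and>
    (\<forall>v. v \<in> H \<and> v \<notin> M \<longrightarrow> neighbours E v \<inter> M \<noteq> {}) \<and>
    (\<forall>v. v \<notin> H \<and> v \<notin> M \<and> v \<notin> St \<and> neighbours E v \<inter> (M - H) = {} \<longrightarrow> b v \<noteq> None) \<and>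
    (\<forall>v z. b v = Some z \<longrightarrow> {v, z} \<in> E \<and> v \<notin> M) \<and>
    (\<forall>v z. b v = Some z \<and> z \<in> M - H \<longrightarrow> {u. b u = Some v} \<noteq> {}) \<and>
    (\<forall>v z. b v = Some z \<and> z \<notin> M - H \<longrightarrow> v \<notin> H \<and> neighbours E v \<inter> (M - H) = {} \<and> {u. b u = Some v} = {}) \<and>
    (\<forall>v. v \<notin> M \<and> {u. b u = Some v} \<noteq> {} \<and> v \<notin> St \<longrightarrow> (\<exists>z. z \<in> M - H \<and> b v = Some z)) \<and>
    (\<forall>v. v \<in> M - H \<and> {u. b u = Some v} \<noteq> {} \<longrightarrow> v \<in> St)"

text \<open>With \<open>k = card D\<close> and \<open>m\<close> the least value of \<open>f\<close>
  on \<open>D\<close>: \<open>k * m \<le> s\<close> and \<open>s ^ 2 < m ^ 3\<close>, so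
  \<open>k ^ 3 * s ^ 2 \<le> (k * m) ^ 3 \<le> s ^ 3\<close>. Cubes and squares keep the test of the
  vertices within the natural numbers.\<close>

lemma cube_count:
  fixes f :: "nat \<Rightarrow> nat"
  assumes "finite D" "sum f D \<le> s" "\<And>v. v \<in> D \<Longrightarrow> s ^ 2 < f v ^ 3"
  shows "card D ^ 3 \<le> s"
proof (cases "D = {}")
  case False
  define m where "m = Min (f ` D)"
  have "m \<in> f ` D" unfolding m_def using assms(1) False by (intro Min_in) auto
  then have m3: "s ^ 2 < m ^ 3" using assms(3) by auto
  have "\<And>v. v \<in> D \<Longrightarrow> m \<le> f v" unfolding m_def using assms(1) by simp
  then have "card D * m \<le> sum f D" using sum_bounded_below[of D m f] by simp
  then have le: "card D * m \<le> s" using assms(2) by simp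
  have "card D \<noteq> 0" using False assms(1) by simp
  moreover have "m \<noteq> 0" using m3 by (cases m) auto
  ultimately have s0: "s > 0" using le by (metis gr0I le_zero_eq mult_is_0)
  have "card D ^ 3 * s ^ 2 \<le> card D ^ 3 * m ^ 3" using m3 by simp
  also have "\<dots> = (card D * m) ^ 3" by (simp add: power_mult_distrib)
  also have "\<dots> \<le> s ^ 3" using le by (rule power_mono) simp
  also have "\<dots> = s * s ^ 2" by (simp add: power3_eq_cube power2_eq_square)
  finally show ?thesis using s0 by simp
qed simp

context op_run
begin

definition "UU = Bl 3 - Cv"

lemma finite_UU: "finite UU" by (simp add: UU_def finite_Bl)

lemma Rs_UU: "Rs \<subseteq> UU"
  using Rs_Bl Xs_props(4) Fs_props(4) c_Cv by (auto simp: UU_def Rs_def Hc_def)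

text \<open>This is the purpose of radius 3: \<open>Rs\<close> has depth at most 2, so every heavy
  neighbour that is told of a change there belongs to the ball, and all such messages are counted by
  pairs from \<open>UU\<close>.\<close>

lemma Rs_adj_UU: "u \<in> Rs \<Longrightarrow> v \<in> Hc \<Longrightarrow> {u, v} \<in> E \<Longrightarrow> v \<in> UU"
  using Bl_adj[of u v] Rs_Bl Rs_dp[of u] by (auto simp: UU_def Hc_def)

text \<open>The summand 2 is for the centre and the loser, which are never converted in their own
  operation.\<close>

lemma card_UU: "\<exists>k. card UU \<le> k + 2 \<and> k ^ 3 \<le> 2 * card E"
proof -
  let ?D = "{v \<in> Bl 3. v \<noteq> c \<and> \<not> kf v \<and> s ^ 2 < degree E v ^ 3}"
  have "UU \<subseteq> ?D \<union> {c, w}" by (auto simp: UU_def Cv_def)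
  then have "card UU \<le> card (?D \<union> {c, w})" by (intro card_mono) (auto simp: finite_Bl)
  also have "\<dots> \<le> card ?D + card {c, w}" by (rule card_Un_le)
  also have "card {c, w} \<le> 2" by (simp add: card_insert_if)
  finally have "card UU \<le> card ?D + 2" by simp
  moreover have "card ?D ^ 3 \<le> s"
  proof (rule cube_count[where f = "degree E"])
    show "finite ?D" by (simp add: finite_Bl)
    show "sum (degree E) ?D \<le> s" unfolding s_eq by (rule sum_mono2) (auto simp: finite_Bl)
  qed auto
  ultimately show ?thesis using s_le le_trans by blast
qed

lemma Cv_degree: "v \<in> Cv \<Longrightarrow> degree E v ^ 3 \<le> (2 * card E) ^ 2"
  using power_mono[OF s_le, of 2] by (auto simp: Cv_def intro: le_trans)

lemma card_Cv_pairs: "card {(u, v). u \<in> Cv \<and> {u, v} \<in> E} = (\<Sum>v\<in>Cv. degree E v)"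
proof -
  have "{(u, v). u \<in> Cv \<and> {u, v} \<in> E} = (SIGMA u:Cv. N u)" by (auto simp: in_neighbours')
  then show ?thesis using finite_Cv finite_N by simp
qed

text \<open>A pair with a converted endpoint is charged to the degree of that endpoint, which the
  conversion pays for.\<close>

lemma card_BB: "card BB \<le> card UU ^ 2 + 2 * (\<Sum>v\<in>Cv. degree E v)"
proof -
  let ?P = "{(u, v). u \<in> Cv \<and> {u, v} \<in> E}"
  have fin: "finite ?P" by (rule finite_subset[OF _ finite_edge_pairs[OF finE]]) auto
  have "BB \<subseteq> UU \<times> UU \<union> ?P \<union> prod.swap ` ?P"
  proof
    fix x assume "x \<in> BB"
    then obtain u v where x: "x = (u, v)" "{u, v} \<in> E" "u \<in> Bl 3" "v \<in> Bl 3" by (auto simp: BB_def)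
    have "v \<in> Cv \<Longrightarrow> (u, v) \<in> prod.swap ` ?P"
      using x(2) by (intro image_eqI[of _ _ "(v, u)"]) (auto simp: insert_commute)
    then show "x \<in> UU \<times> UU \<union> ?P \<union> prod.swap ` ?P" using x by (auto simp: UU_def)
  qed
  then have "card BB \<le> card (UU \<times> UU \<union> ?P \<union> prod.swap ` ?P)" using fin finite_UU by (intro card_mono) auto
  also have "\<dots> \<le> card (UU \<times> UU) + card ?P + card (prod.swap ` ?P)"
    using card_Un_le[of "UU \<times> UU \<union> ?P" "prod.swap ` ?P"] card_Un_le[of "UU \<times> UU" ?P] by linarith
  also have "\<dots> \<le> card (UU \<times> UU) + card ?P + card ?P" using card_image_le[OF fin, of prod.swap] by simp
  finally show ?thesis by (simp add: card_Cv_pairs card_cartesian_product power2_eq_square)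
qed

lemma card_UU2: "S \<subseteq> UU \<times> UU \<Longrightarrow> card S \<le> card UU ^ 2"
  using card_mono[of "UU \<times> UU" S] finite_UU by (simp add: card_cartesian_product power2_eq_square)

lemma st9: "card (stcount E H M Hc M) \<le> (\<Sum>v\<in>Cv. degree E v)"
proof -
  have "stcount E H M Hc M \<subseteq> {(u, v). u \<in> Cv \<and> {u, v} \<in> E}"
  proof
    fix x assume "x \<in> stcount E H M Hc M"
    then obtain u v where x: "x = (u, v)" "{u, v} \<in> E" "(u \<in> Hc) \<noteq> (u \<in> H)"
      by (cases x) (simp add: stcount_def stinbox_def split: if_splits)
    have "u \<in> Cv" using x(3) unfolding Hc_def by blast
    then show "x \<in> {(u, v). u \<in> Cv \<and> {u, v} \<in> E}" using x(1,2) by simp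
  qed
  moreover have "finite {(u, v). u \<in> Cv \<and> {u, v} \<in> E}"
    by (rule finite_subset[OF _ finite_edge_pairs[OF finE]]) auto
  ultimately have "card (stcount E H M Hc M) \<le> card {(u, v). u \<in> Cv \<and> {u, v} \<in> E}" by (rule card_mono[rotated])
  then show ?thesis by (simp only: card_Cv_pairs)
qed

text \<open>The price of the only status change whose messages go beyond the pairs from
  \<open>UU\<close> and the edges at converted vertices: a light centre tells its join to all
  neighbours.\<close>

definition "jcost = (if kd = 1 \<and> jn then degree E c else 0)"

lemma st12: "card (stcount E Hc M Hc Mj) \<le> jcost + card UU ^ 2"
proof (cases "kd = 1 \<and> jn")
  case True
  have "stcount E Hc M Hc Mj \<subseteq> (\<lambda>v. (c, v)) ` N c"
    by (auto simp: stcount_def stinbox_def Mj_def in_neighbours' split: if_splits)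
  then have "card (stcount E Hc M Hc Mj) \<le> card (N c)"
    using finite_N[of c] by (meson card_image_le card_mono finite_imageI le_trans)
  moreover have "jcost = degree E c" unfolding jcost_def using True by (rule if_P)
  ultimately show ?thesis by linarith
next
  case False
  have "stcount E Hc M Hc Mj \<subseteq> UU \<times> UU"
  proof
    fix x assume "x \<in> stcount E Hc M Hc Mj"
    then obtain u v where x: "x = (u, v)" "{u, v} \<in> E" "(u \<in> M) \<noteq> (u \<in> Mj)" "u \<in> Hc \<longrightarrow> v \<in> Hc"
      by (cases x) (simp add: stcount_def stinbox_def split: if_splits)
    then have u: "u = c" "jn" unfolding Mj_def by (auto split: if_splits)
    then have "kd = 2" using False by (auto simp: jn_def)
    then have "c \<in> Hc" unfolding Hc_def using K2 c_Cv by blast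
    then show "x \<in> UU \<times> UU" using x u Rs_adj_UU[of c v] Rs_UU by (auto simp: Rs_def)
  qed
  then show ?thesis using card_UU2 by (simp add: trans_le_add2)
qed

lemma st13: "card (stcount E Hc Mj Hc Mk) \<le> card UU ^ 2"
proof (rule card_UU2, rule subsetI)
  fix x assume "x \<in> stcount E Hc Mj Hc Mk"
  then obtain u v where x: "x = (u, v)" "{u, v} \<in> E" "(u \<in> Mj) \<noteq> (u \<in> Mk)" "u \<in> Hc \<longrightarrow> v \<in> Hc"
    by (cases x) (simp add: stcount_def stinbox_def split: if_splits)
  then have u: "u \<in> Xs" by (auto simp: Mk_def)
  then have "v \<in> Hc" using x(4) Xs_props(4) by blast
  then show "x \<in> UU \<times> UU" using x u Rs_adj_UU[of u v] Rs_UU by (auto simp: Rs_def)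
qed

lemma stT: "card (stcount E Hc Mk Hc Mf) \<le> card UU ^ 2"
proof (rule card_UU2, rule subsetI)
  fix x assume "x \<in> stcount E Hc Mk Hc Mf"
  then obtain u v where x: "x = (u, v)" "{u, v} \<in> E" "(u \<in> Mk) \<noteq> (u \<in> Mf)" "u \<in> Hc \<longrightarrow> v \<in> Hc"
    by (cases x) (simp add: stcount_def stinbox_def split: if_splits)
  then have u: "u \<in> Fs" by (auto simp: Mf_def Js_def)
  then have "v \<in> Hc" using x(4) Fs_props(4) by blast
  then show "x \<in> UU \<times> UU" using x u Rs_adj_UU[of u v] Rs_UU by (auto simp: Rs_def)
qed

lemma opB:
  assumes "13 \<le> t" "t \<le> 16 + T n"
  shows "card (opcount n E Hc M0 b0 H1 M1 b1 (fB t) kf' pr') \<le> card UU ^ 2"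
    and "okop n \<beta> (opinbox n E Hc M0 b0 H1 M1 b1 (fB t) kf' pr' v u)"
proof -
  let ?o = "\<lambda>v u. opinbox n E Hc M0 b0 H1 M1 b1 (fB t) kf' pr' v u"
  have *: "(?o v u \<noteq> None \<longrightarrow> u \<in> UU \<and> v \<in> UU) \<and> okop n \<beta> (?o v u)" for u v
  proof (rule clock_cases[OF assms])
    assume "t = 13" then show ?thesis by (simp add: inbox13 okop_def)
  next
    assume t: "t = 14"
    have "c \<in> UU" using Rs_UU by (auto simp: Rs_def)
    then show ?thesis unfolding t inbox14 okop_def using Rs_adj_UU[of u v] Rs_UU by auto
  next
    assume t: "t = 15"
    have "cn u \<le> n ^ 2"
    proof -
      have "cn u \<le> card Rs" unfolding cn_def by (intro card_mono finite_Rs) (auto simp: Rs_def)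
      also have "\<dots> \<le> n" by (rule cardRs)
      also have "\<dots> \<le> n ^ 2" by (simp add: power2_eq_square)
      finally show ?thesis .
    qed
    moreover have "c \<in> UU" "u \<in> Xs \<Longrightarrow> u \<in> UU" using Rs_UU by (auto simp: Rs_def)
    ultimately show ?thesis unfolding t inbox15 okop_def by auto
  next
    fix r assume r: "t = 16 + r" "r < T n"
    have "{u, v} \<in> E \<and> u \<in> Rs \<and> v \<in> Rs \<Longrightarrow> {u, v} \<in> E'" by (simp add: E'_iff)
    then show ?thesis unfolding r(1) inbox16[OF r(2)] using static_facts(1)[OF r(2), of u v] Rs_UU
      by (cases "s_send A (SS r u) v") (auto simp: okop_def)
  next
    assume t: "t = 16 + T n" then show ?thesis by (simp add: inboxT okop_def)
  qed
  then show "okop n \<beta> (?o v u)" by blast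
  show "card (opcount n E Hc M0 b0 H1 M1 b1 (fB t) kf' pr') \<le> card UU ^ 2"
    by (rule card_UU2) (use * in \<open>auto simp: opcount_def\<close>)
qed

lemma step_gen:
  assumes H0: "Hc \<subseteq> H0" and ng: "\<And>u v. f u \<noteq> Greet v"
    and bs: "\<And>v z. b0 v = Some z \<Longrightarrow> {v, z} \<in> E" "\<And>v z. b1 v = Some z \<Longrightarrow> {v, z} \<in> E"
    and nd: "\<And>u. b0 u \<noteq> b1 u \<Longrightarrow> b0 u = None \<or> b1 u = None"
    and tok: "\<And>v u. opinbox n E H0 M0 b0 Hc M1 b1 f kf pr v u \<noteq> Some Tok"
      "\<And>v u. opinbox n E H0 M0 b0 Hc M1 b1 f kf pr v u \<noteq> Some Ret"
    and act: "\<And>v. act (conf n E H0 M0 b0 Hc M1 b1 f kf pr v) (N v \<inter> (M1 - Hc)) (freshS E H0 Hc M1 v)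
        {u. b1 u = Some v} (stinbox E H0 M0 Hc M1 v) (opinbox n E H0 M0 b0 Hc M1 b1 f kf pr v)
      = \<lparr>a_H = (v \<in> Hc), a_M = (v \<in> M2), a_req = rq v, a_ph = f' v, a_kick = kf' v, a_prs = pr v\<rparr>"
    and b2: "\<And>v. b2 v = bnext E H0 Hc M1 b1 Hc M2 rq (\<lambda>_. False) v"
    and ok: "\<And>u v. okop n \<beta> (opinbox n E H0 M0 b0 Hc M1 b1 f kf pr v u)"
    and cost: "card (stcount E H0 M0 Hc M1) + card {u. b0 u \<noteq> b1 u} + card (opcount n E H0 M0 b0 Hc M1 b1 f kf pr) \<le> k"
  shows "t_run alg (okmsg n \<beta>) E (conf n E H0 M0 b0 Hc M1 b1 f kf pr) 1 k (conf n E Hc M1 b1 Hc M2 b2 f' kf' pr)"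
proof (rule run_conf[OF finE ng bs nd _ ok cost])
  have "(\<lambda>v. tokened (opinbox n E H0 M0 b0 Hc M1 b1 f kf pr v) (N v \<inter> (M1 - Hc))) = (\<lambda>_. False)"
    using tok by (simp add: tokened_def)
  then show "t_round alg E (conf n E H0 M0 b0 Hc M1 b1 f kf pr) = conf n E Hc M1 b1 Hc M2 b2 f' kf' pr"
    using H0 b2 by (intro round_conf[OF ng bs _ _ act]) auto
qed

lemma okop_None [simp]: "okop n \<beta> None" by (simp add: okop_def)

lemma Mj_mem: "v \<in> Mj \<longleftrightarrow> v \<in> M \<or> v = c \<and> (kd = 1 \<and> N c \<inter> (M - Hc) = {} \<or> kd = 2)"
  unfolding Mj_def jn_def by (simp only: split: if_split) blast

lemma opcount_quiet: "9 \<le> t \<Longrightarrow> t < 14 \<Longrightarrow> opcount n E H0 M0 b0 H1 M1 b1 (fA t) kf' pr' = {}"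
  by (simp add: opcount_def inbox_quiet)

lemma HcH: "Hc \<subseteq> H" by (auto simp: Hc_def)

lemma run9: "t_run alg (okmsg n \<beta>) E (conf n E H M b Hc M b (fA 9) kf pr) 1 (\<Sum>v\<in>Cv. degree E v)
    (conf n E Hc M b Hc M b10 (fA 10) kf pr)"
  by (rule step_gen[OF HcH fA_no_Greet regE(1) regE(1), where rq = "\<lambda>_. None"])
     (auto simp: act_A b10_def okop_A opcount_quiet inbox_quiet intro: order_trans[OF _ st9])

lemma run10: "t_run alg (okmsg n \<beta>) E (conf n E Hc M b Hc M b10 (fA 10) kf pr) 1 (card {u. b u \<noteq> b10 u})
    (conf n E Hc M b10 Hc M b11 (fA 11) kf pr)"
  by (rule step_gen[OF order_refl fA_no_Greet regE(1) regE(2) reg_nd(1), where rq = "\<lambda>_. None"])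
     (auto simp: act_A b11_def okop_A opcount_quiet inbox_quiet)

lemma run11: "t_run alg (okmsg n \<beta>) E (conf n E Hc M b10 Hc M b11 (fA 11) kf pr) 1 (card {u. b10 u \<noteq> b11 u})
    (conf n E Hc M b11 Hc Mj b11 (fA 12) kf pr)"
proof (rule step_gen[OF order_refl fA_no_Greet regE(2) regE(3) reg_nd(2), where rq = "\<lambda>_. None"])
  fix v
  show "act (conf n E Hc M b10 Hc M b11 (fA 11) kf pr v) (N v \<inter> (M - Hc)) (freshS E Hc Hc M v)
        {u. b11 u = Some v} (stinbox E Hc M Hc M v) (opinbox n E Hc M b10 Hc M b11 (fA 11) kf pr v)
      = \<lparr>a_H = (v \<in> Hc), a_M = (v \<in> Mj), a_req = None, a_ph = fA 12 v, a_kick = kf v, a_prs = pr v\<rparr>"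
    by (cases "v = c") (simp_all add: act_A Mj_mem)
qed (simp_all add: b12 opcount_quiet inbox_quiet)

lemma run12: "t_run alg (okmsg n \<beta>) E (conf n E Hc M b11 Hc Mj b11 (fA 12) kf pr) 1 (jcost + card UU ^ 2)
    (conf n E Hc Mj b11 Hc Mk b13 (fB 13) kf pr)"
  by (rule step_gen[OF order_refl fA_no_Greet regE(3) regE(3), where rq = req])
     (auto simp: act_12 b13_def okop_A opcount_quiet inbox_quiet intro: order_trans[OF _ st12])

lemma run13: "t_run alg (okmsg n \<beta>) E (conf n E Hc Mj b11 Hc Mk b13 (fB 13) kf pr) 1 (card UU ^ 2 + card {u. b11 u \<noteq> b13 u})
    (conf n E Hc Mk b13 Hc Mk b14 (fB 14) kf pr)"
proof (rule step_gen[OF order_refl fB_no_Greet regE(3) regE(4) reg_nd(3), where rq = "\<lambda>_. None"])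
  have "opcount n E Hc Mj b11 Hc Mk b13 (fB 13) kf pr = {}" by (simp add: opcount_def inbox13)
  then show "card (stcount E Hc Mj Hc Mk) + card {u. b11 u \<noteq> b13 u} + card (opcount n E Hc Mj b11 Hc Mk b13 (fB 13) kf pr)
      \<le> card UU ^ 2 + card {u. b11 u \<noteq> b13 u}" using st13 by simp
qed (use T1 in \<open>auto simp: act_B b14_def inbox13 okop_def\<close>)

lemma run14: "t_run alg (okmsg n \<beta>) E (conf n E Hc Mk b13 Hc Mk b14 (fB 14) kf pr) 1 (card UU ^ 2 + card {u. b13 u \<noteq> b14 u})
    (conf n E Hc Mk b14 Hc Mk b14 (fB 15) kf pr)"
proof (rule step_gen[OF order_refl fB_no_Greet regE(4) regE(5) reg_nd(4), where rq = "\<lambda>_. None"])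
  show "card (stcount E Hc Mk Hc Mk) + card {u. b13 u \<noteq> b14 u} + card (opcount n E Hc Mk b13 Hc Mk b14 (fB 14) kf pr)
      \<le> card UU ^ 2 + card {u. b13 u \<noteq> b14 u}"
    using opB(1)[of 14 Mk b13 Hc Mk b14 kf pr] by simp
qed (use T1 opB(2)[of 14] inboxB_types(4,5)[of 14] b15[OF order_refl] in \<open>auto simp: act_B\<close>)

lemma run15:
  assumes "15 \<le> t" "t < 15 + T n"
  shows "t_run alg (okmsg n \<beta>) E (conf n E Hc Mk b14 Hc Mk b14 (fB t) kf pr) 1 (card UU ^ 2)
    (conf n E Hc Mk b14 Hc Mk b14 (fB (Suc t)) kf pr)"
proof (rule step_gen[OF order_refl fB_no_Greet regE(5) regE(5), where rq = "\<lambda>_. None"])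
  show "card (stcount E Hc Mk Hc Mk) + card {u. b14 u \<noteq> b14 u} + card (opcount n E Hc Mk b14 Hc Mk b14 (fB t) kf pr)
      \<le> card UU ^ 2"
    using opB(1)[of t Mk b14 Hc Mk b14 kf pr] assms by simp
qed (use assms opB(2)[of t] inboxB_types(4,5)[of t] b15[OF order_refl] in \<open>auto simp: act_B\<close>)

lemma Mf_Mk: "Mk \<subseteq> Mf" "Mf - Mk \<subseteq> Fs" by (auto simp: Mf_def Js_def)

lemma run15T: "t_run alg (okmsg n \<beta>) E (conf n E Hc Mk b14 Hc Mk b14 (fB (15 + T n)) kf pr) 1 (card UU ^ 2)
    (conf n E Hc Mk b14 Hc Mf b14 (fB (16 + T n)) kf pr)"
proof (rule step_gen[OF order_refl fB_no_Greet regE(5) regE(5), where rq = "\<lambda>_. None"])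
  show "card (stcount E Hc Mk Hc Mk) + card {u. b14 u \<noteq> b14 u} + card (opcount n E Hc Mk b14 Hc Mk b14 (fB (15 + T n)) kf pr)
      \<le> card UU ^ 2"
    using opB(1)[of "15 + T n" Mk b14 Hc Mk b14 kf pr] by simp
qed (use opB(2)[of "15 + T n"] inboxB_types(4,5)[of "15 + T n"] b15[OF Mf_Mk] in \<open>auto simp: act_B Mf_def\<close>)

lemma run16T: "t_run alg (okmsg n \<beta>) E (conf n E Hc Mk b14 Hc Mf b14 (fB (16 + T n)) kf pr) 1 (card UU ^ 2)
    (conf n E Hc Mf b14 Hc Mf b14 fE (\<lambda>_. False) pr)"
proof (rule step_gen[OF order_refl fB_no_Greet regE(5) regE(5), where rq = "\<lambda>_. None"])
  have "opcount n E Hc Mk b14 Hc Mf b14 (fB (16 + T n)) kf pr = {}" by (simp add: opcount_def inboxT)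
  then show "card (stcount E Hc Mk Hc Mf) + card {u. b14 u \<noteq> b14 u} + card (opcount n E Hc Mk b14 Hc Mf b14 (fB (16 + T n)) kf pr)
      \<le> card UU ^ 2" using stT by simp
qed (use b16[OF Mf_Mk] in \<open>auto simp: act_end inboxT okop_def\<close>)

lemma run15s: "k \<le> T n \<Longrightarrow> t_run alg (okmsg n \<beta>) E (conf n E Hc Mk b14 Hc Mk b14 (fB 15) kf pr) k (k * card UU ^ 2)
    (conf n E Hc Mk b14 Hc Mk b14 (fB (15 + k)) kf pr)"
proof (induction k)
  case 0 then show ?case by (simp add: t_run_refl)
next
  case (Suc k)
  then have "t_run alg (okmsg n \<beta>) E (conf n E Hc Mk b14 Hc Mk b14 (fB 15) kf pr) k (k * card UU ^ 2)
    (conf n E Hc Mk b14 Hc Mk b14 (fB (15 + k)) kf pr)" by simp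
  from t_run_trans[OF this run15[of "15 + k"]] Suc.prems show ?case by (simp add: add.commute)
qed

definition "opcost = 9 * card BB + (\<Sum>v\<in>Cv. degree E v) + jcost + (T n + 5) * card UU ^ 2 + regs"

lemma op_runs: "t_run alg (okmsg n \<beta>) E (conf n E H M b H M b (fA 0) kf pr) (17 + T n) opcost
    (conf n E Hc Mf b14 Hc Mf b14 fE (\<lambda>_. False) pr)"
proof -
  have 0: "t_run alg (okmsg n \<beta>) E (conf n E H M b H M b (fA 0) kf pr) 9 (9 * card BB)
     (conf n E H M b Hc M b (fA 9) kf pr)"
    using run_A[of 9 \<beta>] by (simp add: Hc_def)
  note r = t_run_trans[OF t_run_trans[OF t_run_trans[OF t_run_trans[OF t_run_trans[OF t_run_trans[OF t_run_trans[OF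
     t_run_trans[OF t_run_trans[OF 0 run9] run10] run11] run12] run13] run14] run15s[OF order_refl]] run15T] run16T]
  have "9 + 1 + 1 + 1 + 1 + 1 + 1 + T n + 1 + 1 = 17 + T n" by simp
  moreover have "9 * card BB + (\<Sum>v\<in>Cv. degree E v) + card {u. b u \<noteq> b10 u} + card {u. b10 u \<noteq> b11 u} + (jcost + card UU ^ 2)
     + (card UU ^ 2 + card {u. b11 u \<noteq> b13 u}) + (card UU ^ 2 + card {u. b13 u \<noteq> b14 u}) + T n * card UU ^ 2
     + card UU ^ 2 + card UU ^ 2 = opcost"
    unfolding opcost_def regs_def by (simp add: algebra_simps)
  ultimately show ?thesis using r by simp
qed

text \<open>The factor 21 is 18 for nine rounds of exploration with two orientations, 1 for
  announcing the conversion and 2 for a new registration. In \<open>T n + 16\<close> there are 9 for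
  the exploration, \<open>T n + 5\<close> for the later rounds and 2 for registrations of
  leavers.\<close>

lemma opcost_le: "opcost + registered b14 \<le> registered b + jcost + 21 * (\<Sum>v\<in>Cv. degree E v) + (T n + 16) * card UU ^ 2"
proof -
  have "card Cv \<le> (\<Sum>v\<in>Cv. degree E v)"
  proof -
    have "1 \<le> degree E v" if "v \<in> Cv" for v
    proof -
      have "pa v \<in> N v" using pa_props(1)[of v] that by (auto simp: Cv_def in_neighbours)
      then show ?thesis using finite_N[of v] card_gt_0_iff[of "N v"] by (auto simp: Suc_le_eq)
    qed
    then show ?thesis using sum_mono[of Cv "\<lambda>_. 1" "degree E"] by simp
  qed
  moreover have "card Xs \<le> card UU ^ 2"
  proof -
    have "card Xs \<le> card UU" using Rs_UU by (intro card_mono finite_UU) (auto simp: Rs_def)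
    also have "\<dots> \<le> card UU ^ 2" by (simp add: power2_eq_square)
    finally show ?thesis .
  qed
  ultimately show ?thesis
    using regs_le card_BB unfolding opcost_def registered_def by (simp add: algebra_simps)
qed

end

text \<open>A heavy vertex weighs 2, so that a conversion lowers the sum even if the vertex ends up
  light and outside the set. Leaving out isolated vertices makes the sum finite, and 0 for the empty
  network.\<close>

definition mu :: "nat set set \<Rightarrow> nat set \<Rightarrow> nat set \<Rightarrow> nat" where
  "mu E H M = 2 * card {v \<in> H. neighbours E v \<noteq> {}} + card {v. v \<notin> H \<and> v \<notin> M \<and> neighbours E v \<noteq> {}}"

lemma finite_nonisolated: "finite E \<Longrightarrow> finite {v. neighbours E v \<noteq> {}}"
  by (rule finite_subset[OF _ finite_imageI[OF finite_edge_pairs, of E fst]])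
     (force simp: neighbours_def)+

context op_run
begin

section \<open>The state after an operation\<close>

lemma Mf_light: "Mf - Hc = Mj - Hc"
  using Mk_P Fs_props(4) by (auto simp: Mf_def Js_def)

lemma Mj_light: "v \<notin> Hc \<Longrightarrow> v \<in> Mj \<longleftrightarrow> v \<in> M \<or> v = c \<and> kd = 1 \<and> jn"
proof -
  assume v: "v \<notin> Hc"
  have "kd = 2 \<Longrightarrow> v \<noteq> c" using K2 c_Cv v unfolding Hc_def by blast
  then show ?thesis unfolding Mj_mem jn_def by blast
qed

lemma light_after: "v \<notin> Hc \<Longrightarrow> v \<in> Mf \<longleftrightarrow> v \<in> M \<or> v = c \<and> kd = 1 \<and> jn"
  using Mf_light Mj_light[of v] by blast

lemma w_Xs: "kd = 3 \<Longrightarrow> w \<in> Xs"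
  using w_props K3 unfolding Xs_def Mj_mem by blast

lemma MMk: "v \<in> M \<Longrightarrow> v \<in> Mk \<or> v \<in> Xs" by (auto simp: Mk_def Mj_def)

text \<open>A light centre joins only without light neighbours in the set, and its heavy neighbours
  in the set leave; a heavy centre that joins had no neighbour in the set; in a conflict the loser
  leaves.\<close>

lemma indep_Mk: "u \<in> Mk \<Longrightarrow> v \<in> Mk \<Longrightarrow> {u, v} \<notin> E"
proof
  assume uv: "u \<in> Mk" "v \<in> Mk" and e: "{u, v} \<in> E"
  have cc: "v' \<in> M \<Longrightarrow> v' \<in> Mk \<Longrightarrow> jn \<Longrightarrow> {c, v'} \<in> E \<Longrightarrow> False" for v'
  proof -
    assume v': "v' \<in> M" "v' \<in> Mk" "jn" "{c, v'} \<in> E"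
    have "kd \<noteq> 2" using K2 v' unfolding in_neighbours'[symmetric] by blast
    then have k: "kd = 1" "N c \<inter> (M - Hc) = {}" using v'(3) unfolding jn_def by blast+
    have cH: "c \<notin> H" using K1[OF k(1)] by blast
    have "v' \<in> Hc" using k(2) v' unfolding in_neighbours'[symmetric] by blast
    moreover from this have "v' \<in> Bl 1" using v'(4) by (auto simp: Hc_def Bl_Suc numeral_eq_Suc)
    then have "v' \<in> Bl 3" using Bl_mono[of 1 3] by auto
    moreover have "c \<in> N v' \<inter> (Mj - Hc)" using v' cH HcH by (auto simp: in_neighbours Mj_def)
    moreover have "v' \<noteq> c" using v'(4) loop[of c] by force
    ultimately have "v' \<in> Xs" using v'(1) unfolding Xs_def Mj_mem by blast
    then show False using v'(2) by (simp add: Mk_def)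
  qed
  show False
  proof (cases "u \<in> M \<and> v \<in> M")
    case True
    then have "kd = 3" "{u, v} = {c, w}" using indep e by blast+
    then show False using w_Xs uv unfolding Mk_def by (auto simp: doubleton_eq_iff)
  next
    case False
    then have "jn" "u \<in> M \<and> v = c \<or> v \<in> M \<and> u = c \<or> u = c \<and> v = c"
      using uv unfolding Mk_def Mj_def by (auto split: if_splits)
    then show False using cc[of u] cc[of v] uv e loop[of c] by (auto simp: insert_commute)
  qed
qed

text \<open>Leavers are covered by the centre. A heavy vertex that lost all its covers belongs to
  \<open>Fs\<close>, where the maximality of the static output covers it.\<close>

lemma cover_after:
  assumes v: "v \<in> Hc" "v \<notin> Mf"
  shows "N v \<inter> Mf \<noteq> {}"
proof (cases "v \<in> Xs")
  case True
  then show ?thesis using Xs_props(1,6)[OF True] by (auto simp: Mf_def in_neighbours)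
next
  case False
  then have vM: "v \<notin> M" using MMk v by (auto simp: Mf_def)
  have vH: "v \<in> H" using v HcH by auto
  have vc: "v \<noteq> c"
  proof
    assume vc: "v = c"
    then have "kd \<noteq> 1" "kd \<noteq> 3" using K1 K3 vH vM by blast+
    then have "c \<in> Mj" using kd unfolding Mj_mem by blast
    then show False using False v(2) vc by (auto simp: Mf_def Mk_def)
  qed
  obtain u where u: "u \<in> N v" "u \<in> M" using cov[OF vH vM vc] by auto
  show ?thesis
  proof (cases "N v \<inter> Mk = {}")
    case True
    then have "u \<in> Xs" using MMk u by auto
    then have "v \<in> Bl 2" using Xs_dp(1)[of u] u vH by (auto simp: Bl_Suc numeral_eq_Suc in_neighbours)
    then have "v \<in> Bl 3" using Bl_mono[of 2 3] by auto
    then have "v \<in> Fs" using True v vc by (auto simp: Fs_def Mf_def)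
    moreover have "v \<notin> Js" using v by (auto simp: Mf_def)
    ultimately show ?thesis using static_facts(3) by (auto simp: Mf_def)
  qed (auto simp: Mf_def)
qed

lemma b_keep: "b v = Some z \<Longrightarrow> z \<notin> Mj - Hc \<Longrightarrow> v \<notin> Hc \<Longrightarrow> N v \<inter> (Mj - Hc) = {} \<Longrightarrow> b14 v = Some z"
proof -
  assume a: "b v = Some z" "z \<notin> Mj - Hc" "v \<notin> Hc" "N v \<inter> (Mj - Hc) = {}"
  have P: "N v \<inter> (M - Hc) = {}" "z \<notin> M - Hc" using a(2,4) settle2_prems(1) by blast+
  have "b10 v = Some z" using a P by (simp add: b10_char)
  then have "b11 v = Some z" using b10_keep P by blast
  then have "b13 v = Some z" using a by (simp add: b13_eq)
  then show "b14 v = Some z" using b13_keep a by blast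
qed

text \<open>A vertex that was light before keeps its boss, even one that leaves the set. A converted
  vertex without light cover has a heavy neighbour in the set and registers there.\<close>

lemma dirt_after:
  assumes v: "v \<notin> Hc" "v \<notin> Mf" "v \<notin> St" "N v \<inter> (Mj - Hc) = {}"
  shows "b14 v \<noteq> None"
proof -
  have P: "N v \<inter> (M - Hc) = {}" using v(4) settle2_prems(1) by blast
  have vM: "v \<notin> M" using light_after v by blast
  show ?thesis
  proof (cases "v \<in> H")
    case False
    have "N v \<inter> (M - H) = {}" using P HcH by blast
    then obtain z where z: "b v = Some z" using dirt[OF False vM v(3)] by blast
    have "z \<in> N v" using settle1_prems(1)[OF z] .
    then have "z \<notin> Mj - Hc" using v(4) by blast
    then show ?thesis using b_keep[OF z _ v(1) v(4)] by simp
  next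
    case True
    then have Cv: "v \<in> Cv" using v(1) by (simp add: Hc_def)
    have bN: "b v = None"
    proof (cases "b v")
      case (Some z)
      then have "z \<in> M - H" using bdirt[OF Some] True by blast
      moreover have "z \<in> N v" using settle1_prems(1)[OF Some] .
      ultimately show ?thesis using P HcH by blast
    qed
    have "v \<noteq> c" using Cv c_Cv by blast
    then have ne: "N v \<inter> M \<inter> Hc \<noteq> {}" using cov[OF True vM] P by blast
    have ch: "{u. b u = Some v} = {}" using stack[OF vM _ v(3)] bN by fastforce
    have b10: "b10 v = Some (Min (N v \<inter> M \<inter> Hc))" using bN Cv vM P ne ch by (simp add: b10_char)
    have "Min (N v \<inter> M \<inter> Hc) \<in> N v \<inter> M \<inter> Hc" using ne finite_N by (intro Min_in) auto
    then have z: "Min (N v \<inter> M \<inter> Hc) \<notin> M - Hc" "Min (N v \<inter> M \<inter> Hc) \<notin> Mj - Hc" by blast+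
    have "b11 v = Some (Min (N v \<inter> M \<inter> Hc))" using b10_keep[OF b10 z(1)] .
    then have "b13 v = Some (Min (N v \<inter> M \<inter> Hc))" using v by (simp add: b13_eq)
    then show ?thesis using b13_keep[OF _ z(2)] by simp
  qed
qed

lemma ch13_old: "b13 u = Some v \<Longrightarrow> v \<noteq> c \<Longrightarrow> b11 u = Some v"
  by (cases "b11 u") (auto simp: b13_eq req_eq split: if_splits)

lemma b11_b10: "b11 u = Some v \<Longrightarrow> b10 u = Some v" by (auto simp: b11_eq split: if_splits)

lemma ch10_old: "b10 u = Some v \<Longrightarrow> \<not> (v \<in> M \<and> v \<in> Hc) \<Longrightarrow> b u = Some v"
proof (cases "b u")
  case None
  assume a: "b10 u = Some v" "\<not> (v \<in> M \<and> v \<in> Hc)"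
  have "N u \<inter> M \<inter> Hc \<noteq> {}" "v = Min (N u \<inter> M \<inter> Hc)" using a(1) None by (auto simp: b10_char split: if_splits)
  then have "v \<in> N u \<inter> M \<inter> Hc" using finite_N[of u] Min_in[of "N u \<inter> M \<inter> Hc"] by auto
  then show ?thesis using a by auto
next
  case (Some y)
  assume "b10 u = Some v"
  then show ?thesis using Some by (auto simp: b10_char split: if_splits)
qed

text \<open>A leaver with a list has registered with the light centre, except for the loser, which
  is on the stack; anyone else with a list outside the set was a relay already.\<close>

lemma stack_after:
  assumes v: "v \<notin> Mf" "{u. b14 u = Some v} \<noteq> {}" "v \<notin> St"
  shows "\<exists>z. z \<in> Mf - Hc \<and> b14 v = Some z"
proof -
  have vP: "v \<notin> Mj - Hc" using v(1) Mf_light by blast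
  have ch13: "{u. b13 u = Some v} \<noteq> {}" using v(2) b14_ch[OF vP] by simp
  then obtain u where u: "b13 u = Some v" by blast
  have b14: "b14 v = b13 v" using ch13 by (simp add: b14_eq)
  have vc: "v = c \<Longrightarrow> c \<in> Mk \<Longrightarrow> False" using v(1) by (simp add: Mf_def)
  have u11: "b11 u = Some v"
  proof (cases "v = c")
    case True
    show ?thesis
    proof (cases "b11 u")
      case None
      then have "u \<in> Xs" using u by (auto simp: b13_eq req_eq split: if_splits)
      then show ?thesis using vc True Xs_props(6) by blast
    next
      case (Some y)
      then show ?thesis using u by (auto simp: b13_eq split: if_splits)
    qed
  qed (use ch13_old[OF u] in blast)
  have ch11: "{u. b11 u = Some v} \<noteq> {}" using u11 by blast
  show ?thesis
  proof (cases "v \<in> Xs")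
    case True
    have nk: "\<not> kf v" using K3 v(3) by blast
    have k: "kd = 1" "jn" using Xs_props(7)[OF True] nk by blast+
    have "b11 v = None" using b_M(3) Xs_props(2)[OF True] by blast
    then have "b13 v = Some c" using True nk ch11 by (simp add: b13_eq req_eq)
    moreover have "c \<in> Mf - Hc" using Xs_props(6)[OF True] K1[OF k(1)] HcH unfolding Mf_def by blast
    ultimately show ?thesis using b14 by simp
  next
    case False
    have vM: "v \<notin> M" using MMk v(1) False by (auto simp: Mf_def)
    have u10: "b10 u = Some v" using b11_b10[OF u11] .
    have ub: "b u = Some v" using ch10_old[OF u10] vM by blast
    then obtain z where z: "z \<in> M - H" "b v = Some z" using stack[OF vM _ v(3)] by blast
    have "b10 v = Some z" using z(2) ub by (auto simp: b10_char)
    then have "b11 v = Some z" using u10 by (auto simp: b11_eq)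
    then have "b13 v = Some z" using ch11 by (simp add: b13_eq)
    moreover have "z \<in> Mf - Hc" unfolding Mf_light using z(1) HcH settle2_prems(1) by blast
    ultimately show ?thesis using b14 by simp
  qed
qed

lemma stackP_after:
  assumes v: "v \<in> Mf - Hc" "{u. b14 u = Some v} \<noteq> {}"
  shows "v \<in> St"
proof (cases "v = c \<and> kd = 1")
  case True
  then show ?thesis using K1 by blast
next
  case False
  have vM: "v \<in> M" "v \<notin> Hc" using v(1) light_after[of v] False by blast+
  obtain u where u14: "b14 u = Some v" using v(2) by blast
  then have u13: "b13 u = Some v" by (auto simp: b14_eq split: if_splits)
  have u11: "b11 u = Some v"
  proof (cases "b11 u")
    case None
    then have "u \<in> Xs" "\<not> kf u" "v = c" using u13 by (auto simp: b13_eq req_eq split: if_splits)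
    then show ?thesis using Xs_props(7) False by blast
  next
    case (Some y)
    then show ?thesis using u13 by (auto simp: b13_eq split: if_splits)
  qed
  have u10: "b10 u = Some v" using b11_b10[OF u11] .
  have ub: "b u = Some v" using ch10_old[OF u10] vM by blast
  show ?thesis
  proof (cases "v \<in> H")
    case False
    then show ?thesis using stackP[of v] vM ub by blast
  next
    case True
    then have "{x. b x = Some u} = {}" using bdirt[OF ub] by blast
    moreover have "v \<in> N u \<inter> (M - Hc)" using vM settle1_prems(1)[OF ub] by blast
    ultimately have "b10 u = None" using ub by (auto simp: b10_char)
    then show ?thesis using u10 by simp
  qed
qed

lemma inv_after: "inv_at E St Hc Mf b14"
  unfolding inv_at_def
proof (intro conjI allI ballI impI; (elim conjE)?)
  fix u v assume uv: "u \<in> Mf" "v \<in> Mf"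
  have JM: "f \<in> Js \<Longrightarrow> m \<in> Mk \<Longrightarrow> m \<notin> N f" for f m unfolding Js_def Fs_def by blast
  have "{u, v} \<notin> E" if "u \<in> Js" "v \<in> Mk" using JM[OF that] by (simp add: in_neighbours')
  moreover have "{u, v} \<notin> E" if "v \<in> Js" "u \<in> Mk" using JM[OF that] by (simp add: in_neighbours)
  ultimately show "{u, v} \<notin> E"
    using indep_Mk[of u v] static_facts(2)[of u v] uv unfolding Mf_def by blast
next
  fix v z assume bv: "b14 v = Some z"
  show "{v, z} \<in> E" using regE(5)[OF bv] .
  show "v \<notin> Mf" using bv b14_Mk[of v] b14_Fs[of v] unfolding Mf_def Js_def by auto
next
  fix v z assume "b14 v = Some z" "z \<in> Mf - Hc"
  then show "{u. b14 u = Some v} \<noteq> {}" using b14_rel unfolding Mf_light by blast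
next
  fix v z assume "b14 v = Some z" "z \<notin> Mf - Hc"
  then show "v \<notin> Hc" "N v \<inter> (Mf - Hc) = {}" "{u. b14 u = Some v} = {}" using b14_dirt unfolding Mf_light by blast+
next
  fix v assume "v \<in> Hc" "v \<notin> Mf" then show "N v \<inter> Mf \<noteq> {}" by (rule cover_after)
next
  fix v assume "v \<notin> Hc" "v \<notin> Mf" "v \<notin> St" "N v \<inter> (Mf - Hc) = {}"
  then show "b14 v \<noteq> None" unfolding Mf_light by (rule dirt_after)
next
  fix v assume "v \<notin> Mf" "{u. b14 u = Some v} \<noteq> {}" "v \<notin> St"
  then show "\<exists>z. z \<in> Mf - Hc \<and> b14 v = Some z" by (rule stack_after)
next
  fix v assume "v \<in> Mf - Hc" "{u. b14 u = Some v} \<noteq> {}"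
  then show "v \<in> St" by (rule stackP_after)
qed

lemma Cv_nonisolated: "v \<in> Cv \<Longrightarrow> N v \<noteq> {}"
  using pa_props(1)[of v] by (auto simp: Cv_def in_neighbours)

text \<open>A conversion lowers the weight of a vertex from 2 to at most 1, and the join of a light
  centre removes its weight 1. Only converted vertices can become new light nonmembers.\<close>

lemma mu_after: "mu E Hc Mf + card Cv + (if kd = 1 \<and> jn \<and> N c \<noteq> {} then 1 else 0) \<le> mu E H M"
proof -
  have fin: "finite {v. N v \<noteq> {}}" by (rule finite_nonisolated[OF finE])
  let ?A = "{v \<in> Hc. N v \<noteq> {}}" and ?L' = "{v. v \<notin> Hc \<and> v \<notin> Mf \<and> N v \<noteq> {}}"
    and ?L = "{v. v \<notin> H \<and> v \<notin> M \<and> N v \<noteq> {}}" and ?j = "kd = 1 \<and> jn \<and> N c \<noteq> {}"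
  have f: "finite ?A" "finite ?L" by (rule finite_subset[OF _ fin]; blast)+
  have "{v \<in> H. N v \<noteq> {}} = ?A \<union> Cv" using Cv_H Cv_nonisolated by (auto simp: Hc_def)
  moreover have "card (?A \<union> Cv) = card ?A + card Cv"
    using f finite_Cv by (intro card_Un_disjoint) (auto simp: Hc_def)
  ultimately have 1: "card {v \<in> H. N v \<noteq> {}} = card ?A + card Cv" by simp
  have sub: "?L' \<subseteq> (?L - (if ?j then {c} else {})) \<union> Cv"
  proof
    fix v assume v: "v \<in> ?L'"
    then have vM: "v \<notin> M" "\<not> (v = c \<and> kd = 1 \<and> jn)" using light_after[of v] by auto
    show "v \<in> (?L - (if ?j then {c} else {})) \<union> Cv"
    proof (cases "v \<in> H")
      case True
      then show ?thesis using v by (simp add: Hc_def)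
    next
      case False
      have "v \<notin> (if ?j then {c} else {})" using vM(2) by (simp only: split: if_split) blast
      then show ?thesis using False v vM by simp
    qed
  qed
  have "card ?L' \<le> card (?L - (if ?j then {c} else {})) + card Cv"
    using card_mono[OF _ sub] card_Un_le[of "?L - (if ?j then {c} else {})" Cv] f finite_Cv by (meson finite_Diff finite_UnI le_trans)
  moreover have "card (?L - (if ?j then {c} else {})) + (if ?j then 1 else 0) \<le> card ?L"
  proof (cases ?j)
    case True
    then have "c \<in> ?L" using K1 by blast
    then have "card ?L = Suc (card (?L - {c}))" using f(2) by (rule card.remove[rotated])
    then show ?thesis unfolding if_P[OF True] by linarith
  next
    case False
    show ?thesis unfolding if_not_P[OF False] by simp
  qed
  moreover have "x \<le> y + k \<Longrightarrow> y + j \<le> l \<Longrightarrow> 2 * a' + x + k + j \<le> 2 * (a' + k) + l" for x y k j l a' :: nat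
    unfolding distrib_left mult_2 by presburger
  ultimately show ?thesis unfolding mu_def 1 by blast
qed

text \<open>A light centre gives up only because of a light neighbour in the set that was heavy
  before. Hence an operation of kind 1 makes progress even then.\<close>

lemma abort_converts: "kd = 1 \<Longrightarrow> \<not> jn \<Longrightarrow> Cv \<noteq> {}"
proof
  assume k: "kd = 1" "\<not> jn" and C: "Cv = {}"
  have "Hc = H" unfolding Hc_def C by simp
  then show False using K1[OF k(1)] k unfolding jn_def by blast
qed

lemma holder_after:
  "kd = 1 \<Longrightarrow> b14 c = None \<and> (c \<notin> Mf \<longrightarrow> N c \<inter> (Mf - Hc) \<noteq> {})" "kd = 2 \<Longrightarrow> c \<in> Mf \<and> c \<in> Hc"
  "kd = 3 \<Longrightarrow> b14 w = None \<and> w \<in> Hc"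
proof -
  assume k: "kd = 1"
  have "b c = None" using K1[OF k] by blast
  then have "b10 c = None" using c_Cv by (simp add: b10_char)
  then have "b11 c = None" by (simp add: b11_eq)
  then have "b13 c = None" using Xs_props(8) by (auto simp: b13_eq req_eq)
  moreover have "c \<notin> Mf \<longrightarrow> N c \<inter> (Mf - Hc) \<noteq> {}"
  proof
    assume "c \<notin> Mf"
    moreover have "c \<notin> Hc" using K1[OF k] HcH by blast
    ultimately have "\<not> jn" using light_after[of c] k by blast
    then have "N c \<inter> (M - Hc) \<noteq> {}" using k unfolding jn_def by blast
    then show "N c \<inter> (Mf - Hc) \<noteq> {}" unfolding Mf_light using settle2_prems(1) by blast
  qed
  ultimately show "b14 c = None \<and> (c \<notin> Mf \<longrightarrow> N c \<inter> (Mf - Hc) \<noteq> {})" by (simp add: b14_eq)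
next
  assume k: "kd = 2"
  then have "c \<in> Mj" unfolding Mj_mem by blast
  moreover have "c \<notin> Xs" using Xs_props(8) by blast
  moreover have "c \<in> Hc" unfolding Hc_def using K2[OF k] c_Cv by blast
  ultimately show "c \<in> Mf \<and> c \<in> Hc" unfolding Mf_def Mk_def by blast
next
  assume k: "kd = 3"
  have "b11 w = None" using b_M(3) K3[OF k] by blast
  moreover have "req w = None" unfolding req_eq using k by simp
  ultimately have "b13 w = None" by (simp only: b13_eq if_True simp_thms)
  then show "b14 w = None \<and> w \<in> Hc" using w_props(1)[OF k] by (simp only: b14_eq if_cancel simp_thms)
qed

end

section \<open>Potential\<close>

text \<open>The maximum with 1 lets additive constants be absorbed even when there are no
  edges.\<close>

definition theta :: "nat set set \<Rightarrow> real" where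
  "theta E = max 1 (real (2 * card E) powr (2 / 3))"

definition excess :: "nat set set \<Rightarrow> nat \<Rightarrow> real" where
  "excess E v = max 0 (real (degree E v) - theta E)"

text \<open>The factor 3 pays for making a light member heavy: per neighbour one status message, one
  registration message and one unit of \<open>registered\<close>. The factor 4 adds the message to
  each neighbour by which a light vertex joins.\<close>

definition Xi :: "nat set set \<Rightarrow> nat set \<Rightarrow> nat set \<Rightarrow> real" where
  "Xi E H M = (\<Sum>v | neighbours E v \<noteq> {}. if v \<in> H then 0 else if v \<in> M then 3 * excess E v else 4 * excess E v)"

definition Phi :: "real \<Rightarrow> nat set set \<Rightarrow> nat set \<Rightarrow> nat set \<Rightarrow> (nat \<Rightarrow> nat option) \<Rightarrow> real" where
  "Phi L E H M b = real (registered b) + Xi E H M + L * theta E * real (mu E H M)"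

lemma theta_ge: "theta E \<ge> 1" "theta E \<ge> real (2 * card E) powr (2 / 3)"
  by (simp_all add: theta_def)

lemma cube_theta: "k ^ 3 \<le> 2 * card E \<Longrightarrow> real k ^ 2 \<le> theta E"
proof -
  assume "k ^ 3 \<le> 2 * card E"
  then have k: "real k ^ 3 \<le> real (2 * card E)" by (metis of_nat_le_iff of_nat_power)
  show ?thesis
  proof (cases "k = 0")
    case False
    have "real k ^ 2 = real k powr 2" using False by (subst powr_numeral) auto
    also have "\<dots> = real k powr (3 * (2 / 3))" by simp
    also have "\<dots> = (real k powr 3) powr (2 / 3)" by (rule powr_powr[symmetric])
    also have "real k powr 3 = real k ^ 3" using False by (subst powr_numeral) auto
    finally have "real k ^ 2 = (real k ^ 3) powr (2 / 3)" .
    also have "(real k ^ 3) powr (2 / 3) \<le> real (2 * card E) powr (2 / 3)" using k by (intro powr_mono2) auto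
    finally show ?thesis using theta_ge(2)[of E] by linarith
  qed (use theta_ge(1)[of E] in simp)
qed

lemma degree_theta: "d ^ 3 \<le> (2 * card E) ^ 2 \<Longrightarrow> real d \<le> theta E"
proof -
  assume "d ^ 3 \<le> (2 * card E) ^ 2"
  then have k: "real d ^ 3 \<le> real (2 * card E) ^ 2" by (metis of_nat_le_iff of_nat_power)
  show ?thesis
  proof (cases "d = 0")
    case False
    then have "card E \<noteq> 0" using \<open>d ^ 3 \<le> (2 * card E) ^ 2\<close> by (cases "card E = 0") auto
    have "real d = real d powr (3 * (1 / 3))" using False by simp
    also have "\<dots> = (real d powr 3) powr (1 / 3)" by (rule powr_powr[symmetric])
    also have "real d powr 3 = real d ^ 3" using False by (subst powr_numeral) auto
    also have "(real d ^ 3) powr (1 / 3) \<le> (real (2 * card E) ^ 2) powr (1 / 3)" using k by (intro powr_mono2) auto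
    also have "real (2 * card E) ^ 2 = real (2 * card E) powr 2"
      using \<open>card E \<noteq> 0\<close> by (subst powr_numeral) auto
    also have "(real (2 * card E) powr 2) powr (1 / 3) = real (2 * card E) powr (2 * (1 / 3))" by (rule powr_powr)
    also have "2 * (1 / 3) = (2 / 3 :: real)" by simp
    finally show ?thesis using theta_ge(2)[of E] by linarith
  qed (use theta_ge(1)[of E] in simp)
qed

lemma excess_ge: "excess E v \<ge> 0" "real (degree E v) \<le> theta E + excess E v"
  by (auto simp: excess_def)

section \<open>Amortized cost of one operation\<close>

locale env = mis_scheme A T a for A :: "'s static_alg" and T :: "nat \<Rightarrow> nat" and a :: nat +
  fixes n :: nat and E :: "nat set set" and V :: "nat set" and \<beta> :: real
  assumes finE: "finite E" and loop: "\<And>v. {v, v} \<notin> E"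
    and edges2: "2 * card E \<le> n ^ 2" and T1: "T n \<ge> 1"
    and stat: "static_MIS_algorithm (a + 2) 4 \<beta> T A" and ids: "vertex_ids a n V"
    and EV: "\<And>u v. {u, v} \<in> E \<Longrightarrow> u \<in> V \<and> v \<in> V" and ESG: "\<And>e. e \<in> E \<Longrightarrow> \<exists>u v. e = {u, v}"
    and n2: "n \<ge> 2"
begin

abbreviation "N \<equiv> neighbours E"
definition cfg :: "nat set \<Rightarrow> nat set \<Rightarrow> (nat \<Rightarrow> nat option) \<Rightarrow> (nat \<Rightarrow> 's phase) \<Rightarrow> (nat \<Rightarrow> nat list) \<Rightarrow> nat \<Rightarrow> 's st" where
  "cfg H M b f pr = conf n E H M b H M b f (\<lambda>_. False) pr"
definition idle :: "nat \<Rightarrow> 's phase" where "idle = (\<lambda>_. Idle)"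
text \<open>170 = 22 + 144 + 4: 22 for each unit by which \<open>mu\<close> drops (21 per
  conversion, 1 for a join), 144 = 16 * 9 for the rounds on \<open>UU\<close>, and a reserve of 4
  for the token.\<close>

definition Lam :: real where "Lam = 170 * (real (T n) + 1)"
text \<open>\<open>17 + T n\<close> rounds for an operation and 8 for two round trips of the token
  with four rounds each.\<close>

definition rho :: nat where "rho = 25 + T n"
abbreviation "Ph \<equiv> Phi Lam E"
abbreviation "ok \<equiv> okmsg n \<beta>"

lemma finV: "finite V" using ids by (simp add: vertex_ids_def)

lemma LamT: "166 * (real (T n) + 1) * theta E + 4 \<le> Lam * theta E"
proof -
  have "1 \<le> (real (T n) + 1) * theta E"
    using mult_mono[of 1 "real (T n) + 1" 1 "theta E"] theta_ge(1)[of E] by simp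
  moreover have "Lam * theta E = 166 * (real (T n) + 1) * theta E + 4 * ((real (T n) + 1) * theta E)"
    by (simp add: Lam_def algebra_simps)
  ultimately show ?thesis by linarith
qed

text \<open>Kind 1 can occur many times per update, so it has to pay for itself through the drop of
  \<open>mu\<close>, and even leaves 4 units for the walk. Kinds 2 and 3 occur at most once per
  update and are charged to it.\<close>

lemma operation:
  assumes HV: "H \<subseteq> V" and cV: "c \<in> V"
    and kd: "kd \<in> {1, 2, 3}"
    and K1: "kd = 1 \<Longrightarrow> c \<notin> H \<and> c \<notin> M \<and> N c \<inter> (M - H) = {} \<and> b c = None \<and> c \<in> St"
    and K2: "kd = 2 \<Longrightarrow> c \<in> H \<and> c \<notin> M \<and> N c \<inter> M = {} \<and> {u. b u = Some c} = {}"
    and K3: "kd = 3 \<Longrightarrow> {c, w} \<in> E \<and> c \<in> M \<and> w \<in> M \<and> w \<in> H \<and> w \<in> St"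
    and indep: "\<And>u v. u \<in> M \<Longrightarrow> v \<in> M \<Longrightarrow> {u, v} \<in> E \<Longrightarrow> kd = 3 \<and> {u, v} = {c, w}"
    and cov: "\<And>v. v \<in> H \<Longrightarrow> v \<notin> M \<Longrightarrow> v \<noteq> c \<Longrightarrow> N v \<inter> M \<noteq> {}"
    and dirt: "\<And>v. v \<notin> H \<Longrightarrow> v \<notin> M \<Longrightarrow> v \<notin> St \<Longrightarrow> N v \<inter> (M - H) = {} \<Longrightarrow> b v \<noteq> None"
    and bE: "\<And>v z. b v = Some z \<Longrightarrow> {v, z} \<in> E"
    and bM: "\<And>v z. b v = Some z \<Longrightarrow> v \<notin> M"
    and brel: "\<And>v z. b v = Some z \<Longrightarrow> z \<in> M - H \<Longrightarrow> {u. b u = Some v} \<noteq> {}"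
    and bdirt: "\<And>v z. b v = Some z \<Longrightarrow> z \<notin> M - H \<Longrightarrow> v \<notin> H \<and> N v \<inter> (M - H) = {} \<and> {u. b u = Some v} = {}"
    and stack: "\<And>v. v \<notin> M \<Longrightarrow> {u. b u = Some v} \<noteq> {} \<Longrightarrow> v \<notin> St \<Longrightarrow> \<exists>z. z \<in> M - H \<and> b v = Some z"
    and stackP: "\<And>v. v \<in> M - H \<Longrightarrow> {u. b u = Some v} \<noteq> {} \<Longrightarrow> v \<in> St"
  shows "\<exists>H' M' b' \<kappa>.
    t_run alg ok E (conf n E H M b H M b (idle(c := Op (mem0 kd 0 c (degree E c)))) (\<lambda>v. kd = 3 \<and> v = w) pr)
      (17 + T n) \<kappa> (cfg H' M' b' (idle((if kd = 3 then w else c) := Serve)) pr) \<and>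
    inv_at E St H' M' b' \<and> H' \<subseteq> H \<and> mu E H' M' \<le> mu E H M \<and>
    (kd = 1 \<and> N c \<noteq> {} \<longrightarrow> mu E H' M' < mu E H M) \<and>
    real \<kappa> + Ph H' M' b' \<le> Ph H M b + (if kd = 1 \<and> N c \<noteq> {} then - 4 else Lam * theta E) \<and>
    (kd = 1 \<longrightarrow> b' c = None \<and> (c \<notin> M' \<longrightarrow> N c \<inter> (M' - H') \<noteq> {})) \<and>
    (kd = 2 \<longrightarrow> c \<in> M' \<and> c \<in> H') \<and> (kd = 3 \<longrightarrow> b' w = None \<and> w \<in> H')"
proof -
  have finH: "finite H" using HV finV finite_subset by blast
  interpret O: op_run A T a n E H M St b c kd w pr V \<beta>
    apply (unfold_locales)
    subgoal by (rule finE)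
    subgoal by (rule loop)
    subgoal by (rule finH)
    subgoal by (rule edges2)
    subgoal by (rule T1)
    subgoal by (rule kd)
    subgoal by (rule K1)
    subgoal by (rule K2)
    subgoal by (rule K3)
    subgoal by (rule indep)
    subgoal by (rule cov)
    subgoal by (rule dirt)
    subgoal by (rule bE)
    subgoal by (rule bM)
    subgoal by (rule brel)
    subgoal by (rule bdirt)
    subgoal by (rule stack)
    subgoal by (rule stackP)
    subgoal by (rule stat)
    subgoal by (rule ids)
    subgoal by (rule EV)
    subgoal by (rule ESG)
    subgoal by (rule HV)
    subgoal by (rule cV)
    subgoal by (rule n2)
    done
  have fE: "O.fE = idle((if kd = 3 then w else c) := Serve)"
  proof
    fix v
    show "O.fE v = (idle((if kd = 3 then w else c) := Serve)) v"
    proof (cases "kd = 3")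
      case True
      then have "kd \<notin> {1, 2}" by simp
      then show ?thesis unfolding O.fE_def if_P[OF True] using True by (simp add: idle_def)
    next
      case False
      then have "kd \<in> {1, 2}" using kd by blast
      then show ?thesis unfolding O.fE_def if_not_P[OF False] using False by (simp add: idle_def)
    qed
  qed
  have f0: "O.fA 0 = idle(c := Op (mem0 kd 0 c (degree E c)))" unfolding O.fA_0 idle_def ..
  have run: "t_run alg ok E (conf n E H M b H M b (idle(c := Op (mem0 kd 0 c (degree E c)))) (\<lambda>v. kd = 3 \<and> v = w) pr)
      (17 + T n) O.opcost (cfg O.Hc O.Mf O.b14 (idle((if kd = 3 then w else c) := Serve)) pr)"
    using O.op_runs unfolding f0 fE cfg_def .
  let ?j = "kd = 1 \<and> O.jn"
  let ?jn = "(if kd = 1 \<and> O.jn \<and> N c \<noteq> {} then 1 else 0)::nat"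
  have mu: "mu E O.Hc O.Mf + card O.Cv + ?jn \<le> mu E H M" by (rule O.mu_after)
  have strict: "mu E O.Hc O.Mf < mu E H M" if k: "kd = 1" "N c \<noteq> {}"
  proof (cases "O.jn")
    case True
    have "?jn = 1" using k True by (intro if_P) blast
    then show ?thesis using mu by linarith
  next
    case False
    then have "card O.Cv \<noteq> 0" using O.abort_converts[OF k(1)] O.finite_Cv by simp
    then show ?thesis using mu by linarith
  qed
  have Cd: "real (degree E v) \<le> theta E" if "v \<in> O.Cv" for v
    using O.Cv_degree[OF that] by (rule degree_theta)
  have Cd2: "excess E v = 0" if "v \<in> O.Cv" for v using Cd[OF that] by (simp add: excess_def)
  obtain k where k: "card O.UU \<le> k + 2" "k ^ 3 \<le> 2 * card E" using O.card_UU by blast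
  \<comment> \<open>\<open>k + 2 \<le> 3 * k\<close> unless \<open>k = 0\<close>; hence the factor
    9.\<close>
  have UU: "real (card O.UU) ^ 2 \<le> 9 * theta E"
  proof (cases "k = 0")
    case True
    have "real (card O.UU) ^ 2 \<le> 2 ^ 2" using k(1) True by (intro power_mono) auto
    then show ?thesis using theta_ge(1)[of E] by simp
  next
    case False
    have "real (card O.UU) ^ 2 \<le> (3 * real k) ^ 2" using k(1) False by (intro power_mono) auto
    then show ?thesis using cube_theta[OF k(2)] by (simp add: power_mult_distrib)
  qed
  define jc where "jc = (if ?j then excess E c else 0)"
  \<comment> \<open>The degree of a joining centre is split: the part up to \<open>theta E\<close>
    is paid by the drop of \<open>mu\<close>, the excess by the drop of \<open>Xi\<close>.\<close>
  have jc: "real O.jcost \<le> real ?jn * theta E + jc"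
  proof (cases "?j \<and> N c \<noteq> {}")
    case True
    then have c3: "kd = 1 \<and> O.jn \<and> N c \<noteq> {}" and c2: ?j by blast+
    have "?jn = 1" by (rule if_P[OF c3])
    moreover have "O.jcost = degree E c" "jc = excess E c" unfolding O.jcost_def jc_def by (rule if_P[OF c2])+
    ultimately show ?thesis using excess_ge(2)[of E c] by simp
  next
    case False
    have "O.jcost = 0" unfolding O.jcost_def using False by (cases ?j) auto
    moreover have "jc \<ge> 0" unfolding jc_def using excess_ge(1) by simp
    ultimately show ?thesis using theta_ge(1)[of E] by simp
  qed
  have Xi: "Xi E O.Hc O.Mf + jc \<le> Xi E H M"
  proof -
    let ?W = "{v. N v \<noteq> {}}"
    let ?t = "\<lambda>H M v. if v \<in> H then 0 else if v \<in> M then 3 * excess E v else 4 * excess E v"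
    have fin: "finite ?W" by (rule finite_nonisolated[OF finE])
    have pw: "?t O.Hc O.Mf v + (if v = c then jc else 0) \<le> ?t H M v" for v
    proof (cases "v \<in> O.Hc")
      case True
      then have "v \<in> H" using O.HcH by blast
      moreover have "v = c \<Longrightarrow> jc = 0"
      proof -
        assume "v = c"
        then have "\<not> ?j" using K1 \<open>v \<in> H\<close> by blast
        then show "jc = 0" unfolding jc_def by (rule if_not_P)
      qed
      ultimately show ?thesis using True by simp
    next
      case False
      show ?thesis
      proof (cases "v \<in> H")
        case True
        then have "v \<in> O.Cv" using False by (simp add: O.Hc_def)
        moreover from this have "v \<noteq> c" using O.c_Cv by blast
        ultimately show ?thesis using Cd2[of v] True by simp
      next
        case vH: False
        show ?thesis
        proof (cases "v = c \<and> ?j")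
          case True
          then have "v \<in> O.Mf" "v \<notin> M" using O.light_after[OF False] K1 by blast+
          moreover have "jc = excess E c" unfolding jc_def using True by (intro if_P) blast
          ultimately show ?thesis using True False vH excess_ge(1)[of E v] by simp
        next
          case nc: False
          then have "v \<in> O.Mf \<longleftrightarrow> v \<in> M" using O.light_after[OF False] by blast
          moreover have "v = c \<Longrightarrow> jc = 0" unfolding jc_def using nc by (intro if_not_P) blast
          ultimately show ?thesis using False vH by simp
        qed
      qed
    qed
    have "Xi E O.Hc O.Mf + (\<Sum>v\<in>?W. if v = c then jc else 0) \<le> Xi E H M"
      unfolding Xi_def sum.distrib[symmetric] by (rule sum_mono) (rule pw)
    moreover have "(\<Sum>v\<in>?W. if v = c then jc else 0) = jc"
    proof (cases "c \<in> ?W")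
      case True
      then show ?thesis using fin by simp
    next
      case False
      then have "excess E c = 0" using theta_ge(1)[of E] by (simp add: excess_def)
      then have "jc = 0" unfolding jc_def by simp
      then show ?thesis using fin by simp
    qed
    ultimately show ?thesis by simp
  qed
  have "real (\<Sum>v\<in>O.Cv. degree E v) \<le> real (card O.Cv) * theta E"
    using sum_bounded_above[of O.Cv "\<lambda>v. real (degree E v)" "theta E"] Cd by simp
  moreover have "real O.opcost + real (registered O.b14) \<le> real (registered b) + real O.jcost
      + 21 * real (\<Sum>v\<in>O.Cv. degree E v) + (real (T n) + 16) * real (card O.UU) ^ 2"
  proof -
    have "real (O.opcost + registered O.b14) \<le> real (registered b + O.jcost + 21 * (\<Sum>v\<in>O.Cv. degree E v) + (T n + 16) * card O.UU ^ 2)"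
      using O.opcost_le of_nat_mono by blast
    then show ?thesis by simp
  qed
  moreover have "(real (T n) + 16) * real (card O.UU) ^ 2 \<le> 144 * ((real (T n) + 1) * theta E)"
  proof -
    have "(real (T n) + 16) * real (card O.UU) ^ 2 \<le> (16 * (real (T n) + 1)) * (9 * theta E)"
      using UU theta_ge(1)[of E] by (intro mult_mono) auto
    then show ?thesis by (simp add: algebra_simps)
  qed
  ultimately have cost: "real O.opcost + real (registered O.b14) + Xi E O.Hc O.Mf \<le> real (registered b) + Xi E H M
      + real ?jn * theta E + 21 * (real (card O.Cv) * theta E) + 144 * ((real (T n) + 1) * theta E)"
    using jc Xi by linarith
  define D where "D = (real (T n) + 1) * theta E"
  have D: "theta E \<le> D" "0 \<le> D"
    using theta_ge(1)[of E] mult_right_mono[of 1 "real (T n) + 1" "theta E"] by (simp_all add: D_def)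
  define \<delta> where "\<delta> = real (mu E H M) - real (mu E O.Hc O.Mf)"
  have \<delta>: "real (card O.Cv) + real ?jn \<le> \<delta>" using mu unfolding \<delta>_def by linarith
  have "real ?jn * theta E + 21 * (real (card O.Cv) * theta E) \<le> 22 * (\<delta> * D)"
  proof -
    have "real ?jn * theta E \<le> real ?jn * D" "real (card O.Cv) * theta E \<le> real (card O.Cv) * D"
      using D by (auto intro: mult_left_mono)
    moreover have "(real (card O.Cv) + real ?jn) * D \<le> \<delta> * D" using \<delta> D(2) by (rule mult_right_mono)
    moreover have "0 \<le> real ?jn * D" "0 \<le> real (card O.Cv) * D" using D(2) by auto
    ultimately show ?thesis by (simp only: distrib_right)
  qed
  then have c2: "real O.opcost + real (registered O.b14) + Xi E O.Hc O.Mf \<le> real (registered b) + Xi E H M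
      + 22 * (\<delta> * D) + 144 * D"
    using cost unfolding D_def[symmetric] by linarith
  have PhD: "Lam * theta E = 170 * D" by (simp add: Lam_def D_def)
  have Ph: "Ph O.Hc O.Mf O.b14 = real (registered O.b14) + Xi E O.Hc O.Mf + 170 * D * real (mu E O.Hc O.Mf)"
    "Ph H M b = real (registered b) + Xi E H M + 170 * D * real (mu E H M)"
    unfolding Phi_def PhD by simp_all
  have \<delta>0: "0 \<le> \<delta>" using \<delta> by linarith
  have dd: "170 * D * real (mu E H M) = 170 * D * real (mu E O.Hc O.Mf) + 170 * (\<delta> * D)"
    by (simp add: \<delta>_def algebra_simps)
  have "real O.opcost + Ph O.Hc O.Mf O.b14 \<le> Ph H M b + (if kd = 1 \<and> N c \<noteq> {} then - 4 else Lam * theta E)"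
  proof (cases "kd = 1 \<and> N c \<noteq> {}")
    case True
    have "1 \<le> \<delta>" using strict True unfolding \<delta>_def by (simp add: Suc_le_eq[symmetric] of_nat_diff)
    then have "1 * D \<le> \<delta> * D" using D(2) by (rule mult_right_mono)
    then show ?thesis unfolding if_P[OF True] Ph dd using c2 D theta_ge(1)[of E] by linarith
  next
    case False
    have "0 \<le> \<delta> * D" using \<delta>0 D(2) by simp
    then show ?thesis unfolding if_not_P[OF False] Ph dd PhD using c2 D by linarith
  qed
  moreover have "mu E O.Hc O.Mf \<le> mu E H M" using mu by linarith
  ultimately show ?thesis
    using run O.inv_after O.HcH strict O.holder_after by blast
qed

end

section \<open>The token walk\<close>

lemma inv_atD:
  assumes "inv_at E St H M b"
  shows "\<And>u v. u \<in> M \<Longrightarrow> v \<in> M \<Longrightarrow> {u, v} \<notin> E"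
    "\<And>v. v \<in> H \<Longrightarrow> v \<notin> M \<Longrightarrow> neighbours E v \<inter> M \<noteq> {}"
    "\<And>v. v \<notin> H \<Longrightarrow> v \<notin> M \<Longrightarrow> v \<notin> St \<Longrightarrow> neighbours E v \<inter> (M - H) = {} \<Longrightarrow> b v \<noteq> None"
    "\<And>v z. b v = Some z \<Longrightarrow> {v, z} \<in> E" "\<And>v z. b v = Some z \<Longrightarrow> v \<notin> M"
    "\<And>v z. b v = Some z \<Longrightarrow> z \<in> M - H \<Longrightarrow> {u. b u = Some v} \<noteq> {}"
    "\<And>v z. b v = Some z \<Longrightarrow> z \<notin> M - H \<Longrightarrow> v \<notin> H \<and> neighbours E v \<inter> (M - H) = {} \<and> {u. b u = Some v} = {}"
    "\<And>v. v \<notin> M \<Longrightarrow> {u. b u = Some v} \<noteq> {} \<Longrightarrow> v \<notin> St \<Longrightarrow> \<exists>z. z \<in> M - H \<and> b v = Some z"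
    "\<And>v. v \<in> M - H \<Longrightarrow> {u. b u = Some v} \<noteq> {} \<Longrightarrow> v \<in> St"
  using assms unfolding inv_at_def by (elim conjE; metis)+

text \<open>Dropping the registration of \<open>u\<close> spoils the clauses only at
  \<open>u\<close>, which therefore enters the stack. The list of its boss shrinks, which is
  harmless because the boss is not registered and so no relay.\<close>

lemma inv_unregister:
  assumes inv: "inv_at E St H M b" and u: "b u = Some z" and z: "b z = None"
  shows "inv_at E (insert u St) H M (b(u := None))"
proof -
  note D = inv_atD[OF inv]
  have ch: "v \<noteq> z \<Longrightarrow> {x. (b(u := None)) x = Some v} = {x. b x = Some v}" for v using u by auto
  have sub: "{x. (b(u := None)) x = Some v} \<subseteq> {x. b x = Some v}" for v by auto
  have nz: "(b(u := None)) v = Some y \<Longrightarrow> v \<noteq> z \<and> b v = Some y" for v y using z by (auto split: if_splits)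
  show ?thesis
    unfolding inv_at_def
  proof (intro conjI allI ballI impI; (elim conjE)?)
    fix v y assume "(b(u := None)) v = Some y" "y \<in> M - H"
    then show "{x. (b(u := None)) x = Some v} \<noteq> {}" using nz[of v y] D(6)[of v y] ch[of v] by simp
  next
    fix v y assume a: "(b(u := None)) v = Some y" "y \<notin> M - H"
    then show "v \<notin> H" "neighbours E v \<inter> (M - H) = {}" "{x. (b(u := None)) x = Some v} = {}"
      using nz[of v y] D(7)[of v y] ch[of v] by auto
  next
    fix v assume a: "v \<notin> M" "{x. (b(u := None)) x = Some v} \<noteq> {}" "v \<notin> insert u St"
    then show "\<exists>y. y \<in> M - H \<and> (b(u := None)) v = Some y" using D(8)[of v] sub[of v] by auto
  next
    fix v assume a: "v \<in> M - H" "{x. (b(u := None)) x = Some v} \<noteq> {}"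
    then show "v \<in> insert u St" using D(9)[of v] sub[of v] by auto
  next
    fix v assume "v \<notin> H" "v \<notin> M" "v \<notin> insert u St" "neighbours E v \<inter> (M - H) = {}"
    then show "(b(u := None)) v \<noteq> None" using D(3)[of v] by simp
  next
    fix v y assume "(b(u := None)) v = Some y"
    then show "{v, y} \<in> E" "v \<notin> M" using nz D(4,5) by blast+
  next
    fix x v assume "x \<in> M" "v \<in> M" then show "{x, v} \<notin> E" by (rule D(1))
  next
    fix v assume "v \<in> H" "v \<notin> M" then show "neighbours E v \<inter> M \<noteq> {}" by (rule D(2))
  qed
qed

text \<open>A vertex may leave the stack once it needs no repair itself and its list is empty or
  legitimately kept by a heavy member.\<close>

lemma inv_pop:
  assumes inv: "inv_at E (insert u St) H M b"
    and "u \<in> H \<and> u \<in> M \<or> {x. b x = Some u} = {}"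
    and "u \<notin> H \<Longrightarrow> u \<notin> M \<Longrightarrow> neighbours E u \<inter> (M - H) = {} \<Longrightarrow> b u \<noteq> None"
  shows "inv_at E St H M b"
proof -
  note D = inv_atD[OF inv]
  show ?thesis
    unfolding inv_at_def
  proof (intro conjI allI ballI impI; (elim conjE)?)
    fix v assume a: "v \<notin> M" "{x. b x = Some v} \<noteq> {}" "v \<notin> St"
    then show "\<exists>y. y \<in> M - H \<and> b v = Some y" using D(8)[of v] assms(2) by (cases "v = u") blast+
  next
    fix v assume a: "v \<in> M - H" "{x. b x = Some v} \<noteq> {}"
    then show "v \<in> St" using D(9)[of v] assms(2) by (cases "v = u") blast+
  next
    fix v assume a: "v \<notin> H" "v \<notin> M" "v \<notin> St" "neighbours E v \<inter> (M - H) = {}"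
    show "b v \<noteq> None"
    proof (cases "v = u")
      case True
      then show ?thesis using assms(3) a by simp
    next
      case False
      then show ?thesis using D(3)[OF a(1,2) _ a(4)] a(3) by blast
    qed
  next
    fix v y assume "b v = Some y" "y \<in> M - H" then show "{x. b x = Some v} \<noteq> {}" by (rule D(6))
  next
    fix v y assume "b v = Some y" "y \<notin> M - H"
    then show "v \<notin> H" "neighbours E v \<inter> (M - H) = {}" "{x. b x = Some v} = {}" using D(7)[of v y] by auto
  next
    fix v y assume "b v = Some y" then show "{v, y} \<in> E" "v \<notin> M" using D(4,5) by auto
  next
    fix x v assume "x \<in> M" "v \<in> M" then show "{x, v} \<notin> E" by (rule D(1))
  next
    fix v assume "v \<in> H" "v \<notin> M" then show "neighbours E v \<inter> M \<noteq> {}" by (rule D(2))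
  qed
qed

context env
begin

lemma inv_settled: "inv_at E St H M b \<Longrightarrow> bnext E H H M b H M (\<lambda>_. None) (\<lambda>_. False) v = b v"
proof (cases "b v")
  case (Some z)
  assume inv: "inv_at E St H M b"
  note D = inv_atD[OF inv]
  have "v \<notin> H \<and> N v \<inter> (M - H) = {} \<or> {u. b u = Some v} \<noteq> {}"
    using D(6)[OF Some] D(7)[OF Some] by (cases "z \<in> M - H") blast+
  then show ?thesis using Some D(5)[OF Some] by (simp add: bnext_def)
qed (simp add: bnext_def freshS_def)

lemma inv_finite: "inv_at E St H M b \<Longrightarrow> finite {u. b u \<noteq> None}"
proof -
  assume inv: "inv_at E St H M b"
  have "{u. b u \<noteq> None} \<subseteq> fst ` {(u, v). {u, v} \<in> E}"
  proof
    fix u assume "u \<in> {u. b u \<noteq> None}"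
    then obtain z where "{u, z} \<in> E" using inv_atD(4)[OF inv] by blast
    then show "u \<in> fst ` {(u, v). {u, v} \<in> E}" by force
  qed
  then show ?thesis using finite_edge_pairs[OF finE] by (meson finite_imageI finite_subset)
qed

lemma idle_app [simp]: "idle v = Idle" by (simp add: idle_def)

definition resume :: "nat set \<Rightarrow> nat set \<Rightarrow> (nat \<Rightarrow> nat option) \<Rightarrow> nat \<Rightarrow> 's phase" where
  "resume H M b v = (if v \<notin> H \<and> v \<notin> M \<and> N v \<inter> (M - H) = {} \<and> b v = None
     then Op (mem0 1 0 v (degree E v)) else Serve)"

text \<open>Besides the token only a withdrawal of the receiver is sent, and the drop of
  \<open>registered\<close> pays for that. The second round lets the withdrawal arrive before the
  receiver acts.\<close>

lemma handover:
  assumes inv: "inv_at E St H M b" and inv1: "inv_at E St1 H M b1" and e: "{x, y} \<in> E"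
    and tgt: "msg = Tok \<and> \<not> (x \<in> H \<and> x \<in> M) \<and> {u. b u = Some x} \<noteq> {} \<and> y = Min {u. b u = Some x} \<or>
       msg = Ret \<and> (x \<in> H \<and> x \<in> M \<or> {u. b u = Some x} = {}) \<and> (\<exists>ps. pr x = y # ps)"
    and b1: "b1 = (if msg = Tok \<or> N y \<inter> (M - H) \<noteq> {} then b(y := None) else b)"
    and pr1: "pr1 = (if msg = Tok then pr(y := x # pr y) else pr(x := tl (pr x)))"
  shows "\<exists>\<kappa>. t_run alg ok E (cfg H M b (idle(x := Serve)) pr) 2 \<kappa> (cfg H M b1 (idle(y := resume H M b1 y)) pr1)
     \<and> \<kappa> + registered b1 \<le> 1 + registered b"
proof -
  let ?f = "idle(x := Serve)" and ?g = "idle(y := TW)" and ?k = "\<lambda>_::nat. False"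
  have xy: "x \<noteq> y" using e loop by auto
  note D = inv_atD[OF inv] and D1 = inv_atD[OF inv1]
  have msg: "msg = Tok \<or> msg = Ret" using tgt by blast
  have oi: "opinbox n E H M b H M b ?f ?k pr v u = (if u = x \<and> v = y then Some msg else None)" for u v
  proof -
    have t: "serve_target (conf n E H M b H M b ?f ?k pr x) = Some (y, msg)"
      using tgt by (auto simp: serve_target_def)
    show ?thesis using e t by (auto simp: opinbox_simp opsend_def)
  qed
  have tk: "(\<lambda>v. tokened (opinbox n E H M b H M b ?f ?k pr v) (N v \<inter> (M - H))) =
      (\<lambda>v. v = y \<and> (msg = Tok \<or> N y \<inter> (M - H) \<noteq> {}))"
    using msg by (auto simp: fun_eq_iff tokened_def oi)
  have r1: "t_run alg ok E (conf n E H M b H M b ?f ?k pr) 1 1 (conf n E H M b H M b1 ?g ?k pr1)"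
  proof (rule run_conf[OF finE])
    show "t_round alg E (conf n E H M b H M b ?f ?k pr) = conf n E H M b H M b1 ?g ?k pr1"
    proof (rule round_conf[where req = "\<lambda>_. None"])
      fix v
      show "b1 v = bnext E H H M b H M (\<lambda>_. None)
          (\<lambda>v. tokened (opinbox n E H M b H M b ?f ?k pr v) (N v \<inter> (M - H))) v"
        unfolding tk using inv_settled[OF inv, of v] by (auto simp: bnext_def b1)
      have THE: "(THE p. p = x) = x" by simp
      show "act (conf n E H M b H M b ?f ?k pr v) (N v \<inter> (M - H)) (freshS E H H M v) {u. b u = Some v}
          (stinbox E H M H M v) (opinbox n E H M b H M b ?f ?k pr v) =
         \<lparr>a_H = v \<in> H, a_M = v \<in> M, a_req = None, a_ph = ?g v, a_kick = False, a_prs = pr1 v\<rparr>"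
        using tgt xy by (cases "v = x"; cases "v = y") (auto simp: act_def oi pr1 THE)
    qed (use D(4) in auto)
    have "opcount n E H M b H M b ?f ?k pr = {(x, y)}" by (auto simp: opcount_def oi)
    then show "card (stcount E H M H M) + card {u. b u \<noteq> b u} + card (opcount n E H M b H M b ?f ?k pr) \<le> 1" by simp
  qed (use D(4) msg in \<open>auto simp: oi okop_def\<close>)
  have oi2: "opinbox n E H M b H M b1 ?g ?k pr1 v u = None" for u v
    by (auto simp: opinbox_simp opsend_def)
  have r2: "t_run alg ok E (conf n E H M b H M b1 ?g ?k pr1) 1 (card {u. b u \<noteq> b1 u})
      (conf n E H M b1 H M b1 (idle(y := resume H M b1 y)) ?k pr1)"
  proof (rule run_conf[OF finE])
    have tk2: "(\<lambda>v. tokened (opinbox n E H M b H M b1 ?g ?k pr1 v) (N v \<inter> (M - H))) = (\<lambda>_. False)"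
      by (simp add: tokened_def oi2)
    show "t_round alg E (conf n E H M b H M b1 ?g ?k pr1) = conf n E H M b1 H M b1 (idle(y := resume H M b1 y)) ?k pr1"
    proof (rule round_conf[where req = "\<lambda>_. None"])
      fix v
      show "b1 v = bnext E H H M b1 H M (\<lambda>_. None)
          (\<lambda>v. tokened (opinbox n E H M b H M b1 ?g ?k pr1 v) (N v \<inter> (M - H))) v"
        unfolding tk2 by (rule inv_settled[OF inv1, symmetric])
      show "act (conf n E H M b H M b1 ?g ?k pr1 v) (N v \<inter> (M - H)) (freshS E H H M v) {u. b1 u = Some v}
          (stinbox E H M H M v) (opinbox n E H M b H M b1 ?g ?k pr1 v) =
         \<lparr>a_H = v \<in> H, a_M = v \<in> M, a_req = None, a_ph = (idle(y := resume H M b1 y)) v, a_kick = False, a_prs = pr1 v\<rparr>"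
        by (cases "v = y") (auto simp: act_def oi2 resume_def)
    qed (use D(4) D1(4) in auto)
    show "card (stcount E H M H M) + card {u. b u \<noteq> b1 u} + card (opcount n E H M b H M b1 ?g ?k pr1) \<le> card {u. b u \<noteq> b1 u}"
      by (simp add: opcount_def oi2)
    show "\<And>u. b u \<noteq> b1 u \<Longrightarrow> b u = None \<or> b1 u = None" by (auto simp: b1 split: if_splits)
  qed (use D(4) D1(4) in \<open>auto simp: oi2 okop_def\<close>)
  have "card {u. b u \<noteq> b1 u} + card {u. b1 u \<noteq> None} \<le> card {u. b u \<noteq> None} + 2 * card ({}::nat set)"
    using inv_finite[OF inv] inv_finite[OF inv1]
    by (rule registration_changes) (auto simp: b1 split: if_splits)
  then have "1 + card {u. b u \<noteq> b1 u} + registered b1 \<le> 1 + registered b" by (simp add: registered_def)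
  moreover have "t_run alg ok E (cfg H M b ?f pr) 2 (1 + card {u. b u \<noteq> b1 u}) (cfg H M b1 (idle(y := resume H M b1 y)) pr1)"
    using t_run_trans[OF r1 r2] unfolding cfg_def by (simp add: numeral_2_eq_2)
  ultimately show ?thesis by blast
qed

lemma finish:
  assumes inv: "inv_at E St H M b" and d: "v \<in> H \<and> v \<in> M \<or> {u. b u = Some v} = {}" and p: "pr v = []"
  shows "t_run alg ok E (cfg H M b (idle(v := Serve)) pr) 1 0 (cfg H M b idle pr)"
proof -
  let ?f = "idle(v := Serve)" and ?k = "\<lambda>_::nat. False"
  note D = inv_atD[OF inv]
  have oi: "opinbox n E H M b H M b ?f ?k pr x u = None" for u x
    using d p by (auto simp: opinbox_simp opsend_def serve_target_def)
  have tk: "(\<lambda>v. tokened (opinbox n E H M b H M b ?f ?k pr v) (N v \<inter> (M - H))) = (\<lambda>_. False)"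
    by (simp add: tokened_def oi)
  show ?thesis
    unfolding cfg_def
  proof (rule run_conf[OF finE])
    show "t_round alg E (conf n E H M b H M b ?f ?k pr) = conf n E H M b H M b idle ?k pr"
    proof (rule round_conf[where req = "\<lambda>_. None"])
      fix x
      show "b x = bnext E H H M b H M (\<lambda>_. None)
          (\<lambda>v. tokened (opinbox n E H M b H M b ?f ?k pr v) (N v \<inter> (M - H))) x"
        unfolding tk by (rule inv_settled[OF inv, symmetric])
      show "act (conf n E H M b H M b ?f ?k pr x) (N x \<inter> (M - H)) (freshS E H H M x) {u. b u = Some x}
          (stinbox E H M H M x) (opinbox n E H M b H M b ?f ?k pr x) =
         \<lparr>a_H = x \<in> H, a_M = x \<in> M, a_req = None, a_ph = idle x, a_kick = False, a_prs = pr x\<rparr>"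
        using d p by (cases "x = v") (auto simp: act_def oi)
    qed (use D(4) in auto)
  qed (use D(4) in \<open>auto simp: oi okop_def opcount_def\<close>)
qed

text \<open>\<open>sk\<close> rounds and \<open>sm\<close> messages are reserves that the service of
  \<open>v\<close> leaves over, to pay for the hops by which the token came to
  \<open>v\<close>.\<close>

definition Done :: "nat \<Rightarrow> real \<Rightarrow> nat set \<Rightarrow> nat set \<Rightarrow> nat set \<Rightarrow> (nat \<Rightarrow> nat option) \<Rightarrow> (nat \<Rightarrow> nat list) \<Rightarrow> nat \<Rightarrow> bool" where
  "Done sk sm St H M b pr v \<longleftrightarrow> (\<exists>H' M' b' k \<kappa>.
     t_run alg ok E (cfg H M b (idle(v := resume H M b v)) pr) k \<kappa> (cfg H' M' b' (idle(v := Serve)) pr) \<and>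
     inv_at E St H' M' b' \<and> H' \<subseteq> H \<and> (v \<in> H' \<and> v \<in> M' \<or> {u. b' u = Some v} = {}) \<and>
     (v \<notin> H' \<longrightarrow> v \<notin> M' \<longrightarrow> N v \<inter> (M' - H') = {} \<longrightarrow> b' v \<noteq> None) \<and>
     mu E H' M' \<le> mu E H M \<and> k + sk + rho * mu E H' M' \<le> rho * mu E H M \<and>
     real \<kappa> + sm + Ph H' M' b' \<le> Ph H M b)"

lemma Done_trans:
  assumes r: "t_run alg ok E (cfg H M b (idle(v := resume H M b v)) pr) k \<kappa> (cfg H2 M2 b2 (idle(v := resume H2 M2 b2 v)) pr)"
    and "H2 \<subseteq> H" "mu E H2 M2 \<le> mu E H M" "k + sk + rho * mu E H2 M2 \<le> rho * mu E H M"
    "real \<kappa> + sm + Ph H2 M2 b2 \<le> Ph H M b" and d: "Done 0 0 St H2 M2 b2 pr v"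
  shows "Done sk sm St H M b pr v"
proof -
  obtain H' M' b' k' \<kappa>' where
    r': "t_run alg ok E (cfg H2 M2 b2 (idle(v := resume H2 M2 b2 v)) pr) k' \<kappa>' (cfg H' M' b' (idle(v := Serve)) pr)"
    and i: "inv_at E St H' M' b'" "H' \<subseteq> H2" "v \<in> H' \<and> v \<in> M' \<or> {u. b' u = Some v} = {}"
     "v \<notin> H' \<longrightarrow> v \<notin> M' \<longrightarrow> N v \<inter> (M' - H') = {} \<longrightarrow> b' v \<noteq> None" "mu E H' M' \<le> mu E H2 M2"
    and k: "k' + 0 + rho * mu E H' M' \<le> rho * mu E H2 M2" "real \<kappa>' + 0 + Ph H' M' b' \<le> Ph H2 M2 b2"
    using d unfolding Done_def by blast
  have "(k + k') + sk + rho * mu E H' M' \<le> rho * mu E H M" using k assms(4) by linarith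
  moreover have "real (\<kappa> + \<kappa>') + sm + Ph H' M' b' \<le> Ph H M b" using k assms(5) by simp
  moreover have "H' \<subseteq> H" "mu E H' M' \<le> mu E H M" using i assms by auto
  ultimately show ?thesis unfolding Done_def using t_run_trans[OF r r'] i by blast
qed

text \<open>The induction is on \<open>mu\<close>. The last premise fits a vertex to which the token
  has returned: either its registration was dropped or nobody is registered with it.\<close>

definition Claim :: "nat \<Rightarrow> bool" where
  "Claim m \<longleftrightarrow> (\<forall>H M b St pr v. mu E H M = m \<longrightarrow> H \<subseteq> V \<longrightarrow> N v \<noteq> {} \<longrightarrow> inv_at E St H M b \<longrightarrow> v \<in> St \<longrightarrow>
     b v = None \<or> {u. b u = Some v} = {} \<longrightarrow> Done 0 0 St H M b pr v)"

lemma nbV: "N v \<noteq> {} \<Longrightarrow> v \<in> V" using EV by (auto simp: neighbours_def)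

lemma rho_step: "x < y \<Longrightarrow> 25 + T n + rho * x \<le> rho * y"
proof -
  assume "x < y"
  then have "rho * Suc x \<le> rho * y" by (intro mult_le_mono2) simp
  then show ?thesis by (simp add: rho_def)
qed

lemma rho_less: "k + Suc sk + rho * x \<le> rho * y \<Longrightarrow> x < y"
proof (rule ccontr)
  assume a: "k + Suc sk + rho * x \<le> rho * y" "\<not> x < y"
  then have "rho * y \<le> rho * x" by (intro mult_le_mono2) simp
  then show False using a by linarith
qed

text \<open>The operation at \<open>v\<close> lowers \<open>mu\<close>, which releases
  \<open>rho = 17 + T n + 8\<close> rounds and 4 spare messages; whatever \<open>v\<close> has to
  serve afterwards is covered by the induction hypothesis.\<close>

lemma caseD:
  assumes IH: "\<And>m'. m' < mu E H M \<Longrightarrow> Claim m'" and HV: "H \<subseteq> V" and ni: "N v \<noteq> {}"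
    and inv: "inv_at E St H M b" and St: "v \<in> St"
    and dirty: "v \<notin> H" "v \<notin> M" "N v \<inter> (M - H) = {}" "b v = None"
  shows "Done 8 4 St H M b pr v"
proof -
  note D = inv_atD[OF inv]
  let ?P = "\<lambda>H' M' b' \<kappa>.
    t_run alg ok E (conf n E H M b H M b (idle(v := Op (mem0 1 0 v (degree E v)))) (\<lambda>x. (1::nat) = 3 \<and> x = v) pr)
      (17 + T n) \<kappa> (cfg H' M' b' (idle((if (1::nat) = 3 then v else v) := Serve)) pr) \<and>
    inv_at E St H' M' b' \<and> H' \<subseteq> H \<and> mu E H' M' \<le> mu E H M \<and>
    ((1::nat) = 1 \<and> N v \<noteq> {} \<longrightarrow> mu E H' M' < mu E H M) \<and>
    real \<kappa> + Ph H' M' b' \<le> Ph H M b + (if (1::nat) = 1 \<and> N v \<noteq> {} then - 4 else Lam * theta E) \<and>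
    ((1::nat) = 1 \<longrightarrow> b' v = None \<and> (v \<notin> M' \<longrightarrow> N v \<inter> (M' - H') \<noteq> {})) \<and>
    ((1::nat) = 2 \<longrightarrow> v \<in> M' \<and> v \<in> H') \<and> ((1::nat) = 3 \<longrightarrow> b' v = None \<and> v \<in> H')"
  have "\<exists>H' M' b' \<kappa>. ?P H' M' b' \<kappa>"
  proof (rule operation[OF HV nbV[OF ni]])
    show "v \<notin> H \<and> v \<notin> M \<and> N v \<inter> (M - H) = {} \<and> b v = None \<and> v \<in> St" using dirty St by blast
    show "(1::nat) = 3 \<and> {x, y} = {v, v}" if "x \<in> M" "y \<in> M" "{x, y} \<in> E" for x y using D(1) that by blast
  qed (simp, simp, simp, (rule D(2); assumption), (rule D(3); assumption), (rule D(4); assumption), (rule D(5); assumption),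
       (rule D(6); assumption), (rule D(7); assumption), (rule D(8); assumption), (rule D(9); assumption))
  then obtain H' M' b' \<kappa> where P: "?P H' M' b' \<kappa>" by blast
  have o: "t_run alg ok E (conf n E H M b H M b (idle(v := Op (mem0 1 0 v (degree E v)))) (\<lambda>x. False) pr)
      (17 + T n) \<kappa> (cfg H' M' b' (idle(v := Serve)) pr)"
    "inv_at E St H' M' b'" "H' \<subseteq> H" "mu E H' M' < mu E H M" "real \<kappa> + Ph H' M' b' \<le> Ph H M b - 4"
    "b' v = None" "v \<notin> M' \<longrightarrow> N v \<inter> (M' - H') \<noteq> {}"
    using P ni by simp_all
  have res: "resume H M b v = Op (mem0 1 0 v (degree E v))" "resume H' M' b' v = Serve"
    using dirty o(7) by (auto simp: resume_def)
  show ?thesis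
  proof (rule Done_trans)
    show "t_run alg ok E (cfg H M b (idle(v := resume H M b v)) pr) (17 + T n) \<kappa> (cfg H' M' b' (idle(v := resume H' M' b' v)) pr)"
      using o(1) unfolding res cfg_def .
    show "17 + T n + 8 + rho * mu E H' M' \<le> rho * mu E H M" using rho_step[OF o(4)] by simp
    show "Done 0 0 St H' M' b' pr v"
      using IH[OF o(4)] o ni St HV unfolding Claim_def by blast
  qed (use o in auto)
qed

text \<open>Going to \<open>u\<close> and back takes four rounds and, net of registrations, two
  messages, paid from the reserve of \<open>u\<close>. A positive reserve of rounds means that
  \<open>mu\<close> has dropped, so that resuming \<open>v\<close> falls under the induction
  hypothesis.\<close>

lemma visit:
  assumes inv: "inv_at E St H M b" and St: "v \<in> St" and bv: "b v = None" and nS: "\<not> (v \<in> H \<and> v \<in> M)"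
    and ch: "{u. b u = Some v} \<noteq> {}" and u: "u = Min {u. b u = Some v}"
    and d: "Done (sk + 4) (sm + 2) (insert u St) H M (b(u := None)) (pr(u := v # pr u)) u"
  shows "\<exists>H2 M2 b2 k \<kappa>. t_run alg ok E (cfg H M b (idle(v := Serve)) pr) k \<kappa> (cfg H2 M2 b2 (idle(v := resume H2 M2 b2 v)) pr) \<and>
    inv_at E St H2 M2 b2 \<and> H2 \<subseteq> H \<and> mu E H2 M2 < mu E H M \<and> k + sk + rho * mu E H2 M2 \<le> rho * mu E H M \<and>
    real \<kappa> + sm + Ph H2 M2 b2 \<le> Ph H M b \<and> (b2 v = None \<or> {u. b2 u = Some v} = {})"
proof -
  let ?b1 = "b(u := None)" and ?pr1 = "pr(u := v # pr u)"
  have "finite {u. b u = Some v}" by (rule finite_subset[OF _ inv_finite[OF inv]]) auto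
  then have bu: "b u = Some v" using Min_in[of "{u. b u = Some v}"] ch u by auto
  have e: "{u, v} \<in> E" using inv_atD(4)[OF inv bu] .
  then have e': "{v, u} \<in> E" by (simp add: insert_commute)
  have uv: "u \<noteq> v" using e loop by auto
  have inv1: "inv_at E (insert u St) H M ?b1" by (rule inv_unregister[OF inv bu bv])
  obtain \<kappa>1 where r1: "t_run alg ok E (cfg H M b (idle(v := Serve)) pr) 2 \<kappa>1 (cfg H M ?b1 (idle(u := resume H M ?b1 u)) ?pr1)"
     "\<kappa>1 + registered ?b1 \<le> 1 + registered b"
    using handover[OF inv inv1 e', of Tok pr ?pr1] nS ch u by auto
  obtain H' M' b' k \<kappa> where
    r2: "t_run alg ok E (cfg H M ?b1 (idle(u := resume H M ?b1 u)) ?pr1) k \<kappa> (cfg H' M' b' (idle(u := Serve)) ?pr1)"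
    and i: "inv_at E (insert u St) H' M' b'" "H' \<subseteq> H" and du: "u \<in> H' \<and> u \<in> M' \<or> {x. b' x = Some u} = {}"
     and du2: "u \<notin> H' \<longrightarrow> u \<notin> M' \<longrightarrow> N u \<inter> (M' - H') = {} \<longrightarrow> b' u \<noteq> None" and mu: "mu E H' M' \<le> mu E H M"
    and k: "k + (sk + 4) + rho * mu E H' M' \<le> rho * mu E H M" "real \<kappa> + (sm + 2) + Ph H' M' b' \<le> Ph H M ?b1"
    using d unfolding Done_def by blast
  have less: "mu E H' M' < mu E H M" by (rule rho_less[of k "sk + 3"]) (use k(1) in simp)
  have inv2: "inv_at E St H' M' b'" using inv_pop[OF i(1) du] du2 by blast
  note D2 = inv_atD[OF inv2]
  \<comment> \<open>The return rule of \<open>tokened\<close>: by the invariant, a registered vertex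
    next to a light member is a relay, and a registered vertex not next to one has an empty
    list.\<close>
  define b2 where "b2 = (if N v \<inter> (M' - H') \<noteq> {} then b'(v := None) else b')"
  have inv3: "inv_at E St H' M' b2"
  proof (cases "N v \<inter> (M' - H') \<noteq> {} \<and> b' v \<noteq> None")
    case True
    then obtain z where z: "b' v = Some z" by auto
    have "z \<in> M' - H'" using D2(7)[OF z] True by blast
    then have "b' z = None" using D2(5)[of z] by (cases "b' z") auto
    from inv_unregister[OF inv2 z this] show ?thesis using St True by (simp add: b2_def insert_absorb)
  next
    case False
    then have "b2 = b'" by (auto simp: b2_def fun_eq_iff)
    then show ?thesis using inv2 by simp
  qed
  have pr: "pr = ?pr1(u := tl (?pr1 u))" by auto
  obtain \<kappa>3 where r3: "t_run alg ok E (cfg H' M' b' (idle(u := Serve)) ?pr1) 2 \<kappa>3 (cfg H' M' b2 (idle(v := resume H' M' b2 v)) pr)"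
     "\<kappa>3 + registered b2 \<le> 1 + registered b'"
    using handover[OF inv2 inv3 e, of Ret ?pr1 pr] du b2_def pr by auto
  have "(2 + k + 2) + sk + rho * mu E H' M' \<le> rho * mu E H M" using k(1) by linarith
  moreover have "real (\<kappa>1 + \<kappa> + \<kappa>3) + sm + Ph H' M' b2 \<le> Ph H M b"
  proof -
    have "real \<kappa>1 + real (registered ?b1) \<le> 1 + real (registered b)" "real \<kappa>3 + real (registered b2) \<le> 1 + real (registered b')"
      using r1(2) r3(2) by linarith+
    then show ?thesis using k(2) unfolding Phi_def by simp
  qed
  moreover have "b2 v = None \<or> {x. b2 x = Some v} = {}"
  proof (cases "N v \<inter> (M' - H') = {}")
    case True
    show ?thesis
    proof (cases "b' v")
      case (Some z)
      then have "z \<in> N v" using D2(4) by (simp add: in_neighbours')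
      then have "{x. b' x = Some v} = {}" using D2(7)[OF Some] True by blast
      then show ?thesis using True by (simp add: b2_def)
    qed (simp add: b2_def)
  qed (simp add: b2_def)
  ultimately show ?thesis
    using t_run_trans[OF t_run_trans[OF r1(1) r2] r3(1)] inv3 i(2) less by blast
qed

lemma visit_Done:
  assumes IH: "\<And>m'. m' < mu E H M \<Longrightarrow> Claim m'" and HV: "H \<subseteq> V" and ni: "N v \<noteq> {}"
    and v: "inv_at E St H M b" "v \<in> St" "b v = None" "\<not> (v \<in> H \<and> v \<in> M)" "{u. b u = Some v} \<noteq> {}"
    and u: "u = Min {u. b u = Some v}" and res: "resume H M b v = Serve"
    and d: "Done (sk + 4) (sm + 2) (insert u St) H M (b(u := None)) (pr(u := v # pr u)) u"
  shows "Done sk sm St H M b pr v"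
proof -
  obtain H2 M2 b2 k \<kappa> where o: "t_run alg ok E (cfg H M b (idle(v := Serve)) pr) k \<kappa> (cfg H2 M2 b2 (idle(v := resume H2 M2 b2 v)) pr)"
    "inv_at E St H2 M2 b2" "H2 \<subseteq> H" "mu E H2 M2 < mu E H M" "k + sk + rho * mu E H2 M2 \<le> rho * mu E H M"
    "real \<kappa> + sm + Ph H2 M2 b2 \<le> Ph H M b" "b2 v = None \<or> {u. b2 u = Some v} = {}"
    using visit[OF v u d] by blast
  show ?thesis
  proof (rule Done_trans)
    show "t_run alg ok E (cfg H M b (idle(v := resume H M b v)) pr) k \<kappa> (cfg H2 M2 b2 (idle(v := resume H2 M2 b2 v)) pr)"
      using o(1) unfolding res .
    show "Done 0 0 St H2 M2 b2 pr v" using IH[OF o(4)] o HV ni v unfolding Claim_def by blast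
  qed (use o in auto)
qed

text \<open>Since \<open>v\<close> is outside the set, whoever is registered with it is a waiting
  vertex, so the first visit meets a vertex that starts an operation. One round trip turns the
  reserves 8 and 4 into 4 and 2.\<close>

lemma caseR:
  assumes IH: "\<And>m'. m' < mu E H M \<Longrightarrow> Claim m'" and HV: "H \<subseteq> V" and ni: "N v \<noteq> {}"
    and inv: "inv_at E St H M b" and St: "v \<in> St" and bv: "b v = None" and vM: "v \<notin> M"
    and ch: "{u. b u = Some v} \<noteq> {}" and res: "resume H M b v = Serve"
  shows "Done 4 2 St H M b pr v"
proof -
  note D = inv_atD[OF inv]
  define u where u: "u = Min {u. b u = Some v}"
  have "finite {u. b u = Some v}" by (rule finite_subset[OF _ inv_finite[OF inv]]) auto
  then have bu: "b u = Some v" using Min_in[of "{u. b u = Some v}"] ch u by auto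
  have du: "u \<notin> H" "N u \<inter> (M - H) = {}" "u \<notin> M" using D(7)[OF bu] D(5)[OF bu] vM by auto
  have "v \<in> N u" using D(4)[OF bu] by (simp add: in_neighbours')
  then have "Done 8 4 (insert u St) H M (b(u := None)) (pr(u := v # pr u)) u"
    using du by (intro caseD[OF IH HV _ inv_unregister[OF inv bu bv]]) auto
  then show ?thesis
    using vM by (intro visit_Done[OF IH HV ni inv St bv _ ch u res]) auto
qed

text \<open>The longest way to the next operation leads from a light member over a relay to a
  waiting vertex. These two round trips use up the reserves of 8 rounds and 4 messages, which is why
  \<open>rho\<close> and \<open>Lam\<close> contain these numbers.\<close>

theorem serve: "Claim m"
proof (induction m rule: less_induct)
  case (less m)
  show ?case
    unfolding Claim_def
  proof (intro allI impI)
    fix H M b St pr v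
    assume m: "mu E H M = m" and HV: "H \<subseteq> V" and ni: "N v \<noteq> {}" and inv: "inv_at E St H M b" and St: "v \<in> St"
      and bc: "b v = None \<or> {u. b u = Some v} = {}"
    have IH: "\<And>m'. m' < mu E H M \<Longrightarrow> Claim m'" using less m by simp
    note D = inv_atD[OF inv]
    have weaken: "Done sk sm St H M b pr v \<Longrightarrow> 0 \<le> sm \<Longrightarrow> Done 0 0 St H M b pr v" for sk sm
    proof -
      assume "Done sk sm St H M b pr v" "0 \<le> sm"
      then obtain H' M' b' k \<kappa> where
        "t_run alg ok E (cfg H M b (idle(v := resume H M b v)) pr) k \<kappa> (cfg H' M' b' (idle(v := Serve)) pr)"
        "inv_at E St H' M' b'" "H' \<subseteq> H" "v \<in> H' \<and> v \<in> M' \<or> {u. b' u = Some v} = {}"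
        "v \<notin> H' \<longrightarrow> v \<notin> M' \<longrightarrow> N v \<inter> (M' - H') = {} \<longrightarrow> b' v \<noteq> None" "mu E H' M' \<le> mu E H M"
        and k: "k + sk + rho * mu E H' M' \<le> rho * mu E H M" "real \<kappa> + sm + Ph H' M' b' \<le> Ph H M b"
        unfolding Done_def by blast
      moreover have "k + 0 + rho * mu E H' M' \<le> rho * mu E H M" "real \<kappa> + 0 + Ph H' M' b' \<le> Ph H M b"
        using k \<open>0 \<le> sm\<close> by linarith+
      ultimately show ?thesis unfolding Done_def by blast
    qed
    show "Done 0 0 St H M b pr v"
    proof (cases "v \<notin> H \<and> v \<notin> M \<and> N v \<inter> (M - H) = {} \<and> b v = None")
      case True
      then show ?thesis using caseD[OF IH HV ni inv St, of pr] weaken[of 8 4] by simp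
    next
      case nd: False
      have res: "resume H M b v = Serve" using nd by (auto simp: resume_def)
      show ?thesis
      proof (cases "v \<in> H \<and> v \<in> M \<or> {u. b u = Some v} = {}")
        case True
        have "t_run alg ok E (cfg H M b (idle(v := resume H M b v)) pr) 0 0 (cfg H M b (idle(v := Serve)) pr)"
          unfolding res by (rule t_run_refl)
        moreover have "v \<notin> H \<longrightarrow> v \<notin> M \<longrightarrow> N v \<inter> (M - H) = {} \<longrightarrow> b v \<noteq> None"
          using nd by (intro impI) (simp del: not_None_eq)
        ultimately show ?thesis unfolding Done_def using True inv
          by (intro exI[of _ H] exI[of _ M] exI[of _ b] exI[of _ "0::nat"] conjI) (assumption | simp)+
      next
        case False
        then have ch: "{u. b u = Some v} \<noteq> {}" and nS: "\<not> (v \<in> H \<and> v \<in> M)" and bv: "b v = None" using bc by auto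
        show ?thesis
        proof (cases "v \<in> M")
          case vM: False
          show ?thesis using caseR[OF IH HV ni inv St bv vM ch res] weaken[of 4 2] by simp
        next
          case True
          then have vP: "v \<in> M - H" using nS by blast
          define u where u: "u = Min {u. b u = Some v}"
          have "finite {u. b u = Some v}" by (rule finite_subset[OF _ inv_finite[OF inv]]) auto
          then have bu: "b u = Some v" using Min_in[of "{u. b u = Some v}"] ch u by auto
          have vN: "v \<in> N u" using D(4)[OF bu] by (simp add: in_neighbours')
          have chu: "{x. (b(u := None)) x = Some u} \<noteq> {}"
          proof -
            obtain x where x: "b x = Some u" using D(6)[OF bu vP] by blast
            have "x \<noteq> u" using D(4)[OF x] loop by auto
            then show ?thesis using x by auto
          qed
          have "resume H M (b(u := None)) u = Serve" using vN vP by (auto simp: resume_def)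
          then have "Done 4 2 (insert u St) H M (b(u := None)) (pr(u := v # pr u)) u"
            using D(5)[OF bu] vN chu by (intro caseR[OF IH HV _ inv_unregister[OF inv bu bv]]) auto
          then show ?thesis by (intro visit_Done[OF IH HV ni inv St bv nS ch u res]) auto
        qed
      qed
    qed
  qed
qed

end

section \<open>Handling one update\<close>

text \<open>With an empty stack no light member has a list, so there are no relays, and hence nobody
  outside the set has a list either.\<close>

lemma inv_idle:
  assumes inv: "inv_at E {} H M b"
  shows "b v = Some z \<Longrightarrow> z \<in> H \<and> z \<in> M" "v \<notin> M \<Longrightarrow> {u. b u = Some v} = {}" "v \<notin> H \<Longrightarrow> {u. b u = Some v} = {}"
    "b v = Some z \<Longrightarrow> v \<notin> H \<and> v \<notin> M \<and> neighbours E v \<inter> (M - H) = {}"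
proof -
  note D = inv_atD[OF inv]
  show 1: "b v = Some z \<Longrightarrow> z \<in> H \<and> z \<in> M" for v z
  proof -
    assume z: "b v = Some z"
    then have ne: "{u. b u = Some z} \<noteq> {}" by blast
    have "z \<notin> M - H" using D(9)[OF _ ne] by blast
    moreover have "z \<in> M"
    proof (rule ccontr)
      assume "z \<notin> M"
      then obtain y where y: "y \<in> M - H" "b z = Some y" using D(8)[OF _ ne] by blast
      then have "{u. b u = Some y} \<noteq> {}" by blast
      then show False using D(9)[OF y(1)] by blast
    qed
    ultimately show ?thesis by blast
  qed
  show "v \<notin> M \<Longrightarrow> {u. b u = Some v} = {}" "v \<notin> H \<Longrightarrow> {u. b u = Some v} = {}" using 1[of _ v] by auto
  assume b: "b v = Some z"
  then have "z \<notin> M - H" using 1[of v z] by blast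
  then show "v \<notin> H \<and> v \<notin> M \<and> neighbours E v \<inter> (M - H) = {}" using D(7)[OF b] D(5)[OF b] by blast
qed

lemma inv_idleI:
  assumes "\<And>u v. u \<in> M \<Longrightarrow> v \<in> M \<Longrightarrow> {u, v} \<notin> E"
    and "\<And>v. v \<in> H \<Longrightarrow> v \<notin> M \<Longrightarrow> neighbours E v \<inter> M \<noteq> {}"
    and "\<And>v. v \<notin> H \<Longrightarrow> v \<notin> M \<Longrightarrow> neighbours E v \<inter> (M - H) = {} \<Longrightarrow> b v \<noteq> None"
    and "\<And>v z. b v = Some z \<Longrightarrow> {v, z} \<in> E \<and> z \<in> H \<and> z \<in> M"
    and "\<And>v z. b v = Some z \<Longrightarrow> v \<notin> H \<and> v \<notin> M \<and> neighbours E v \<inter> (M - H) = {}"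
  shows "inv_at E {} H M b"
proof -
  have ch: "v \<notin> M \<or> v \<notin> H \<Longrightarrow> {u. b u = Some v} = {}" for v using assms(4) by blast
  show ?thesis
    unfolding inv_at_def
  proof (intro conjI allI ballI impI; (elim conjE)?)
    fix v z assume a: "b v = Some z" "z \<notin> M - H"
    show "v \<notin> H" "neighbours E v \<inter> (M - H) = {}" "{u. b u = Some v} = {}" using assms(5)[OF a(1)] ch[of v] by auto
  next
    fix v z assume "b v = Some z" "z \<in> M - H"
    then show "{u. b u = Some v} \<noteq> {}" using assms(4) by blast
  next
    fix v assume "v \<notin> M" "{u. b u = Some v} \<noteq> {}"
    then show "\<exists>z. z \<in> M - H \<and> b v = Some z" using ch by simp
  next
    fix v assume "v \<in> M - H" "{u. b u = Some v} \<noteq> {}"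
    then show "v \<in> {}" using ch by simp
  next
    fix v z assume "b v = Some z"
    then show "{v, z} \<in> E" "v \<notin> M" using assms(4,5) by auto
  next
    fix u v assume "u \<in> M" "v \<in> M" then show "{u, v} \<notin> E" by (rule assms(1))
  next
    fix v assume "v \<in> H" "v \<notin> M" then show "neighbours E v \<inter> M \<noteq> {}" by (rule assms(2))
  next
    fix v assume "v \<notin> H" "v \<notin> M" "neighbours E v \<inter> (M - H) = {}" then show "b v \<noteq> None" by (rule assms(3))
  qed
qed

context env
begin

abbreviation nopr :: "nat \<Rightarrow> nat list" where "nopr \<equiv> \<lambda>_. []"

text \<open>The potential left over is part of both bounds, so that they telescope over the update
  sequence.\<close>

definition Settles :: "(nat \<Rightarrow> 's st) \<Rightarrow> nat \<Rightarrow> real \<Rightarrow> bool" where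
  "Settles s0 kb cb \<longleftrightarrow> (\<exists>H' M' b' k \<kappa>. t_run alg ok E s0 k \<kappa> (cfg H' M' b' idle nopr) \<and> inv_at E {} H' M' b' \<and> H' \<subseteq> V \<and>
     k + rho * mu E H' M' \<le> kb \<and> real \<kappa> + Ph H' M' b' \<le> cb)"

lemma Settles_refl:
  assumes "inv_at E {} H M b" "H \<subseteq> V"
  shows "Settles (cfg H M b idle nopr) (rho * mu E H M) (Ph H M b)"
proof -
  have "0 + rho * mu E H M \<le> rho * mu E H M" "real 0 + Ph H M b \<le> Ph H M b" by simp_all
  then show ?thesis unfolding Settles_def using t_run_refl assms by blast
qed

lemma Settles_trans:
  assumes "t_run alg ok E s0 k \<kappa> s1" "Settles s1 kb cb" "k + kb \<le> kb'" "real \<kappa> + cb \<le> cb'"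
  shows "Settles s0 kb' cb'"
proof -
  obtain H' M' b' k' \<kappa>' where r: "t_run alg ok E s1 k' \<kappa>' (cfg H' M' b' idle nopr)"
    and o: "inv_at E {} H' M' b'" "H' \<subseteq> V" "k' + rho * mu E H' M' \<le> kb" "real \<kappa>' + Ph H' M' b' \<le> cb"
    using assms(2) unfolding Settles_def by blast
  have "k + k' + rho * mu E H' M' \<le> kb'" "real (\<kappa> + \<kappa>') + Ph H' M' b' \<le> cb'" using o assms(3,4) by simp_all
  then show ?thesis unfolding Settles_def using t_run_trans[OF assms(1) r] o by blast
qed

lemma root_settles:
  assumes inv: "inv_at E {y} H M b" and HV: "H \<subseteq> V" and by0: "b y = None" and res: "resume H M b y = Serve"
  shows "Settles (cfg H M b (idle(y := Serve)) nopr) (1 + rho * mu E H M) (Ph H M b)"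
proof -
  have "Done 0 0 {y} H M b nopr y"
  \<comment> \<open>\<open>Claim\<close> excludes isolated vertices because their joins do not lower
    \<open>mu\<close>; an isolated root has nobody to serve.\<close>
  proof (cases "N y = {}")
    case False
    then show ?thesis using serve[of "mu E H M"] inv HV by0 unfolding Claim_def by blast
  next
    case True
    have "b u \<noteq> Some y" for u
    proof
      assume "b u = Some y"
      then have "u \<in> N y" using inv_atD(4)[OF inv] by (simp add: in_neighbours)
      then show False using True by simp
    qed
    then have ch: "{u. b u = Some y} = {}" by blast
    have nd: "y \<notin> H \<longrightarrow> y \<notin> M \<longrightarrow> N y \<inter> (M - H) = {} \<longrightarrow> b y \<noteq> None"
      using res by (auto simp: resume_def split: if_splits)
    have "t_run alg ok E (cfg H M b (idle(y := resume H M b y)) nopr) 0 0 (cfg H M b (idle(y := Serve)) nopr)"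
      unfolding res by (rule t_run_refl)
    then show ?thesis unfolding Done_def using ch nd inv
      by (intro exI[of _ H] exI[of _ M] exI[of _ b] exI[of _ "0::nat"] conjI) (assumption | simp)+
  qed
  then obtain H' M' b' k \<kappa> where r: "t_run alg ok E (cfg H M b (idle(y := Serve)) nopr) k \<kappa> (cfg H' M' b' (idle(y := Serve)) nopr)"
    and i: "inv_at E {y} H' M' b'" "H' \<subseteq> H" and du: "y \<in> H' \<and> y \<in> M' \<or> {x. b' x = Some y} = {}"
     and du2: "y \<notin> H' \<longrightarrow> y \<notin> M' \<longrightarrow> N y \<inter> (M' - H') = {} \<longrightarrow> b' y \<noteq> None"
    and k: "k + 0 + rho * mu E H' M' \<le> rho * mu E H M" "real \<kappa> + 0 + Ph H' M' b' \<le> Ph H M b"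
    unfolding Done_def res by blast
  have inv2: "inv_at E {} H' M' b'" using inv_pop[of E y "{}", OF i(1) du] du2 by blast
  have r2: "t_run alg ok E (cfg H' M' b' (idle(y := Serve)) nopr) 1 0 (cfg H' M' b' idle nopr)"
    by (rule finish[OF i(1) du]) simp
  have "H' \<subseteq> V" using i(2) HV by blast
  moreover have "k + 1 + rho * mu E H' M' \<le> 1 + rho * mu E H M" "real (\<kappa> + 0) + Ph H' M' b' \<le> Ph H M b" using k by simp_all
  ultimately show ?thesis unfolding Settles_def using t_run_trans[OF r r2] inv2 by blast
qed

lemma resume_M: "v \<in> M \<Longrightarrow> resume H M b v = Serve" "v \<in> H \<Longrightarrow> resume H M b v = Serve"
  "N v \<inter> (M - H) \<noteq> {} \<Longrightarrow> resume H M b v = Serve"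
  by (auto simp: resume_def)

lemma LamD: "1 \<le> Lam * theta E"
proof -
  have "0 \<le> (real (T n) + 1) * theta E" using theta_ge(1)[of E] by simp
  then show ?thesis using LamT by linarith
qed

subsection \<open>Deletion\<close>

lemma delete_settles:
  assumes E0: "E = E0 - {{u, v}}" "{u, v} \<in> E0" "finite E0" and inv0: "inv_at E0 {} H M b" and HV: "H \<subseteq> V"
    and uv: "u \<noteq> v" "u \<in> V" "v \<in> V"
  shows "\<exists>b1. registered b1 \<le> registered b \<and>
    Settles (t_wake alg (Delete u v) (conf n E0 H M b H M b idle (\<lambda>_. False) nopr))
      (2 * rho + rho * mu E H M) (Ph H M b1 + Lam * theta E)"
proof -
  note D = inv_atD[OF inv0] and I = inv_idle[OF inv0]
  define b1 where "b1 x = (if x = u \<and> b u = Some v \<or> x = v \<and> b v = Some u then None else b x)" for x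
  define nd1 where "nd1 x \<longleftrightarrow> x \<notin> M \<and> x \<notin> H \<and> N x \<inter> (M - H) = {} \<and> b1 x = None" for x
  define nd2 where "nd2 x \<longleftrightarrow> x \<notin> M \<and> x \<in> H \<and> N x \<inter> M = {}" for x
  define f where "f x = (if x = u \<or> x = v then
       (if nd1 x then Op (mem0 1 0 x (degree E x)) else if nd2 x then Op (mem0 2 0 x (degree E x)) else Idle) else Idle)" for x
  have Nu: "N u = neighbours E0 u - {v}" "N v = neighbours E0 v - {u}"
    "x \<noteq> u \<Longrightarrow> x \<noteq> v \<Longrightarrow> N x = neighbours E0 x" for x
    by (auto simp: E0(1) neighbours_def doubleton_eq_iff)
  have wake: "t_wake alg (Delete u v) (conf n E0 H M b H M b idle (\<lambda>_. False) nopr) = conf n E H M b1 H M b1 f (\<lambda>_. False) nopr"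
  proof -
    have one: "notify (Deleted y) (conf n E0 H M b H M b idle (\<lambda>_. False) nopr x) = conf n E H M b1 H M b1 f (\<lambda>_. False) nopr x"
      if xy: "x = u \<and> y = v \<or> x = v \<and> y = u" for x y
    proof -
      have Nx: "neighbours E0 x - {y} = N x" using xy Nu by blast
      have ch: "{z. b z = Some x} - {y} = {z. b1 z = Some x}" using xy uv(1) by (auto simp: b1_def)
      have bx: "(if b x = Some y then None else b x) = b1 x" using xy uv(1) by (auto simp: b1_def)
      have sub: "neighbours E0 x \<inter> C - {y} = N x \<inter> C" for C using Nx by blast
      have nS: "(if x \<in> H \<or> x \<in> H then neighbours E0 x \<inter> (M \<inter> H) else {}) - {y} =
          (if x \<in> H \<or> x \<in> H then N x \<inter> (M \<inter> H) else {})" using sub by simp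
      have nd2: "(x \<notin> M \<and> x \<in> H \<and> N x \<inter> (M - H) = {} \<and> (if x \<in> H \<or> x \<in> H then N x \<inter> (M \<inter> H) else {}) = {}) = nd2 x"
        unfolding nd2_def by auto
      have fx: "f x = (if nd1 x then Op (mem0 1 0 x (degree E x)) else if nd2 x then Op (mem0 2 0 x (degree E x)) else Idle)"
        using xy by (auto simp: f_def)
      show ?thesis
        unfolding notify.simps Let_def conf_def st.simps bx ch sub nS Nx nd2 fx nd1_def by (rule refl)
    qed
    have rest: "conf n E0 H M b H M b idle (\<lambda>_. False) nopr x = conf n E H M b1 H M b1 f (\<lambda>_. False) nopr x" if x: "x \<noteq> u" "x \<noteq> v" for x
    proof -
      have "{z. b z = Some x} = {z. b1 z = Some x}" using x by (auto simp: b1_def)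
      moreover have "b1 x = b x" "f x = Idle" using x by (auto simp: b1_def f_def)
      ultimately show ?thesis unfolding conf_def Nu(3)[OF x] by simp
    qed
    show ?thesis
      by (rule ext) (use one[of u v] one[of v u] rest uv(1) in \<open>simp\<close>)
  qed
  have regsub: "{x. b1 x \<noteq> None} \<subseteq> {x. b x \<noteq> None}" by (auto simp: b1_def)
  have finb: "finite {x. b x \<noteq> None}"
    by (rule finite_subset[OF _ finite_imageI[OF finite_edge_pairs[OF E0(3)], of fst]]) (use D(4) in force)
  have reg: "registered b1 \<le> registered b" unfolding registered_def by (rule card_mono[OF finb regsub])
  have b1E: "{x, z} \<in> E \<and> z \<in> H \<and> z \<in> M" if "b1 x = Some z" for x z
  proof -
    have bx: "b x = Some z" using that by (auto simp: b1_def split: if_splits)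
    have "{x, z} \<noteq> {u, v}" using that bx by (auto simp: b1_def doubleton_eq_iff split: if_splits)
    then show ?thesis using D(4)[OF bx] I(1)[OF bx] E0(1) by blast
  qed
  have b1D: "x \<notin> H \<and> x \<notin> M \<and> N x \<inter> (M - H) = {}" if "b1 x = Some z" for x z
  proof -
    have "b x = Some z" using that by (auto simp: b1_def split: if_splits)
    moreover have "N x \<subseteq> neighbours E0 x" by (auto simp: E0(1) neighbours_def)
    ultimately show ?thesis using I(4)[of x z] by blast
  qed
  have ch1: "x \<notin> M \<or> x \<notin> H \<Longrightarrow> {y. b1 y = Some x} = {}" for x using b1E by blast
  have ind: "x \<in> M \<Longrightarrow> y \<in> M \<Longrightarrow> {x, y} \<notin> E" for x y using D(1) E0(1) by blast
  have cov: "x \<in> H \<Longrightarrow> x \<notin> M \<Longrightarrow> \<not> ((x = u \<or> x = v) \<and> nd2 x) \<Longrightarrow> N x \<inter> M \<noteq> {}" for x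
    using D(2)[of x] Nu(3)[of x] by (auto simp: nd2_def)
  have dirt: "x \<notin> H \<Longrightarrow> x \<notin> M \<Longrightarrow> N x \<inter> (M - H) = {} \<Longrightarrow> \<not> ((x = u \<or> x = v) \<and> nd1 x) \<Longrightarrow> b1 x \<noteq> None" for x
    using D(3)[of x] Nu(3)[of x] by (cases "x = u \<or> x = v") (auto simp: nd1_def b1_def)
  \<comment> \<open>An endpoint in need of repair has just lost its last cover or its boss, and in
    both cases that was the other endpoint. So the other one is in the set, and a single operation
    starts.\<close>
  have other: "nd1 x \<or> nd2 x \<Longrightarrow> x = u \<and> y = v \<or> x = v \<and> y = u \<Longrightarrow> y \<in> M" for x y
  proof -
    assume a: "nd1 x \<or> nd2 x" "x = u \<and> y = v \<or> x = v \<and> y = u"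
    have Nx: "N x = neighbours E0 x - {y}" using a(2) Nu by blast
    show "y \<in> M"
    proof (cases "nd2 x")
      case True
      then show ?thesis using D(2)[of x] Nx by (auto simp: nd2_def)
    next
      case False
      then have n1: "nd1 x" using a by blast
      show ?thesis
      proof (cases "neighbours E0 x \<inter> (M - H) = {}")
        case True
        then obtain z where z: "b x = Some z" using D(3)[of x] n1 by (auto simp: nd1_def)
        then have "z = y" using n1 a(2) by (auto simp: nd1_def b1_def split: if_splits)
        then show ?thesis using I(1)[OF z] by blast
      next
        case False
        then show ?thesis using n1 Nx by (auto simp: nd1_def)
      qed
    qed
  qed
  show ?thesis
  proof (cases "\<exists>y. (y = u \<or> y = v) \<and> (nd1 y \<or> nd2 y)")
    case False
    have "f = idle" using False by (auto simp: f_def fun_eq_iff)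
    moreover have "inv_at E {} H M b1"
      by (rule inv_idleI[OF ind cov dirt b1E b1D]) (use False in blast)+
    ultimately have "Settles (conf n E H M b1 H M b1 f (\<lambda>_. False) nopr) (rho * mu E H M) (Ph H M b1)"
      using Settles_refl[OF _ HV, of M b1] by (simp add: cfg_def)
    then have "Settles (conf n E H M b1 H M b1 f (\<lambda>_. False) nopr) (2 * rho + rho * mu E H M) (Ph H M b1 + Lam * theta E)"
      by (rule Settles_trans[OF t_run_refl[where c = 0]]) (use LamD in simp_all)
    then show ?thesis unfolding wake using reg by blast
  next
    case True
    then obtain y where y: "y = u \<or> y = v" "nd1 y \<or> nd2 y" by blast
    define x where "x = (if y = u then v else u)"
    have xy: "y = u \<and> x = v \<or> y = v \<and> x = u" using y(1) by (auto simp: x_def)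
    have xM: "x \<in> M" using other[OF y(2) xy] .
    define kd where "kd = (if nd1 y then 1 else 2 :: nat)"
    have f: "f = idle(y := Op (mem0 kd 0 y (degree E y)))"
    proof
      fix z
      have "\<not> nd1 x" "\<not> nd2 x" using xM by (simp_all add: nd1_def nd2_def)
      moreover have "z = u \<or> z = v \<longleftrightarrow> z = y \<or> z = x" using xy by blast
      ultimately show "f z = (idle(y := Op (mem0 kd 0 y (degree E y)))) z"
        using y(2) unfolding f_def kd_def by (cases "z = y"; cases "z = x") auto
    qed
    have only: "z = u \<or> z = v \<Longrightarrow> nd1 z \<or> nd2 z \<Longrightarrow> z = y" for z
      using xy xM by (auto simp: nd1_def nd2_def)
    have yV: "y \<in> V" using y uv by auto
    let ?P = "\<lambda>H' M' b' \<kappa>.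
      t_run alg ok E (conf n E H M b1 H M b1 (idle(y := Op (mem0 kd 0 y (degree E y)))) (\<lambda>x. kd = 3 \<and> x = y) nopr)
        (17 + T n) \<kappa> (cfg H' M' b' (idle((if kd = 3 then y else y) := Serve)) nopr) \<and>
      inv_at E {y} H' M' b' \<and> H' \<subseteq> H \<and> mu E H' M' \<le> mu E H M \<and>
      (kd = 1 \<and> N y \<noteq> {} \<longrightarrow> mu E H' M' < mu E H M) \<and>
      real \<kappa> + Ph H' M' b' \<le> Ph H M b1 + (if kd = 1 \<and> N y \<noteq> {} then - 4 else Lam * theta E) \<and>
      (kd = 1 \<longrightarrow> b' y = None \<and> (y \<notin> M' \<longrightarrow> N y \<inter> (M' - H') \<noteq> {})) \<and>
      (kd = 2 \<longrightarrow> y \<in> M' \<and> y \<in> H') \<and> (kd = 3 \<longrightarrow> b' y = None \<and> y \<in> H')"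
    have "\<exists>H' M' b' \<kappa>. ?P H' M' b' \<kappa>"
    proof (rule operation[OF HV yV])
      show "kd \<in> {1, 2, 3}" by (simp add: kd_def)
      show "kd = 1 \<Longrightarrow> y \<notin> H \<and> y \<notin> M \<and> N y \<inter> (M - H) = {} \<and> b1 y = None \<and> y \<in> {y}"
        by (auto simp: kd_def nd1_def split: if_splits)
      show "kd = 2 \<Longrightarrow> y \<in> H \<and> y \<notin> M \<and> N y \<inter> M = {} \<and> {z. b1 z = Some y} = {}"
        using y(2) ch1[of y] by (auto simp: kd_def nd2_def split: if_splits)
      show "kd = 3 \<Longrightarrow> {y, y} \<in> E \<and> y \<in> M \<and> y \<in> M \<and> y \<in> H \<and> y \<in> {y}" by (simp add: kd_def split: if_splits)
      show "kd = 3 \<and> {p, q} = {y, y}" if "p \<in> M" "q \<in> M" "{p, q} \<in> E" for p q using ind that by blast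
      show "N z \<inter> M \<noteq> {}" if "z \<in> H" "z \<notin> M" "z \<noteq> y" for z using cov[OF that(1,2)] only[of z] that(3) by blast
      show "b1 z \<noteq> None" if "z \<notin> H" "z \<notin> M" "z \<notin> {y}" "N z \<inter> (M - H) = {}" for z
        using dirt[OF that(1,2,4)] only[of z] that(3) by blast
      show "{p, z} \<in> E" "p \<notin> M" if "b1 p = Some z" for p z using b1E[OF that] b1D[OF that] by auto
      show "{q. b1 q = Some p} \<noteq> {}" if "b1 p = Some z" "z \<in> M - H" for p z using b1E[OF that(1)] that(2) by blast
      show "p \<notin> H \<and> N p \<inter> (M - H) = {} \<and> {q. b1 q = Some p} = {}" if "b1 p = Some z" "z \<notin> M - H" for p z
        using b1D[OF that(1)] ch1[of p] by blast
      show "\<exists>z. z \<in> M - H \<and> b1 p = Some z" if "p \<notin> M" "{q. b1 q = Some p} \<noteq> {}" "p \<notin> {y}" for p using ch1[of p] that by blast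
      show "p \<in> {y}" if "p \<in> M - H" "{q. b1 q = Some p} \<noteq> {}" for p using ch1[of p] that by blast
    qed
    then obtain H' M' b' \<kappa> where P: "?P H' M' b' \<kappa>" by blast
    have k3: "kd \<noteq> 3" "kd = 1 \<or> kd = 2" by (auto simp: kd_def)
    have kf: "(\<lambda>x. kd = 3 \<and> x = y) = (\<lambda>_. False)" using k3 by simp
    have r: "t_run alg ok E (conf n E H M b1 H M b1 f (\<lambda>_. False) nopr) (17 + T n) \<kappa> (cfg H' M' b' (idle(y := Serve)) nopr)"
      using P unfolding f kf by simp
    have i: "inv_at E {y} H' M' b'" "H' \<subseteq> V" using P HV by auto
    have bN: "b' y = None" using P k3 inv_atD(5)[OF i(1), of y] by (cases "b' y") auto
    have P12: "kd = 1 \<longrightarrow> b' y = None \<and> (y \<notin> M' \<longrightarrow> N y \<inter> (M' - H') \<noteq> {})" "kd = 2 \<longrightarrow> y \<in> M' \<and> y \<in> H'"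
      using P by simp_all
    have res: "resume H' M' b' y = Serve" using P12 k3(2) resume_M[of y M' H' b'] by argo
    have "Settles (conf n E H M b1 H M b1 f (\<lambda>_. False) nopr) (2 * rho + rho * mu E H M) (Ph H M b1 + Lam * theta E)"
    proof (rule Settles_trans[OF r root_settles[OF i bN res]])
      have "rho * mu E H' M' \<le> rho * mu E H M" using P by simp
      moreover have "18 + T n \<le> 2 * rho" by (simp add: rho_def)
      ultimately show "17 + T n + (1 + rho * mu E H' M') \<le> 2 * rho + rho * mu E H M" by linarith
      have "(if kd = 1 \<and> N y \<noteq> {} then - 4 else Lam * theta E) \<le> Lam * theta E" using LamD by simp
      then show "real \<kappa> + Ph H' M' b' \<le> Ph H M b1 + Lam * theta E" using P by linarith
    qed
    then show ?thesis unfolding wake using reg by blast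
  qed
qed

subsection \<open>Insertion\<close>

text \<open>In this round the endpoints do not know each other's status, which the configurations of
  \<open>round_conf\<close> presuppose, so it is computed directly from the states.\<close>

lemma greet:
  assumes E0: "E = insert {u, v} E0" "{u, v} \<notin> E0" and inv0: "inv_at E0 {} H M b" and uv: "u \<noteq> v"
  defines "lose x y \<equiv> x \<in> M \<and> y \<in> M \<and> (if (x \<in> H) = (y \<in> H) then y < x else x \<in> H)"
  defines "loser x \<equiv> x = u \<and> lose u v \<or> x = v \<and> lose v u"
  defines "winner x \<equiv> u \<in> M \<and> v \<in> M \<and> (x = u \<or> x = v) \<and> \<not> loser x"
  shows "t_run alg ok E (t_wake alg (Insert u v) (conf n E0 H M b H M b idle (\<lambda>_. False) nopr)) 1 2
    (conf n E H M b (H \<union> Collect loser) M (\<lambda>x. if N x \<inter> (M - H) = {} then b x else None)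
      (\<lambda>x. if winner x then CW 1 else Idle) loser nopr)"
proof -
  note D = inv_atD[OF inv0] and I = inv_idle[OF inv0]
  define ss where "ss = t_wake alg (Insert u v) (conf n E0 H M b H M b idle (\<lambda>_. False) nopr)"
  let ?b1 = "\<lambda>x. if N x \<inter> (M - H) = {} then b x else None"
  define pair where "pair x z \<longleftrightarrow> x = u \<and> z = v \<or> x = v \<and> z = u" for x z
  define g where "g x = (if x = u then Greet v else if x = v then Greet u else Idle :: 's phase)" for x
  have Nx: "z \<in> N x \<longleftrightarrow> z \<in> neighbours E0 x \<or> pair x z" for x z
    by (auto simp: E0(1) neighbours_def doubleton_eq_iff pair_def)
  have np: "pair x z \<Longrightarrow> z \<notin> neighbours E0 x" for x z using E0(2) by (auto simp: pair_def neighbours_def insert_commute)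
  have s0: "ss x = (conf n E0 H M b H M b idle (\<lambda>_. False) nopr x)\<lparr>nbs := N x, ph := g x\<rparr>" for x
  proof -
    have "N u = insert v (neighbours E0 u)" "N v = insert u (neighbours E0 v)" "x \<noteq> u \<Longrightarrow> x \<noteq> v \<Longrightarrow> N x = neighbours E0 x"
      by (auto simp: Nx pair_def)
    then show ?thesis unfolding ss_def using uv by (auto simp: g_def conf_def)
  qed
  have sent: "t_sent alg E ss z x = (if pair x z then Some (Some (z \<in> H, z \<in> M), None, None) else None)" for z x
  proof -
    have "stsend (ss z) x = (if pair x z then Some (z \<in> H, z \<in> M) else None)"
      unfolding s0 using uv by (auto simp: stsend_def conf_def g_def pair_def)
    moreover have "rgsend (ss z) x = None" unfolding s0 by (auto simp: rgsend_def conf_def)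
    moreover have "opsend (ss z) x = None" unfolding s0 by (auto simp: opsend_def conf_def g_def)
    moreover have "pair x z \<Longrightarrow> {z, x} \<in> E" by (auto simp: pair_def E0(1))
    ultimately show ?thesis by (simp add: t_sent_def send_def)
  qed
  have ins: "stin (\<lambda>z. t_sent alg E ss z x) = (\<lambda>z. if pair x z then Some (z \<in> H, z \<in> M) else None)"
    "rgin (\<lambda>z. t_sent alg E ss z x) = (\<lambda>_. None)" "opin (\<lambda>z. t_sent alg E ss z x) = (\<lambda>_. None)" for x
    by (auto simp: fun_eq_iff stin_def rgin_def opin_def sent)
  have sel: "nn (ss x) = n" "me (ss x) = x" "nbs (ss x) = N x" "isH (ss x) = (x \<in> H)" "inM (ss x) = (x \<in> M)"
    "nH (ss x) = neighbours E0 x \<inter> H" "nP (ss x) = neighbours E0 x \<inter> (M - H)"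
    "nS (ss x) = (if x \<in> H then neighbours E0 x \<inter> (M \<inter> H) else {})" "boss (ss x) = b x"
    "ch (ss x) = {z. b z = Some x}" "ph (ss x) = g x" "kick (ss x) = False" "prs (ss x) = []" for x
    unfolding s0 by (simp_all add: conf_def)
  have round: "t_round alg E ss = conf n E H M b (H \<union> Collect loser) M ?b1 (\<lambda>x. if winner x then CW 1 else Idle) loser nopr"
  proof
    fix x
    let ?si = "\<lambda>z. if pair x z then Some (z \<in> H, z \<in> M) else None"
    let ?nS = "if x \<in> H then N x \<inter> (M \<inter> H) else {z. pair x z \<and> z \<in> M \<inter> H}"
    have e1: "{z \<in> N x. case ?si z of Some (h, _) \<Rightarrow> h | None \<Rightarrow> z \<in> neighbours E0 x \<inter> H} = N x \<inter> H"
      by (auto simp: Nx split: if_splits)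
    have e2: "{z \<in> N x. case ?si z of Some (h, m) \<Rightarrow> \<not> h \<and> m | None \<Rightarrow> z \<in> neighbours E0 x \<inter> (M - H)} = N x \<inter> (M - H)"
      by (auto simp: Nx split: if_splits)
    have e3: "{z \<in> N x. case ?si z of Some (h, m) \<Rightarrow> h \<and> m | None \<Rightarrow> z \<in> (if x \<in> H then neighbours E0 x \<inter> (M \<inter> H) else {})} = ?nS"
      by (auto simp: Nx split: if_splits)
    have a: "act (ss x) (N x \<inter> (M - H)) ?nS {z. b z = Some x} ?si (\<lambda>_. None) =
      \<lparr>a_H = x \<in> H \<union> Collect loser, a_M = x \<in> M, a_req = None, a_ph = if winner x then CW 1 else Idle, a_kick = loser x, a_prs = []\<rparr>"
      using uv unfolding act_def Let_def sel
      by (cases "x = u"; cases "x = v"; simp add: g_def pair_def winner_def loser_def lose_def; blast)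
    have tk: "\<not> tokened (\<lambda>_. None) X" for X by (simp add: tokened_def)
    \<comment> \<open>A loser that turns heavy starts with an empty record of heavy members around
      it. That is correct: it belongs to an independent set, and its opponent is light as
      well.\<close>
    have S: "(if x \<in> H \<union> Collect loser \<or> x \<in> H then ?nS else {}) =
        (if x \<in> H \<union> Collect loser \<or> x \<in> H then N x \<inter> (M \<inter> H) else {})"
    proof (cases "x \<in> H \<or> \<not> loser x")
      case False
      then have "x \<in> M" "\<And>z. pair x z \<Longrightarrow> z \<notin> H" using uv by (auto simp: loser_def lose_def pair_def split: if_splits)
      moreover have "z \<notin> M" if "z \<in> neighbours E0 x" for z using D(1)[OF \<open>x \<in> M\<close>, of z] that by (auto simp: in_neighbours')
      ultimately have "N x \<inter> (M \<inter> H) = {}" "{z. pair x z \<and> z \<in> M \<inter> H} = {}" using Nx[of _ x] by blast+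
      then show ?thesis using False by simp
    qed auto
    have N0: "neighbours E0 x \<inter> (M - H) \<subseteq> N x \<inter> (M - H)" by (auto simp: Nx)
    have B: "(if b x = None then
              (if (None :: nat option) \<noteq> None then None
               else if x \<notin> H \<and> x \<notin> M \<and> N x \<inter> (M - H) = {} \<and> ?nS \<noteq> {} \<and> {z. b z = Some x} = {} then Some (Min ?nS) else None)
            else if x \<notin> M \<and> (x \<notin> H \<union> Collect loser \<and> N x \<inter> (M - H) = {} \<or> {z. b z = Some x} \<noteq> {}) then b x else None) = ?b1 x"
    proof (cases "b x")
      case None
      have "\<not> (x \<notin> H \<and> x \<notin> M \<and> N x \<inter> (M - H) = {})" using D(3)[of x] N0 None by blast
      then show ?thesis using None by auto
    next
      case (Some z)
      have "x \<notin> H" "x \<notin> M" using I(4)[OF Some] by auto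
      moreover have "\<not> loser x" using \<open>x \<notin> M\<close> by (auto simp: loser_def lose_def)
      moreover have "{z. b z = Some x} = {}" using I(2)[OF \<open>x \<notin> M\<close>] .
      ultimately show ?thesis using Some by simp
    qed
    show "t_round alg E ss x = conf n E H M b (H \<union> Collect loser) M ?b1 (\<lambda>x. if winner x then CW 1 else Idle) loser nopr x"
      unfolding t_round_def alg_simps step_def Let_def ins option.case(1) unfolding sel e1 e2 e3 Collect_mem_eq
      unfolding mem_Collect_eq a act.simps S if_not_P[OF tk] B conf_def by (rule refl)
  qed
  have "{(z, x). t_sent alg E ss z x \<noteq> None} \<subseteq> {(u, v), (v, u)}" by (auto simp: sent pair_def split: if_splits)
  then have "t_msgs alg E ss \<le> card {(u, v), (v, u)}" unfolding t_msgs_def by (intro card_mono) auto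
  moreover have "card {(u, v), (v, u)} = 2" using uv by simp
  ultimately have 2: "t_msgs alg E ss \<le> 2" by simp
  have okm: "ok m" if "t_sent alg E ss p q = Some m" for p q m
  proof -
    have "snd (snd m) = None" using that sent[of p q] by (cases "pair q p") auto
    then show ?thesis by (simp add: okmsg_def okop_def)
  qed
  show ?thesis unfolding ss_def[symmetric] by (rule t_run_step[OF round 2 okm])
qed

lemma insert_settles:
  assumes E0: "E = insert {u, v} E0" "{u, v} \<notin> E0" and inv0: "inv_at E0 {} H M b" and HV: "H \<subseteq> V"
    and uv: "u \<noteq> v" "u \<in> V" "v \<in> V"
  shows "Settles (t_wake alg (Insert u v) (conf n E0 H M b H M b idle (\<lambda>_. False) nopr))
      (3 * rho + rho * mu E H M) (Ph H M b + 4 * Lam * theta E)"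
proof -
  note D = inv_atD[OF inv0] and I = inv_idle[OF inv0]
  let ?s0 = "t_wake alg (Insert u v) (conf n E0 H M b H M b idle (\<lambda>_. False) nopr)"
  have th: "5 * theta E \<le> Lam * theta E" "1 \<le> theta E" "1 \<le> Lam * theta E"
    using theta_ge(1)[of E] mult_right_mono[of 5 Lam "theta E"] LamD by (auto simp: Lam_def)
  have sub: "neighbours E0 x \<subseteq> N x" for x by (auto simp: E0(1) neighbours_def)
  have Nx: "x \<noteq> u \<Longrightarrow> x \<noteq> v \<Longrightarrow> N x = neighbours E0 x" for x by (auto simp: E0(1) neighbours_def doubleton_eq_iff)
  have finb: "finite {x. b x \<noteq> None}"
    by (rule finite_subset[OF _ finite_imageI[OF finite_edge_pairs[OF finE], of fst]]) (use D(4) E0(1) in force)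
  have oi: "opinbox n E H0 M0 b0 H1 M1 b1 f kf nopr y x = None" if "\<And>x. f x = Idle \<or> (\<exists>k. f x = CW k)"
    for H0 M0 b0 H1 M1 b1 f kf x y
    using that[of x] by (auto simp: opinbox_simp opsend_def)
  have tk: "(\<lambda>y. tokened (opinbox n E H0 M0 b0 H1 M1 b1 f kf nopr y) (X y)) = (\<lambda>_. False)"
    if "\<And>x. f x = Idle \<or> (\<exists>k. f x = CW k)" for H0 M0 b0 H1 M1 b1 f kf X
    by (simp add: tokened_def oi[OF that])
  show ?thesis
  proof (cases "u \<in> M \<and> v \<in> M")
    case False
    define b1 where "b1 x = (if N x \<inter> (M - H) = {} then b x else None)" for x
    have r1: "t_run alg ok E ?s0 1 2 (conf n E H M b H M b1 idle (\<lambda>_. False) nopr)"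
    proof -
      have l: "(\<lambda>x. x = u \<and> u \<in> M \<and> v \<in> M \<and> (if (u \<in> H) = (v \<in> H) then v < u else u \<in> H) \<or>
          x = v \<and> v \<in> M \<and> u \<in> M \<and> (if (v \<in> H) = (u \<in> H) then u < v else v \<in> H)) = (\<lambda>_. False)" using False by blast
      have w: "(\<lambda>x. if u \<in> M \<and> v \<in> M \<and> X x then CW 1 else Idle) = idle" for X using False by (auto simp: fun_eq_iff)
      show ?thesis using greet[OF E0 inv0 uv(1)] unfolding l w b1_def[abs_def] by simp
    qed
    have b1b: "b1 x = Some z \<Longrightarrow> b x = Some z \<and> N x \<inter> (M - H) = {}" for x z by (auto simp: b1_def split: if_splits)
    have inv: "inv_at E {} H M b1"
    proof (rule inv_idleI)
      show "{x, y} \<notin> E" if "x \<in> M" "y \<in> M" for x y using that D(1)[of x y] False by (auto simp: E0(1) doubleton_eq_iff)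
      show "N x \<inter> M \<noteq> {}" if "x \<in> H" "x \<notin> M" for x using D(2)[OF that] sub[of x] by blast
      show "b1 x \<noteq> None" if "x \<notin> H" "x \<notin> M" "N x \<inter> (M - H) = {}" for x
        using D(3)[of x] sub[of x] that unfolding b1_def by auto
      show "{x, z} \<in> E \<and> z \<in> H \<and> z \<in> M" if "b1 x = Some z" for x z
        using b1b[OF that] D(4)[of x z] I(1)[of x z] E0(1) by blast
      show "x \<notin> H \<and> x \<notin> M \<and> N x \<inter> (M - H) = {}" if "b1 x = Some z" for x z
        using b1b[OF that] I(4)[of x z] by blast
    qed
    have bE: "b x = Some z \<Longrightarrow> {x, z} \<in> E" for x z using D(4) E0(1) by blast
    have r2: "t_run alg ok E (conf n E H M b H M b1 idle (\<lambda>_. False) nopr) 1 (card {x. b x \<noteq> b1 x}) (cfg H M b1 idle nopr)"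
    proof (rule run_conf[OF finE])
      show "t_round alg E (conf n E H M b H M b1 idle (\<lambda>_. False) nopr) = cfg H M b1 idle nopr"
        unfolding cfg_def
      proof (rule round_conf[where req = "\<lambda>_. None"])
        fix x
        show "act (conf n E H M b H M b1 idle (\<lambda>_. False) nopr x) (N x \<inter> (M - H)) (freshS E H H M x) {z. b1 z = Some x}
          (stinbox E H M H M x) (opinbox n E H M b H M b1 idle (\<lambda>_. False) nopr x) =
         \<lparr>a_H = x \<in> H, a_M = x \<in> M, a_req = None, a_ph = idle x, a_kick = False, a_prs = []\<rparr>"
          by (subst act_Idle) (simp_all add: oi)
        show "b1 x = bnext E H H M b1 H M (\<lambda>_. None)
          (\<lambda>y. tokened (opinbox n E H M b H M b1 idle (\<lambda>_. False) nopr y) (N y \<inter> (M - H))) x"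
          using inv_settled[OF inv, of x] by (simp add: tk)
      qed (use bE inv_atD(4)[OF inv] in auto)
      show "card (stcount E H M H M) + card {x. b x \<noteq> b1 x} + card (opcount n E H M b H M b1 idle (\<lambda>_. False) nopr) \<le> card {x. b x \<noteq> b1 x}"
        by (simp add: opcount_def oi)
    qed (use bE inv_atD(4)[OF inv] in \<open>auto simp: oi okop_def b1_def split: if_splits\<close>)
    have "card {x. b x \<noteq> b1 x} + card {x. b1 x \<noteq> None} \<le> card {x. b x \<noteq> None} + 2 * card ({}::nat set)"
      by (rule registration_changes[OF finb inv_finite[OF inv]]) (auto simp: b1_def split: if_splits)
    then have reg: "card {x. b x \<noteq> b1 x} + registered b1 \<le> registered b" by (simp add: registered_def)
    show ?thesis
    proof (rule Settles_trans[OF t_run_trans[OF r1 r2] Settles_refl[OF inv HV]])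
      show "1 + 1 + rho * mu E H M \<le> 3 * rho + rho * mu E H M" by (simp add: rho_def)
      have "real (card {x. b x \<noteq> b1 x}) + real (registered b1) \<le> real (registered b)" using reg by linarith
      then show "real (2 + card {x. b x \<noteq> b1 x}) + Ph H M b1 \<le> Ph H M b + 4 * Lam * theta E"
        using th by (simp add: Phi_def)
    qed
  next
    case True
    define w where "w = (if (u \<in> H) = (v \<in> H) then max u v else if u \<in> H then u else v)"
    define c where "c = (if w = u then v else u)"
    have cw: "{c, w} = {u, v}" "c \<noteq> w" "c \<in> M" "w \<in> M" "c \<in> V" "w \<in> V"
      using True uv by (auto simp: c_def w_def max_def)
    have e: "{c, w} \<in> E" using cw(1) E0(1) by simp
    define H1 where "H1 = insert w H"
    define kf where "kf x \<longleftrightarrow> x = w" for x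
    let ?f1 = "idle(c := CW (Suc 0))" and ?f2 = "idle(c := CW 0)" and ?f3 = "idle(c := Op (mem0 3 0 c (degree E c)))"
    \<comment> \<open>Those who have to hear that the loser is heavy from now on; a loser that was
      heavy already costs nothing here.\<close>
    define Y where "Y = (if w \<in> H then {} else N w)"
    define b2 where "b2 x = (if b x = None \<and> x \<notin> H1 \<and> x \<notin> M \<and> N x \<inter> (M - H1) = {} \<and> x \<in> Y then Some w else b x)" for x
    have bD: "x \<notin> H1 \<and> x \<notin> M \<and> N x \<inter> (M - H) = {} \<and> {x, z} \<in> E \<and> z \<in> M \<and> z \<in> H" if "b x = Some z" for x z
    proof -
      have a: "x \<notin> H" "x \<notin> M" "neighbours E0 x \<inter> (M - H) = {}" using I(4)[OF that] by auto
      then have "x \<noteq> u" "x \<noteq> v" "x \<noteq> w" using True cw(4) by auto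
      then show ?thesis using a Nx[of x] I(1)[OF that] D(4)[OF that] by (auto simp: H1_def E0(1))
    qed
    have b2D: "x \<notin> H1 \<and> x \<notin> M \<and> N x \<inter> (M - H1) = {} \<and> {x, z} \<in> E \<and> z \<in> M \<and> z \<in> H1" if "b2 x = Some z" for x z
    proof (cases "b x = None")
      case False
      then have "b x = Some z" using that by (simp add: b2_def del: not_None_eq)
      then show ?thesis using bD[of x z] by (auto simp: H1_def)
    next
      case True
      then have "x \<notin> H1" "x \<notin> M" "N x \<inter> (M - H1) = {}" "x \<in> Y" "z = w" using that by (auto simp: b2_def split: if_splits)
      then show ?thesis using cw(4) by (auto simp: Y_def H1_def in_neighbours split: if_splits)
    qed
    have ch: "x \<notin> M \<or> x \<notin> H1 \<Longrightarrow> {z. b2 z = Some x} = {}" for x using b2D by blast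
    have chb: "x \<notin> M \<Longrightarrow> {z. b z = Some x} = {}" for x using bD by blast
    have b1b: "(if N x \<inter> (M - H) = {} then b x else None) = b x" for x using bD[of x] by (cases "b x") auto
    have r1: "t_run alg ok E ?s0 1 2 (conf n E H M b H1 M b ?f1 kf nopr)"
    proof -
      have l: "(\<lambda>x. x = u \<and> u \<in> M \<and> v \<in> M \<and> (if (u \<in> H) = (v \<in> H) then v < u else u \<in> H) \<or>
          x = v \<and> v \<in> M \<and> u \<in> M \<and> (if (v \<in> H) = (u \<in> H) then u < v else v \<in> H)) = kf"
        using True uv(1) by (auto simp: fun_eq_iff kf_def w_def max_def)
      have h: "H \<union> Collect kf = H1" by (auto simp: H1_def kf_def)
      have w: "(\<lambda>x. if u \<in> M \<and> v \<in> M \<and> (x = u \<or> x = v) \<and> \<not> kf x then CW 1 else Idle) = ?f1"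
        using True cw(1,2) uv(1) by (auto simp: fun_eq_iff kf_def doubleton_eq_iff)
      have l': "(x = u \<and> u \<in> M \<and> v \<in> M \<and> (if (u \<in> H) = (v \<in> H) then v < u else u \<in> H) \<or>
          x = v \<and> v \<in> M \<and> u \<in> M \<and> (if (v \<in> H) = (u \<in> H) then u < v else v \<in> H)) = kf x" for x
        using fun_cong[OF l, of x] .
      show ?thesis using greet[OF E0 inv0 uv(1)] unfolding l' h w b1b by (simp add: h)
    qed
    have fr: "freshS E H H1 M x = (if x \<in> Y then {w} else {})" if "x \<notin> H1" for x
      using that cw(4) by (auto simp: freshS_def H1_def Y_def in_neighbours insert_commute)
    have bn: "bnext E H H1 M b H1 M (\<lambda>_. None) (\<lambda>_. False) x = b2 x" for x
    proof (cases "b x")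
      case None
      show ?thesis
      proof (cases "x \<notin> H1 \<and> x \<notin> M")
        case True
        then show ?thesis using None fr[of x] chb[of x] by (simp add: bnext_def b2_def)
      next
        case False
        then show ?thesis using None by (auto simp: bnext_def b2_def)
      qed
    next
      case (Some z)
      have "N x \<inter> (M - H1) = {}" using bD[OF Some] by (auto simp: H1_def)
      then show ?thesis using Some bD[OF Some] by (simp add: bnext_def b2_def)
    qed
    have bn2: "bnext E H1 H1 M b2 H1 M (\<lambda>_. None) (\<lambda>_. False) x = b2 x" for x
    proof (cases "b2 x")
      case None
      then show ?thesis by (simp add: bnext_def freshS_def)
    next
      case (Some z)
      then show ?thesis using b2D[OF Some] by (simp add: bnext_def)
    qed
    have finY: "finite Y" using finite_neighbours[OF finE] by (simp add: Y_def)
    have f1: "\<And>x. ?f1 x = Idle \<or> (\<exists>k. ?f1 x = CW k)" and f2: "\<And>x. ?f2 x = Idle \<or> (\<exists>k. ?f2 x = CW k)" by auto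
    have r2: "t_run alg ok E (conf n E H M b H1 M b ?f1 kf nopr) 1 (card Y) (conf n E H1 M b H1 M b2 ?f2 kf nopr)"
    proof (rule run_conf[OF finE])
      show "t_round alg E (conf n E H M b H1 M b ?f1 kf nopr) = conf n E H1 M b H1 M b2 ?f2 kf nopr"
      proof (rule round_conf[where req = "\<lambda>_. None"])
        fix x
        show "act (conf n E H M b H1 M b ?f1 kf nopr x) (N x \<inter> (M - H1)) (freshS E H H1 M x) {z. b z = Some x}
          (stinbox E H M H1 M x) (opinbox n E H M b H1 M b ?f1 kf nopr x) =
         \<lparr>a_H = x \<in> H1, a_M = x \<in> M, a_req = None, a_ph = ?f2 x, a_kick = kf x, a_prs = []\<rparr>"
          by (cases "x = c") (auto simp: act_def oi[OF f1])
        show "b2 x = bnext E H H1 M b H1 M (\<lambda>_. None)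
          (\<lambda>y. tokened (opinbox n E H M b H1 M b ?f1 kf nopr y) (N y \<inter> (M - H1))) x"
          unfolding tk[OF f1] by (rule bn[symmetric])
      qed (use bD in auto)
      have "stcount E H M H1 M \<subseteq> Pair w ` Y"
        by (auto simp: stcount_def stinbox_def H1_def Y_def in_neighbours insert_commute split: if_splits)
      then have "card (stcount E H M H1 M) \<le> card (Pair w ` Y)" using finY by (intro card_mono) auto
      also have "\<dots> \<le> card Y" using finY by (rule card_image_le)
      finally show "card (stcount E H M H1 M) + card {x. b x \<noteq> b x} + card (opcount n E H M b H1 M b ?f1 kf nopr) \<le> card Y"
        by (simp add: opcount_def oi[OF f1])
    qed (use bD in \<open>auto simp: oi[OF f1] okop_def\<close>)
    have bb: "b x \<noteq> b2 x \<Longrightarrow> x \<in> Y \<and> b x = None" for x by (auto simp: b2_def split: if_splits)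
    have r3: "t_run alg ok E (conf n E H1 M b H1 M b2 ?f2 kf nopr) 1 (card Y) (conf n E H1 M b2 H1 M b2 ?f3 kf nopr)"
    proof (rule run_conf[OF finE])
      show "t_round alg E (conf n E H1 M b H1 M b2 ?f2 kf nopr) = conf n E H1 M b2 H1 M b2 ?f3 kf nopr"
      proof (rule round_conf[where req = "\<lambda>_. None"])
        fix x
        show "act (conf n E H1 M b H1 M b2 ?f2 kf nopr x) (N x \<inter> (M - H1)) (freshS E H1 H1 M x) {z. b2 z = Some x}
          (stinbox E H1 M H1 M x) (opinbox n E H1 M b H1 M b2 ?f2 kf nopr x) =
         \<lparr>a_H = x \<in> H1, a_M = x \<in> M, a_req = None, a_ph = ?f3 x, a_kick = kf x, a_prs = []\<rparr>"
          by (cases "x = c") (auto simp: act_def oi[OF f2])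
        show "b2 x = bnext E H1 H1 M b2 H1 M (\<lambda>_. None)
          (\<lambda>y. tokened (opinbox n E H1 M b H1 M b2 ?f2 kf nopr y) (N y \<inter> (M - H1))) x"
          unfolding tk[OF f2] by (rule bn2[symmetric])
      qed (use bD b2D in auto)
      have "card {x. b x \<noteq> b2 x} \<le> card Y" using bb finY by (intro card_mono) auto
      then show "card (stcount E H1 M H1 M) + card {x. b x \<noteq> b2 x} + card (opcount n E H1 M b H1 M b2 ?f2 kf nopr) \<le> card Y"
        by (simp add: opcount_def oi[OF f2])
      show "\<And>x. b x \<noteq> b2 x \<Longrightarrow> b x = None \<or> b2 x = None" using bb by blast
    qed (use bD b2D in \<open>auto simp: oi[OF f2] okop_def\<close>)
    have reg: "registered b2 \<le> registered b + card Y"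
    proof -
      have "{x. b2 x \<noteq> None} \<subseteq> {x. b x \<noteq> None} \<union> Y"
      proof
        fix x assume "x \<in> {x. b2 x \<noteq> None}"
        then show "x \<in> {x. b x \<noteq> None} \<union> Y" using bb[of x] by (cases "b x = b2 x") auto
      qed
      then have "card {x. b2 x \<noteq> None} \<le> card ({x. b x \<noteq> None} \<union> Y)" using finb finY by (intro card_mono) auto
      then show ?thesis unfolding registered_def using card_Un_le[of "{x. b x \<noteq> None}" Y] by linarith
    qed
    have H1V: "H1 \<subseteq> V" using HV cw(6) by (simp add: H1_def)
    let ?P = "\<lambda>H' M' b' \<kappa>.
      t_run alg ok E (conf n E H1 M b2 H1 M b2 (idle(c := Op (mem0 3 0 c (degree E c)))) (\<lambda>x. 3 = (3::nat) \<and> x = w) nopr)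
        (17 + T n) \<kappa> (cfg H' M' b' (idle((if 3 = (3::nat) then w else c) := Serve)) nopr) \<and>
      inv_at E {w} H' M' b' \<and> H' \<subseteq> H1 \<and> mu E H' M' \<le> mu E H1 M \<and>
      (3 = (1::nat) \<and> N c \<noteq> {} \<longrightarrow> mu E H' M' < mu E H1 M) \<and>
      real \<kappa> + Ph H' M' b' \<le> Ph H1 M b2 + (if 3 = (1::nat) \<and> N c \<noteq> {} then - 4 else Lam * theta E) \<and>
      (3 = (1::nat) \<longrightarrow> b' c = None \<and> (c \<notin> M' \<longrightarrow> N c \<inter> (M' - H') \<noteq> {})) \<and>
      (3 = (2::nat) \<longrightarrow> c \<in> M' \<and> c \<in> H') \<and> (3 = (3::nat) \<longrightarrow> b' w = None \<and> w \<in> H')"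
    have "\<exists>H' M' b' \<kappa>. ?P H' M' b' \<kappa>"
    proof (rule operation[OF H1V cw(5)])
      show "{c, w} \<in> E \<and> c \<in> M \<and> w \<in> M \<and> w \<in> H1 \<and> w \<in> {w}" using e cw by (simp add: H1_def)
      show "3 = (3::nat) \<and> {p, q} = {c, w}" if "p \<in> M" "q \<in> M" "{p, q} \<in> E" for p q
        using D(1)[OF that(1,2)] that(3) cw(1) by (auto simp: E0(1))
      show "N x \<inter> M \<noteq> {}" if "x \<in> H1" "x \<notin> M" for x
        using D(2)[of x] that sub[of x] cw(4) by (auto simp: H1_def)
      show "b2 x \<noteq> None" if a: "x \<notin> H1" "x \<notin> M" "x \<notin> {w}" "N x \<inter> (M - H1) = {}" for x
      proof (cases "w \<in> N x \<and> w \<notin> H")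
        case True
        then have "x \<in> Y" by (simp add: Y_def in_neighbours insert_commute)
        then show ?thesis using a by (simp add: b2_def)
      next
        case False
        then have "N x \<inter> (M - H) = {}" using a by (auto simp: H1_def)
        then have "b x \<noteq> None" using D(3)[of x] a sub[of x] by (auto simp: H1_def)
        then show ?thesis by (simp add: b2_def)
      qed
      show "{p, z} \<in> E" "p \<notin> M" if "b2 p = Some z" for p z using b2D[OF that] by auto
      show "{q. b2 q = Some p} \<noteq> {}" if "b2 p = Some z" "z \<in> M - H1" for p z using b2D[OF that(1)] that(2) by blast
      show "p \<notin> H1 \<and> N p \<inter> (M - H1) = {} \<and> {q. b2 q = Some p} = {}" if "b2 p = Some z" "z \<notin> M - H1" for p z
        using b2D[OF that(1)] ch[of p] by blast
      show "\<exists>z. z \<in> M - H1 \<and> b2 p = Some z" if "p \<notin> M" "{q. b2 q = Some p} \<noteq> {}" "p \<notin> {w}" for p using ch[of p] that by blast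
      show "p \<in> {w}" if "p \<in> M - H1" "{q. b2 q = Some p} \<noteq> {}" for p using ch[of p] that by blast
    qed simp_all
    then obtain H' M' b' \<kappa> where P: "?P H' M' b' \<kappa>" by blast
    have kf: "kf = (\<lambda>x. x = w)" by (simp add: kf_def fun_eq_iff)
    have r: "t_run alg ok E (conf n E H1 M b2 H1 M b2 ?f3 kf nopr) (17 + T n) \<kappa> (cfg H' M' b' (idle(w := Serve)) nopr)"
      using P unfolding kf by simp
    have i: "inv_at E {w} H' M' b'" "H' \<subseteq> V" using P H1V by auto
    have bN: "b' w = None" and wH: "w \<in> H'" using P by auto
    have mu1: "mu E H1 M \<le> mu E H M + 2"
    proof -
      have fH: "finite {x \<in> H. N x \<noteq> {}}" by (rule finite_subset[OF _ finite_nonisolated[OF finE]]) auto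
      have "{x \<in> H1. N x \<noteq> {}} \<subseteq> insert w {x \<in> H. N x \<noteq> {}}" by (auto simp: H1_def)
      then have "card {x \<in> H1. N x \<noteq> {}} \<le> card (insert w {x \<in> H. N x \<noteq> {}})" using fH by (intro card_mono) auto
      also have "\<dots> \<le> Suc (card {x \<in> H. N x \<noteq> {}})" by (rule card_insert_le_m1) simp_all
      finally have "card {x \<in> H1. N x \<noteq> {}} \<le> Suc (card {x \<in> H. N x \<noteq> {}})" .
      moreover have "{x. x \<notin> H1 \<and> x \<notin> M \<and> N x \<noteq> {}} = {x. x \<notin> H \<and> x \<notin> M \<and> N x \<noteq> {}}"
        using cw(4) by (auto simp: H1_def)
      ultimately show ?thesis by (simp add: mu_def)
    qed
    \<comment> \<open>The announcement and the registrations use at most \<open>2 * card Y\<close>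
      messages and add at most \<open>card Y\<close> registrations. The loser gives up
      \<open>3 * excess\<close>, which leaves \<open>3 * theta E\<close> to be charged to the
      update.\<close>
    have xi: "Xi E H1 M + 3 * real (card Y) \<le> Xi E H M + 3 * theta E"
    proof (cases "w \<in> H")
      case True
      then have "H1 = H" "card Y = 0" by (auto simp: H1_def Y_def)
      then show ?thesis using th by simp
    next
      case False
      let ?g = "\<lambda>H x. if x \<in> H then 0 else if x \<in> M then 3 * excess E x else 4 * excess E x"
      have wN: "w \<in> {x. N x \<noteq> {}}" using e by (auto simp: neighbours_def insert_commute)
      have "Xi E H1 M = ?g H1 w + (\<Sum>x\<in>{x. N x \<noteq> {}} - {w}. ?g H1 x)"
        unfolding Xi_def using finite_nonisolated[OF finE] wN by (rule sum.remove)
      also have "(\<Sum>x\<in>{x. N x \<noteq> {}} - {w}. ?g H1 x) = (\<Sum>x\<in>{x. N x \<noteq> {}} - {w}. ?g H x)"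
        by (rule sum.cong) (auto simp: H1_def)
      finally have a: "Xi E H1 M = (\<Sum>x\<in>{x. N x \<noteq> {}} - {w}. ?g H x)" by (simp add: H1_def)
      have b: "Xi E H M = ?g H w + (\<Sum>x\<in>{x. N x \<noteq> {}} - {w}. ?g H x)"
        unfolding Xi_def using finite_nonisolated[OF finE] wN by (rule sum.remove)
      have "real (card Y) \<le> theta E + excess E w" using excess_ge(2)[of E w] False by (simp add: Y_def)
      then show ?thesis using a b False cw(4) by simp
    qed
    show ?thesis
    proof (rule Settles_trans[OF t_run_trans[OF t_run_trans[OF t_run_trans[OF r1 r2] r3] r] root_settles[OF i bN resume_M(2)[OF wH]]])
      have "rho * mu E H' M' \<le> rho * (mu E H M + 2)" using P mu1 by (intro mult_le_mono2) linarith
      then show "1 + 1 + 1 + (17 + T n) + (1 + rho * mu E H' M') \<le> 3 * rho + rho * mu E H M" by (simp add: rho_def)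
      have k: "real \<kappa> + Ph H' M' b' \<le> Ph H1 M b2 + Lam * theta E" using P by simp
      have "Lam * theta E * real (mu E H1 M) \<le> Lam * theta E * (real (mu E H M) + 2)"
        using mu1 th(3) by (intro mult_left_mono) linarith+
      then have m: "Lam * theta E * real (mu E H1 M) \<le> Lam * theta E * real (mu E H M) + 2 * (Lam * theta E)"
        by (simp add: algebra_simps)
      have "Ph H1 M b2 + 2 * real (card Y) \<le> Ph H M b + 3 * theta E + 2 * (Lam * theta E)"
        unfolding Phi_def using xi m reg by linarith
      then show "real (2 + card Y + card Y + \<kappa>) + Ph H' M' b' \<le> Ph H M b + 4 * Lam * theta E"
        using k th unfolding mult.assoc of_nat_add of_nat_numeral by linarith
    qed
  qed
qed

end

section \<open>Change of the potential under an update\<close>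

lemma theta_mono: "card E0 \<le> card E \<Longrightarrow> theta E0 \<le> theta E"
  unfolding theta_def by (intro max.mono order.refl powr_mono2) auto

text \<open>By concavity of \<open>x powr (2 / 3)\<close>.\<close>

lemma theta_step:
  assumes "card E1 = Suc (card E0)"
  shows "real (card E0) * (theta E1 - theta E0) \<le> theta E0"
proof (cases "card E0 = 0")
  case False
  define m where "m = real (card E0)"
  have m: "m > 0" "real (2 * card E0) = 2 * m" "real (2 * card E1) = 2 * m * (1 + 1 / m)"
    using False assms by (auto simp: m_def field_simps)
  have "(1 + 1 / m) powr (2 / 3) \<le> (1 + 1 / m) powr 1" using m(1) by (intro powr_mono) auto
  then have p: "(1 + 1 / m) powr (2 / 3) \<le> 1 + 1 / m" using m(1) by (simp add: add_pos_pos)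
  have "real (2 * card E1) powr (2 / 3) = (2 * m) powr (2 / 3) * (1 + 1 / m) powr (2 / 3)"
    unfolding m(3) by (rule powr_mult)
  also have "\<dots> \<le> theta E0 * (1 + 1 / m)"
    using p theta_ge(1)[of E0] theta_ge(2)[of E0] m by (intro mult_mono) auto
  finally have "real (2 * card E1) powr (2 / 3) \<le> theta E0 * (1 + 1 / m)" .
  moreover have "1 * 1 \<le> theta E0 * (1 + 1 / m)" using theta_ge(1)[of E0] m(1) by (intro mult_mono) auto
  ultimately have "theta E1 \<le> theta E0 * (1 + 1 / m)" by (simp add: theta_def[of E1])
  then have "m * theta E1 \<le> m * (theta E0 * (1 + 1 / m))" using m(1) by (intro mult_left_mono) auto
  also have "\<dots> = m * theta E0 + theta E0" using m(1) by (simp add: field_simps)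
  finally show ?thesis by (simp add: m_def algebra_simps)
qed (use theta_ge(1)[of E0] in simp)

lemma card_nonisolated: "finite E \<Longrightarrow> card {v. neighbours E v \<noteq> {}} \<le> 2 * card E"
proof -
  assume f: "finite E"
  have "{v. neighbours E v \<noteq> {}} \<subseteq> fst ` {(u, v). {u, v} \<in> E}" by (force simp: neighbours_def)
  then have "card {v. neighbours E v \<noteq> {}} \<le> card (fst ` {(u, v). {u, v} \<in> E})"
    using finite_edge_pairs[OF f] by (intro card_mono) auto
  also have "\<dots> \<le> card {(u, v). {u, v} \<in> E}" by (rule card_image_le[OF finite_edge_pairs[OF f]])
  finally show ?thesis using card_edge_pairs[OF f] by linarith
qed

lemma mu_sum:
  assumes "finite W" "{v. neighbours E v \<noteq> {}} \<subseteq> W"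
  shows "mu E H M = (\<Sum>v\<in>W. if neighbours E v = {} then 0 else if v \<in> H then 2 else if v \<in> M then 0 else 1)"
proof -
  let ?A = "{v \<in> H. neighbours E v \<noteq> {}}" and ?B = "{v. v \<notin> H \<and> v \<notin> M \<and> neighbours E v \<noteq> {}}"
  have AB: "?A \<subseteq> W" "?B \<subseteq> W" using assms(2) by auto
  have "(\<Sum>v\<in>W. if neighbours E v = {} then 0 else if v \<in> H then 2 else if v \<in> M then 0 else 1)
     = (\<Sum>v\<in>W. (if v \<in> ?A then 2 else 0) + (if v \<in> ?B then 1 else 0))"
    by (rule sum.cong) auto
  also have "\<dots> = (\<Sum>v\<in>W \<inter> ?A. 2) + (\<Sum>v\<in>W \<inter> ?B. 1)"
    by (simp only: sum.distrib sum.inter_restrict[OF assms(1)])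
  also have "\<dots> = mu E H M" using AB by (simp add: mu_def Int_absorb1)
  finally show ?thesis by simp
qed

lemma Xi_sum:
  assumes "finite W" "{v. neighbours E v \<noteq> {}} \<subseteq> W"
  shows "Xi E H M = (\<Sum>v\<in>W. if v \<in> H then 0 else if v \<in> M then 3 * excess E v else 4 * excess E v)"
  unfolding Xi_def
proof (rule sum.mono_neutral_left[OF assms])
  have "excess E v = 0" if "neighbours E v = {}" for v
    using that theta_ge(1)[of E] by (simp add: excess_def)
  then show "\<forall>v\<in>W - {v. neighbours E v \<noteq> {}}. (if v \<in> H then 0 else if v \<in> M then 3 * excess E v else 4 * excess E v) = 0"
    by auto
qed

lemma mu_le: "finite E \<Longrightarrow> mu E H M \<le> 4 * card E"
proof -
  assume f: "finite E"
  let ?W = "{v. neighbours E v \<noteq> {}}"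
  have "mu E H M \<le> (\<Sum>v\<in>?W. 2)"
    unfolding mu_sum[OF finite_nonisolated[OF f] order.refl] by (rule sum_mono) auto
  then show ?thesis using card_nonisolated[OF f] by simp
qed

lemma neighbours_insert: "neighbours (insert {u, v} E) x = (if x = u then insert v (neighbours E x) else {}) \<union>
    (if x = v then insert u (neighbours E x) else {}) \<union> neighbours E x"
  by (auto simp: neighbours_def doubleton_eq_iff)

lemma sum_two_points:
  fixes f g :: "nat \<Rightarrow> 'a :: ordered_comm_monoid_add"
  assumes "finite W" "u \<noteq> v" "u \<in> W" "v \<in> W" and "\<And>x. x \<in> W \<Longrightarrow> x \<noteq> u \<Longrightarrow> x \<noteq> v \<Longrightarrow> f x \<le> g x"
    and "f u \<le> g u + d" "f v \<le> g v + d"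
  shows "sum f W \<le> sum g W + (d + d)"
proof -
  have s: "sum h W = h u + (h v + sum h (W - {u} - {v}))" for h :: "nat \<Rightarrow> 'a"
    using assms(1-4) by (simp add: sum.remove[of W u] sum.remove[of "W - {u}" v])
  have "sum f (W - {u} - {v}) \<le> sum g (W - {u} - {v})" by (rule sum_mono) (use assms(5) in auto)
  then have "sum f W \<le> (g u + d) + ((g v + d) + sum g (W - {u} - {v}))"
    unfolding s[of f] by (intro add_mono assms(6,7))
  then show ?thesis unfolding s[of g] by (simp add: ac_simps)
qed

context
  fixes E0 :: "nat set set" and u v :: nat
  assumes fin: "finite E0" and new: "{u, v} \<notin> E0" and uv: "u \<noteq> v"
begin

abbreviation "E1 \<equiv> insert {u, v} E0"

lemma W_facts: "finite {x. neighbours E1 x \<noteq> {}}" "{x. neighbours E0 x \<noteq> {}} \<subseteq> {x. neighbours E1 x \<noteq> {}}"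
  "u \<in> {x. neighbours E1 x \<noteq> {}}" "v \<in> {x. neighbours E1 x \<noteq> {}}" "card E1 = Suc (card E0)"
proof -
  show "finite {x. neighbours E1 x \<noteq> {}}" using fin by (intro finite_nonisolated) simp
qed (use fin new in \<open>auto simp: neighbours_insert\<close>)

lemma degree_insert: "x \<noteq> u \<Longrightarrow> x \<noteq> v \<Longrightarrow> degree E1 x = degree E0 x" "degree E1 u = Suc (degree E0 u)"
   "degree E1 v = Suc (degree E0 v)" "degree E0 x \<le> degree E1 x"
proof -
  show a: "x \<noteq> u \<Longrightarrow> x \<noteq> v \<Longrightarrow> degree E1 x = degree E0 x" for x by (simp add: neighbours_insert)
  have "v \<notin> neighbours E0 u" "u \<notin> neighbours E0 v" using new by (auto simp: in_neighbours insert_commute)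
  then show b: "degree E1 u = Suc (degree E0 u)" and c: "degree E1 v = Suc (degree E0 v)"
    using uv finite_neighbours[OF fin] by (auto simp: neighbours_insert insert_absorb)
  show "degree E0 x \<le> degree E1 x" using a[of x] b c by (cases "x = u"; cases "x = v") auto
qed

lemma mu_insert: "mu E1 H M \<le> mu E0 H M + 4" "mu E0 H M \<le> mu E1 H M"
proof -
  have "mu E1 H M \<le> mu E0 H M + (2 + 2)"
    unfolding mu_sum[OF W_facts(1,2)] mu_sum[OF W_facts(1) order.refl]
    by (rule sum_two_points[OF W_facts(1) uv W_facts(3,4)]) (auto simp: neighbours_insert)
  then show "mu E1 H M \<le> mu E0 H M + 4" by simp
  show "mu E0 H M \<le> mu E1 H M"
    unfolding mu_sum[OF W_facts(1,2)] mu_sum[OF W_facts(1) order.refl]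
    by (rule sum_mono) (auto simp: neighbours_insert)
qed

lemma theta_insert: "theta E0 \<le> theta E1" "real (card E0) * (theta E1 - theta E0) \<le> theta E0"
  using theta_mono[of E0 E1] theta_step[of E1 E0] W_facts(5) by simp_all

lemma Xi_insert: "Xi E1 H M \<le> Xi E0 H M + 8"
proof -
  have x: "x \<noteq> u \<Longrightarrow> x \<noteq> v \<Longrightarrow> excess E1 x \<le> excess E0 x" "excess E1 u \<le> excess E0 u + 1" "excess E1 v \<le> excess E0 v + 1" for x
    using degree_insert(1)[of x] degree_insert(2,3) theta_insert(1) by (auto simp: excess_def)
  have "Xi E1 H M \<le> Xi E0 H M + (4 + 4)"
    unfolding Xi_sum[OF W_facts(1,2)] Xi_sum[OF W_facts(1) order.refl]
    by (rule sum_two_points[OF W_facts(1) uv W_facts(3,4)]) (use x excess_ge(1)[of E0] in auto)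
  then show ?thesis by simp
qed

text \<open>Each excess grows at most by the drop of \<open>theta\<close>. At most
  \<open>2 * card E0\<close> vertices are concerned, and by concavity \<open>card E0\<close> times
  the drop is at most \<open>theta E0\<close>.\<close>

lemma Xi_delete: "Xi E0 H M \<le> Xi E1 H M + 8 * theta E0"
proof -
  define \<delta> where "\<delta> = theta E1 - theta E0"
  have d: "\<delta> \<ge> 0" using theta_insert(1) by (simp add: \<delta>_def)
  let ?W = "{x. neighbours E0 x \<noteq> {}}" and ?g = "\<lambda>E x. if x \<in> H then 0 else if x \<in> M then 3 * excess E x else 4 * excess E x"
  have x: "excess E0 x \<le> excess E1 x + \<delta>" for x
    using degree_insert(4)[of x] d by (auto simp: excess_def \<delta>_def)
  have "Xi E0 H M \<le> (\<Sum>x\<in>?W. ?g E1 x + 4 * \<delta>)"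
    unfolding Xi_def
  proof (rule sum_mono)
    fix y show "?g E0 y \<le> ?g E1 y + 4 * \<delta>" using x[of y] d by auto
  qed
  also have "\<dots> = (\<Sum>x\<in>?W. ?g E1 x) + 4 * (real (card ?W) * \<delta>)" by (simp add: sum.distrib)
  also have "(\<Sum>x\<in>?W. ?g E1 x) \<le> (\<Sum>x | neighbours E1 x \<noteq> {}. ?g E1 x)"
    using excess_ge(1)[of E1] W_facts by (intro sum_mono2) auto
  also have "real (card ?W) * \<delta> \<le> 2 * real (card E0) * \<delta>"
    using card_nonisolated[OF fin] d by (intro mult_right_mono) linarith+
  also have "\<dots> \<le> 2 * theta E0" using theta_insert(2) by (simp add: \<delta>_def mult.assoc)
  finally show ?thesis by (simp add: Xi_def)
qed

text \<open>9 = 4 + 4 + 1: the rise of \<open>mu\<close> by at most 4, the rise of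
  \<open>theta\<close> applied to \<open>mu \<le> 4 * card E0\<close>, and the rise of
  \<open>Xi\<close> by at most 8.\<close>

lemma Phi_insert: "L \<ge> 8 \<Longrightarrow> Phi L E1 H M b \<le> Phi L E0 H M b + 9 * L * theta E1"
proof -
  assume L: "L \<ge> 8"
  let ?m0 = "real (mu E0 H M)"
  have "theta E1 * real (mu E1 H M) \<le> theta E1 * (?m0 + 4)"
    using mu_insert(1)[of H M] theta_ge(1)[of E1] by (intro mult_left_mono) linarith+
  also have "\<dots> = theta E0 * ?m0 + (theta E1 - theta E0) * ?m0 + 4 * theta E1" by (simp add: algebra_simps)
  also have "(theta E1 - theta E0) * ?m0 \<le> (theta E1 - theta E0) * (4 * real (card E0))"
    using mu_le[OF fin, of H M] theta_insert(1) by (intro mult_left_mono) linarith+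
  also have "\<dots> \<le> 4 * theta E1" using theta_insert by (simp add: mult.commute)
  finally have a: "theta E1 * real (mu E1 H M) \<le> theta E0 * ?m0 + 8 * theta E1" by simp
  have "L * (theta E1 * real (mu E1 H M)) \<le> L * (theta E0 * ?m0 + 8 * theta E1)"
    using a L by (intro mult_left_mono) auto
  then have b: "L * theta E1 * real (mu E1 H M) \<le> L * theta E0 * ?m0 + 8 * (L * theta E1)" by (simp add: algebra_simps)
  have "8 * 1 \<le> L * theta E1" using L theta_ge(1)[of E1] by (intro mult_mono) auto
  then show ?thesis unfolding Phi_def mult.assoc[of 9] using b Xi_insert[of H M] by linarith
qed

lemma Phi_delete: "L \<ge> 8 \<Longrightarrow> Phi L E0 H M b \<le> Phi L E1 H M b + 9 * L * theta E0"
proof -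
  assume L: "L \<ge> 8"
  have "L * theta E0 * real (mu E0 H M) \<le> L * theta E1 * real (mu E1 H M)"
    using L theta_insert(1) mu_insert(2)[of H M] theta_ge(1)[of E0] by (intro mult_mono) auto
  moreover have "8 * theta E0 \<le> L * theta E0" "0 \<le> L * theta E0"
    using L theta_ge(1)[of E0] by (simp_all add: mult_right_mono)
  ultimately show ?thesis unfolding Phi_def mult.assoc[of 9] using Xi_delete[of H M] by linarith
qed

end

section \<open>Assembling the bounds for one update\<close>

lemma Phi_nonneg: "L \<ge> 0 \<Longrightarrow> 0 \<le> Phi L E H M b"
  unfolding Phi_def Xi_def using excess_ge(1)[of E] theta_ge(1)[of E]
  by (intro add_nonneg_nonneg sum_nonneg mult_nonneg_nonneg) auto

lemma Phi_empty: "inv_at {} St H M b \<Longrightarrow> Phi L {} H M b = 0"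
proof -
  assume inv: "inv_at {} St H M b"
  have "b x = None" for x using inv_atD(4)[OF inv, of x] by (cases "b x") auto
  then show ?thesis by (simp add: Phi_def Xi_def mu_def neighbours_def registered_def)
qed

lemma t_run_empty: "t_run Z ok {} s k c s' \<Longrightarrow> t_run Z ok {} s k 0 s'"
  by (simp add: t_run_def t_msgs_def t_sent_def)

lemma theta_nonempty: "finite E \<Longrightarrow> E \<noteq> {} \<Longrightarrow> theta E = real (2 * card E) powr (2 / 3)"
proof -
  assume "finite E" "E \<noteq> {}"
  then have "1 \<le> card E" by (simp add: Suc_le_eq card_gt_0_iff)
  then have "1 \<le> real (2 * card E)" by linarith
  then have "1 \<le> real (2 * card E) powr (2 / 3)" by (intro ge_one_powr_ge_zero) auto
  then show ?thesis by (simp add: theta_def)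
qed

context env
begin

lemma Settles_mono: "Settles s kb cb \<Longrightarrow> kb \<le> kb' \<Longrightarrow> cb \<le> cb' \<Longrightarrow> Settles s kb' cb'"
  by (rule Settles_trans[OF t_run_refl[where c = 0]]) auto

text \<open>7 = 3 + 4 and 13 = 4 + 9 add the cost of handling an insertion and the change of the
  potentials by the insertion itself; deletions stay below these values.\<close>

lemma update_settles:
  assumes up: "legal_update V E0 up" "E = apply_update up E0" and E0: "finite E0" "\<And>x. {x, x} \<notin> E0" "\<And>u v. {u, v} \<in> E0 \<Longrightarrow> u \<in> V \<and> v \<in> V"
    and inv0: "inv_at E0 {} H M b" and HV: "H \<subseteq> V"
  shows "\<exists>H' M' b' k \<kappa>. t_run alg ok E (t_wake alg up (conf n E0 H M b H M b idle (\<lambda>_. False) nopr)) k \<kappa> (cfg H' M' b' idle nopr) \<and>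
     inv_at E {} H' M' b' \<and> H' \<subseteq> V \<and> k + rho * mu E H' M' \<le> 7 * rho + rho * mu E0 H M \<and>
     real \<kappa> + Ph H' M' b' \<le> Phi Lam E0 H M b + 13 * Lam * real (2 * card E) powr (2 / 3)"
proof -
  have L: "Lam \<ge> 8" by (simp add: Lam_def)
  have S: "Settles (t_wake alg up (conf n E0 H M b H M b idle (\<lambda>_. False) nopr)) (7 * rho + rho * mu E0 H M)
      (Phi Lam E0 H M b + 13 * Lam * theta E)"
  proof (cases up)
    case (Insert u v)
    have uv: "u \<noteq> v" "u \<in> V" "v \<in> V" and nw: "{u, v} \<notin> E0" and E: "E = insert {u, v} E0" using up Insert by auto
    show ?thesis
      unfolding Insert
    proof (rule Settles_mono[OF insert_settles[OF E nw inv0 HV uv]])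
      have "rho * mu E H M \<le> rho * (mu E0 H M + 4)" using mu_insert(1)[OF E0(1) nw uv(1), of H M] by (simp add: E)
      then show "3 * rho + rho * mu E H M \<le> 7 * rho + rho * mu E0 H M" by (simp add: algebra_simps)
      show "Ph H M b + 4 * Lam * theta E \<le> Phi Lam E0 H M b + 13 * Lam * theta E"
        using Phi_insert[OF E0(1) nw uv(1) L, of H M b] by (simp add: E algebra_simps)
    qed
  next
    case (Delete u v)
    have e: "{u, v} \<in> E0" and E: "E = E0 - {{u, v}}" using up Delete by auto
    have uv: "u \<noteq> v" "u \<in> V" "v \<in> V" using E0(2,3) e by blast+
    have E1: "E0 = insert {u, v} E" "{u, v} \<notin> E" using e E by auto
    obtain b1 where b1: "registered b1 \<le> registered b"
      and s: "Settles (t_wake alg (Delete u v) (conf n E0 H M b H M b idle (\<lambda>_. False) nopr)) (2 * rho + rho * mu E H M) (Ph H M b1 + Lam * theta E)"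
      using delete_settles[OF E e E0(1) inv0 HV uv] by blast
    show ?thesis
      unfolding Delete
    proof (rule Settles_mono[OF s])
      have "rho * mu E H M \<le> rho * mu E0 H M" using mu_insert(2)[OF finE E1(2) uv(1), of H M] by (simp add: E1(1)[symmetric])
      then show "2 * rho + rho * mu E H M \<le> 7 * rho + rho * mu E0 H M" by linarith
      have "Ph H M b1 \<le> Ph H M b" using b1 by (simp add: Phi_def)
      moreover have "Ph H M b \<le> Phi Lam E0 H M b + 9 * Lam * theta E"
        using Phi_delete[OF finE E1(2) uv(1) L, of H M b] by (simp add: E1(1)[symmetric])
      ultimately show "Ph H M b1 + Lam * theta E \<le> Phi Lam E0 H M b + 13 * Lam * theta E"
        using LamD by linarith
    qed
  qed
  then obtain H' M' b' k \<kappa> where r: "t_run alg ok E (t_wake alg up (conf n E0 H M b H M b idle (\<lambda>_. False) nopr)) k \<kappa> (cfg H' M' b' idle nopr)"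
    and i: "inv_at E {} H' M' b'" "H' \<subseteq> V" "k + rho * mu E H' M' \<le> 7 * rho + rho * mu E0 H M"
    and c: "real \<kappa> + Ph H' M' b' \<le> Phi Lam E0 H M b + 13 * Lam * theta E"
    unfolding Settles_def by blast
  show ?thesis
  proof (cases "E = {}")
    case False
    then show ?thesis using r i c theta_nonempty[OF finE] by metis
  next
    \<comment> \<open>Here \<open>theta E\<close> is 1 but the power in the claim is 0. Without
      edges no message can be sent and the potential vanishes.\<close>
    case True
    have "real 0 + Ph H' M' b' \<le> Phi Lam E0 H M b + 13 * Lam * real (2 * card E) powr (2 / 3)"
      using Phi_nonneg[of Lam E0 H M b] L Phi_empty[of "{}" H' M' b' Lam] i(1) True by simp
    moreover have "t_run alg ok E (t_wake alg up (conf n E0 H M b H M b idle (\<lambda>_. False) nopr)) k 0 (cfg H' M' b' idle nopr)"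
      using t_run_empty r True by metis
    ultimately show ?thesis using i by blast
  qed
qed

lemma idle_silent:
  assumes inv: "inv_at E {} H M b"
  shows "t_silent alg (cfg H M b idle nopr v)"
proof -
  let ?s = "conf n E H M b H M b idle (\<lambda>_. False) nopr"
  have snd: "send (?s x) y = None" for x y
    by (simp add: send_def stsend_def rgsend_def opsend_def conf_def)
  have oi: "opinbox n E H M b H M b idle (\<lambda>_. False) nopr y x = None" for x y
    by (simp add: opinbox_simp opsend_def)
  have tk: "(\<lambda>y. tokened (opinbox n E H M b H M b idle (\<lambda>_. False) nopr y) (X y)) = (\<lambda>_. False)" for X
    by (simp add: tokened_def oi)
  have "t_round alg E ?s = ?s"
  proof (rule round_conf[where req = "\<lambda>_. None"])
    fix x
    show "act (?s x) (N x \<inter> (M - H)) (freshS E H H M x) {z. b z = Some x}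
        (stinbox E H M H M x) (opinbox n E H M b H M b idle (\<lambda>_. False) nopr x) =
       \<lparr>a_H = x \<in> H, a_M = x \<in> M, a_req = None, a_ph = idle x, a_kick = False, a_prs = []\<rparr>"
      by (subst act_Idle) (simp_all add: oi)
    show "b x = bnext E H H M b H M (\<lambda>_. None) (\<lambda>y. tokened (opinbox n E H M b H M b idle (\<lambda>_. False) nopr y) (N y \<inter> (M - H))) x"
      unfolding tk by (rule inv_settled[OF inv, symmetric])
  qed (use inv_atD(4)[OF inv] in auto)
  then have "t_round alg E ?s v = ?s v" by simp
  moreover have "(\<lambda>u. t_sent alg E ?s u v) = (\<lambda>_. None)" by (simp add: t_sent_def snd fun_eq_iff)
  ultimately show ?thesis unfolding t_silent_def cfg_def by (simp add: t_round_def snd)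
qed

end

lemma inv_MIS:
  assumes inv: "inv_at E {} H M b" and EV: "\<And>u v. {u, v} \<in> E \<Longrightarrow> u \<in> V \<and> v \<in> V"
  shows "maximal_independent_set V E {v \<in> V. v \<in> M}"
proof -
  note D = inv_atD[OF inv] and I = inv_idle[OF inv]
  have cov: "\<exists>z\<in>M. {v, z} \<in> E" if v: "v \<notin> M" for v
  proof (cases "v \<in> H \<or> neighbours E v \<inter> (M - H) \<noteq> {}")
    case True
    then show ?thesis using D(2)[of v] v by (auto simp: neighbours_def)
  next
    case False
    then obtain z where z: "b v = Some z" using D(3)[of v] v by auto
    then show ?thesis using D(4)[OF z] I(1)[OF z] by blast
  qed
  have ind: "independent_set V E {v \<in> V. v \<in> M}" using D(1) by (auto simp: independent_set_def)
  have "S' = {v \<in> V. v \<in> M}" if S: "independent_set V E S'" "{v \<in> V. v \<in> M} \<subseteq> S'" for S'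
  proof -
    have "v \<in> M" if v: "v \<in> S'" for v
    proof (rule ccontr)
      assume "v \<notin> M"
      then obtain z where z: "z \<in> M" "{v, z} \<in> E" using cov by blast
      then have "z \<in> S'" using EV S(2) by blast
      then show False using S(1) v z(2) unfolding independent_set_def by blast
    qed
    moreover have "S' \<subseteq> V" using S(1) by (simp add: independent_set_def)
    ultimately show ?thesis using S(2) by blast
  qed
  then show ?thesis unfolding maximal_independent_set_def using ind by blast
qed

section \<open>Encoding of messages\<close>

fun nbits :: "nat \<Rightarrow> bool list" where
  "nbits k = (if k = 0 then [] else odd k # nbits (k div 2))"

declare nbits.simps [simp del]

fun bits_nat :: "bool list \<Rightarrow> nat" where
  "bits_nat [] = 0" | "bits_nat (b # bs) = of_bool b + 2 * bits_nat bs"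

lemma bits_nat_nbits: "bits_nat (nbits k) = k"
proof (induction k rule: nbits.induct)
  case (1 k)
  then show ?case by (cases "k = 0") (simp_all add: nbits.simps[of k] nbits.simps[of 0])
qed

lemma nbits_inject [simp]: "nbits k = nbits l \<longleftrightarrow> k = l"
  by (metis bits_nat_nbits)

lemma length_nbits: "k > 0 \<Longrightarrow> 2 ^ length (nbits k) \<le> 2 * k"
proof (induction k rule: nbits.induct)
  case (1 k)
  show ?case
  proof (cases "k = 1")
    case False
    then have "2 ^ length (nbits (k div 2)) \<le> 2 * (k div 2)" using 1 by simp
    then show ?thesis using 1(2) by (simp add: nbits.simps[of k])
  qed (simp add: nbits.simps)
qed

fun stbits :: "(bool \<times> bool) option \<Rightarrow> bool list" where
  "stbits None = [False, False, False]" | "stbits (Some (h, m)) = [True, h, m]"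

fun rgbits :: "bool option \<Rightarrow> bool list" where
  "rgbits None = [False, False]" | "rgbits (Some r) = [True, r]"

fun opbits :: "opmsg option \<Rightarrow> bool list" where
  "opbits None = []"
| "opbits (Some (Explore k)) = False # False # False # nbits k"
| "opbits (Some (Up k)) = False # False # True # nbits k"
| "opbits (Some (Down k)) = False # True # False # nbits k"
| "opbits (Some (Mem x)) = [False, True, True, x]"
| "opbits (Some (Cnt k)) = True # False # False # nbits k"
| "opbits (Some (Sim l)) = True # False # True # l"
| "opbits (Some Tok) = [True, True, False]"
| "opbits (Some Ret) = [True, True, True]"

text \<open>The first two parts have the fixed lengths 3 and 2 and can be split off; the part of
  variable length comes last and needs no delimiter.\<close>

definition enc :: "msg \<Rightarrow> bool list" where
  "enc m = stbits (fst m) @ rgbits (fst (snd m)) @ opbits (snd (snd m))"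

lemma length_stbits [simp]: "length (stbits x) = 3"
  by (cases x rule: stbits.cases) simp_all

lemma length_rgbits [simp]: "length (rgbits x) = 2"
  by (cases x rule: rgbits.cases) simp_all

lemma stbits_inject [simp]: "stbits x = stbits y \<longleftrightarrow> x = y"
  by (cases x rule: stbits.cases; cases y rule: stbits.cases) simp_all

lemma rgbits_inject [simp]: "rgbits x = rgbits y \<longleftrightarrow> x = y"
  by (cases x rule: rgbits.cases; cases y rule: rgbits.cases) simp_all

lemma opbits_inject [simp]: "opbits x = opbits y \<longleftrightarrow> x = y"
  by (cases x rule: opbits.cases; cases y rule: opbits.cases) simp_all

lemma inj_enc: "inj enc"
  by (rule injI) (auto simp: enc_def prod_eq_iff)

lemma (in mis_scheme) length_enc:
  assumes "okmsg n \<beta> m" "n \<ge> 2"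
  shows "real (length (enc m)) \<le> (13 + \<bar>\<beta>\<bar>) * log 2 (real n)"
proof -
  define l where "l = log 2 (real n)"
  have l1: "l \<ge> 1" using assms(2) by (simp add: l_def le_log_iff)
  have nb: "real (length (nbits k)) \<le> 1 + 2 * l" if "k \<le> n ^ 2" for k
  proof (cases "k = 0")
    case False
    then have "2 ^ length (nbits k) \<le> 2 * n ^ 2" using length_nbits[of k] that by linarith
    then have "real (2 ^ length (nbits k)) \<le> real (2 * n ^ 2)" by (rule of_nat_mono)
    then have "log 2 (2 ^ length (nbits k)) \<le> log 2 (2 * real n ^ 2)"
      using assms(2) by (subst log_le_cancel_iff) auto
    also have "\<dots> = 1 + 2 * l" using assms(2) by (simp add: log_mult log_nat_power l_def)
    finally show ?thesis by (simp add: log_nat_power)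
  qed (use l1 in \<open>simp add: nbits.simps\<close>)
  define g where "g = \<bar>\<beta>\<bar> * l"
  have bl: "\<beta> * l \<le> g" "0 \<le> g" using l1 by (auto simp: g_def intro: mult_right_mono)
  have "real (length (opbits (snd (snd m)))) \<le> 4 + 2 * l + g"
    using assms(1) l1 bl unfolding okmsg_def okop_def l_def[symmetric]
    by (cases "snd (snd m)" rule: opbits.cases) (auto dest: nb)
  then have "real (length (enc m)) \<le> 9 + 2 * l + g" by (simp add: enc_def)
  then show ?thesis using l1 unfolding l_def[symmetric] by (simp add: g_def algebra_simps)
qed

section \<open>The round complexity of a static algorithm is positive\<close>

text \<open>Without communication, a vertex of the complete graph that joins on the empty input also joins
  when the input consists of another vertex.\<close>

lemma static_rounds_pos:
  assumes alg: "static_MIS_algorithm a D \<beta> T A" and a: "a \<ge> 1" and D: "D \<ge> 1" and n: "n \<ge> 2"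
  shows "T n \<ge> 1"
proof (rule ccontr)
  assume "\<not> T n \<ge> 1"
  then have T0: "T n = 0" by simp
  define V where "V = {..<n}"
  define E where "E = {{u, v} | u v. u \<in> V \<and> v \<in> V \<and> u \<noteq> v}"
  define out where "out M = {v \<in> V. s_out A (s_init A n v (neighbours E v) (v \<in> M))}" for M
  have e: "{u, v} \<in> E" if "u \<in> V" "v \<in> V" "u \<noteq> v" for u v using that by (auto simp: E_def)
  have "n ^ 1 \<le> n ^ a" using a n by (intro power_increasing) auto
  then have ids: "vertex_ids a n V" by (auto simp: vertex_ids_def V_def)
  have sg: "simple_graph V E" by (auto simp: simple_graph_def V_def E_def)
  have diam: "diameter_at_most V E D"
    unfolding diameter_at_most_def
  proof (intro ballI)
    fix u v assume uv: "u \<in> V" "v \<in> V"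
    show "\<exists>k\<le>D. (u, v) \<in> {(x, y). {x, y} \<in> E} ^^ k"
    proof (cases "u = v")
      case True
      then show ?thesis by (intro exI[of _ 0]) simp
    next
      case False
      then show ?thesis using e uv D by (intro exI[of _ 1]) simp
    qed
  qed
  have mis: "maximal_independent_set V E (out M)" "M \<subseteq> out M" if "independent_set V E M" for M
  proof -
    have o: "out M = {v \<in> V. s_out A (static_states A n E M (T n) v)}"
      by (simp add: out_def static_states_def static_start_def T0)
    show "maximal_independent_set V E (out M)" "M \<subseteq> out M"
      unfolding o using alg ids sg diam that unfolding static_MIS_algorithm_def by blast+
  qed
  have single: "independent_set V E {w}" if "w \<in> V" for w
    using that by (auto simp: independent_set_def E_def)
  have ie: "independent_set V E {}" by (simp add: independent_set_def)
  have "out {} \<noteq> {}"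
  proof
    assume o: "out {} = {}"
    have "0 \<in> V" using n by (simp add: V_def)
    then show False using mis(1)[OF ie] single[of 0] o unfolding maximal_independent_set_def by blast
  qed
  then obtain x where x: "x \<in> out {}" by blast
  then have xV: "x \<in> V" by (simp add: out_def)
  obtain w where w: "w \<in> V" "w \<noteq> x"
    using n by (cases "x = 0") (auto simp: V_def intro: that[of 1] that[of 0])
  have "x \<in> out {w}" using x w by (simp add: out_def)
  moreover have "w \<in> out {w}" using mis(2)[OF single[OF w(1)]] by simp
  moreover have "independent_set V E (out {w})" using mis(1)[OF single[OF w(1)]] by (simp add: maximal_independent_set_def)
  ultimately show False using e[OF xV w(1)] w(2) by (auto simp: independent_set_def)
qed

section \<open>Update sequences\<close>

lemma edges_after_0 [simp]: "edges_after us 0 = {}"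
  by (simp add: edges_after_def)

lemma edges_after_Suc: "i < length us \<Longrightarrow> edges_after us (Suc i) = apply_update (us ! i) (edges_after us i)"
  by (simp add: edges_after_def take_Suc_conv_app_nth)

lemma edges_after_pairs:
  assumes "update_sequence V us" "i \<le> length us" "e \<in> edges_after us i"
  shows "\<exists>u\<in>V. \<exists>v\<in>V. u \<noteq> v \<and> e = {u, v}"
  using assms(2,3)
proof (induction i)
  case (Suc i)
  then have "legal_update V (edges_after us i) (us ! i)" using assms(1) by (simp add: update_sequence_def)
  then show ?case using Suc by (cases "us ! i") (auto simp: edges_after_Suc)
qed simp

lemma edges_after_bound:
  assumes "update_sequence V us" "i \<le> length us" "finite V"
  shows "finite (edges_after us i)" "2 * card (edges_after us i) \<le> card V ^ 2"
proof -
  have sub: "edges_after us i \<subseteq> {B. B \<subseteq> V \<and> card B = 2}"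
    using edges_after_pairs[OF assms(1,2)] by fastforce
  have fin: "finite {B. B \<subseteq> V \<and> card B = 2}" using assms(3) by simp
  show "finite (edges_after us i)" using sub fin by (rule finite_subset)
  have "card (edges_after us i) \<le> card V choose 2" using card_mono[OF fin sub] n_subsets[OF assms(3)] by simp
  moreover have "2 * (card V choose 2) \<le> card V ^ 2" 
  proof -
    have "2 * (card V * (card V - 1) div 2) \<le> card V * (card V - 1)" by simp
    also have "\<dots> \<le> card V ^ 2" by (simp add: power2_eq_square)
    finally show ?thesis unfolding choose_two .
  qed
  ultimately show "2 * card (edges_after us i) \<le> card V ^ 2" by linarith
qed

lemma avg_edges_pos: "update_sequence V us \<Longrightarrow> finite V \<Longrightarrow> us \<noteq> [] \<Longrightarrow> 0 < avg_edges us"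
proof -
  assume u: "update_sequence V us" "finite V" "us \<noteq> []"
  have l: "legal_update V {} (us ! 0)" using u unfolding update_sequence_def by (metis edges_after_0 length_greater_0_conv)
  then have "edges_after us (Suc 0) \<noteq> {}" using u(3) by (cases "us ! 0") (auto simp: edges_after_Suc)
  moreover have "finite (edges_after us (Suc 0))" using u by (intro edges_after_bound(1)) (auto simp: Suc_le_eq)
  ultimately have "0 < real (card (edges_after us (Suc 0)))" by (simp add: card_gt_0_iff)
  moreover have "Suc 0 \<in> {1..length us}" using u(3) by (simp add: Suc_le_eq)
  ultimately have "0 < (\<Sum>i=1..length us. real (card (edges_after us i)))" by (intro sum_pos2) auto
  then show ?thesis using u(3) by (simp add: avg_edges_def)
qed

lemma avg_edges_le_max: "us \<noteq> [] \<Longrightarrow> avg_edges us \<le> max_edges us"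
proof -
  assume "us \<noteq> []"
  have "(\<Sum>i=1..length us. real (card (edges_after us i))) \<le> (\<Sum>i=1..length us. max_edges us)"
    unfolding max_edges_def by (intro sum_mono of_nat_mono Max_ge) auto
  then show ?thesis using \<open>us \<noteq> []\<close> by (simp add: avg_edges_def field_simps)
qed

text \<open>Tangent bound: \<open>x powr (2 / 3) \<le> \<mu> powr (2 / 3) + x * \<mu> powr (- 1 / 3)\<close>.\<close>

lemma sum_powr_two_thirds:
  fixes m :: "nat \<Rightarrow> real"
  assumes m: "\<And>i. m i \<ge> 0" and \<mu>: "(\<Sum>i<N. m i) = real N * \<mu>" "\<mu> > 0"
  shows "(\<Sum>i<N. (2 * m i) powr (2 / 3)) \<le> 4 * real N * \<mu> powr (2 / 3)"
proof -
  have t: "x powr (2 / 3) \<le> \<mu> powr (2 / 3) + x * \<mu> powr (- 1 / 3)" if x: "x \<ge> 0" for x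
  proof (cases "x \<le> \<mu>")
    case True
    then have "x powr (2 / 3) \<le> \<mu> powr (2 / 3)" using x by (intro powr_mono2) auto
    moreover have "0 \<le> x * \<mu> powr (- 1 / 3)" using x by simp
    ultimately show ?thesis by linarith
  next
    case False
    then have p: "x > 0" using \<mu>(2) by linarith
    have "x powr (2 / 3) = x powr (1 + - 1 / 3)" by simp
    also have "\<dots> = x * x powr (- 1 / 3)" using p by (simp only: powr_add powr_one)
    also have "\<dots> \<le> x * \<mu> powr (- 1 / 3)"
      using p False \<mu>(2) by (intro mult_left_mono powr_mono2') auto
    finally show ?thesis using powr_ge_zero[of \<mu> "2 / 3"] by linarith
  qed
  have two: "2 powr (2 / 3) \<le> (2 :: real)" using powr_mono[of "2 / 3" 1 "2 :: real"] by simp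
  have "(\<Sum>i<N. (2 * m i) powr (2 / 3)) \<le> (\<Sum>i<N. 2 * (\<mu> powr (2 / 3) + m i * \<mu> powr (- 1 / 3)))"
  proof (rule sum_mono)
    fix i
    have "(2 * m i) powr (2 / 3) = 2 powr (2 / 3) * m i powr (2 / 3)" by (rule powr_mult)
    also have "\<dots> \<le> 2 * (\<mu> powr (2 / 3) + m i * \<mu> powr (- 1 / 3))" using two t[OF m[of i]] by (intro mult_mono) auto
    finally show "(2 * m i) powr (2 / 3) \<le> 2 * (\<mu> powr (2 / 3) + m i * \<mu> powr (- 1 / 3))" .
  qed
  also have "\<dots> = 2 * (real N * \<mu> powr (2 / 3) + (\<Sum>i<N. m i) * \<mu> powr (- 1 / 3))"
    by (simp add: sum_distrib_left[symmetric] sum_distrib_right[symmetric] sum.distrib)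
  also have "(\<Sum>i<N. m i) * \<mu> powr (- 1 / 3) = real N * (\<mu> powr 1 * \<mu> powr (- 1 / 3))" using \<mu> by simp
  also have "\<mu> powr 1 * \<mu> powr (- 1 / 3) = \<mu> powr (1 + - 1 / 3)" by (rule powr_add[symmetric])
  also have "1 + - 1 / 3 = (2 / 3 :: real)" by simp
  finally show ?thesis by simp
qed

section \<open>The whole execution\<close>

locale execution = mis_scheme A T a for A :: "'s static_alg" and T :: "nat \<Rightarrow> nat" and a :: nat +
  fixes n :: nat and V :: "nat set" and \<beta> :: real and us :: "edge_update list"
  assumes T1: "T n \<ge> 1" and stat: "static_MIS_algorithm (a + 2) 4 \<beta> T A" and ids: "vertex_ids a n V"
    and n2: "n \<ge> 2" and us: "update_sequence V us"
begin

abbreviation "Eg \<equiv> edges_after us"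
abbreviation "B \<equiv> nat_alg alg enc"
abbreviation "st E H M b \<equiv> conf n E H M b H M b (\<lambda>_. Idle) (\<lambda>_. False) (\<lambda>_. [])"

lemma finV: "finite V" using ids by (simp add: vertex_ids_def)

lemma Eg_env: "i \<le> length us \<Longrightarrow> env A T a n (Eg i) V \<beta>"
proof -
  assume i: "i \<le> length us"
  note p = edges_after_pairs[OF us i]
  have cV: "card V = n" using ids by (simp add: vertex_ids_def)
  have ne: "{x, x} \<notin> Eg i" for x using p[of "{x, x}"] by (auto simp: doubleton_eq_iff)
  have eV: "x \<in> V \<and> y \<in> V" if "{x, y} \<in> Eg i" for x y using p[OF that] by (auto simp: doubleton_eq_iff)
  show ?thesis
    using edges_after_bound[OF us i finV] cV ne eV T1 stat ids n2 p by unfold_locales blast+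
qed

definition Lc :: real where "Lc = 170 * (real (T n) + 1)"
definition Rc :: nat where "Rc = 25 + T n"

definition good :: "nat \<Rightarrow> bool" where
  "good i \<longleftrightarrow> (\<exists>H M b. replay alg enc \<circ> states_after B n V us i = st (Eg i) H M b \<and> inv_at (Eg i) {} H M b \<and> H \<subseteq> V \<and>
     (\<Sum>j<i. update_rounds B n V us j) + Rc * mu (Eg i) H M \<le> 7 * Rc * i \<and>
     (\<Sum>j<i. real (update_messages B n V us j)) + Phi Lc (Eg i) H M b \<le>
        13 * Lc * (\<Sum>j<i. real (2 * card (Eg (Suc j))) powr (2 / 3)))"

lemma good_0: "good 0"
proof -
  \<comment> \<open>All natural numbers count as light members, so that a configuration also
    describes the isolated vertices outside \<open>V\<close>.\<close>
  have "replay alg enc \<circ> states_after B n V us 0 = st (Eg 0) {} UNIV (\<lambda>_. None)"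
    by (simp add: fun_eq_iff replay_init[OF inj_enc] conf_def neighbours_def alg_def)
  moreover have inv: "inv_at (Eg 0) {} {} UNIV (\<lambda>_. None)" by (simp add: inv_at_def)
  moreover have "Phi Lc (Eg 0) {} UNIV (\<lambda>_. None) = 0" using Phi_empty inv by simp
  moreover have "mu (Eg 0) {} UNIV = 0" by (simp add: mu_def)
  ultimately show ?thesis unfolding good_def by fastforce
qed

lemma good_Suc:
  assumes i: "i < length us" and good: "good i"
  shows "good (Suc i)" "\<exists>r. quiescent B V (states_during B n V us i r)"
    "\<And>r u v msg. r < update_rounds B n V us i \<Longrightarrow> dynamic_sent B (Eg (Suc i)) (states_during B n V us i r) u v = Some msg \<Longrightarrow>
      \<exists>m. okmsg n \<beta> m \<and> msg = enc m"
proof -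
  let ?F = "Eg i" and ?E = "Eg (Suc i)" and ?up = "us ! i"
  have e0: "env A T a n ?F V \<beta>" and e: "env A T a n ?E V \<beta>" using Eg_env i by simp_all
  note F0 = env.finE[OF e0] env.loop[OF e0] env.EV[OF e0] and F = env.finE[OF e] env.EV[OF e]
  obtain H M b where st0: "replay alg enc \<circ> states_after B n V us i = st ?F H M b" and inv0: "inv_at ?F {} H M b" and HV: "H \<subseteq> V"
    and R0: "(\<Sum>j<i. update_rounds B n V us j) + Rc * mu ?F H M \<le> 7 * Rc * i"
    and C0: "(\<Sum>j<i. real (update_messages B n V us j)) + Phi Lc ?F H M b \<le> 13 * Lc * (\<Sum>j<i. real (2 * card (Eg (Suc j))) powr (2 / 3))"
    using good unfolding good_def by blast
  define h where "h = wake_endpoints B ?up (states_after B n V us i)"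
  have rh: "replay alg enc \<circ> h = t_wake alg ?up (st ?F H M b)" unfolding h_def replay_wake[OF inj_enc] st0 ..
  have legal: "legal_update V ?F ?up" using us i by (simp add: update_sequence_def)
  have up: "?E = apply_update ?up ?F" by (rule edges_after_Suc[OF i])
  obtain H' M' b' k \<kappa> where r: "t_run alg (okmsg n \<beta>) ?E (t_wake alg ?up (st ?F H M b)) k \<kappa> (st ?E H' M' b')"
    and inv: "inv_at ?E {} H' M' b'" and HV': "H' \<subseteq> V" and k: "k + Rc * mu ?E H' M' \<le> 7 * Rc + Rc * mu ?F H M"
    and c: "real \<kappa> + Phi Lc ?E H' M' b' \<le> Phi Lc ?F H M b + 13 * Lc * real (2 * card ?E) powr (2 / 3)"
    using env.update_settles[OF e legal up F0 inv0 HV]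
    unfolding env.cfg_def[OF e] env.idle_def[OF e] env.Lam_def[OF e] env.rho_def[OF e] Lc_def[symmetric] Rc_def[symmetric] by blast
  have quiet: "t_silent alg (st ?E H' M' b' v)" for v
    using env.idle_silent[OF e inv, of v] unfolding env.cfg_def[OF e] env.idle_def[OF e] .
  have quiet0: "t_silent alg (st ?F H M b v)" for v
    using env.idle_silent[OF e0 inv0, of v] unfolding env.cfg_def[OF e0] env.idle_def[OF e0] .
  have out: "t_silent alg (replay alg enc (h v))" if "v \<notin> V" for v
  proof -
    have "t_wake alg ?up (st ?F H M b) v = st ?F H M b v"
    proof (cases ?up)
      case (Insert x y)
      then have "v \<noteq> x" "v \<noteq> y" using legal that by auto
      then show ?thesis by (simp add: Insert)
    next
      case (Delete x y)
      then have "v \<noteq> x" "v \<noteq> y" using legal F0(3)[of x y] that by auto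
      then show ?thesis by (simp add: Delete)
    qed
    then show ?thesis using quiet0[of v] fun_cong[OF rh, of v] by simp
  qed
  note U = nat_alg_update[OF inj_enc F out r[folded rh] quiet]
  have sd: "states_during B n V us i r = (dynamic_round B ?E ^^ r) h" for r by (simp add: states_during_def h_def)
  have ur: "update_rounds B n V us i = recovery_rounds B V ?E h" by (simp add: update_rounds_def h_def)
  have um: "update_messages B n V us i \<le> \<kappa>" unfolding update_messages_def ur sd by (rule U(4))
  have sa: "replay alg enc \<circ> states_after B n V us (Suc i) = st ?E H' M' b'"
    using U(3) by (simp add: Let_def h_def)
  show "\<exists>r. quiescent B V (states_during B n V us i r)" unfolding sd using U(1) by blast
  show "\<And>r u v msg. r < update_rounds B n V us i \<Longrightarrow> dynamic_sent B ?E (states_during B n V us i r) u v = Some msg \<Longrightarrow>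
      \<exists>m. okmsg n \<beta> m \<and> msg = enc m" unfolding sd ur using U(5) by blast
  have "(\<Sum>j<Suc i. update_rounds B n V us j) + Rc * mu ?E H' M' \<le> 7 * Rc * Suc i"
    using R0 k U(2) by (simp add: ur algebra_simps)
  moreover have "(\<Sum>j<Suc i. real (update_messages B n V us j)) + Phi Lc ?E H' M' b' \<le>
        13 * Lc * (\<Sum>j<Suc i. real (2 * card (Eg (Suc j))) powr (2 / 3))"
    using C0 c um unfolding sum.lessThan_Suc distrib_left by linarith
  ultimately show "good (Suc i)" unfolding good_def using sa inv HV' by blast
qed

lemma good: "i \<le> length us \<Longrightarrow> good i"
  by (induction i) (auto intro: good_0 good_Suc(1))

lemma execution_MIS: "i \<le> length us \<Longrightarrow> maximal_independent_set V (Eg i) {v \<in> V. d_out B (states_after B n V us i v)}"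
proof -
  assume i: "i \<le> length us"
  obtain H M b where st: "replay alg enc \<circ> states_after B n V us i = st (Eg i) H M b" and inv: "inv_at (Eg i) {} H M b"
    using good[OF i] unfolding good_def by blast
  have "d_out B (states_after B n V us i v) = (v \<in> M)" for v
    using fun_cong[OF st, of v] by (simp add: nat_alg_def[OF inj_enc])
  then show ?thesis using inv_MIS[OF inv] env.EV[OF Eg_env[OF i]] by simp
qed

text \<open>\<open>7 * (25 + T n) \<le> 7 * 26 * T n\<close>, since
  \<open>T n \<ge> 1\<close>.\<close>

lemma execution_rounds: "us \<noteq> [] \<Longrightarrow> amortized_rounds B n V us \<le> 182 * real (T n)"
proof -
  assume ne: "us \<noteq> []"
  have "(\<Sum>j<length us. update_rounds B n V us j) \<le> 7 * Rc * length us" using good[of "length us"] unfolding good_def by auto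
  then have "(\<Sum>j<length us. real (update_rounds B n V us j)) \<le> real (7 * Rc * length us)"
    by (metis of_nat_mono of_nat_sum)
  also have "\<dots> \<le> 182 * real (T n) * real (length us)"
    using T1 by (simp add: Rc_def mult_right_mono)
  finally show ?thesis using ne by (simp add: amortized_rounds_def divide_le_eq)
qed

text \<open>17680 = 13 * 340 * 4, where 340 = 2 * 170 comes from
  \<open>T n + 1 \<le> 2 * T n\<close> and 4 from the averaging.\<close>

lemma execution_messages: "us \<noteq> [] \<Longrightarrow> amortized_messages B n V us \<le> 17680 * real (T n) * avg_edges us powr (2 / 3)"
proof -
  assume ne: "us \<noteq> []"
  let ?N = "length us" and ?\<mu> = "avg_edges us"
  have L: "0 \<le> Lc" "Lc \<le> 340 * real (T n)" using T1 by (auto simp: Lc_def)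
  have avg: "(\<Sum>j<?N. real (card (Eg (Suc j)))) = real ?N * ?\<mu>"
    using ne by (simp add: avg_edges_def sum.atLeast1_atMost_eq)
  have "(\<Sum>j<?N. real (update_messages B n V us j)) \<le> 13 * Lc * (\<Sum>j<?N. real (2 * card (Eg (Suc j))) powr (2 / 3))"
  proof -
    obtain H M b where "(\<Sum>j<?N. real (update_messages B n V us j)) + Phi Lc (Eg ?N) H M b \<le>
        13 * Lc * (\<Sum>j<?N. real (2 * card (Eg (Suc j))) powr (2 / 3))"
      using good[of ?N] unfolding good_def by blast
    then show ?thesis using Phi_nonneg[OF L(1), of "Eg ?N" H M b] by linarith
  qed
  also have "\<dots> \<le> 13 * (340 * real (T n)) * (4 * real ?N * ?\<mu> powr (2 / 3))"
  proof (rule mult_mono)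
    show "(\<Sum>j<?N. real (2 * card (Eg (Suc j))) powr (2 / 3)) \<le> 4 * real ?N * ?\<mu> powr (2 / 3)"
      using sum_powr_two_thirds[OF _ avg avg_edges_pos[OF us finV ne]] by simp
  qed (use L in \<open>auto intro: sum_nonneg\<close>)
  finally show ?thesis using ne by (simp add: amortized_messages_def divide_le_eq mult_ac)
qed

end

section \<open>From single executions to the theorem\<close>

lemma (in mis_scheme) init_silent: "t_silent alg (t_init alg n v)"
  by (simp add: t_silent_def alg_def send_def stsend_def rgsend_def opsend_def step_def Let_def act_def
      stin_def rgin_def opin_def tokened_def)

lemma update_needs_two_vertices:
  assumes "vertex_ids a n V" "update_sequence V us" "us \<noteq> []"
  shows "n \<ge> 2"
proof -
  have "legal_update V {} (us ! 0)" using assms unfolding update_sequence_def by (metis edges_after_0 length_greater_0_conv)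
  then obtain u v where uv: "u \<in> V" "v \<in> V" "u \<noteq> v" by (cases "us ! 0") auto
  then have "card {u, v} \<le> card V" using assms(1) by (intro card_mono) (auto simp: vertex_ids_def)
  then show ?thesis using assms(1) uv(3) by (simp add: vertex_ids_def)
qed

theorem theorem2:
  fixes T' :: "nat \<Rightarrow> nat"
  assumes "\<forall>a D. \<exists>(A :: 's static_alg) b c. static_MIS_algorithm a D b (\<lambda>n. c * T' n) A"
  shows "\<forall>a. \<exists>(B :: nat dynamic_alg) b C. dynamic_MIS_algorithm a b B \<and>
           (\<forall>n V us. vertex_ids a n V \<and> update_sequence V us \<and> us \<noteq> [] \<longrightarrow>
              amortized_rounds B n V us \<le> C * real (T' n) \<and>
              amortized_messages B n V us \<le> C * max_edges us powr (2 / 3) * real (T' n) \<and>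
              amortized_messages B n V us \<le> C * avg_edges us powr (2 / 3) * real (T' n))"
proof
  fix a
  \<comment> \<open>The exponent \<open>a + 2\<close> makes room for the pendant IDs, and 4 is the
    diameter bound of the simulated networks.\<close>
  obtain A :: "'s static_alg" and \<beta> c where A: "static_MIS_algorithm (a + 2) 4 \<beta> (\<lambda>n. c * T' n) A"
    using assms by blast
  define T where "T = (\<lambda>n. c * T' n)"
  note A = A[folded T_def]
  interpret S: mis_scheme A T a .
  define B where "B = nat_alg S.alg enc"
  have ex: "execution A T a n V \<beta> us" if "vertex_ids a n V" "update_sequence V us" "us \<noteq> []" for n V us
    using static_rounds_pos[OF A] update_needs_two_vertices[OF that] that A by unfold_locales auto
  have init: "quiescent B V (d_init B n)" for V n
    using S.init_silent by (simp add: B_def quiescent_nat_alg[OF inj_enc] replay_init[OF inj_enc])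
  have "dynamic_MIS_algorithm a (13 + \<bar>\<beta>\<bar>) B"
    unfolding dynamic_MIS_algorithm_def
  proof (intro allI impI, elim conjE)
    fix n V us assume V: "vertex_ids a n V" and us: "update_sequence V us"
    show "quiescent B V (d_init B n) \<and> (\<forall>i<length us. \<exists>r. quiescent B V (states_during B n V us i r)) \<and>
        (\<forall>i<length us. \<forall>r<update_rounds B n V us i. \<forall>u v msg.
            dynamic_sent B (edges_after us (Suc i)) (states_during B n V us i r) u v = Some msg \<longrightarrow>
            real (length msg) \<le> (13 + \<bar>\<beta>\<bar>) * log 2 (real n)) \<and>
        (\<forall>i\<le>length us. maximal_independent_set V (edges_after us i) {v \<in> V. d_out B (states_after B n V us i v)})"
    \<comment> \<open>\<open>n \<ge> 2\<close> follows from the existence of an update, so the empty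
      sequence is treated separately.\<close>
    proof (cases "us = []")
      case True
      have "d_out B (d_init B n v)" for v
        by (simp add: B_def nat_alg_def[OF inj_enc] replay_def[OF inj_enc] S.alg_def)
      then have "maximal_independent_set V {} {v \<in> V. d_out B (d_init B n v)}"
        by (auto simp: maximal_independent_set_def independent_set_def)
      then show ?thesis using init True by simp
    next
      case False
      interpret X: execution A T a n V \<beta> us by (rule ex[OF V us False])
      have "real (length msg) \<le> (13 + \<bar>\<beta>\<bar>) * log 2 (real n)" if i: "i < length us" and r: "r < update_rounds B n V us i"
        and s: "dynamic_sent B (edges_after us (Suc i)) (states_during B n V us i r) u v = Some msg" for i r u v msg
      proof -
        obtain m where "S.okmsg n \<beta> m" "msg = enc m"
          using X.good_Suc(3)[OF i X.good[OF less_imp_le[OF i]] r[unfolded B_def] s[unfolded B_def]] by blast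
        then show ?thesis using S.length_enc[OF _ X.n2] by blast
      qed
      moreover have "\<exists>r. quiescent B V (states_during B n V us i r)" if i: "i < length us" for i
        using X.good_Suc(2)[OF i X.good[OF less_imp_le[OF i]]] unfolding B_def .
      ultimately show ?thesis using init X.execution_MIS unfolding B_def by blast
    qed
  qed
  moreover have "amortized_rounds B n V us \<le> 17680 * real c * real (T' n) \<and>
      amortized_messages B n V us \<le> 17680 * real c * max_edges us powr (2 / 3) * real (T' n) \<and>
      amortized_messages B n V us \<le> 17680 * real c * avg_edges us powr (2 / 3) * real (T' n)"
    if V: "vertex_ids a n V" and us: "update_sequence V us" and ne: "us \<noteq> []" for n V us
  proof -
    interpret X: execution A T a n V \<beta> us by (rule ex[OF V us ne])
    have "amortized_rounds B n V us \<le> 182 * (real c * real (T' n))"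
      using X.execution_rounds[OF ne] by (simp add: B_def T_def)
    also have "\<dots> \<le> 17680 * (real c * real (T' n))" by (intro mult_right_mono) auto
    finally have r: "amortized_rounds B n V us \<le> 17680 * real c * real (T' n)" by simp
    have m: "amortized_messages B n V us \<le> 17680 * real c * avg_edges us powr (2 / 3) * real (T' n)"
      using X.execution_messages[OF ne] by (simp add: B_def T_def mult_ac)
    also have "\<dots> \<le> 17680 * real c * max_edges us powr (2 / 3) * real (T' n)"
      using avg_edges_le_max[OF ne] avg_edges_pos[OF us X.finV ne]
      by (intro mult_right_mono mult_left_mono powr_mono2) auto
    finally show ?thesis using r m by blast
  qed
  ultimately show "\<exists>(B :: nat dynamic_alg) b C. dynamic_MIS_algorithm a b B \<and>
           (\<forall>n V us. vertex_ids a n V \<and> update_sequence V us \<and> us \<noteq> [] \<longrightarrow>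
              amortized_rounds B n V us \<le> C * real (T' n) \<and>
              amortized_messages B n V us \<le> C * max_edges us powr (2 / 3) * real (T' n) \<and>
              amortized_messages B n V us \<le> C * avg_edges us powr (2 / 3) * real (T' n))"
    by blast
qed

end
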